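(* For each Q-datum $\mathcal{Q}=(\Delta,\sigma,\xi)$ for $\mathfrak{g}$, let $[\mathcal{Q}]$ denote the set of all reduced words for the longest element $w_0\in\mathsf{W}$ which are adapted to $\mathcal{Q}$. Then $[\mathcal{Q}]$ forms a single commutation class, and there is a unique isomorphism of quivers $\Gamma_{\mathcal{Q}}\cong\Upsilon_{[\mathcal{Q}]}$ which intertwines $\pi$ and $\mathrm{res}^{[\mathcal{Q}]}$. Moreover, the assignment $\mathcal{Q}\mapsto[\mathcal{Q}]$ gives a bijection $$\{\text{Q-data for }\mathfrak{g}\}/2r\mathbb{Z}\;\longleftrightarrow\;[\![\Delta^{\sigma}]\!],$$ where $/2r\mathbb{Z}$ means that constant differences between height functions are ignored, and $[\![\Delta^\sigma]\!]$ is the $\sigma$-adapted $r$-cluster point.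
   Context: Basic notation. Let $\mathsf{g}$ be a finite-dimensional complex simple Lie algebra of type ADE with Dynkin diagram $\Delta$ (vertex set $\Delta_0$; $\imath\sim\jmath$ means adjacent). $\mathsf{P}=\bigoplus_{\imath\in\Delta_0}\mathbb{Z}\varpi_\imath$ is the weight lattice, $\alpha_\imath$ the simple roots, $(\cdot,\cdot)$ the symmetric form on $\mathsf{P}$ with $(\varpi_\imath,\alpha_\jmath)=\delta_{\imath\jmath}$, $\mathsf{W}\subset\mathrm{Aut}(\mathsf{P})$ the Weyl group generated by $s_\imath(\lambda)=\lambda-(\lambda,\alpha_\imath)\alpha_\imath$, $\mathsf{R}^+$ the set of positive roots, $w_0$ the longest element, $N=\ell(w_0)=|\mathsf{R}^+|$, and $\imath\mapsto\imath^*$ the involution of $\Delta_0$ with $w_0(\alpha_\imath)=-\alpha_{\imath^*}$. Let $\sigma$ be an automorphism of $\Delta$ such that there is no $\imath$ with $\imath\sim\sigma(\imath)$, and let $r\in\{1,2,3\}$ be its order; $\sigma$ acts on $\mathsf{P}$ by $\sigma(\varpi_\imath)=\varpi_{\sigma(\imath)}$. Let $I$ be the set of $\sigma$-orbits in $\Delta_0$, $\imath\mapsto\bar\imath$ the quotient map, $n=|I|$, $d_i=|i|\in\{1,r\}$ for $i\in I$. Write $i\sim j$ in $I$ if some representatives are adjacent; put $c_{ii}=2$, $c_{ij}=-\lceil d_j/d_i\rceil$ if $i\sim j$, $c_{ij}=0$ otherwise. Then $(c_{ij})$ is the Cartan matrix of a complex simple Lie algebra $\mathfrak{g}$; every such $\mathfrak{g}$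 arises so: $\sigma=\mathrm{id}$ and $\mathfrak{g}=\mathsf{g}$ if $\mathfrak{g}$ is simply-laced, and otherwise $(\mathsf{g},r,\mathfrak{g})=(A_{2n-1},2,B_n),(D_{n+1},2,C_n),(E_6,2,F_4),(D_4,3,G_2)$. The pair $(\Delta,\sigma)$ is fixed and $h^\vee$ is the dual Coxeter number of $\mathfrak{g}$. Q-data. A height function on $(\Delta,\sigma)$ is a function $\xi:\Delta_0\to\mathbb{Z}$, $\imath\mapsto\xi_\imath$, such that (a) $|\xi_\imath-\xi_\jmath|=d_{\bar\imath}$ whenever $\imath\sim\jmath$ and $d_{\bar\imath}=d_{\bar\jmath}$; (b) for $i,j\in I$ with $i\sim j$ and $d_i<d_j$ (so $d_i=1$, $d_j=r$, $i=\{\imath\}$), there is a unique $j^\circ\in j$ with $|\xi_\imath-\xi_{j^\circ}|=1$ and $\xi_{\sigma^l(j^\circ)}=\xi_{j^\circ}-2l$ for $0\le l<r$. A Q-datum for $\mathfrak{g}$ is a triple $\mathcal{Q}=(\Delta,\sigma,\xi)$ with $\xi$ a height function. Fix once and for all a $\sigma$-parity function: integers $\epsilon_\imath$ ($\imath\in\Delta_0$), $0\le\epsilon_\imath<2d_{\bar\imath}$, with $\epsilon_{\imath}\equiv\epsilon_{\imath'}\pmod 2$ if $\bar\imath=\bar\imath'$; $\epsilon_{\sigma^l(\imath)}\equiv\epsilon_\imath-2l\pmod{2d_{\bar\imath}}$ for $l\in\mathbb{Z}$; and $\epsilon_\imath\equiv\epsilon_\jmath+\min(d_{\bar\imath},d_{\bar\jmath})\pmod{2\min(d_{\bar\imath},d_{\bar\jmath})}$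 if $\imath\sim\jmath$. All height functions are required to satisfy in addition (c) $\xi_\imath-\epsilon_\imath\in2d_{\bar\imath}\mathbb{Z}$ for all $\imath$ (this can be achieved by adding a constant). A vertex $\imath$ is a source of $\mathcal{Q}$ if $\xi_\imath>\xi_\jmath$ for all $\jmath\sim\imath$; then $s_\imath\mathcal{Q}=(\Delta,\sigma,s_\imath\xi)$ with $(s_\imath\xi)_\jmath=\xi_\jmath-2d_{\bar\jmath}\delta_{\imath\jmath}$ is again a Q-datum. A sequence $(\imath_1,\dots,\imath_l)$ in $\Delta_0$ is adapted to $\mathcal{Q}$ if $\imath_k$ is a source of $s_{\imath_{k-1}}\cdots s_{\imath_1}\mathcal{Q}$ for all $1\le k\le l$. Quivers. The repetition quiver $\widehat\Delta^\sigma$ has vertex set $\widehat\Delta^\sigma_0=\{(\imath,p)\in\Delta_0\times\mathbb{Z}\mid p-\epsilon_\imath\in2d_{\bar\imath}\mathbb{Z}\}$ and an arrow $(\imath,p)\to(\jmath,s)$ whenever $\imath\sim\jmath$ and $s-p=\min(d_{\bar\imath},d_{\bar\jmath})$. $\pi:\widehat\Delta^\sigma_0\to\Delta_0$ is the first projection. The twisted Auslander–Reiten quiver $\Gamma_{\mathcal{Q}}$ is the full subquiver of $\widehat\Delta^\sigma$ with vertex set $\{(\imath,\xi_\imath-2d_{\bar\imath}k)\mid k\in\mathbb{Z},\ 0\le2d_{\bar\imath}k<rh^\vee+\xi_\imath-\xi_{\imath^*}\}$. Commutation classes. Two sequences in $\Delta_0$ are commutation equivalent if one is obtained from the other by repeatedly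 swapping adjacent entries $(\imath,\jmath)$ with $\imath\not\sim\jmath$; the class of $\boldsymbol i$ is the commutation class $[\boldsymbol i]$. For a reduced word $\boldsymbol i=(\imath_1,\dots,\imath_N)$ of $w_0$ put $\beta_k^{\boldsymbol i}=s_{\imath_1}\cdots s_{\imath_{k-1}}(\alpha_{\imath_k})$, so $\mathsf{R}^+=\{\beta^{\boldsymbol i}_k\}$. The residue is $\mathrm{res}^{[\boldsymbol i]}(\beta_k^{\boldsymbol i})=\imath_k$ (depends only on $[\boldsymbol i]$). The combinatorial AR quiver $\Upsilon_{[\boldsymbol i]}$ has vertex set $\mathsf{R}^+$ and an arrow $\beta^{\boldsymbol i}_k\to\beta^{\boldsymbol i}_j$ iff $j<k$, $\imath_j\sim\imath_k$ and there is no $j<j'<k$ with $\imath_{j'}\in\{\imath_j,\imath_k\}$ (it depends only on $[\boldsymbol i]$). The reflection functor sends a reduced word $(\imath_1,\dots,\imath_N)$ of $w_0$ to the reduced word $(\imath_2,\dots,\imath_N,\imath_1^* )$; the induced operations on commutation classes generate an equivalence relation whose classes are called $r$-cluster points. The set $[\![\Delta^\sigma]\!]$. If $\sigma\ne\mathrm{id}$: a $\sigma$-Coxeter element is $\tau=s_{\imath_1}\cdots s_{\imath_n}\sigma$ with $\{\bar\imath_1,\dots,\bar\imath_n\}=I$; it yields the reduced word $\boldsymbol i(\tau)=(\imath_1,\dots,\imath_n,\sigma(\imath_1),\dots,\sigma(\imath_n),\dots,\sigma^{rh^\vee/2-1}(\imath_1),\dots,\sigma^{rh^\vee/2-1}(\imath_n))$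 of $w_0$, whose commutation class depends only on $\tau$, and all the classes $[\boldsymbol i(\tau)]$ lie in one $r$-cluster point, which is denoted $[\![\Delta^\sigma]\!]$. If $\sigma=\mathrm{id}$: $[\![\Delta^\sigma]\!]$ is the set of commutation classes of reduced words of $w_0$ adapted to some Dynkin quiver $Q$ with underlying graph $\Delta$ (i.e. $\imath_k$ is a source of $s_{\imath_{k-1}}\cdots s_{\imath_1}Q$ for all $k$, where $s_\imath$ reverses all arrows at the source $\imath$); this is a single $r$-cluster point. *)

theory Defs
  imports Complex_Main "HOL-Library.FuncSet" "HOL-Number_Theory.Cong"
begin

section \<open>Simply-laced Dynkin diagrams with automorphism\<close>

text \<open>
  A diagram is given by its adjacency relation on a finite vertex type. Vertices of the
  model diagrams are numbered as in Bourbaki.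
\<close>

definition A_edges :: "nat \<Rightarrow> nat set set" where
  "A_edges n = {{i, i + 1} | i. 1 \<le> i \<and> i < n}"

definition D_edges :: "nat \<Rightarrow> nat set set" where
  "D_edges n = A_edges (n - 1) \<union> {{n - 2, n}}"

definition E_edges :: "nat \<Rightarrow> nat set set" where
  "E_edges n = {{1, 3}, {2, 4}, {3, 4}} \<union> {{i, i + 1} | i. 4 \<le> i \<and> i < n}"

definition ADE_diagrams :: "(nat \<times> nat set set) set" where
  "ADE_diagrams =
     {(n, A_edges n) | n. n \<ge> 1} \<union> {(n, D_edges n) | n. n \<ge> 4} \<union>
     {(n, E_edges n) | n. n \<in> {6, 7, 8}}"

definition ADE_diagram :: "('v::finite \<Rightarrow> 'v \<Rightarrow> bool) \<Rightarrow> bool" where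
  "ADE_diagram adj \<longleftrightarrow>
     (\<exists>(n, E) \<in> ADE_diagrams. \<exists>f. bij_betw f UNIV {1..n} \<and>
        (\<forall>i j. adj i j \<longleftrightarrow> {f i, f j} \<in> E))"

definition diagram_automorphism :: "('v \<Rightarrow> 'v \<Rightarrow> bool) \<Rightarrow> ('v \<Rightarrow> 'v) \<Rightarrow> bool" where
  "diagram_automorphism adj \<sigma> \<longleftrightarrow> bij \<sigma> \<and> (\<forall>i j. adj (\<sigma> i) (\<sigma> j) \<longleftrightarrow> adj i j)"

definition aut_order :: "('v \<Rightarrow> 'v) \<Rightarrow> nat" where
  "aut_order \<sigma> = (LEAST r. 0 < r \<and> \<sigma> ^^ r = id)"

definition orb :: "('v \<Rightarrow> 'v) \<Rightarrow> 'v \<Rightarrow> 'v set" where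
  "orb \<sigma> i = {(\<sigma> ^^ l) i | l. True}"

definition orbits :: "('v \<Rightarrow> 'v) \<Rightarrow> 'v set set" where
  "orbits \<sigma> = range (orb \<sigma>)"

definition orb_size :: "('v \<Rightarrow> 'v) \<Rightarrow> 'v \<Rightarrow> int" where
  "orb_size \<sigma> i = int (card (orb \<sigma> i))"

definition orb_adj :: "('v \<Rightarrow> 'v \<Rightarrow> bool) \<Rightarrow> 'v set \<Rightarrow> 'v set \<Rightarrow> bool" where
  "orb_adj adj a b \<longleftrightarrow> (\<exists>i \<in> a. \<exists>j \<in> b. adj i j)"

definition folded_cartan :: "('v \<Rightarrow> 'v \<Rightarrow> bool) \<Rightarrow> 'v set \<Rightarrow> 'v set \<Rightarrow> int" where
  "folded_cartan adj a b =
     (if a = b then 2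
      else if orb_adj adj a b then - \<lceil>real (card b) / real (card a)\<rceil>
      else 0)"


section \<open>The dual Coxeter number of a Cartan matrix\<close>

text \<open>
  For a Cartan matrix \<open>c\<close> on an index set \<open>I\<close>, with the convention
  \<open>c i j = \<langle>h\<^sub>i, \<alpha>\<^sub>j\<rangle>\<close>, the set below consists of the pairs (real root, its coroot), each
  given by its coordinates with respect to the simple roots, respectively coroots.
\<close>

inductive_set root_coroot :: "'i set \<Rightarrow> ('i \<Rightarrow> 'i \<Rightarrow> int) \<Rightarrow> (('i \<Rightarrow> int) \<times> ('i \<Rightarrow> int)) set"
  for I c where
  simple: "i \<in> I \<Longrightarrow> ((\<lambda>k. of_bool (k = i)), (\<lambda>k. of_bool (k = i))) \<in> root_coroot I c"
| reflect: "i \<in> I \<Longrightarrow> (\<beta>, \<gamma>) \<in> root_coroot I c \<Longrightarrow>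
    ((\<lambda>k. \<beta> k - (\<Sum>j\<in>I. c i j * \<beta> j) * of_bool (k = i)),
     (\<lambda>k. \<gamma> k - (\<Sum>j\<in>I. \<gamma> j * c j i) * of_bool (k = i))) \<in> root_coroot I c"

text \<open>
  The dual Coxeter number is \<open>1 + \<langle>\<rho>, \<theta>\<^sup>\<or>\<rangle>\<close>, where \<open>\<theta>\<close> is the highest root: one plus the sum
  of the coordinates of \<open>\<theta>\<^sup>\<or>\<close> in the simple coroots.
\<close>

definition dual_coxeter :: "'i set \<Rightarrow> ('i \<Rightarrow> 'i \<Rightarrow> int) \<Rightarrow> int" where
  "dual_coxeter I c =
     (THE h. \<exists>\<theta> \<theta>v. (\<theta>, \<theta>v) \<in> root_coroot I c \<and>
        (\<forall>(\<beta>, \<gamma>) \<in> root_coroot I c. \<forall>i\<in>I. \<beta> i \<le> \<theta> i) \<and>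
        h = 1 + (\<Sum>i\<in>I. \<theta>v i))"

definition r_dual_coxeter :: "('v \<Rightarrow> 'v \<Rightarrow> bool) \<Rightarrow> ('v \<Rightarrow> 'v) \<Rightarrow> int" where
  "r_dual_coxeter adj \<sigma> = int (aut_order \<sigma>) * dual_coxeter (orbits \<sigma>) (folded_cartan adj)"


section \<open>Weyl group and roots of the simply-laced diagram\<close>

text \<open>
  A weight \<open>\<lambda> = \<Sum>\<^sub>i \<lambda>\<^sub>i \<varpi>\<^sub>i\<close> is the function \<open>i \<mapsto> \<lambda>\<^sub>i = (\<lambda>, \<alpha>\<^sub>i)\<close>.
\<close>

type_synonym 'v weight = "'v \<Rightarrow> int"

definition simple_root :: "('v \<Rightarrow> 'v \<Rightarrow> bool) \<Rightarrow> 'v \<Rightarrow> 'v weight" where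
  "simple_root adj i = (\<lambda>j. if j = i then 2 else if adj i j then - 1 else 0)"

definition simple_refl :: "('v \<Rightarrow> 'v \<Rightarrow> bool) \<Rightarrow> 'v \<Rightarrow> 'v weight \<Rightarrow> 'v weight" where
  "simple_refl adj i \<mu> = (\<lambda>j. \<mu> j - \<mu> i * simple_root adj i j)"

definition word_prod :: "('v \<Rightarrow> 'v \<Rightarrow> bool) \<Rightarrow> 'v list \<Rightarrow> 'v weight \<Rightarrow> 'v weight" where
  "word_prod adj is = foldr (\<lambda>i w. simple_refl adj i \<circ> w) is id"

text \<open>Simple reflections are involutions, so no inverses are needed to generate the group.\<close>

definition weyl_group :: "('v \<Rightarrow> 'v \<Rightarrow> bool) \<Rightarrow> ('v weight \<Rightarrow> 'v weight) set" where
  "weyl_group adj = range (word_prod adj)"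

definition weyl_length :: "('v \<Rightarrow> 'v \<Rightarrow> bool) \<Rightarrow> ('v weight \<Rightarrow> 'v weight) \<Rightarrow> nat" where
  "weyl_length adj w = (LEAST l. \<exists>is. length is = l \<and> word_prod adj is = w)"

definition longest_element :: "('v \<Rightarrow> 'v \<Rightarrow> bool) \<Rightarrow> 'v weight \<Rightarrow> 'v weight" where
  "longest_element adj =
     (THE w. w \<in> weyl_group adj \<and> (\<forall>v \<in> weyl_group adj. weyl_length adj v \<le> weyl_length adj w))"

definition star :: "('v \<Rightarrow> 'v \<Rightarrow> bool) \<Rightarrow> 'v \<Rightarrow> 'v" where
  "star adj i = (THE j. longest_element adj (simple_root adj i) = - simple_root adj j)"

definition positive_roots :: "('v::finite \<Rightarrow> 'v \<Rightarrow> bool) \<Rightarrow> 'v weight set" where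
  "positive_roots adj =
     {\<beta>. (\<exists>w \<in> weyl_group adj. \<exists>i. \<beta> = w (simple_root adj i)) \<and>
          (\<exists>m :: 'v \<Rightarrow> nat. \<forall>j. \<beta> j = (\<Sum>i\<in>UNIV. int (m i) * simple_root adj i j))}"

text \<open>Only reduced words of the longest element \<open>w\<^sub>0\<close> occur.\<close>

definition reduced_words :: "('v \<Rightarrow> 'v \<Rightarrow> bool) \<Rightarrow> 'v list set" where
  "reduced_words adj =
     {is. word_prod adj is = longest_element adj \<and>
          length is = weyl_length adj (longest_element adj)}"


section \<open>Commutation classes and \<open>r\<close>-cluster points\<close>

definition comm_step :: "('v \<Rightarrow> 'v \<Rightarrow> bool) \<Rightarrow> 'v list \<Rightarrow> 'v list \<Rightarrow> bool" where
  "comm_step adj xs ys \<longleftrightarrow>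
     (\<exists>us i j vs. xs = us @ [i, j] @ vs \<and> ys = us @ [j, i] @ vs \<and> \<not> adj i j)"

definition comm_class :: "('v \<Rightarrow> 'v \<Rightarrow> bool) \<Rightarrow> 'v list \<Rightarrow> 'v list set" where
  "comm_class adj is = {js. (comm_step adj)\<^sup>*\<^sup>* is js}"

definition comm_classes :: "('v \<Rightarrow> 'v \<Rightarrow> bool) \<Rightarrow> 'v list set set" where
  "comm_classes adj = comm_class adj ` reduced_words adj"

definition reflection_functor :: "('v \<Rightarrow> 'v \<Rightarrow> bool) \<Rightarrow> 'v list \<Rightarrow> 'v list" where
  "reflection_functor adj is = tl is @ [star adj (hd is)]"

definition reflection_step :: "('v \<Rightarrow> 'v \<Rightarrow> bool) \<Rightarrow> 'v list set \<Rightarrow> 'v list set \<Rightarrow> bool" where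
  "reflection_step adj C C' \<longleftrightarrow>
     (\<exists>is \<in> reduced_words adj. C = comm_class adj is \<and>
        C' = comm_class adj (reflection_functor adj is))"

definition r_cluster_points :: "('v \<Rightarrow> 'v \<Rightarrow> bool) \<Rightarrow> 'v list set set set" where
  "r_cluster_points adj = comm_classes adj // {(C, C'). equivclp (reflection_step adj) C C'}"


section \<open>Combinatorial Auslander--Reiten quivers\<close>

text \<open>
  None of the quivers considered here has multiple arrows, so the arrows form a relation and
  an isomorphism is determined by its action on vertices.
\<close>

record 'a quiver =
  verts :: "'a set"
  arrows :: "('a \<times> 'a) set"

definition quiver_iso :: "'a quiver \<Rightarrow> 'b quiver \<Rightarrow> ('a \<Rightarrow> 'b) \<Rightarrow> bool" where
  "quiver_iso G H f \<longleftrightarrow> bij_betw f (verts G) (verts H) \<and>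
     (\<forall>x \<in> verts G. \<forall>y \<in> verts G. (x, y) \<in> arrows G \<longleftrightarrow> (f x, f y) \<in> arrows H)"

text \<open>The root \<open>\<beta>\<^sub>k\<close> of a word; positions are counted from 0.\<close>

definition word_root :: "('v \<Rightarrow> 'v \<Rightarrow> bool) \<Rightarrow> 'v list \<Rightarrow> nat \<Rightarrow> 'v weight" where
  "word_root adj is k = word_prod adj (take k is) (simple_root adj (is ! k))"

text \<open>
  Residue and combinatorial AR quiver of a commutation class \<open>C\<close> of reduced words. The data
  read off from a word in \<open>C\<close> do not depend on the word.
\<close>

definition residue :: "('v \<Rightarrow> 'v \<Rightarrow> bool) \<Rightarrow> 'v list set \<Rightarrow> 'v weight \<Rightarrow> 'v" where
  "residue adj C \<beta> = (THE i. \<exists>is \<in> C. \<exists>k < length is. word_root adj is k = \<beta> \<and> is ! k = i)"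

definition comb_AR_quiver :: "('v::finite \<Rightarrow> 'v \<Rightarrow> bool) \<Rightarrow> 'v list set \<Rightarrow> 'v weight quiver" where
  "comb_AR_quiver adj C =
     \<lparr>verts = positive_roots adj,
      arrows = {(word_root adj is k, word_root adj is j) | is j k.
        is \<in> C \<and> j < k \<and> k < length is \<and> adj (is ! j) (is ! k) \<and>
        \<not> (\<exists>j'. j < j' \<and> j' < k \<and> is ! j' \<in> {is ! j, is ! k})}\<rparr>"


section \<open>The \<open>\<sigma>\<close>-adapted \<open>r\<close>-cluster point\<close>

text \<open>
  \<open>Q i j\<close> means that the Dynkin quiver \<open>Q\<close> has an arrow from \<open>i\<close> to \<open>j\<close>.
\<close>

definition dynkin_quiver :: "('v \<Rightarrow> 'v \<Rightarrow> bool) \<Rightarrow> ('v \<Rightarrow> 'v \<Rightarrow> bool) \<Rightarrow> bool" where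
  "dynkin_quiver adj Q \<longleftrightarrow>
     (\<forall>i j. (adj i j \<longleftrightarrow> Q i j \<or> Q j i) \<and> \<not> (Q i j \<and> Q j i))"

definition quiver_source :: "('v \<Rightarrow> 'v \<Rightarrow> bool) \<Rightarrow> 'v \<Rightarrow> bool" where
  "quiver_source Q i \<longleftrightarrow> (\<forall>j. \<not> Q j i)"

definition quiver_reflect :: "'v \<Rightarrow> ('v \<Rightarrow> 'v \<Rightarrow> bool) \<Rightarrow> 'v \<Rightarrow> 'v \<Rightarrow> bool" where
  "quiver_reflect i Q = (\<lambda>j k. if j = i \<or> k = i then Q k j else Q j k)"

fun quiver_adapted :: "('v \<Rightarrow> 'v \<Rightarrow> bool) \<Rightarrow> 'v list \<Rightarrow> bool" where
  "quiver_adapted Q [] \<longleftrightarrow> True"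
| "quiver_adapted Q (i # is) \<longleftrightarrow> quiver_source Q i \<and> quiver_adapted (quiver_reflect i Q) is"

text \<open>
  The sequences \<open>(i\<^sub>1, \<dots>, i\<^sub>n)\<close> such that \<open>s\<^bsub>i\<^sub>1\<^esub> \<dots> s\<^bsub>i\<^sub>n\<^esub> \<sigma>\<close> is a \<open>\<sigma>\<close>-Coxeter element, and the
  associated reduced word of \<open>w\<^sub>0\<close>. Its commutation class depends only on the element, so
  ranging over sequences and ranging over \<open>\<sigma>\<close>-Coxeter elements give the same classes.
\<close>

definition coxeter_sequences :: "('v \<Rightarrow> 'v) \<Rightarrow> 'v list set" where
  "coxeter_sequences \<sigma> =
     {is. length is = card (orbits \<sigma>) \<and> orb \<sigma> ` set is = orbits \<sigma>}"

definition coxeter_word :: "('v \<Rightarrow> 'v \<Rightarrow> bool) \<Rightarrow> ('v \<Rightarrow> 'v) \<Rightarrow> 'v list \<Rightarrow> 'v list" where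
  "coxeter_word adj \<sigma> is =
     concat (map (\<lambda>k. map (\<sigma> ^^ k) is) [0 ..< nat (r_dual_coxeter adj \<sigma> div 2)])"

text \<open>
  For \<open>\<sigma> \<noteq> id\<close> it is the one \<open>r\<close>-cluster point containing the classes of all Coxeter words.
\<close>

definition adapted_cluster_point :: "('v \<Rightarrow> 'v \<Rightarrow> bool) \<Rightarrow> ('v \<Rightarrow> 'v) \<Rightarrow> 'v list set set" where
  "adapted_cluster_point adj \<sigma> =
     (if \<sigma> = id
      then {comm_class adj is | is. is \<in> reduced_words adj \<and>
              (\<exists>Q. dynkin_quiver adj Q \<and> quiver_adapted Q is)}
      else (THE X. X \<in> r_cluster_points adj \<and>
              (\<forall>is \<in> coxeter_sequences \<sigma>. comm_class adj (coxeter_word adj \<sigma> is) \<in> X)))"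


section \<open>Q-data\<close>

definition height_function ::
  "('v \<Rightarrow> 'v \<Rightarrow> bool) \<Rightarrow> ('v \<Rightarrow> 'v) \<Rightarrow> ('v \<Rightarrow> int) \<Rightarrow> bool" where
  "height_function adj \<sigma> \<xi> \<longleftrightarrow>
     (\<forall>i j. adj i j \<and> orb_size \<sigma> i = orb_size \<sigma> j \<longrightarrow> \<bar>\<xi> i - \<xi> j\<bar> = orb_size \<sigma> i) \<and>
     (\<forall>a \<in> orbits \<sigma>. \<forall>b \<in> orbits \<sigma>. orb_adj adj a b \<and> card a < card b \<longrightarrow>
        (\<forall>i \<in> a. \<exists>!j. j \<in> b \<and> \<bar>\<xi> i - \<xi> j\<bar> = 1 \<and>
           (\<forall>l < aut_order \<sigma>. \<xi> ((\<sigma> ^^ l) j) = \<xi> j - 2 * int l)))"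

text \<open>
  In the third condition exponents \<open>l \<ge> 0\<close> suffice, since \<open>\<sigma>\<close> has finite order.
\<close>

definition parity_function ::
  "('v \<Rightarrow> 'v \<Rightarrow> bool) \<Rightarrow> ('v \<Rightarrow> 'v) \<Rightarrow> ('v \<Rightarrow> int) \<Rightarrow> bool" where
  "parity_function adj \<sigma> \<epsilon> \<longleftrightarrow>
     (\<forall>i. 0 \<le> \<epsilon> i \<and> \<epsilon> i < 2 * orb_size \<sigma> i) \<and>
     (\<forall>i i'. orb \<sigma> i = orb \<sigma> i' \<longrightarrow> [\<epsilon> i = \<epsilon> i'] (mod 2)) \<and>
     (\<forall>i l. [\<epsilon> ((\<sigma> ^^ l) i) = \<epsilon> i - 2 * int l] (mod (2 * orb_size \<sigma> i))) \<and>
     (\<forall>i j. adj i j \<longrightarrow>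
        [\<epsilon> i = \<epsilon> j + min (orb_size \<sigma> i) (orb_size \<sigma> j)]
          (mod (2 * min (orb_size \<sigma> i) (orb_size \<sigma> j))))"

text \<open>A Q-datum on the fixed pair \<open>(\<Delta>, \<sigma>)\<close> is identified with its height function.\<close>

definition Q_data ::
  "('v \<Rightarrow> 'v \<Rightarrow> bool) \<Rightarrow> ('v \<Rightarrow> 'v) \<Rightarrow> ('v \<Rightarrow> int) \<Rightarrow> ('v \<Rightarrow> int) set" where
  "Q_data adj \<sigma> \<epsilon> =
     {\<xi>. height_function adj \<sigma> \<xi> \<and> (\<forall>i. 2 * orb_size \<sigma> i dvd \<xi> i - \<epsilon> i)}"

text \<open>
  Since \<open>r\<close> is the size of some orbit, two elements of \<open>Q_data\<close> that differ by a constant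
  differ by a constant in \<open>2r\<int>\<close>.
\<close>

definition shift_rel ::
  "('v \<Rightarrow> 'v \<Rightarrow> bool) \<Rightarrow> ('v \<Rightarrow> 'v) \<Rightarrow> ('v \<Rightarrow> int) \<Rightarrow> (('v \<Rightarrow> int) \<times> ('v \<Rightarrow> int)) set" where
  "shift_rel adj \<sigma> \<epsilon> =
     {(\<xi>, \<xi>'). \<xi> \<in> Q_data adj \<sigma> \<epsilon> \<and> \<xi>' \<in> Q_data adj \<sigma> \<epsilon> \<and>
        (\<exists>m :: int. \<forall>i. \<xi>' i = \<xi> i + 2 * int (aut_order \<sigma>) * m)}"

definition source :: "('v \<Rightarrow> 'v \<Rightarrow> bool) \<Rightarrow> ('v \<Rightarrow> int) \<Rightarrow> 'v \<Rightarrow> bool" where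
  "source adj \<xi> i \<longleftrightarrow> (\<forall>j. adj i j \<longrightarrow> \<xi> i > \<xi> j)"

definition Q_reflect :: "('v \<Rightarrow> 'v) \<Rightarrow> 'v \<Rightarrow> ('v \<Rightarrow> int) \<Rightarrow> 'v \<Rightarrow> int" where
  "Q_reflect \<sigma> i \<xi> = \<xi>(i := \<xi> i - 2 * orb_size \<sigma> i)"

fun adapted :: "('v \<Rightarrow> 'v \<Rightarrow> bool) \<Rightarrow> ('v \<Rightarrow> 'v) \<Rightarrow> ('v \<Rightarrow> int) \<Rightarrow> 'v list \<Rightarrow> bool" where
  "adapted adj \<sigma> \<xi> [] \<longleftrightarrow> True"
| "adapted adj \<sigma> \<xi> (i # is) \<longleftrightarrow> source adj \<xi> i \<and> adapted adj \<sigma> (Q_reflect \<sigma> i \<xi>) is"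

definition adapted_words ::
  "('v \<Rightarrow> 'v \<Rightarrow> bool) \<Rightarrow> ('v \<Rightarrow> 'v) \<Rightarrow> ('v \<Rightarrow> int) \<Rightarrow> 'v list set" where
  "adapted_words adj \<sigma> \<xi> = {is \<in> reduced_words adj. adapted adj \<sigma> \<xi> is}"


section \<open>Repetition quiver and twisted Auslander--Reiten quiver\<close>

definition repetition_quiver ::
  "('v \<Rightarrow> 'v \<Rightarrow> bool) \<Rightarrow> ('v \<Rightarrow> 'v) \<Rightarrow> ('v \<Rightarrow> int) \<Rightarrow> ('v \<times> int) quiver" where
  "repetition_quiver adj \<sigma> \<epsilon> =
     (let V = {(i, p). 2 * orb_size \<sigma> i dvd p - \<epsilon> i}
      in \<lparr>verts = V,
          arrows = {((i, p), (j, s)) | i p j s. (i, p) \<in> V \<and> (j, s) \<in> V \<and>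
            adj i j \<and> s - p = min (orb_size \<sigma> i) (orb_size \<sigma> j)}\<rparr>)"

definition full_subquiver :: "'a quiver \<Rightarrow> 'a set \<Rightarrow> 'a quiver" where
  "full_subquiver G S = \<lparr>verts = verts G \<inter> S, arrows = arrows G \<inter> S \<times> S\<rparr>"

definition twisted_AR_quiver ::
  "('v \<Rightarrow> 'v \<Rightarrow> bool) \<Rightarrow> ('v \<Rightarrow> 'v) \<Rightarrow> ('v \<Rightarrow> int) \<Rightarrow> ('v \<Rightarrow> int) \<Rightarrow> ('v \<times> int) quiver" where
  "twisted_AR_quiver adj \<sigma> \<epsilon> \<xi> =
     full_subquiver (repetition_quiver adj \<sigma> \<epsilon>)
       {(i, \<xi> i - 2 * orb_size \<sigma> i * k) | i k.
          0 \<le> 2 * orb_size \<sigma> i * k \<and>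
          2 * orb_size \<sigma> i * k < r_dual_coxeter adj \<sigma> + \<xi> i - \<xi> (star adj i)}"

end

theory Submission
  imports Defs "HOL-Library.Function_Algebras" "HOL-Analysis.Analysis"
begin

text \<open>
  Encode a Q-datum by the down-set \<open>{(i, p). p \<le> \<xi> i}\<close> of the repetition quiver. Applying a source
  removes a maximal vertex, so words adapted to \<open>\<xi>\<close> are linear extensions of the difference of two
  down-sets, and two of them with the same final height function are commutation equivalent.
  Everything hinges on the claim that the reduced words of the longest element that are adapted
  to \<open>\<xi>\<close> are exactly those that end at \<open>\<xi> \<circ> star - h\<close>, where \<open>h\<close> is \<open>r\<close> times the dual Coxeter
  number. It is proved uniformly. At the first angle \<open>\<theta>\<close> for which the quantum Cartan matrix at
  \<open>q = exp (\<i> \<theta>)\<close> is singular, its kernel contains a positive vector \<open>v\<close> (Perron--Frobenius), and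
  \<open>(i, p) \<mapsto> v i * sin ((c - p) * \<theta>)\<close> is additive on the meshes of the repetition quiver. This gives a
  linear form whose value on the root attached to \<open>(i, p)\<close> is this wave, so all roots met along an
  adapted word are positive during half a period \<open>h = pi / \<theta>\<close>, and then all of them have been met.
  Counting the vertices in half a period gives \<open>2 |R\<^sup>+| = h |I|\<close>; the trace of the Casimir operator
  of the folded root system gives the same equation for \<open>r h\<^sup>\<or>\<close>, hence \<open>h = r h\<^sup>\<or>\<close>.

  The isomorphism of quivers sends the vertex removed at step \<open>k\<close> to the \<open>k\<close>-th root; it is unique
  because a fibre-preserving automorphism shifts every column by a constant. An adapted word
  determines the differences of \<open>\<xi>\<close> from the number of letters \<open>i\<close> before the first neighbour \<open>j\<close>.
  Reflection functors correspond to source reflections of \<open>\<xi>\<close>, so the classes of adapted words form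
  one \<open>r\<close>-cluster point, and every Coxeter word is adapted to the height function
  \<open>t i - 2 l\<close> at the vertex \<open>\<sigma>\<^sup>l i\<close> for a suitable \<open>\<sigma>\<close>-invariant \<open>t\<close>.
\<close>

section \<open>Roots and reduced words\<close>

text \<open>The obstacle is that the lower boundary of the twisted quiver involves
  \<open>star\<close>, defined through the longest element, and \<open>r_dual_coxeter\<close>,
  defined through the recursion for the folded roots; neither is visible along an adapted word.
  Waves enter because a function \<open>v i * q ^ p\<close> on the repetition quiver is additive on
  meshes when the invariant vector \<open>v\<close> lies in the kernel of the quantum Cartan matrix
  at \<open>q\<close>. For \<open>q\<close> on the unit circle the real solutions are sines, and
  their change of sign after half a period is what the longest element does to the positive roots.
  Positivity is checked only for horizontal cuts of the repetition quiver, column by column; every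
  other height function is reached from a cut by source reflections, and these preserve the claim
  about the endpoint. The involution enters through levels: \<open>p\<close> is a level of column
  \<open>i\<close> exactly if \<open>p - h\<close> is a level of column \<open>star i\<close>. For
  nontrivial \<sigma> this also determines which power of \<sigma> the involution is.\<close>

lemma equivclp_invariant:
  assumes "equivclp R x y" "P x" "\<And>a b. R a b \<Longrightarrow> P a \<longleftrightarrow> P b"
  shows "P y"
  using assms(1,2) unfolding equivclp_def symclp_def
  by (induction rule: rtranclp_induct) (auto simp: assms(3))

text \<open>Roots are stored as coefficient vectors over the simple roots, whereas
  \<open>weight\<close> stores pairings with them. In these coordinates positivity is a condition on
  signs, and a word without the letter \<open>i\<close> visibly preserves the \<open>i\<close>-th
  coordinate.\<close>

definition sroot :: "'v \<Rightarrow> 'v \<Rightarrow> int" where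
  "sroot i = (\<lambda>k. of_bool (k = i))"

definition nonneg :: "('v \<Rightarrow> int) \<Rightarrow> bool" where
  "nonneg m \<longleftrightarrow> (\<forall>k. 0 \<le> m k)"

lemma sum_sroot [simp]: "(\<Sum>k\<in>UNIV. sroot i k * f k) = f (i::'v::finite)"
  by (simp add: sroot_def)

lemma nonneg_sroot [simp]: "nonneg (sroot i)"
  by (simp add: nonneg_def sroot_def)

definition additive :: "(('v \<Rightarrow> int) \<Rightarrow> ('v \<Rightarrow> int)) \<Rightarrow> bool" where
  "additive w \<longleftrightarrow> (\<forall>x y. w (x + y) = w x + w y)"

lemma additive_zero: "additive w \<Longrightarrow> w 0 = 0"
  unfolding additive_def by (metis add.right_neutral add_left_cancel)

lemma additive_uminus: "additive w \<Longrightarrow> w (- x) = - w x"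
  by (metis additive_def additive_zero add.right_inverse add_left_cancel)

lemma additive_diff: "additive w \<Longrightarrow> w (x - y) = w x - w y"
  by (metis additive_def additive_uminus diff_conv_add_uminus)

lemma additive_scale_nat: "additive w \<Longrightarrow> w (\<lambda>k. int n * x k) = (\<lambda>k. int n * w x k)"
proof (induction n)
  case 0
  then show ?case using additive_zero[of w] by (simp add: zero_fun_def)
next
  case (Suc n)
  have "(\<lambda>k. int (Suc n) * x k) = (\<lambda>k. int n * x k) + x"
    by (auto simp: algebra_simps)
  then show ?case using Suc by (auto simp: additive_def algebra_simps)
qed

lemma additive_scale:
  assumes "additive w"
  shows "w (\<lambda>k. c * x k) = (\<lambda>k. c * w x k)"
proof (cases "c \<ge> 0")
  case True
  then show ?thesis using additive_scale_nat[OF assms, of "nat c" x] by simp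
next
  case False
  have "(\<lambda>k. c * x k) = - (\<lambda>k. int (nat (- c)) * x k)"
    using False by (auto simp: fun_eq_iff)
  then have "w (\<lambda>k. c * x k) = - w (\<lambda>k. int (nat (- c)) * x k)"
    using additive_uminus[OF assms] by metis
  also have "\<dots> = - (\<lambda>k. int (nat (- c)) * w x k)"
    by (simp only: additive_scale_nat[OF assms])
  finally show ?thesis using False by (auto simp: fun_eq_iff)
qed

lemma additive_sum:
  assumes "additive w" "finite A"
  shows "w (\<Sum>a\<in>A. f a) = (\<Sum>a\<in>A. w (f a))"
  using assms(2)
proof induction
  case empty
  show ?case using additive_zero[OF assms(1)] by (simp only: sum.empty)
next
  case (insert x F)
  then show ?case using assms(1) by (simp only: sum.insert additive_def not_False_eq_True)
qed

lemma sum_fun_apply: "(\<Sum>a\<in>A. f a) k = (\<Sum>a\<in>A. f a k)"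
  by (induction A rule: infinite_finite_induct) auto

lemma sroot_expansion: "(m :: 'v::finite \<Rightarrow> int) = (\<Sum>i\<in>UNIV. (\<lambda>k. m i * sroot i k))"
  by (auto simp: fun_eq_iff sum_fun_apply sroot_def)

lemma additive_expansion:
  fixes w :: "('v::finite \<Rightarrow> int) \<Rightarrow> ('v \<Rightarrow> int)"
  assumes "additive w"
  shows "w m k = (\<Sum>i\<in>UNIV. m i * w (sroot i) k)"
proof -
  have "w m = w (\<Sum>i\<in>UNIV. (\<lambda>k. m i * sroot i k))"
    using sroot_expansion[of m] by simp
  also have "\<dots> = (\<Sum>i\<in>UNIV. w (\<lambda>k. m i * sroot i k))"
    by (rule additive_sum[OF assms]) simp
  finally show ?thesis
    by (simp add: sum_fun_apply additive_scale[OF assms])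
qed

lemma additive_eqI:
  fixes w :: "('v::finite \<Rightarrow> int) \<Rightarrow> ('v \<Rightarrow> int)"
  assumes "additive w" "additive v" "\<And>i. w (sroot i) = v (sroot i)"
  shows "w = v"
proof (intro ext)
  fix m k
  show "w m k = v m k"
    unfolding additive_expansion[OF assms(1), of m k] additive_expansion[OF assms(2), of m k]
    by (simp only: assms(3))
qed

text \<open>Row \<open>i\<close> of the Cartan matrix applied to \<open>m\<close>, that is, the
  pairing of \<open>m\<close> with \<open>sroot i\<close>. As a function of \<open>i\<close> it is
  the weight with root coordinates \<open>m\<close>.\<close>

definition pr :: "('v::finite \<Rightarrow> 'v \<Rightarrow> bool) \<Rightarrow> ('v \<Rightarrow> int) \<Rightarrow> 'v \<Rightarrow> int" where
  "pr adj m i = (\<Sum>j\<in>UNIV. simple_root adj i j * m j)"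

definition ip :: "('v::finite \<Rightarrow> 'v \<Rightarrow> bool) \<Rightarrow> ('v \<Rightarrow> int) \<Rightarrow> ('v \<Rightarrow> int) \<Rightarrow> int" where
  "ip adj x y = (\<Sum>i\<in>UNIV. x i * pr adj y i)"

definition refl :: "('v::finite \<Rightarrow> 'v \<Rightarrow> bool) \<Rightarrow> 'v \<Rightarrow> ('v \<Rightarrow> int) \<Rightarrow> 'v \<Rightarrow> int" where
  "refl adj i m = (\<lambda>k. m k - pr adj m i * sroot i k)"

definition act :: "('v::finite \<Rightarrow> 'v \<Rightarrow> bool) \<Rightarrow> 'v list \<Rightarrow> ('v \<Rightarrow> int) \<Rightarrow> 'v \<Rightarrow> int" where
  "act adj is = foldr (\<lambda>i w. refl adj i \<circ> w) is id"

text \<open>In a positive definite simply-laced lattice the roots are the vectors of norm 2. With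
  this definition invariance is immediate; that every such vector is a translate of a simple root,
  up to sign, comes out of \<open>word_roots_image\<close>.\<close>

definition roots :: "('v::finite \<Rightarrow> 'v \<Rightarrow> bool) \<Rightarrow> ('v \<Rightarrow> int) set" where
  "roots adj = {m. ip adj m m = 2}"

definition pos_roots :: "('v::finite \<Rightarrow> 'v \<Rightarrow> bool) \<Rightarrow> ('v \<Rightarrow> int) set" where
  "pos_roots adj = {m \<in> roots adj. nonneg m}"

text \<open>These are the inversions of the element itself and not of its inverse, so they respond
  to a letter appended on the right.\<close>

definition inversions :: "('v::finite \<Rightarrow> 'v \<Rightarrow> bool) \<Rightarrow> 'v list \<Rightarrow> ('v \<Rightarrow> int) set" where
  "inversions adj is = {m \<in> pos_roots adj. nonneg (- act adj is m)}"

text \<open>Phrased by the signs of the roots met along the word, since these are the signs that the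
  sine wave decides. Agreement with minimal length follows from \<open>reduced_iff_card\<close> and
  \<open>weyl_length_word\<close>.\<close>

definition reduced :: "('v::finite \<Rightarrow> 'v \<Rightarrow> bool) \<Rightarrow> 'v list \<Rightarrow> bool" where
  "reduced adj is \<longleftrightarrow> (\<forall>us i vs. is = us @ i # vs \<longrightarrow> nonneg (act adj us (sroot i)))"

definition negating :: "('v::finite \<Rightarrow> 'v \<Rightarrow> bool) \<Rightarrow> 'v list \<Rightarrow> bool" where
  "negating adj is \<longleftrightarrow> (\<forall>i. nonneg (- act adj is (sroot i)))"

lemma act_Nil [simp]: "act adj [] = id"
  by (simp add: act_def)

lemma act_Cons: "act adj (i # is) = refl adj i \<circ> act adj is"
  by (simp add: act_def)

lemma act_append: "act adj (is @ js) = act adj is \<circ> act adj js"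
  by (induction "is") (auto simp: act_Cons)

lemma pr_add: "pr adj (x + y) i = pr adj x i + pr adj y i"
  by (simp add: pr_def sum.distrib algebra_simps)

lemma pr_uminus: "pr adj (- x) i = - pr adj x i"
  by (simp add: pr_def sum_negf)

lemma pr_diff: "pr adj (x - y) i = pr adj x i - pr adj y i"
  by (simp add: pr_def sum_subtractf algebra_simps)

lemma pr_scale: "pr adj (\<lambda>k. c * x k) i = c * pr adj x i"
  by (simp add: pr_def sum_distrib_left algebra_simps)

lemma pr_sroot: "pr adj (sroot j) i = simple_root adj i j"
proof -
  have "pr adj (sroot j) i = (\<Sum>k\<in>UNIV. sroot j k * simple_root adj i k)"
    by (simp add: pr_def mult.commute)
  then show ?thesis by simp
qed

lemma ip_add_left: "ip adj (x + y) z = ip adj x z + ip adj y z"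
  by (simp add: ip_def sum.distrib algebra_simps)

lemma ip_add_right: "ip adj x (y + z) = ip adj x y + ip adj x z"
  by (simp add: ip_def pr_add sum.distrib algebra_simps)

lemma ip_uminus_left: "ip adj (- x) y = - ip adj x y"
  by (simp add: ip_def sum_negf)

lemma ip_uminus_right: "ip adj x (- y) = - ip adj x y"
  by (simp add: ip_def pr_uminus sum_negf)

lemma ip_diff_left: "ip adj (x - y) z = ip adj x z - ip adj y z"
  by (simp add: ip_def sum_subtractf algebra_simps)

lemma ip_diff_right: "ip adj x (y - z) = ip adj x y - ip adj x z"
  by (simp add: ip_def pr_diff sum_subtractf algebra_simps)

lemma ip_scale_left: "ip adj (\<lambda>k. c * x k) y = c * ip adj x y"
  by (simp add: ip_def sum_distrib_left algebra_simps)

lemma ip_scale_right: "ip adj x (\<lambda>k. c * y k) = c * ip adj x y"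
  by (simp add: ip_def pr_scale sum_distrib_left algebra_simps)

lemma ip_zero [simp]: "ip adj 0 x = 0" "ip adj x 0 = 0"
  by (simp_all add: ip_def pr_def)

lemma ip_sroot_left: "ip adj (sroot i) y = pr adj y i"
  by (simp add: ip_def)

lemma ip_sum_left: "ip adj (\<Sum>a\<in>A. f a) y = (\<Sum>a\<in>A. ip adj (f a) y)"
  by (induction A rule: infinite_finite_induct) (simp_all only: sum.infinite sum.empty sum.insert not_False_eq_True ip_zero ip_add_left)

lemma ip_sum_right: "ip adj y (\<Sum>a\<in>A. f a) = (\<Sum>a\<in>A. ip adj y (f a))"
  by (induction A rule: infinite_finite_induct) (simp_all only: sum.infinite sum.empty sum.insert not_False_eq_True ip_zero ip_add_right)

lemmas ip_linear = ip_add_left ip_add_right ip_uminus_left ip_uminus_right ip_diff_left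
  ip_diff_right ip_scale_left ip_scale_right

lemma refl_alt: "refl adj i m = m - (\<lambda>k. pr adj m i * sroot i k)"
  by (auto simp: refl_def)

lemma refl_apply: "refl adj i m k = (if k = i then m i - pr adj m i else m k)"
  by (auto simp: refl_def sroot_def)

lemma additive_refl: "additive (refl adj i)"
  by (auto simp: additive_def refl_def pr_add algebra_simps)

lemma additive_act: "additive (act adj is)"
proof (induction "is")
  case Nil
  then show ?case by (simp add: additive_def)
next
  case (Cons i "is")
  then show ?case using additive_refl[of adj i] by (simp add: act_Cons additive_def)
qed

lemmas act_add = additive_act[unfolded additive_def, rule_format]
lemmas act_uminus = additive_uminus[OF additive_act]
lemmas act_diff = additive_diff[OF additive_act]
lemmas act_scale = additive_scale[OF additive_act]
lemmas act_expansion = additive_expansion[OF additive_act]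
lemmas act_zero [simp] = additive_zero[OF additive_act]

lemma act_apply_notin: "i \<notin> set is \<Longrightarrow> act adj is m i = m i"
  by (induction "is") (auto simp: act_Cons refl_apply)

lemma reduced_Nil [simp]: "reduced adj []"
  by (simp add: reduced_def)

lemma reduced_prefix: "reduced adj (is @ js) \<Longrightarrow> reduced adj is"
  by (auto simp: reduced_def)

lemma reduced_snoc:
  "reduced adj (is @ [i]) \<longleftrightarrow> reduced adj is \<and> nonneg (act adj is (sroot i))"
proof safe
  assume r: "reduced adj (is @ [i])"
  then show "reduced adj is" by (rule reduced_prefix)
  show "nonneg (act adj is (sroot i))" using r by (auto simp: reduced_def)
next
  assume r: "reduced adj is" "nonneg (act adj is (sroot i))"
  show "reduced adj (is @ [i])"
    unfolding reduced_def
  proof (intro allI impI)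
    fix us j vs assume e: "is @ [i] = us @ j # vs"
    show "nonneg (act adj us (sroot j))"
      using e r by (cases vs rule: rev_cases) (auto simp: reduced_def)
  qed
qed

lemma word_prod_Cons: "word_prod adj (i # is) = simple_refl adj i \<circ> word_prod adj is"
  by (simp add: word_prod_def)

lemma word_prod_Nil: "word_prod adj [] = id"
  by (simp add: word_prod_def)

section \<open>The root system and the length function of a positive definite graph\<close>

locale posdef_graph =
  fixes adj :: "'v::finite \<Rightarrow> 'v \<Rightarrow> bool"
  assumes adj_sym: "adj i j \<Longrightarrow> adj j i"
    and adj_irrefl: "\<not> adj i i"
    and connected: "adj\<^sup>*\<^sup>* i j"
    and posdef: "x \<noteq> (\<lambda>_. 0::real) \<Longrightarrow>
      (\<Sum>i\<in>UNIV. \<Sum>j\<in>UNIV. if adj i j then x i * x j else 0) < (\<Sum>i\<in>UNIV. 2 * (x i)\<^sup>2)"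
begin

lemma adj_commute: "adj i j \<longleftrightarrow> adj j i"
  using adj_sym by blast

lemma simple_root_commute: "simple_root adj i j = simple_root adj j i"
  by (auto simp: simple_root_def adj_commute)

lemma ip_commute: "ip adj x y = ip adj y x"
proof -
  have "ip adj x y = (\<Sum>i\<in>UNIV. \<Sum>j\<in>UNIV. x i * simple_root adj i j * y j)"
    by (simp add: ip_def pr_def sum_distrib_left algebra_simps)
  also have "\<dots> = (\<Sum>j\<in>UNIV. \<Sum>i\<in>UNIV. x i * simple_root adj i j * y j)"
    by (rule sum.swap)
  also have "\<dots> = ip adj y x"
    by (simp add: ip_def pr_def sum_distrib_left algebra_simps simple_root_commute)
  finally show ?thesis .
qed

lemma ip_sroot_right: "ip adj y (sroot i) = pr adj y i"
  by (simp add: ip_commute[of y] ip_sroot_left)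

lemma pr_alt: "pr adj m i = 2 * m i - (\<Sum>j | adj i j. m j)"
proof -
  have "simple_root adj i j * m j = (if j = i then 2 * m i else 0) - (if adj i j then m j else 0)" for j
    using adj_irrefl[of i] by (auto simp: simple_root_def)
  then have "pr adj m i = (\<Sum>j\<in>UNIV. (if j = i then 2 * m i else 0) - (if adj i j then m j else 0))"
    by (simp add: pr_def)
  then show ?thesis
    by (simp add: sum_subtractf sum.If_cases)
qed

lemma ip_pos: assumes "x \<noteq> 0" shows "0 < ip adj x x"
proof -
  define y where "y = (\<lambda>i. real_of_int (x i))"
  have "y \<noteq> (\<lambda>_. 0)" using assms by (auto simp: y_def fun_eq_iff)
  from posdef[OF this] have
    "(\<Sum>i\<in>UNIV. \<Sum>j\<in>UNIV. if adj i j then y i * y j else 0) < (\<Sum>i\<in>UNIV. 2 * (y i)\<^sup>2)" .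
  moreover have "real_of_int (ip adj x x) =
      (\<Sum>i\<in>UNIV. 2 * (y i)\<^sup>2) - (\<Sum>i\<in>UNIV. \<Sum>j\<in>UNIV. if adj i j then y i * y j else 0)"
    by (simp add: ip_def pr_alt y_def sum_subtractf algebra_simps sum.If_cases power2_eq_square
        sum_distrib_left)
  ultimately show ?thesis by linarith
qed

lemma ip_nonneg: "0 \<le> ip adj x x"
  using ip_pos[of x] by (cases "x = 0") auto

lemma ip_refl: "ip adj (refl adj i x) (refl adj i y) = ip adj x y"
  by (simp add: refl_alt ip_linear ip_sroot_left ip_sroot_right pr_sroot simple_root_def)

lemma ip_act: "ip adj (act adj is x) (act adj is y) = ip adj x y"
  by (induction "is" arbitrary: x y) (auto simp: act_Cons ip_refl)

lemma refl_refl [simp]: "refl adj i (refl adj i m) = m"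
  by (auto simp: refl_alt pr_diff pr_scale pr_sroot simple_root_def fun_eq_iff)

lemma act_rev [simp]: "act adj (rev is) (act adj is m) = m"
  by (induction "is" arbitrary: m) (auto simp: act_append act_Cons)

lemma act_rev' [simp]: "act adj is (act adj (rev is) m) = m"
  using act_rev[of "rev is"] by simp

lemma inj_act: "act adj is x = act adj is y \<Longrightarrow> x = y"
  by (metis act_rev)

lemma sroot_roots [simp]: "sroot i \<in> roots adj"
  by (simp add: roots_def ip_sroot_left pr_sroot simple_root_def)

lemma act_roots [simp]: "act adj is m \<in> roots adj \<longleftrightarrow> m \<in> roots adj"
  by (simp add: roots_def ip_act)

lemma refl_roots [simp]: "refl adj i m \<in> roots adj \<longleftrightarrow> m \<in> roots adj"
  by (simp add: roots_def ip_refl)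

lemma uminus_roots [simp]: "- m \<in> roots adj \<longleftrightarrow> m \<in> roots adj"
  by (simp add: roots_def ip_linear)

lemma roots_neq_0: "m \<in> roots adj \<Longrightarrow> m \<noteq> 0"
  by (auto simp: roots_def)

lemma nonneg_antisym: "m \<in> roots adj \<Longrightarrow> nonneg m \<Longrightarrow> \<not> nonneg (- m)"
proof
  assume m: "m \<in> roots adj" "nonneg m" "nonneg (- m)"
  have "m k = 0" for k
    using m(2,3)[unfolded nonneg_def, THEN spec, of k] by simp
  then have "m = 0" by auto
  then show False using roots_neq_0[OF m(1)] by simp
qed

text \<open>The double sum runs over ordered pairs, so each edge contributes its product twice, and
  the diagonal contributes twice a square.\<close>

lemma root_norm_bound: "even (ip adj x x)"
proof -
  have "ip adj x x = (\<Sum>i\<in>UNIV. 2 * (x i * x i)) - (\<Sum>i\<in>UNIV. \<Sum>j\<in>UNIV. if adj i j then x i * x j else 0)"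
    by (simp add: ip_def pr_alt sum_subtractf algebra_simps sum.If_cases sum_distrib_left)
  moreover have "even (\<Sum>(i,j)\<in>{(i,j). adj i j}. x i * x j)"
  proof -
    obtain f :: "'v \<Rightarrow> nat" where f: "inj f"
      using finite_imp_inj_to_nat_seg[of "UNIV :: 'v set"] by auto
    let ?E = "\<lambda>R. {(i,j). adj i j \<and> R (f i) (f j)}"
    have "{(i,j). adj i j} = ?E (<) \<union> ?E (>)"
      using f adj_irrefl by (auto simp: inj_def) (metis linorder_neqE_nat)
    then have "(\<Sum>(i,j)\<in>{(i,j). adj i j}. x i * x j) = (\<Sum>(i,j)\<in>?E (<). x i * x j) + (\<Sum>(i,j)\<in>?E (>). x i * x j)"
      by (simp add: sum.union_disjoint disjoint_iff)
    also have "(\<Sum>(i,j)\<in>?E (>). x i * x j) = (\<Sum>(i,j)\<in>?E (<). x i * x j)"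
      by (rule sum.reindex_bij_witness[of _ "\<lambda>(i,j). (j,i)" "\<lambda>(i,j). (j,i)"])
        (auto simp: adj_commute mult.commute)
    finally show ?thesis by simp
  qed
  moreover have "(\<Sum>i\<in>UNIV. \<Sum>j\<in>UNIV. if adj i j then x i * x j else 0) = (\<Sum>(i,j)\<in>{(i,j). adj i j}. x i * x j)"
    by (simp add: sum.cartesian_product)
      (intro sum.mono_neutral_cong_right, auto split: if_splits)
  ultimately show ?thesis by (simp add: dvd_sum)
qed

lemma ip_ge_2: "x \<noteq> 0 \<Longrightarrow> 2 \<le> ip adj x x"
  using ip_pos[of x] root_norm_bound[of x] by (auto elim!: evenE)

text \<open>Splitting a vector of norm 2 into its positive and negative part, each of norm at
  least 2 unless it vanishes, shows that it cannot have coordinates of both signs.\<close>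

lemma root_sign: assumes "m \<in> roots adj" shows "nonneg m \<or> nonneg (- m)"
proof (rule ccontr)
  assume "\<not> ?thesis"
  then obtain a b where ab: "m a < 0" "m b > 0" by (auto simp: nonneg_def not_le)
  define p where "p = (\<lambda>k. max 0 (m k))"
  define q where "q = (\<lambda>k. max 0 (- m k))"
  have m: "m = p - q" by (auto simp: p_def q_def max_def)
  have "p b \<noteq> 0" "q a \<noteq> 0" using ab by (auto simp: p_def q_def)
  then have "p \<noteq> 0" "q \<noteq> 0" by auto
  then have "2 \<le> ip adj p p" "2 \<le> ip adj q q" by (auto intro: ip_ge_2)
  moreover have "ip adj p q \<le> 0"
  proof -
    have "p i * pr adj q i \<le> 0" for i
    proof (cases "p i = 0")
      case False
      then have "q i = 0" "p i > 0" by (auto simp: p_def q_def max_def split: if_splits)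
      moreover have "0 \<le> (\<Sum>j | adj i j. q j)" by (intro sum_nonneg) (auto simp: q_def)
      ultimately show ?thesis by (simp add: pr_alt zero_le_mult_iff)
    qed auto
    then show ?thesis by (auto simp: ip_def intro: sum_nonpos)
  qed
  moreover have "ip adj m m = ip adj p p + ip adj q q - 2 * ip adj p q"
    by (simp add: m ip_linear ip_commute[of q p])
  ultimately show False using assms by (simp add: roots_def)
qed

lemma root_not_nonneg: "m \<in> roots adj \<Longrightarrow> \<not> nonneg m \<longleftrightarrow> nonneg (- m)"
  using root_sign[of m] nonneg_antisym[of m] by auto

lemma pos_rootsD: "m \<in> pos_roots adj \<Longrightarrow> m \<in> roots adj" "m \<in> pos_roots adj \<Longrightarrow> nonneg m"
  by (auto simp: pos_roots_def)

lemma sroot_pos [simp]: "sroot i \<in> pos_roots adj"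
  by (simp add: pos_roots_def)

lemma refl_sroot [simp]: "refl adj i (sroot i) = - sroot i"
  by (auto simp: refl_alt pr_sroot simple_root_def)

text \<open>A vector supported on \<open>i\<close> alone has norm \<open>2 * m i * m i\<close>, so
  norm 2 and positivity force it to be \<open>sroot i\<close>.\<close>

lemma pos_root_other:
  assumes "m \<in> pos_roots adj" "m \<noteq> sroot i"
  obtains k where "k \<noteq> i" "m k > 0"
proof (cases "\<exists>k. k \<noteq> i \<and> m k > 0")
  case False
  then have z: "m k = 0" if "k \<noteq> i" for k
    using False assms(1) that by (auto simp: pos_roots_def nonneg_def not_less intro: antisym)
  then have "m = (\<lambda>k. m i * sroot i k)" by (auto simp: sroot_def)
  then have "ip adj m m = ip adj (\<lambda>k. m i * sroot i k) (\<lambda>k. m i * sroot i k)"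
    by simp
  also have "\<dots> = m i * m i * 2"
    unfolding ip_scale_left ip_scale_right ip_sroot_left pr_sroot by (simp add: simple_root_def)
  finally have "ip adj m m = m i * m i * 2" .
  then have "m i * m i = 1" using assms(1) by (simp add: pos_roots_def roots_def)
  moreover have "m i \<ge> 0" using assms(1) by (auto simp: pos_roots_def nonneg_def)
  ultimately have "m i = 1" by (simp add: zmult_eq_1_iff)
  then have "m = sroot i" using z by (auto simp: sroot_def)
  then show ?thesis using assms by simp
qed (use that in auto)

text \<open>The reflection changes coordinate \<open>i\<close> only, so some other coordinate stays
  positive, and \<open>root_sign\<close> then settles the sign of all of them.\<close>

lemma refl_pos:
  assumes "m \<in> pos_roots adj" "m \<noteq> sroot i"
  shows "refl adj i m \<in> pos_roots adj" "refl adj i m \<noteq> sroot i"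
proof -
  obtain k where k: "k \<noteq> i" "m k > 0" using pos_root_other[OF assms] .
  then have k2: "refl adj i m k > 0" by (simp add: refl_apply)
  have r: "refl adj i m \<in> roots adj" using assms by (simp add: pos_rootsD)
  show "refl adj i m \<in> pos_roots adj"
  proof -
    have "\<not> nonneg (- refl adj i m)"
    proof
      assume "nonneg (- refl adj i m)"
      then have "0 \<le> (- refl adj i m) k" unfolding nonneg_def by blast
      then show False using k2 by simp
    qed
    then show ?thesis using root_sign[OF r] r by (simp add: pos_roots_def)
  qed
  show "refl adj i m \<noteq> sroot i"
    using k k2 by (auto simp: sroot_def)
qed

text \<open>Both \<open>m + sroot i\<close> and \<open>m - sroot i\<close> have nonnegative norm,
  and these norms are 4 plus or minus twice the pairing.\<close>

lemma pr_bound: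
  assumes "m \<in> roots adj" shows "\<bar>pr adj m i\<bar> \<le> 2"
proof -
  have "0 \<le> ip adj (m + sroot i) (m + sroot i)" "0 \<le> ip adj (m - sroot i) (m - sroot i)"
    by (rule ip_nonneg)+
  then show ?thesis using assms
    by (simp add: ip_linear ip_sroot_left ip_sroot_right pr_sroot simple_root_def roots_def)
qed

lemma pr_inj: assumes "pr adj x = pr adj y" shows "x = y"
proof -
  have "ip adj (x - y) (x - y) = 0"
    using assms by (simp add: ip_def pr_diff)
  then show ?thesis using ip_pos[of "x - y"] by fastforce
qed

text \<open>Pairing with the simple roots embeds the roots into a finite box.\<close>

lemma finite_roots [simp]: "finite (roots adj)"
proof (rule finite_imageD)
  show "finite (pr adj ` roots adj)"
  proof (rule finite_subset)
    show "pr adj ` roots adj \<subseteq> PiE UNIV (\<lambda>_. {-2..2})"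
    proof (clarsimp simp: PiE_def)
      show "- 2 \<le> pr adj m i \<and> pr adj m i \<le> 2" if "m \<in> roots adj" for m i
        using pr_bound[OF that, of i] by (simp add: abs_le_iff)
    qed
    show "finite (PiE (UNIV :: 'v set) (\<lambda>_. {-2..2::int}))"
      by (rule finite_PiE) auto
  qed
  show "inj_on (pr adj) (roots adj)" using pr_inj by (auto intro: inj_onI)
qed

lemma finite_pos_roots [simp]: "finite (pos_roots adj)"
  by (rule finite_subset[OF _ finite_roots]) (auto simp: pos_roots_def)

lemma act_neg_not_nonneg: "nonneg (- act adj is (sroot i)) \<longleftrightarrow> \<not> nonneg (act adj is (sroot i))"
  using root_not_nonneg[of "act adj is (sroot i)"] by simp

text \<open>A simple reflection changes the sign of one positive root only, its own. Following
  \<open>sroot i\<close> through the word from the right, a letter \<open>j\<close> at which the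
  root becomes negative must find it equal to \<open>sroot j\<close>.\<close>

lemma exchange:
  assumes "nonneg (- act adj is (sroot i))"
  obtains us j vs where "is = us @ j # vs" "act adj vs (sroot i) = sroot j"
  using assms
proof (induction "is" arbitrary: thesis)
  case Nil
  then have "nonneg (- sroot i)" by (metis act_Nil id_apply)
  then show ?case using nonneg_antisym[OF sroot_roots nonneg_sroot, of i] by blast
next
  case (Cons j "is")
  show ?case
  proof (cases "nonneg (- act adj is (sroot i))")
    case True
    then obtain us k vs where "is = us @ k # vs" "act adj vs (sroot i) = sroot k"
      using Cons.IH by blast
    then show ?thesis using Cons.prems(1)[of "j # us" k vs] by simp
  next
    case False
    then have p: "act adj is (sroot i) \<in> pos_roots adj"
      using act_neg_not_nonneg by (simp add: pos_roots_def)
    have "act adj is (sroot i) = sroot j"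
    proof (rule ccontr)
      assume "act adj is (sroot i) \<noteq> sroot j"
      from refl_pos(1)[OF p this] have "nonneg (act adj (j # is) (sroot i))"
        by (simp add: pos_roots_def act_Cons)
      then show False using Cons.prems(2) act_neg_not_nonneg by blast
    qed
    then show ?thesis using Cons.prems(1)[of "[]" j "is"] by simp
  qed
qed

lemma act_refl_conj:
  assumes "act adj vs (sroot i) = sroot j"
  shows "act adj (vs @ [i]) = act adj (j # vs)"
proof
  fix m
  have "pr adj m i = ip adj (act adj vs (sroot i)) (act adj vs m)"
    by (simp add: ip_act ip_sroot_left)
  also have "\<dots> = pr adj (act adj vs m) j"
    by (simp only: assms ip_sroot_left)
  finally show "act adj (vs @ [i]) m = act adj (j # vs) m"
    by (simp add: act_append act_Cons refl_alt[of adj] act_diff act_scale assms)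
qed

text \<open>If the word is not empty, its prefix without the last letter \<open>i\<close> makes
  \<open>sroot i\<close> negative. By the exchange property this last letter cancels against a
  letter \<open>j\<close> of the prefix, and the shorter word satisfies the same assumption.\<close>

lemma act_eq_id:
  assumes "\<And>i. nonneg (act adj is (sroot i))"
  shows "act adj is = id"
  using assms
proof (induction "length is" arbitrary: "is" rule: less_induct)
  case less
  show ?case
  proof (cases "is" rule: rev_cases)
    case (snoc js i)
    have "nonneg (- act adj js (sroot i))"
      using less.prems[of i] by (simp add: snoc act_append act_Cons act_uminus)
    then obtain us j vs where u: "js = us @ j # vs" "act adj vs (sroot i) = sroot j"
      by (rule exchange)
    have "act adj is = act adj us \<circ> refl adj j \<circ> act adj (vs @ [i])"
      by (simp add: snoc u act_append act_Cons comp_assoc)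
    also have "\<dots> = act adj us \<circ> refl adj j \<circ> refl adj j \<circ> act adj vs"
      using act_refl_conj[OF u(2)] by (simp add: act_Cons comp_assoc)
    also have "\<dots> = act adj (us @ vs)"
      by (auto simp: act_append)
    finally have e: "act adj is = act adj (us @ vs)" .
    have "act adj (us @ vs) = id"
    proof (rule less.hyps)
      show "length (us @ vs) < length is" by (simp add: snoc u)
      show "nonneg (act adj (us @ vs) (sroot i))" for i
        using less.prems e by simp
    qed
    then show ?thesis using e by simp
  qed simp
qed

lemma inversions_cong: "act adj is = act adj js \<Longrightarrow> inversions adj is = inversions adj js"
  by (simp add: inversions_def)

lemma finite_inversions [simp]: "finite (inversions adj is)"
  by (rule finite_subset[OF _ finite_pos_roots]) (auto simp: inversions_def)

text \<open>Reflection at \<open>i\<close> permutes the positive roots other than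
  \<open>sroot i\<close>; it carries the old inversions to new ones, and \<open>sroot i\<close> is
  the additional inversion.\<close>

lemma card_inversions_snoc_pos:
  assumes "nonneg (act adj is (sroot i))"
  shows "card (inversions adj (is @ [i])) = Suc (card (inversions adj is))"
proof -
  have ne: "m \<noteq> sroot i" if "m \<in> inversions adj is" for m
    using that assms act_neg_not_nonneg by (auto simp: inversions_def)
  have "inversions adj (is @ [i]) = insert (sroot i) (refl adj i ` inversions adj is)"
  proof safe
    fix m assume m: "m \<in> inversions adj (is @ [i])" "m \<notin> refl adj i ` inversions adj is"
    show "m = sroot i"
    proof (rule ccontr)
      assume "m \<noteq> sroot i"
      then have "refl adj i m \<in> inversions adj is"
        using m refl_pos[of m i] by (simp add: inversions_def act_append act_Cons)
      then show False using m(2) by (metis image_eqI refl_refl)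
    qed
  next
    show "sroot i \<in> inversions adj (is @ [i])"
      using assms by (simp add: inversions_def act_append act_Cons act_uminus)
  next
    fix m assume m: "m \<in> inversions adj is"
    then show "refl adj i m \<in> inversions adj (is @ [i])"
      using ne[OF m] refl_pos[of m i] by (simp add: inversions_def act_append act_Cons)
  qed
  moreover have "sroot i \<notin> refl adj i ` inversions adj is"
  proof
    assume "sroot i \<in> refl adj i ` inversions adj is"
    then obtain m where m: "m \<in> inversions adj is" "sroot i = refl adj i m" by auto
    then show False using refl_pos(2)[of m i] ne[OF m(1)] by (simp add: inversions_def)
  qed
  moreover have "card (refl adj i ` inversions adj is) = card (inversions adj is)"
    by (intro card_image inj_onI) (metis refl_refl)
  ultimately show ?thesis by simp
qed

lemma card_inversions_snoc_neg:
  assumes "nonneg (- act adj is (sroot i))"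
  shows "card (inversions adj is) = Suc (card (inversions adj (is @ [i])))"
proof -
  have "nonneg (act adj (is @ [i]) (sroot i))"
    using assms by (simp add: act_append act_Cons act_uminus)
  from card_inversions_snoc_pos[OF this]
  have "card (inversions adj ((is @ [i]) @ [i])) = Suc (card (inversions adj (is @ [i])))" .
  moreover have "act adj ((is @ [i]) @ [i]) = act adj is"
    by (auto simp: act_append act_Cons)
  ultimately show ?thesis using inversions_cong[of "(is @ [i]) @ [i]" "is"] by simp
qed

lemma card_inversions_le: "card (inversions adj is) \<le> length is"
proof (induction "is" rule: rev_induct)
  case Nil
  have "inversions adj [] = {}"
    using nonneg_antisym by (auto simp: inversions_def pos_roots_def)
  then show ?case by simp
next
  case (snoc i "is")
  then show ?case
    using card_inversions_snoc_pos[of "is" i] card_inversions_snoc_neg[of "is" i]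
      act_neg_not_nonneg[of "is" i] by (cases "nonneg (act adj is (sroot i))") auto
qed

text \<open>Each letter raises or lowers the number of inversions by one, so this number equals the
  length precisely if it never drops.\<close>

lemma reduced_iff_card: "reduced adj is \<longleftrightarrow> card (inversions adj is) = length is"
proof (induction "is" rule: rev_induct)
  case Nil
  then show ?case using card_inversions_le[of "[]"] by simp
next
  case (snoc i "is")
  show ?case
  proof (cases "nonneg (act adj is (sroot i))")
    case True
    then show ?thesis using snoc card_inversions_snoc_pos[OF True] by (simp add: reduced_snoc)
  next
    case False
    then have "nonneg (- act adj is (sroot i))" using act_neg_not_nonneg by blast
    from card_inversions_snoc_neg[OF this] show ?thesis
      using False card_inversions_le[of "is"] by (simp add: reduced_snoc)
  qed
qed

lemma reduced_cong:
  assumes "act adj is = act adj js" "length is = length js"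
  shows "reduced adj is \<longleftrightarrow> reduced adj js"
  by (simp only: reduced_iff_card inversions_cong[OF assms(1)] assms(2))

lemma exists_reduced: "\<exists>js. reduced adj js \<and> act adj js = act adj is"
proof (induction "card (inversions adj is)" arbitrary: "is" rule: less_induct)
  case less
  show ?case
  proof (cases "\<forall>i. nonneg (act adj is (sroot i))")
    case True
    then have "act adj is = id" by (intro act_eq_id) auto
    then show ?thesis by (intro exI[of _ "[]"]) simp
  next
    case False
    then obtain i where i: "nonneg (- act adj is (sroot i))" using act_neg_not_nonneg by blast
    then have "card (inversions adj (is @ [i])) < card (inversions adj is)"
      using card_inversions_snoc_neg by simp
    from less[OF this] obtain js where js: "reduced adj js" "act adj js = act adj (is @ [i])"
      by blast
    have "act adj (js @ [i]) = act adj is"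
      by (auto simp: act_append act_Cons js)
    moreover have "reduced adj (js @ [i])"
      using js i by (simp add: reduced_snoc act_append act_Cons act_uminus)
    ultimately show ?thesis by blast
  qed
qed

lemma act_rev_cong:
  assumes "act adj is = act adj js" shows "act adj (rev is) = act adj (rev js)"
proof
  fix x
  have "act adj (rev is) x = act adj (rev is) (act adj is (act adj (rev js) x))"
    by (simp add: assms)
  then show "act adj (rev is) x = act adj (rev js) x" by simp
qed

text \<open>The number of inversions is the minimal length of a word, and reversing words exchanges
  the words of an element with those of its inverse. Comparison with a reduced word of the inverse
  avoids matching the two sets of inversions.\<close>

lemma reduced_rev: assumes "reduced adj is" shows "reduced adj (rev is)"
proof -
  obtain js where js: "reduced adj js" "act adj js = act adj (rev is)"
    using exists_reduced by blast
  have "length is = card (inversions adj is)" using assms by (simp add: reduced_iff_card)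
  also have "\<dots> = card (inversions adj (rev js))"
    using act_rev_cong[OF js(2)] inversions_cong[of "rev js" "is"] by simp
  also have "\<dots> \<le> length js" using card_inversions_le[of "rev js"] by simp
  also have "\<dots> = card (inversions adj (rev is))"
    using js(1) inversions_cong[OF js(2)] by (simp add: reduced_iff_card)
  finally show ?thesis using card_inversions_le[of "rev is"] by (simp add: reduced_iff_card)
qed

lemma reduced_suffix: assumes "reduced adj (is @ js)" shows "reduced adj js"
proof -
  have "reduced adj (rev (is @ js))" using assms by (rule reduced_rev)
  then have "reduced adj (rev js)" using reduced_prefix by (metis rev_append)
  then show ?thesis using reduced_rev by fastforce
qed

lemma reduced_Cons_sign:
  assumes "reduced adj (i # is)" shows "nonneg (- act adj (rev (i # is)) (sroot i))"
proof -
  have "reduced adj (rev is @ [i])" using reduced_rev[OF assms] by simp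
  then show ?thesis by (simp add: reduced_snoc act_append act_Cons act_uminus)
qed

text \<open>The inverse of the element makes the simple root of the first letter of
  \<open>is\<close> negative, but written with \<open>js\<close>, which lacks that letter, it keeps
  the coefficient there equal to 1.\<close>

lemma reduced_disjoint_support:
  assumes "reduced adj is" "act adj is = act adj js" "set is \<inter> set js = {}"
  shows "is = []"
proof (cases "is")
  case (Cons i is')
  have "nonneg (- act adj (rev is) (sroot i))"
    using assms(1) reduced_Cons_sign by (simp add: Cons)
  then have "nonneg (- act adj (rev js) (sroot i))"
    using act_rev_cong[OF assms(2)] by simp
  then have "0 \<le> - act adj (rev js) (sroot i) i"
    unfolding nonneg_def by simp
  moreover have "act adj (rev js) (sroot i) i = 1"
    using assms(3) by (subst act_apply_notin) (auto simp: Cons sroot_def)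
  ultimately show ?thesis by simp
qed simp

section \<open>Passage from root coordinates to weights, and the longest element\<close>

lemma simple_refl_pairing:
  "(\<Sum>k\<in>UNIV. simple_refl adj i \<mu> k * refl adj i m k) = (\<Sum>k\<in>UNIV. \<mu> k * m k)"
proof -
  define p where "p = pr adj m i"
  have "(\<Sum>k\<in>UNIV. simple_refl adj i \<mu> k * refl adj i m k)
      = (\<Sum>k\<in>UNIV. \<mu> k * m k - p * (sroot i k * \<mu> k) - \<mu> i * (simple_root adj i k * m k)
        + \<mu> i * p * (sroot i k * simple_root adj i k))"
    unfolding simple_refl_def refl_def p_def[symmetric] by (simp add: algebra_simps)
  also have "\<dots> = (\<Sum>k\<in>UNIV. \<mu> k * m k) - p * (\<Sum>k\<in>UNIV. sroot i k * \<mu> k)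
        - \<mu> i * (\<Sum>k\<in>UNIV. simple_root adj i k * m k)
        + \<mu> i * p * (\<Sum>k\<in>UNIV. sroot i k * simple_root adj i k)"
    by (simp only: sum.distrib sum_subtractf sum_distrib_left)
  also have "(\<Sum>k\<in>UNIV. simple_root adj i k * m k) = p"
    by (simp add: p_def pr_def)
  finally show ?thesis by (simp add: simple_root_def)
qed

text \<open>The sum \<open>\<mu> k * m k\<close> over all \<open>k\<close> is the invariant pairing
  of a weight with a root vector. The two actions are contragredient for it, so identities between
  group elements can be tested on either side.\<close>

lemma word_prod_pairing:
  "(\<Sum>k\<in>UNIV. word_prod adj is \<mu> k * act adj is m k) = (\<Sum>k\<in>UNIV. \<mu> k * m k)"
  by (induction "is") (simp_all add: word_prod_Nil word_prod_Cons act_Cons simple_refl_pairing)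

lemma word_prod_apply: "word_prod adj is \<mu> k = (\<Sum>j\<in>UNIV. \<mu> j * act adj (rev is) (sroot k) j)"
proof -
  have "(\<Sum>j\<in>UNIV. \<mu> j * act adj (rev is) (sroot k) j)
      = (\<Sum>j\<in>UNIV. word_prod adj is \<mu> j * act adj is (act adj (rev is) (sroot k)) j)"
    by (rule word_prod_pairing[symmetric])
  also have "\<dots> = (\<Sum>j\<in>UNIV. sroot k j * word_prod adj is \<mu> j)"
    by (simp add: mult.commute del: sum_sroot)
  finally show ?thesis by simp
qed

lemma word_prod_eq_iff: "word_prod adj is = word_prod adj js \<longleftrightarrow> act adj is = act adj js"
proof
  assume "act adj is = act adj js"
  from act_rev_cong[OF this] show "word_prod adj is = word_prod adj js"
    by (auto simp: word_prod_apply fun_eq_iff)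
next
  assume w: "word_prod adj is = word_prod adj js"
  have "act adj (rev is) (sroot k) i = act adj (rev js) (sroot k) i" for k i
  proof -
    have "word_prod adj is (sroot i) k = word_prod adj js (sroot i) k" using w by simp
    then show ?thesis by (simp add: word_prod_apply)
  qed
  then have "act adj (rev is) = act adj (rev js)"
    by (intro additive_eqI additive_act) (auto simp: fun_eq_iff)
  from act_rev_cong[OF this] show "act adj is = act adj js" by simp
qed

lemma weyl_length_word: "weyl_length adj (word_prod adj is) = card (inversions adj is)"
  unfolding weyl_length_def
proof (rule Least_equality)
  obtain js where js: "reduced adj js" "act adj js = act adj is" using exists_reduced by blast
  then have "length js = card (inversions adj is)"
    using inversions_cong[OF js(2)] by (simp add: reduced_iff_card)
  then show "\<exists>js. length js = card (inversions adj is) \<and> word_prod adj js = word_prod adj is"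
    using js(2) word_prod_eq_iff by blast
next
  fix l assume "\<exists>js. length js = l \<and> word_prod adj js = word_prod adj is"
  then obtain js where "length js = l" "act adj js = act adj is" by (auto simp: word_prod_eq_iff)
  then show "card (inversions adj is) \<le> l"
    using card_inversions_le[of js] inversions_cong[of js "is"] by simp
qed

lemma negating_iff: "negating adj is \<longleftrightarrow> inversions adj is = pos_roots adj"
proof
  assume n: "negating adj is"
  have "nonneg (- act adj is m)" if m: "nonneg m" for m
    unfolding nonneg_def
  proof
    fix k
    have "(- act adj is m) k = (\<Sum>i\<in>UNIV. m i * (- act adj is (sroot i)) k)"
      by (simp add: act_expansion[of adj "is" m] sum_negf)
    also have "\<dots> \<ge> 0"
      using m n by (intro sum_nonneg mult_nonneg_nonneg) (auto simp: nonneg_def negating_def)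
    finally show "0 \<le> (- act adj is m) k" .
  qed
  then show "inversions adj is = pos_roots adj"
    by (auto simp: inversions_def pos_roots_def)
next
  assume "inversions adj is = pos_roots adj"
  then show "negating adj is"
    using sroot_pos unfolding negating_def inversions_def by blast
qed

lemma negating_pos: "negating adj is \<Longrightarrow> m \<in> pos_roots adj \<Longrightarrow> nonneg (- act adj is m)"
  using negating_iff by (auto simp: inversions_def)

lemma negating_cong: "act adj is = act adj js \<Longrightarrow> negating adj is \<longleftrightarrow> negating adj js"
  by (simp add: negating_def)

text \<open>Take an element with the largest number of inversions: if it kept a simple root
  positive, appending that letter would give one more.\<close>

lemma exists_negating: "\<exists>is. negating adj is"
proof -
  have "card (inversions adj is) \<le> card (pos_roots adj)" for "is"
    by (rule card_mono) (auto simp: inversions_def)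
  then obtain "is" where m: "\<And>js. card (inversions adj js) \<le> card (inversions adj is)"
    using ex_has_greatest_nat[of "\<lambda>_. True" "[]" "\<lambda>is. card (inversions adj is)" "card (pos_roots adj) + 1"]
    by (auto simp: less_Suc_eq_le)
  have "nonneg (- act adj is (sroot i))" for i
  proof (rule ccontr)
    assume "\<not> ?thesis"
    then have "nonneg (act adj is (sroot i))" using act_neg_not_nonneg by blast
    from card_inversions_snoc_pos[OF this] m[of "is @ [i]"] show False by simp
  qed
  then show ?thesis by (auto simp: negating_def)
qed

lemma negating_rev_neg:
  assumes "negating adj is" "p \<in> pos_roots adj"
  shows "nonneg (- act adj (rev is) p)"
proof (rule ccontr)
  assume "\<not> ?thesis"
  then have "act adj (rev is) p \<in> pos_roots adj"
    using root_not_nonneg[of "act adj (rev is) p"] assms(2) by (auto simp: pos_roots_def)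
  from negating_pos[OF assms(1) this] show False
    using assms(2) nonneg_antisym[of p] by (simp add: pos_roots_def)
qed

text \<open>The inverse of one element times the other keeps all simple roots positive, hence is the
  identity by \<open>act_eq_id\<close>.\<close>

lemma negating_unique:
  assumes "negating adj is" "negating adj js" shows "act adj is = act adj js"
proof -
  have "act adj (rev is @ js) = id"
  proof (rule act_eq_id)
    fix i
    have "- act adj js (sroot i) \<in> pos_roots adj"
      using assms(2) by (simp add: pos_roots_def negating_def)
    from negating_rev_neg[OF assms(1) this]
    show "nonneg (act adj (rev is @ js) (sroot i))"
      by (simp add: act_append act_uminus)
  qed
  then have "act adj (rev is) (act adj js x) = x" for x
    by (metis act_append comp_apply id_apply)
  then have "act adj is x = act adj js x" for x
    by (metis act_rev')
  then show ?thesis by auto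
qed

lemma longest_element_word:
  assumes "negating adj is" shows "longest_element adj = word_prod adj is"
  unfolding longest_element_def
proof (rule the_equality)
  have c: "card (inversions adj js) \<le> card (inversions adj is)" for js
    using assms by (auto simp: negating_iff inversions_def intro!: card_mono)
  then show "word_prod adj is \<in> weyl_group adj \<and>
      (\<forall>v\<in>weyl_group adj. weyl_length adj v \<le> weyl_length adj (word_prod adj is))"
    by (auto simp: weyl_group_def weyl_length_word)
  fix w assume w: "w \<in> weyl_group adj \<and> (\<forall>v\<in>weyl_group adj. weyl_length adj v \<le> weyl_length adj w)"
  then obtain js where js: "w = word_prod adj js" by (auto simp: weyl_group_def)
  then have "card (inversions adj is) \<le> card (inversions adj js)"
    using w by (auto simp: weyl_group_def weyl_length_word)
  moreover have "card (inversions adj js) \<le> card (pos_roots adj)"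
    by (rule card_mono) (auto simp: inversions_def)
  ultimately have "card (inversions adj js) = card (pos_roots adj)"
    using assms by (simp add: negating_iff)
  then have "inversions adj js = pos_roots adj"
    by (intro card_subset_eq) (auto simp: inversions_def)
  then show "w = word_prod adj is"
    using assms negating_unique negating_iff word_prod_eq_iff js by blast
qed

text \<open>This replaces the definitions by least length and by maximal length with two conditions
  on signs, which are all that is used about reduced words of the longest element when the wave is
  applied.\<close>

lemma reduced_words_iff: "is \<in> reduced_words adj \<longleftrightarrow> negating adj is \<and> reduced adj is"
proof -
  obtain js where js: "negating adj js" using exists_negating by blast
  show ?thesis
    using js negating_unique[OF js, of "is"] negating_cong[of "is" js] inversions_cong[of "is" js]
    by (auto simp: reduced_words_def longest_element_word[OF js] word_prod_eq_iff weyl_length_word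
        reduced_iff_card)
qed

lemma length_reduced_words: "is \<in> reduced_words adj \<Longrightarrow> length is = card (pos_roots adj)"
  by (auto simp: reduced_words_iff reduced_iff_card negating_iff)

lemma exists_reduced_word: "\<exists>is. is \<in> reduced_words adj"
proof -
  obtain "is" where "negating adj is" using exists_negating by blast
  moreover obtain js where "reduced adj js" "act adj js = act adj is"
    using exists_reduced by blast
  ultimately show ?thesis using negating_cong reduced_words_iff by blast
qed

lemma reduced_words_cong:
  assumes "act adj is = act adj js" "length is = length js"
  shows "is \<in> reduced_words adj \<longleftrightarrow> js \<in> reduced_words adj"
  unfolding reduced_words_iff using negating_cong[OF assms(1)] reduced_cong[OF assms] by blast

lemma reduced_words_letters: assumes "is \<in> reduced_words adj" shows "i \<in> set is"
proof (rule ccontr)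
  assume "i \<notin> set is"
  then have "act adj is (sroot i) i = 1" by (simp add: act_apply_notin sroot_def)
  moreover have "0 \<le> (- act adj is (sroot i)) i"
    using assms unfolding reduced_words_iff negating_def nonneg_def by blast
  ultimately show False by simp
qed

lemma simple_root_pr: "simple_root adj i = pr adj (sroot i)"
  by (auto simp: pr_sroot simple_root_commute)

lemma simple_refl_pr: "simple_refl adj i (pr adj m) = pr adj (refl adj i m)"
  by (auto simp: simple_refl_def refl_alt pr_diff pr_scale pr_sroot simple_root_commute[of i])

lemma word_prod_pr: "word_prod adj is (pr adj m) = pr adj (act adj is m)"
  by (induction "is") (simp_all add: word_prod_Nil word_prod_Cons act_Cons simple_refl_pr)

text \<open>\<open>sroot i\<close> is a combination of the vectors \<open>p k\<close> with
  nonnegative integer coefficients \<open>m k\<close>. Each \<open>p k\<close> is nonzero with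
  nonnegative entries, so its entries sum to at least 1, while those of \<open>sroot i\<close> sum
  to exactly 1. Hence a single coefficient is 1 and all others vanish.\<close>

lemma negating_sroot:
  assumes n: "negating adj is" shows "\<exists>j. act adj is (sroot i) = - sroot j"
proof -
  define m where "m = - act adj is (sroot i)"
  define p where "p = (\<lambda>k. - act adj (rev is) (sroot k))"
  have m: "m \<in> pos_roots adj" using n by (simp add: m_def pos_roots_def negating_def)
  then have m0: "0 \<le> m k" for k by (simp add: pos_roots_def nonneg_def)
  have p: "nonneg (p k)" "p k \<noteq> 0" for k
    using negating_rev_neg[OF n, of "sroot k"] roots_neq_0[of "p k"] by (auto simp: p_def)
  have h: "1 \<le> (\<Sum>l\<in>UNIV. p k l)" for k
  proof (rule ccontr)
    assume "\<not> ?thesis"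
    moreover have "\<forall>l. 0 \<le> p k l" using p(1) unfolding nonneg_def by blast
    ultimately have "(\<Sum>l\<in>UNIV. p k l) = 0"
      using sum_nonneg[of UNIV "p k"] by (auto simp: not_le)
    then have "\<forall>l. p k l = 0" using \<open>\<forall>l. 0 \<le> p k l\<close> by (simp add: sum_nonneg_eq_0_iff)
    then show False using p(2)[of k] by auto
  qed
  have "sroot i = - act adj (rev is) m" by (simp add: m_def act_uminus)
  then have e: "sroot i l = (\<Sum>k\<in>UNIV. m k * p k l)" for l
    by (simp add: act_expansion[of adj "rev is" m] p_def sum_negf)
  have "1 = (\<Sum>l\<in>UNIV. sroot i l)" by (simp add: sroot_def)
  also have "\<dots> = (\<Sum>k\<in>UNIV. m k * (\<Sum>l\<in>UNIV. p k l))"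
    unfolding e by (subst sum.swap) (simp add: sum_distrib_left)
  finally have s: "(\<Sum>k\<in>UNIV. m k * (\<Sum>l\<in>UNIV. p k l)) = 1" by simp
  obtain a where a: "m a \<noteq> 0" using roots_neq_0[of m] m by (auto simp: pos_roots_def fun_eq_iff)
  have le: "(\<Sum>k\<in>A. m k) \<le> 1" for A
  proof -
    have "(\<Sum>k\<in>A. m k) \<le> (\<Sum>k\<in>UNIV. m k)" by (rule sum_mono2) (auto simp: m0)
    also have "\<dots> \<le> (\<Sum>k\<in>UNIV. m k * (\<Sum>l\<in>UNIV. p k l))"
    proof (rule sum_mono)
      show "m k \<le> m k * (\<Sum>l\<in>UNIV. p k l)" for k
        using mult_left_mono[OF h[of k] m0[of k]] by simp
    qed
    finally show ?thesis using s by simp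
  qed
  have "m k = (if k = a then 1 else 0)" for k
    using le[of "{a, k}"] le[of "{a}"] a m0[of a] m0[of k] by (auto split: if_splits)
  then have "m = sroot a" by (auto simp: sroot_def)
  then have "act adj is (sroot i) = - sroot a" by (simp add: m_def minus_equation_iff)
  then show ?thesis ..
qed

lemma sroot_inj [simp]: "sroot i = sroot j \<longleftrightarrow> i = j"
  by (auto simp: sroot_def fun_eq_iff)

lemma negating_star:
  assumes "negating adj is" shows "act adj is (sroot i) = - sroot (star adj i)"
proof -
  have e: "longest_element adj (simple_root adj i) = - simple_root adj j \<longleftrightarrow>
      act adj is (sroot i) = - sroot j" for j
  proof -
    have "- pr adj (sroot j) = pr adj (- sroot j)" by (auto simp: pr_uminus)
    then show ?thesis
      using pr_inj[of "act adj is (sroot i)" "- sroot j"]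
      by (auto simp: longest_element_word[OF assms] simple_root_pr word_prod_pr)
  qed
  obtain j where j: "act adj is (sroot i) = - sroot j" using negating_sroot[OF assms] by blast
  have "star adj i = j"
    unfolding star_def e using j by (intro the_equality) auto
  then show ?thesis using j by simp
qed

lemma negating_rev: assumes "negating adj is" shows "negating adj (rev is)"
  using negating_rev_neg[OF assms sroot_pos] by (simp add: negating_def)

lemma star_star [simp]: "star adj (star adj i) = i"
proof -
  obtain "is" where n: "negating adj is" using exists_negating by blast
  have "act adj is (act adj is (sroot i)) = sroot i"
    using negating_unique[OF n negating_rev[OF n]] by (metis act_rev)
  then show ?thesis by (simp add: negating_star[OF n] act_uminus)
qed

lemma bij_star: "bij (star adj)"
  by (rule o_bij[of "star adj"]) (auto simp: fun_eq_iff)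

lemma star_adj: "adj (star adj i) (star adj j) \<longleftrightarrow> adj i j"
proof -
  obtain "is" where n: "negating adj is" using exists_negating by blast
  have "ip adj (act adj is (sroot i)) (act adj is (sroot j)) = ip adj (sroot i) (sroot j)"
    by (rule ip_act)
  then have "simple_root adj (star adj j) (star adj i) = simple_root adj j i"
    by (simp add: negating_star[OF n] ip_uminus_left ip_uminus_right ip_sroot_right pr_sroot
        simple_root_commute)
  moreover have "star adj i = star adj j \<longleftrightarrow> i = j" by (metis star_star)
  ultimately show ?thesis
    using adj_irrefl by (auto simp: simple_root_def adj_commute split: if_splits)
qed

text \<open>If the longest element is \<open>s_i u\<close>, then \<open>u\<close> takes
  \<open>sroot (star adj i)\<close> to \<open>sroot i\<close>; conjugation turns
  \<open>s_i u\<close> into \<open>u\<close> followed by the letter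
  \<open>star adj i\<close>.\<close>

lemma reduced_words_rotate:
  assumes "i # is \<in> reduced_words adj" shows "is @ [star adj i] \<in> reduced_words adj"
proof -
  have n: "negating adj (i # is)" using assms reduced_words_iff by blast
  have "act adj (i # is) (sroot (star adj i)) = - sroot i"
    using negating_star[OF n, of "star adj i"] by simp
  then have "act adj is (sroot (star adj i)) = refl adj i (- sroot i)"
    by (metis act_Cons comp_apply refl_refl)
  also have "\<dots> = sroot i" by (metis refl_sroot refl_refl)
  finally have "act adj (is @ [star adj i]) = act adj (i # is)" by (rule act_refl_conj)
  then show ?thesis using reduced_words_cong[of "is @ [star adj i]" "i # is"] assms by simp
qed

section \<open>Diagram automorphisms, and the roots met along a reduced word\<close>

lemma pr_automorphism:
  assumes "diagram_automorphism adj \<tau>"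
  shows "pr adj (m \<circ> \<tau>) i = pr adj m (\<tau> i)"
proof -
  have b: "bij \<tau>" "\<And>i j. adj (\<tau> i) (\<tau> j) \<longleftrightarrow> adj i j"
    using assms by (auto simp: diagram_automorphism_def)
  have "pr adj m (\<tau> i) = (\<Sum>j\<in>UNIV. simple_root adj (\<tau> i) (\<tau> j) * m (\<tau> j))"
    unfolding pr_def by (rule sum.reindex_bij_betw[symmetric]) (use b in auto)
  moreover have "simple_root adj (\<tau> i) (\<tau> j) = simple_root adj i j" for j
    using b bij_is_inj[OF b(1)] by (simp add: simple_root_def inj_eq)
  ultimately show ?thesis by (simp add: pr_def)
qed

lemma ip_automorphism:
  assumes "diagram_automorphism adj \<tau>"
  shows "ip adj (x \<circ> \<tau>) (y \<circ> \<tau>) = ip adj x y"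
proof -
  have "ip adj x y = (\<Sum>i\<in>UNIV. x (\<tau> i) * pr adj y (\<tau> i))"
    unfolding ip_def
    by (rule sum.reindex_bij_betw[symmetric]) (use assms in \<open>auto simp: diagram_automorphism_def\<close>)
  then show ?thesis by (simp add: ip_def pr_automorphism[OF assms])
qed

lemma act_automorphism:
  assumes "diagram_automorphism adj \<tau>"
  shows "act adj (map \<tau> is) m \<circ> \<tau> = act adj is (m \<circ> \<tau>)"
proof (induction "is")
  case (Cons i "is")
  have "inj \<tau>" using assms by (auto simp: diagram_automorphism_def bij_def)
  then have "refl adj (\<tau> i) x \<circ> \<tau> = refl adj i (x \<circ> \<tau>)" for x
    by (auto simp: refl_def sroot_def pr_automorphism[OF assms] inj_eq)
  then show ?case unfolding list.map act_Cons comp_apply[of "refl adj _"] using Cons by metis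
qed simp

lemma sroot_automorphism:
  "diagram_automorphism adj \<tau> \<Longrightarrow> sroot (\<tau> i) \<circ> \<tau> = sroot i"
  by (auto simp: sroot_def diagram_automorphism_def bij_def inj_eq)

text \<open>Renaming the letters of a negating word by \<tau> gives a negating word again, and only
  one element is negating.\<close>

lemma star_automorphism:
  assumes "diagram_automorphism adj \<tau>"
  shows "star adj (\<tau> i) = \<tau> (star adj i)"
proof -
  obtain "is" where n: "negating adj is" using exists_negating by blast
  have s: "surj \<tau>" using assms by (auto simp: diagram_automorphism_def bij_def)
  have e: "act adj (map \<tau> is) (sroot (\<tau> i)) \<circ> \<tau> = act adj is (sroot i)" for i
    by (simp add: act_automorphism[OF assms] sroot_automorphism[OF assms])
  have "nonneg (- act adj (map \<tau> is) (sroot i))" for i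
    unfolding nonneg_def
  proof
    fix k
    obtain i' k' where ik: "i = \<tau> i'" "k = \<tau> k'" using s by (metis surjD)
    have "0 \<le> (- act adj is (sroot i')) k'" using n unfolding negating_def nonneg_def by blast
    then show "0 \<le> (- act adj (map \<tau> is) (sroot i)) k"
      using e[of i', THEN fun_cong, of k'] by (simp add: ik)
  qed
  then have "negating adj (map \<tau> is)" by (simp add: negating_def)
  from negating_star[OF this, of "\<tau> i"] e[of i] negating_star[OF n, of i]
  have "- sroot (star adj (\<tau> i)) \<circ> \<tau> = - sroot (star adj i)" by metis
  then have "(- sroot (star adj (\<tau> i)) \<circ> \<tau>) (star adj i) = (- sroot (star adj i)) (star adj i)" by metis
  then show ?thesis by (auto simp: sroot_def split: if_splits)
qed

text \<open>If two of the roots agreed, the letters \<open>vs\<close> strictly between them would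
  take the later simple root to the negative of the earlier one, although \<open>vs\<close> followed
  by the later letter is a reduced word.\<close>

lemma word_roots_distinct:
  assumes "reduced adj is" "j < k" "k < length is"
  shows "act adj (take j is) (sroot (is ! j)) \<noteq> act adj (take k is) (sroot (is ! k))"
proof
  assume e: "act adj (take j is) (sroot (is ! j)) = act adj (take k is) (sroot (is ! k))"
  define vs where "vs = take (k - j - 1) (drop (Suc j) is)"
  have t: "take k is = take j is @ is ! j # vs"
  proof -
    have "take k is = take j is @ take (k - j) (drop j is)"
      using assms take_add[of j "k - j" "is"] by simp
    moreover have "drop j is = is ! j # drop (Suc j) is"
      using assms by (simp add: Cons_nth_drop_Suc)
    moreover have "k - j = Suc (k - j - 1)" using assms by simp
    ultimately show ?thesis by (simp add: vs_def)
  qed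
  have "sroot (is ! j) = refl adj (is ! j) (act adj vs (sroot (is ! k)))"
    using e inj_act[of "take j is"] by (simp add: t act_append act_Cons)
  then have "act adj vs (sroot (is ! k)) = - sroot (is ! j)"
    by (metis refl_refl refl_sroot)
  moreover have "nonneg (act adj vs (sroot (is ! k)))"
  proof -
    have "is = take k is @ is ! k # drop (Suc k) is"
      using assms by (simp add: Cons_nth_drop_Suc)
    also have "\<dots> = (take j is @ [is ! j]) @ (vs @ [is ! k]) @ drop (Suc k) is"
      by (simp add: t)
    finally have "reduced adj ((take j is @ [is ! j]) @ (vs @ [is ! k]) @ drop (Suc k) is)"
      using assms(1) by argo
    from reduced_prefix[OF reduced_suffix[OF this]] have "reduced adj (vs @ [is ! k])" .
    then show ?thesis by (simp add: reduced_snoc)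
  qed
  ultimately show False using nonneg_antisym[of "sroot (is ! j)"] by simp
qed

lemma word_roots_inj:
  assumes "reduced adj is"
  shows "inj_on (\<lambda>k. act adj (take k is) (sroot (is ! k))) {..<length is}"
  by (rule linorder_inj_onI) (use word_roots_distinct[OF assms] in auto)

lemma word_roots_pos:
  assumes "reduced adj is" "k < length is"
  shows "act adj (take k is) (sroot (is ! k)) \<in> pos_roots adj"
proof -
  have "reduced adj (take k is @ is ! k # drop (Suc k) is)"
    using assms by (simp add: Cons_nth_drop_Suc)
  then have "nonneg (act adj (take k is) (sroot (is ! k)))" unfolding reduced_def by blast
  then show ?thesis by (simp add: pos_roots_def)
qed

lemma word_roots_image:
  assumes "is \<in> reduced_words adj"
  shows "(\<lambda>k. act adj (take k is) (sroot (is ! k))) ` {..<length is} = pos_roots adj"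
proof (rule card_subset_eq)
  have r: "reduced adj is" using assms reduced_words_iff by blast
  show "(\<lambda>k. act adj (take k is) (sroot (is ! k))) ` {..<length is} \<subseteq> pos_roots adj"
    using word_roots_pos[OF r] by auto
  show "card ((\<lambda>k. act adj (take k is) (sroot (is ! k))) ` {..<length is}) = card (pos_roots adj)"
    unfolding card_image[OF word_roots_inj[OF r]] card_lessThan by (rule length_reduced_words[OF assms])
qed simp

lemma word_root_pr: "word_root adj is k = pr adj (act adj (take k is) (sroot (is ! k)))"
  by (simp add: word_root_def simple_root_pr word_prod_pr)

lemma pr_sum: "pr adj m j = (\<Sum>i\<in>UNIV. m i * simple_root adj i j)"
  unfolding pr_def by (rule sum.cong) (simp_all add: simple_root_commute[of j] mult.commute)

text \<open>A vector of norm 2 with nonnegative coordinates is shown to be a translate of a simple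
  root by locating it among the roots met along a reduced word of the longest element.\<close>

lemma positive_roots_eq: "positive_roots adj = pr adj ` pos_roots adj"
proof safe
  fix \<beta> assume b: "\<beta> \<in> positive_roots adj"
  then obtain w i where "w \<in> weyl_group adj" "\<beta> = w (simple_root adj i)"
    unfolding positive_roots_def by auto
  then obtain "is" where b1: "\<beta> = word_prod adj is (simple_root adj i)"
    unfolding weyl_group_def by auto
  obtain m where b2: "\<And>j. \<beta> j = (\<Sum>i\<in>UNIV. int (m i) * simple_root adj i j)"
    using b unfolding positive_roots_def by auto
  have e1: "\<beta> = pr adj (\<lambda>i. int (m i))"
    unfolding fun_eq_iff pr_sum by (rule allI) (rule b2)
  have e2: "\<beta> = pr adj (act adj is (sroot i))"
    using b1 unfolding simple_root_pr word_prod_pr .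
  have "act adj is (sroot i) = (\<lambda>i. int (m i))" by (rule pr_inj[OF trans[OF e2[symmetric] e1]])
  then have "act adj is (sroot i) \<in> pos_roots adj"
    using act_roots[of "is" "sroot i"] by (simp add: pos_roots_def nonneg_def)
  then show "\<beta> \<in> pr adj ` pos_roots adj" using e2 by blast
next
  fix m assume m: "m \<in> pos_roots adj"
  obtain "is" where i: "is \<in> reduced_words adj" using exists_reduced_word by blast
  have "m \<in> (\<lambda>k. act adj (take k is) (sroot (is ! k))) ` {..<length is}"
    unfolding word_roots_image[OF i] by (rule m)
  then obtain k where mk: "m = act adj (take k is) (sroot (is ! k))" by (rule imageE)
  have A: "pr adj m = word_prod adj (take k is) (simple_root adj (is ! k))"
    unfolding simple_root_pr word_prod_pr mk[symmetric] ..
  have m0: "int (nat (m i)) = m i" for i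
    using m by (simp add: pos_roots_def nonneg_def)
  show "pr adj m \<in> positive_roots adj"
    unfolding positive_roots_def
  proof (intro CollectI conjI)
    show "\<exists>w\<in>weyl_group adj. \<exists>i. pr adj m = w (simple_root adj i)"
      unfolding weyl_group_def by (rule bexI, rule exI, rule A, rule rangeI)
    show "\<exists>m'::'v \<Rightarrow> nat. \<forall>j. pr adj m j = (\<Sum>i\<in>UNIV. int (m' i) * simple_root adj i j)"
    proof (rule exI, rule allI)
      fix j show "pr adj m j = (\<Sum>i\<in>UNIV. int (nat (m i)) * simple_root adj i j)"
        unfolding m0 by (rule pr_sum)
    qed
  qed
qed

end

section \<open>Dynkin diagrams as rooted trees\<close>

text \<open>Ground state substitution: with \<open>x = u * y\<close> the quadratic form equals half
  the sum of the \<open>Q i j\<close> over adjacent pairs plus the sum of the \<open>R i\<close>,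
  all of them nonnegative. If it vanishes, \<open>y\<close> is constant along edges and zero at the
  vertex \<open>a\<close> of strict inequality, so \<open>x = 0\<close>.\<close>

lemma superharmonic_posdef:
  fixes adj :: "'v::finite \<Rightarrow> 'v \<Rightarrow> bool" and u x :: "'v \<Rightarrow> real"
  assumes sym: "\<And>i j. adj i j \<Longrightarrow> adj j i"
    and conn: "\<And>i j. adj\<^sup>*\<^sup>* i j"
    and u: "\<And>i. u i > 0"
    and sup: "\<And>i. (\<Sum>j | adj i j. u j) \<le> 2 * u i"
    and strict: "(\<Sum>j | adj a j. u j) < 2 * u a"
    and x: "x \<noteq> (\<lambda>_. 0)"
  shows "(\<Sum>i\<in>UNIV. \<Sum>j\<in>UNIV. if adj i j then x i * x j else 0) < (\<Sum>i\<in>UNIV. 2 * (x i)\<^sup>2)"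
proof (rule ccontr)
  assume neg: "\<not> ?thesis"
  define y where "y = (\<lambda>i. x i / u i)"
  have xy: "x i = u i * y i" for i using u[of i] by (simp add: y_def)
  let ?I = "\<lambda>t. \<Sum>i\<in>UNIV. \<Sum>j\<in>UNIV. if adj i j then t i j else (0::real)"
  define Q where "Q = (\<lambda>i j. u i * u j * (y i - y j)\<^sup>2)"
  have swap: "?I t = ?I (\<lambda>i j. t j i)" for t
    using sym by (subst sum.swap) (intro sum.cong, auto)
  have lin: "?I (\<lambda>i j. a * s i j + b * t i j) = a * ?I s + b * ?I t" for a b s t
    unfolding sum_distrib_left sum.distrib[symmetric] by (intro sum.cong) auto
  have "Q i j = 1 * (u i * u j * (y i)\<^sup>2) + 1 * (1 * (u j * u i * (y j)\<^sup>2) + (- 2) * (x i * x j))" for i j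
    by (simp add: Q_def xy power2_eq_square algebra_simps)
  then have "?I Q = ?I (\<lambda>i j. 1 * (u i * u j * (y i)\<^sup>2)
      + 1 * (1 * (u j * u i * (y j)\<^sup>2) + (- 2) * (x i * x j)))"
    by presburger
  also have "\<dots> = ?I (\<lambda>i j. u i * u j * (y i)\<^sup>2) + ?I (\<lambda>i j. u j * u i * (y j)\<^sup>2)
      - 2 * ?I (\<lambda>i j. x i * x j)"
    unfolding lin by simp
  also have "?I (\<lambda>i j. u j * u i * (y j)\<^sup>2) = ?I (\<lambda>i j. u i * u j * (y i)\<^sup>2)"
    by (rule swap[symmetric])
  also have "?I (\<lambda>i j. u i * u j * (y i)\<^sup>2) = (\<Sum>i\<in>UNIV. u i * (y i)\<^sup>2 * (\<Sum>j | adj i j. u j))"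
    by (simp add: sum.If_cases sum_distrib_left sum_distrib_right mult_ac)
  finally have Q: "?I Q = 2 * (\<Sum>i\<in>UNIV. u i * (y i)\<^sup>2 * (\<Sum>j | adj i j. u j)) - 2 * ?I (\<lambda>i j. x i * x j)"
    by simp
  define R where "R = (\<lambda>i. u i * (y i)\<^sup>2 * (2 * u i - (\<Sum>j | adj i j. u j)))"
  have "(\<Sum>i\<in>UNIV. R i) = (\<Sum>i\<in>UNIV. 2 * (x i)\<^sup>2) - (\<Sum>i\<in>UNIV. u i * (y i)\<^sup>2 * (\<Sum>j | adj i j. u j))"
    unfolding sum_subtractf[symmetric]
    by (intro sum.cong) (simp_all add: R_def xy power2_eq_square algebra_simps)
  then have le: "?I Q + 2 * (\<Sum>i\<in>UNIV. R i) \<le> 0"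
    using neg Q by linarith
  have Q0: "0 \<le> Q i j" for i j using u[of i] u[of j] by (simp add: Q_def)
  have R0: "0 \<le> R i" for i
    using u[of i] sup[of i] by (simp add: R_def)
  have "0 \<le> ?I Q" "0 \<le> (\<Sum>i\<in>UNIV. R i)" using Q0 R0 by (auto intro!: sum_nonneg)
  then have IQ: "?I Q = 0" and SR: "(\<Sum>i\<in>UNIV. R i) = 0" using le by linarith+
  have "R a = 0" using SR R0 by (subst (asm) sum_nonneg_eq_0_iff) auto
  then have ya: "y a = 0" using u[of a] strict by (simp add: R_def)
  have "(if adj i j then Q i j else 0) = 0" for i j
  proof -
    have "(\<Sum>j\<in>UNIV. if adj i j then Q i j else 0) = 0"
      using IQ Q0 by (subst (asm) sum_nonneg_eq_0_iff) (auto intro!: sum_nonneg)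
    then show ?thesis using Q0 by (subst (asm) sum_nonneg_eq_0_iff) auto
  qed
  then have Qz: "Q i j = 0" if "adj i j" for i j
    using that by (metis (full_types))
  have eq: "y i = y j" if "adj i j" for i j
    using Qz[OF that] u[of i] u[of j] by (simp add: Q_def)
  have "y a = y i" for i
    using conn[of a i] by (induction rule: rtranclp_induct) (auto dest: eq)
  then show False using x ya by (auto simp: xy)
qed

text \<open>What is used of the classification: at most three unbranched arms meet in
  \<open>ctr\<close>. The second alternative of \<open>aut_ctr\<close> covers the paths with an even
  number of vertices, whose flip exchanges the two adjacent middle vertices and so is excluded as
  \<sigma>.\<close>

locale tree_diagram = posdef_graph adj for adj :: "'v::finite \<Rightarrow> 'v \<Rightarrow> bool" +
  fixes ctr :: 'v and par :: "'v \<Rightarrow> 'v" and dep :: "'v \<Rightarrow> nat"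
  assumes dep_ctr: "dep ctr = 0"
    and dep_par: "i \<noteq> ctr \<Longrightarrow> dep i = Suc (dep (par i))"
    and adj_iff: "adj i j \<longleftrightarrow> (i \<noteq> ctr \<and> j = par i) \<or> (j \<noteq> ctr \<and> i = par j)"
    and child_unique: "k \<noteq> ctr \<Longrightarrow> i \<noteq> ctr \<Longrightarrow> j \<noteq> ctr \<Longrightarrow> par i = k \<Longrightarrow> par j = k \<Longrightarrow> i = j"
    and ctr_degree: "card {j. adj ctr j} \<le> 3"
    and aut_ctr: "(\<forall>\<tau>. diagram_automorphism adj \<tau> \<longrightarrow> \<tau> ctr = ctr) \<or>
      (\<forall>\<tau>. diagram_automorphism adj \<tau> \<and> (\<nexists>i. adj i (\<tau> i)) \<longrightarrow> \<tau> = id)"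

text \<open>A certificate on the numbered model: a tree given by centre \<open>c\<close>, parents
  \<open>P\<close> and depths \<open>D\<close>, and a positive vector \<open>U\<close> that feeds
  \<open>superharmonic_posdef\<close>.\<close>

definition superharmonic_tree ::
    "nat \<Rightarrow> nat set set \<Rightarrow> nat \<Rightarrow> (nat \<Rightarrow> nat) \<Rightarrow> (nat \<Rightarrow> nat) \<Rightarrow> (nat \<Rightarrow> nat) \<Rightarrow> bool" where
  "superharmonic_tree n E c P D U \<longleftrightarrow> c \<in> {1..n} \<and> D c = 0 \<and>
     (\<forall>k\<in>{1..n} - {c}. P k \<in> {1..n} \<and> D k = Suc (D (P k))) \<and>
     (\<forall>k\<in>{1..n}. \<forall>l\<in>{1..n}. {k, l} \<in> E \<longleftrightarrow> (k \<noteq> c \<and> l = P k) \<or> (l \<noteq> c \<and> k = P l)) \<and>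
     (\<forall>k\<in>{1..n} - {c}. \<forall>l\<in>{1..n} - {c}. P k = P l \<and> P k \<noteq> c \<longrightarrow> k = l) \<and>
     card {l\<in>{1..n}. {c, l} \<in> E} \<le> 3 \<and>
     (\<forall>k\<in>{1..n}. 0 < U k \<and> (\<Sum>l | l \<in> {1..n} \<and> {k, l} \<in> E. U l) \<le> 2 * U k) \<and>
     (\<exists>k\<in>{1..n}. (\<Sum>l | l \<in> {1..n} \<and> {k, l} \<in> E. U l) < 2 * U k)"

lemma A_edges_iff: "{k, l} \<in> A_edges n \<longleftrightarrow>
    (l = k + 1 \<and> 1 \<le> k \<and> k < n) \<or> (k = l + 1 \<and> 1 \<le> l \<and> l < n)"
  by (auto simp: A_edges_def doubleton_eq_iff)

lemma D_edges_iff: "{k, l} \<in> D_edges n \<longleftrightarrow>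
    (l = k + 1 \<and> 1 \<le> k \<and> k < n - 1) \<or> (k = l + 1 \<and> 1 \<le> l \<and> l < n - 1) \<or>
    (k = n - 2 \<and> l = n) \<or> (k = n \<and> l = n - 2)"
  using A_edges_iff[of k l "n - 1"] by (auto simp: D_edges_def doubleton_eq_iff)

lemma E_edges_iff: "{k, l} \<in> E_edges n \<longleftrightarrow>
    (k = 1 \<and> l = 3) \<or> (k = 3 \<and> l = 1) \<or> (k = 2 \<and> l = 4) \<or> (k = 4 \<and> l = 2) \<or>
    (k = 3 \<and> l = 4) \<or> (k = 4 \<and> l = 3) \<or>
    (l = k + 1 \<and> 4 \<le> k \<and> k < n) \<or> (k = l + 1 \<and> 4 \<le> l \<and> l < n)"
  by (auto simp: E_edges_def doubleton_eq_iff)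

lemma sum_le_superset:
  fixes U :: "nat \<Rightarrow> nat"
  assumes "A \<subseteq> B" "finite B" "sum U B \<le> b" shows "sum U A \<le> b"
  using sum_mono2[OF assms(2,1), of U] assms(3) by simp

text \<open>The centre is the middle of the path: the flip fixes it for odd \<open>n\<close> and
  moves it to a neighbour for even \<open>n\<close>.\<close>

lemma superharmonic_tree_A:
  assumes "n \<ge> 1"
  defines "m \<equiv> (n + 1) div 2"
  shows "superharmonic_tree n (A_edges n) m (\<lambda>k. if k < m then k + 1 else k - 1)
    (\<lambda>k. if k \<le> m then m - k else k - m) (\<lambda>_. 1)"
proof -
  have N: "{l. l \<in> {1..n} \<and> {k, l} \<in> A_edges n} \<subseteq> {k - 1, k + 1}" for k
    unfolding A_edges_iff by auto
  have s: "(\<Sum>l\<in>{k - 1, k + 1}. 1) \<le> (2::nat)" for k :: nat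
    by (simp add: card_insert_if)
  have m: "1 \<le> m" "m \<le> n" using assms by (auto simp: m_def)
  have c: "card {l\<in>{1..n}. {m, l} \<in> A_edges n} \<le> card {m - 1, m + 1}"
    by (rule card_mono) (use N[of m] in auto)
  have "{l. l \<in> {1..n} \<and> {1, l} \<in> A_edges n} \<subseteq> {2}"
    unfolding A_edges_iff by auto
  then have "(\<Sum>l | l \<in> {1..n} \<and> {1, l} \<in> A_edges n. 1) \<le> (1::nat)"
    by (rule sum_le_superset) auto
  then have st: "\<exists>k\<in>{1..n}. (\<Sum>l | l \<in> {1..n} \<and> {k, l} \<in> A_edges n. 1) < 2 * (1::nat)"
    using assms(1) by (intro bexI[of _ 1]) auto
  have sup: "(\<Sum>l | l \<in> {1..n} \<and> {k, l} \<in> A_edges n. 1) \<le> 2 * (1::nat)" for k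
    by (rule sum_le_superset[OF N]) (use s in auto)
  show ?thesis
    unfolding superharmonic_tree_def
  proof (intro conjI ballI)
    show "card {l\<in>{1..n}. {m, l} \<in> A_edges n} \<le> 3"
      using c s[of m] by simp
    show "(\<Sum>l | l \<in> {1..n} \<and> {k, l} \<in> A_edges n. 1) \<le> 2 * (1::nat)" for k by (rule sup)
    show "\<exists>k\<in>{1..n}. (\<Sum>l | l \<in> {1..n} \<and> {k, l} \<in> A_edges n. 1) < 2 * (1::nat)" by (rule st)
  qed (use m in \<open>auto simp: A_edges_iff split: if_splits\<close>)
qed

lemma superharmonic_tree_D:
  assumes "n \<ge> 4"
  shows "superharmonic_tree n (D_edges n) (n - 2)
      (\<lambda>k. if k < n - 2 then k + 1 else n - 2)
      (\<lambda>k. if k \<le> n - 2 then n - 2 - k else 1) (\<lambda>k. if k \<le> n - 2 then 2 else 1)"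
    and "card {l\<in>{1..n}. {n - 2, l} \<in> D_edges n} = 3"
proof -
  let ?U = "\<lambda>k. if k \<le> n - 2 then 2 else (1::nat)"
  let ?N = "\<lambda>k. {l. l \<in> {1..n} \<and> {k, l} \<in> D_edges n}"
  have N1: "?N k \<subseteq> {k - 1, k + 1}" if "k < n - 2" for k
    using that unfolding D_edges_iff by auto
  have N2: "?N (n - 2) = {n - 3, n - 1, n}"
    using assms unfolding D_edges_iff by auto
  have N3: "?N k \<subseteq> {n - 2}" if "k > n - 2" for k
    using that unfolding D_edges_iff by auto
  show c: "card {l\<in>{1..n}. {n - 2, l} \<in> D_edges n} = 3"
    using N2 assms by (simp add: card_insert_if) arith
  have sup: "sum ?U (?N k) \<le> 2 * ?U k" for k
  proof -
    consider "k < n - 2" | "k = n - 2" | "k > n - 2" by linarith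
    then show ?thesis
    proof cases
      case 1
      have "sum ?U {k - 1, k + 1} \<le> 2 * ?U k" using 1 by simp
      then show ?thesis by (intro sum_le_superset[OF N1[OF 1]]) auto
    next
      case 2
      show ?thesis unfolding 2 N2 using assms by (simp add: sum.insert_if)
    next
      case 3
      have "sum ?U {n - 2} \<le> 2 * ?U k" using 3 by simp
      then show ?thesis by (intro sum_le_superset[OF N3[OF 3]]) auto
    qed
  qed
  have st: "\<exists>k\<in>{1..n}. sum ?U (?N k) < 2 * ?U k"
  proof (rule bexI[of _ 1])
    have "?N 1 \<subseteq> {2}" using assms unfolding D_edges_iff by auto
    then have "sum ?U (?N 1) \<le> 2" by (rule sum_le_superset) auto
    then show "sum ?U (?N 1) < 2 * ?U 1" using assms by simp
  qed (use assms in auto)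
  show "superharmonic_tree n (D_edges n) (n - 2)
      (\<lambda>k. if k < n - 2 then k + 1 else n - 2)
      (\<lambda>k. if k \<le> n - 2 then n - 2 - k else 1) ?U"
    unfolding superharmonic_tree_def
  proof (intro conjI ballI)
    show "card {l\<in>{1..n}. {n - 2, l} \<in> D_edges n} \<le> 3" using c by simp
    show "\<exists>k\<in>{1..n}. sum ?U (?N k) < 2 * ?U k" by (rule st)
    show "sum ?U (?N k) \<le> 2 * ?U k" for k by (rule sup)
  qed (use assms in \<open>auto simp: D_edges_iff split: if_splits\<close>)
qed

text \<open>The vector is (2, 3, 4, 6, 5, 4, 3, 2), the highest root of E8, cut off after
  \<open>n\<close> entries. It satisfies the harmonic equation except at the last vertex, where the
  inequality is strict.\<close>

lemma superharmonic_tree_E: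
  assumes "n \<in> {6, 7, 8}"
  shows "superharmonic_tree n (E_edges n) 4
      (\<lambda>k. if k = 1 then 3 else if k \<le> 3 then 4 else k - 1)
      (\<lambda>k. if k = 1 then 2 else if k \<le> 3 then 1 else k - 4)
      (\<lambda>k. if k \<le> 3 then k + 1 else 10 - k)"
    and "card {l\<in>{1..n}. {4, l} \<in> E_edges n} = 3"
proof -
  let ?U = "\<lambda>k. if k \<le> 3 then k + 1 else 10 - (k::nat)"
  let ?N = "\<lambda>k. {l. l \<in> {1..n} \<and> {k, l} \<in> E_edges n}"
  have n: "6 \<le> n" "n \<le> 8" using assms by auto
  have N: "?N 1 \<subseteq> {3}" "?N 2 \<subseteq> {4}" "?N 3 \<subseteq> {1, 4}" "?N 4 = {2, 3, 5}"
    using n unfolding E_edges_iff by auto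
  have N5: "?N k \<subseteq> {k - 1, k + 1}" if "k \<ge> 5" for k
    using that unfolding E_edges_iff by auto
  show c: "card {l\<in>{1..n}. {4, l} \<in> E_edges n} = 3"
    using N(4) by simp
  have sup: "sum ?U (?N k) \<le> 2 * ?U k" if k: "k \<in> {1..n}" for k
  proof -
    consider "k = 1" | "k = 2" | "k = 3" | "k = 4" | "k \<ge> 5" using k by fastforce
    then show ?thesis
    proof cases
      case 1
      show ?thesis unfolding 1 by (rule sum_le_superset[OF N(1)]) auto
    next
      case 2
      show ?thesis unfolding 2 by (rule sum_le_superset[OF N(2)]) auto
    next
      case 3
      show ?thesis unfolding 3 by (rule sum_le_superset[OF N(3)]) auto
    next
      case 4
      show ?thesis unfolding 4 N(4) by simp
    next
      case 5
      have "sum ?U {k - 1, k + 1} \<le> 2 * ?U k" using 5 k n by (cases "k = 5") auto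
      then show ?thesis by (intro sum_le_superset[OF N5[OF 5]]) auto
    qed
  qed
  have st: "\<exists>k\<in>{1..n}. sum ?U (?N k) < 2 * ?U k"
  proof (rule bexI[of _ n])
    have "?N n \<subseteq> {n - 1}" using n unfolding E_edges_iff by auto
    then have "sum ?U (?N n) \<le> 11 - n" by (rule sum_le_superset) (use n in auto)
    then show "sum ?U (?N n) < 2 * ?U n" using n by simp
  qed (use n in auto)
  show "superharmonic_tree n (E_edges n) 4
      (\<lambda>k. if k = 1 then 3 else if k \<le> 3 then 4 else k - 1)
      (\<lambda>k. if k = 1 then 2 else if k \<le> 3 then 1 else k - 4) ?U"
    unfolding superharmonic_tree_def
  proof (intro conjI ballI)
    show "card {l\<in>{1..n}. {4, l} \<in> E_edges n} \<le> 3" using c by simp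
    show "\<exists>k\<in>{1..n}. sum ?U (?N k) < 2 * ?U k" by (rule st)
    show "sum ?U (?N k) \<le> 2 * ?U k" if "k \<in> {1..n}" for k by (rule sup[OF that])
  qed (use n in \<open>auto simp: E_edges_iff split: if_splits\<close>)
qed

lemma A_automorphism:
  assumes t: "bij_betw t {1..n} {1..n}"
    and E: "\<And>k l. k \<in> {1..n} \<Longrightarrow> l \<in> {1..n} \<Longrightarrow> {t k, t l} \<in> A_edges n \<longleftrightarrow> {k, l} \<in> A_edges n"
  shows "(\<forall>k\<in>{1..n}. t k = k) \<or> (\<forall>k\<in>{1..n}. t k = n + 1 - k)"
proof (cases "n = 0")
  case False
  have mem: "t k \<in> {1..n}" if "k \<in> {1..n}" for k using t that by (auto simp: bij_betw_def)
  have inj: "k = l" if "k \<in> {1..n}" "l \<in> {1..n}" "t k = t l" for k l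
    by (rule inj_onD[OF bij_betw_imp_inj_on[OF t] that(3,1,2)])
  have step: "t (k + 1) = t k + 1 \<or> t k = t (k + 1) + 1" if "1 \<le> k" "k < n" for k
    using E[of k "k + 1"] that by (auto simp: A_edges_iff)
  have end1: "t 1 = 1 \<or> t 1 = n"
  proof (rule ccontr)
    assume a: "\<not> ?thesis"
    then have r: "1 < t 1" "t 1 < n" using mem[of 1] False by auto
    have "t 1 - 1 \<in> t ` {1..n}" "t 1 + 1 \<in> t ` {1..n}"
      using t r by (auto simp: bij_betw_def)
    then obtain a b where ab: "a \<in> {1..n}" "t a = t 1 - 1" "b \<in> {1..n}" "t b = t 1 + 1" by force
    have "{1, a} \<in> A_edges n" "{1, b} \<in> A_edges n"
      using E[of 1 a] E[of 1 b] ab r by (auto simp: A_edges_iff)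
    then have "a = 2" "b = 2" by (auto simp: A_edges_iff)
    then show False using ab by simp
  qed
  have main: "t k = (if t 1 = 1 then k else n + 1 - k)" if "k \<in> {1..n}" for k
    using that
  proof (induction k rule: less_induct)
    case (less k)
    consider "k = 1" | "k = 2" | "k \<ge> 3" using less.prems by fastforce
    then show ?case
    proof cases
      case 1
      then show ?thesis using end1 by auto
    next
      case 2
      then show ?thesis
        using end1 step[of 1] mem[of 1] mem[of 2] less.prems by (auto simp: numeral_2_eq_2)
    next
      case 3
      define l where "l = k - 2"
      have k: "k = l + 2" "1 \<le> l" "l + 2 \<le> n" using 3 less.prems by (auto simp: l_def)
      have "t l = (if t 1 = 1 then l else n + 1 - l)" "t (l + 1) = (if t 1 = 1 then l + 1 else n - l)"
        using less.IH[of l] less.IH[of "l + 1"] k by auto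
      moreover have "t (l + 2) \<noteq> t l" using inj[of "l + 2" l] k by auto
      ultimately show ?thesis using step[of "l + 1"] k by (auto split: if_splits)
    qed
  qed
  show ?thesis
  proof (cases "t 1 = 1")
    case True
    then show ?thesis using main by simp
  next
    case neq: False
    then show ?thesis using main by simp
  qed
qed auto

lemma ADE_tree_diagram:
  fixes adj :: "'v::finite \<Rightarrow> 'v \<Rightarrow> bool"
  assumes "ADE_diagram adj"
  shows "\<exists>ctr par dep. tree_diagram adj ctr par dep"
proof -
  obtain n E f where nE: "(n, E) \<in> ADE_diagrams" and f: "bij_betw f (UNIV::'v set) {1..n}"
    and adj: "\<And>i j. adj i j \<longleftrightarrow> {f i, f j} \<in> E"
    using assms by (auto simp: ADE_diagram_def)
  define g where "g = inv f"
  have inj: "inj f" and fr: "range f = {1..n}" using f by (auto simp: bij_betw_def)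
  have gf [simp]: "g (f i) = i" for i using inj by (simp add: g_def)
  have fg [simp]: "f (g k) = k" if "k \<in> {1..n}" for k
    using that fr by (metis f_inv_into_f g_def)
  have f_in: "f i \<in> {1..n}" for i using fr by auto
  have nbr: "{l. l \<in> {1..n} \<and> {f i, l} \<in> E} = f ` {j. adj i j}" for i
    using fr by (auto simp: adj)
  have aut: "bij_betw (\<lambda>k. f (\<tau> (g k))) {1..n} {1..n} \<and>
      (\<forall>k\<in>{1..n}. \<forall>l\<in>{1..n}. {f (\<tau> (g k)), f (\<tau> (g l))} \<in> E \<longleftrightarrow> {k, l} \<in> E)"
    if "diagram_automorphism adj \<tau>" for \<tau>
  proof -
    have b: "bij \<tau>" and a: "\<And>i j. adj (\<tau> i) (\<tau> j) \<longleftrightarrow> adj i j"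
      using that by (auto simp: diagram_automorphism_def)
    have "bij_betw (f \<circ> \<tau> \<circ> g) {1..n} {1..n}"
      using bij_betw_inv_into[OF f] b f unfolding g_def by (blast intro: bij_betw_trans)
    then show ?thesis using a adj fg by (auto simp: comp_def)
  qed
  obtain c P D U where T: "superharmonic_tree n E c P D U" and
    A: "(\<forall>\<tau>. diagram_automorphism adj \<tau> \<longrightarrow> \<tau> (g c) = g c) \<or>
      (\<forall>\<tau>. diagram_automorphism adj \<tau> \<and> (\<nexists>i. adj i (\<tau> i)) \<longrightarrow> \<tau> = id) \<or>
      card {l\<in>{1..n}. {c, l} \<in> E} = 3"
  proof -
    consider "E = A_edges n" "n \<ge> 1" | "E = D_edges n" "n \<ge> 4" | "E = E_edges n" "n \<in> {6,7,8}"
      using nE by (auto simp: ADE_diagrams_def)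
    then show ?thesis
    proof cases
      case 1
      define m where "m = (n + 1) div 2"
      have m: "m \<in> {1..n}" using 1 by (auto simp: m_def)
      have "(\<forall>\<tau>. diagram_automorphism adj \<tau> \<longrightarrow> \<tau> (g m) = g m) \<or>
        (\<forall>\<tau>. diagram_automorphism adj \<tau> \<and> (\<nexists>i. adj i (\<tau> i)) \<longrightarrow> \<tau> = id)"
      proof (cases "odd n")
        case True
        have "\<tau> (g m) = g m" if "diagram_automorphism adj \<tau>" for \<tau>
        proof -
          have "f (\<tau> (g m)) = m"
            using A_automorphism[of "\<lambda>k. f (\<tau> (g k))" n] aut[OF that] m True
            by (auto simp: 1 m_def elim!: oddE)
          then show ?thesis by (metis gf)
        qed
        then show ?thesis by blast
      next
        case False
        have "\<tau> = id" if "diagram_automorphism adj \<tau>" "\<nexists>i. adj i (\<tau> i)" for \<tau>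
        proof -
          have "(\<forall>k\<in>{1..n}. f (\<tau> (g k)) = k) \<or> (\<forall>k\<in>{1..n}. f (\<tau> (g k)) = n + 1 - k)"
            using A_automorphism[of "\<lambda>k. f (\<tau> (g k))" n] aut[OF that(1)] by (auto simp: 1)
          then show ?thesis
          proof
            assume "\<forall>k\<in>{1..n}. f (\<tau> (g k)) = k"
            then have "f (\<tau> i) = f i" for i using f_in[of i] by (metis gf)
            then show ?thesis using inj by (auto simp: inj_def)
          next
            assume a: "\<forall>k\<in>{1..n}. f (\<tau> (g k)) = n + 1 - k"
            have "adj (g m) (\<tau> (g m))"
              using a m False 1 by (auto simp: adj A_edges_iff m_def elim!: evenE)
            then show ?thesis using that(2) by blast
          qed
        qed
        then show ?thesis by blast
      qed
      then show ?thesis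
        using that superharmonic_tree_A[OF 1(2)] unfolding 1(1) m_def by blast
    next
      case 2
      then show ?thesis using that superharmonic_tree_D[OF 2(2)] by blast
    next
      case 3
      then show ?thesis using that superharmonic_tree_E[OF 3(2)] by blast
    qed
  qed
  define ctr par dep where "ctr = g c" and "par = (\<lambda>i. g (P (f i)))" and "dep = (\<lambda>i. D (f i))"
  have T1: "c \<in> {1..n}" and T2: "D c = 0"
    and T3: "\<And>k. k \<in> {1..n} - {c} \<Longrightarrow> P k \<in> {1..n}"
    and T4: "\<And>k. k \<in> {1..n} - {c} \<Longrightarrow> D k = Suc (D (P k))"
    and T5: "card {l\<in>{1..n}. {c, l} \<in> E} \<le> 3"
    using T unfolding superharmonic_tree_def by blast+
  have c: "c \<in> {1..n}" "f ctr = c" using T1 by (simp_all add: ctr_def)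
  have ne: "i \<noteq> ctr \<longleftrightarrow> f i \<in> {1..n} - {c}" for i using c inj f_in by (auto simp: inj_def)
  have P: "f (par i) = P (f i)" if "i \<noteq> ctr" for i
    using T3 that unfolding ne par_def by (intro fg) blast
  have dep_ctr: "dep ctr = 0" using T2 c by (simp add: dep_def)
  have dep_par: "dep i = Suc (dep (par i))" if "i \<noteq> ctr" for i
    using T4[of "f i"] that P[OF that] unfolding ne dep_def by simp
  have feq: "f i = f j \<longleftrightarrow> i = j" for i j using inj by (auto simp: inj_def)
  have adj_iff: "adj i j \<longleftrightarrow> (i \<noteq> ctr \<and> j = par i) \<or> (j \<noteq> ctr \<and> i = par j)" for i j
  proof -
    have "adj i j \<longleftrightarrow> (f i \<noteq> c \<and> f j = P (f i)) \<or> (f j \<noteq> c \<and> f i = P (f j))"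
      using T f_in[of i] f_in[of j] unfolding superharmonic_tree_def adj by blast
    also have "\<dots> \<longleftrightarrow> (i \<noteq> ctr \<and> f j = f (par i)) \<or> (j \<noteq> ctr \<and> f i = f (par j))"
      using P[of i] P[of j] c(2) feq by metis
    finally show ?thesis by (simp add: feq)
  qed
  have child_unique: "i = j" if "k \<noteq> ctr" "i \<noteq> ctr" "j \<noteq> ctr" "par i = k" "par j = k" for i j k
  proof -
    have "P (f i) = P (f j)" "P (f i) \<noteq> c" using that P[of i] P[of j] c(2) feq by metis+
    then have "f i = f j"
      using T that(2,3) unfolding ne superharmonic_tree_def by blast
    then show ?thesis by (simp add: feq)
  qed
  have crd: "card {j. adj ctr j} = card {l\<in>{1..n}. {c, l} \<in> E}"
    using nbr[of ctr] c(2) by (simp add: card_image inj_on_subset[OF inj])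
  then have deg3: "card {j. adj ctr j} \<le> 3" using T5 by simp
  have sym: "adj i j \<Longrightarrow> adj j i" for i j by (simp add: adj insert_commute)
  have irr: "\<not> adj i i" for i
  proof
    assume "adj i i"
    then have "i \<noteq> ctr" "i = par i" by (auto simp: adj_iff)
    then show False using dep_par[of i] by simp
  qed
  have to_ctr: "adj\<^sup>*\<^sup>* ctr i" for i
  proof (induction "dep i" arbitrary: i)
    case 0
    then have "i = ctr" using dep_par[of i] by fastforce
    then show ?case by simp
  next
    case (Suc d)
    then have "i \<noteq> ctr" using dep_ctr by auto
    then have "adj\<^sup>*\<^sup>* ctr (par i)" "adj (par i) i"
      using Suc dep_par[of i] by (auto simp: adj_iff)
    then show ?case by (rule rtranclp.rtrancl_into_rtrancl)
  qed
  have conn: "adj\<^sup>*\<^sup>* i j" for i j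
  proof -
    have "symp adj" using sym by (auto simp: symp_def)
    then have "adj\<^sup>*\<^sup>* i ctr" using to_ctr[of i] by (metis symp_rtranclp sympD)
    then show ?thesis using to_ctr[of j] by (rule rtranclp_trans)
  qed
  define u where "u = (\<lambda>i. real (U (f i)))"
  have su: "(\<Sum>j | adj i j. u j) = real (\<Sum>l | l \<in> {1..n} \<and> {f i, l} \<in> E. U l)" for i
    unfolding nbr u_def by (simp add: sum.reindex inj_on_subset[OF inj])
  have "u i > 0" "(\<Sum>j | adj i j. u j) \<le> 2 * u i" for i
  proof -
    have "0 < U (f i)" "(\<Sum>l | l \<in> {1..n} \<and> {f i, l} \<in> E. U l) \<le> 2 * U (f i)"
      using T f_in[of i] unfolding superharmonic_tree_def by blast+
    note U = this
    show "u i > 0" using U(1) by (simp add: u_def)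
    show "(\<Sum>j | adj i j. u j) \<le> 2 * u i"
      unfolding su using U(2) by (simp only: u_def)
  qed
  note u = this
  obtain k where "k \<in> {1..n}" "(\<Sum>l | l \<in> {1..n} \<and> {k, l} \<in> E. U l) < 2 * U k"
    using T unfolding superharmonic_tree_def by blast
  then have "(\<Sum>j | adj (g k) j. u j) < 2 * u (g k)"
    unfolding su by (simp only: u_def fg)
  note strict = this
  have two: "card {j. adj i j} \<le> 2" if "i \<noteq> ctr" for i
  proof (cases "\<exists>j. j \<noteq> ctr \<and> par j = i")
    case True
    then obtain j where "j \<noteq> ctr" "par j = i" by blast
    then have "{j. adj i j} \<subseteq> {par i, j}" using that child_unique[of i] by (auto simp: adj_iff)
    then have "card {j. adj i j} \<le> card {par i, j}" by (intro card_mono) auto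
    then show ?thesis by (simp add: card_insert_if split: if_splits)
  next
    case False
    then have "{j. adj i j} \<subseteq> {par i}" by (auto simp: adj_iff)
    then have "card {j. adj i j} \<le> card {par i}" by (intro card_mono) auto
    then show ?thesis by simp
  qed
  \<comment> \<open>In types D and E the centre is the only vertex with three neighbours.\<close>
  have A3: "\<tau> ctr = ctr" if "card {l\<in>{1..n}. {c, l} \<in> E} = 3" "diagram_automorphism adj \<tau>" for \<tau>
  proof (rule ccontr)
    assume ne: "\<tau> ctr \<noteq> ctr"
    have b: "bij \<tau>" and a: "\<And>i j. adj (\<tau> i) (\<tau> j) \<longleftrightarrow> adj i j"
      using that(2) by (auto simp: diagram_automorphism_def)
    have "\<tau> ` {j. adj ctr j} = {j. adj (\<tau> ctr) j}"
    proof safe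
      fix x assume x: "adj (\<tau> ctr) x"
      obtain y where "x = \<tau> y" using bij_is_surj[OF b] by (rule surjE)
      then show "x \<in> \<tau> ` {j. adj ctr j}" using x a by simp
    qed (simp add: a)
    then have "card {j. adj (\<tau> ctr) j} = card {j. adj ctr j}"
      using card_image[OF inj_on_subset[OF bij_is_inj[OF b]], of "{j. adj ctr j}"] by simp
    then show False using two[OF ne] that(1) crd by simp
  qed
  have "tree_diagram adj ctr par dep"
  proof unfold_locales
    show "(\<forall>\<tau>. diagram_automorphism adj \<tau> \<longrightarrow> \<tau> ctr = ctr) \<or>
      (\<forall>\<tau>. diagram_automorphism adj \<tau> \<and> (\<nexists>i. adj i (\<tau> i)) \<longrightarrow> \<tau> = id)"
      using A A3 unfolding ctr_def by blast
    show "i \<noteq> ctr \<Longrightarrow> dep i = Suc (dep (par i))" for i by (rule dep_par)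
    show "adj i j \<longleftrightarrow> (i \<noteq> ctr \<and> j = par i) \<or> (j \<noteq> ctr \<and> i = par j)" for i j by (rule adj_iff)
    show "k \<noteq> ctr \<Longrightarrow> i \<noteq> ctr \<Longrightarrow> j \<noteq> ctr \<Longrightarrow> par i = k \<Longrightarrow> par j = k \<Longrightarrow> i = j" for i j k
      by (rule child_unique)
    show "(\<Sum>i\<in>UNIV. \<Sum>j\<in>UNIV. if adj i j then x i * x j else 0) < (\<Sum>i\<in>UNIV. 2 * (x i)\<^sup>2)"
      if "x \<noteq> (\<lambda>_. 0)" for x :: "'v \<Rightarrow> real"
      by (rule superharmonic_posdef[where u = u and a = "g k"]) (fact sym conn u strict that)+
  qed (use dep_ctr deg3 sym irr conn in auto)
  then show ?thesis by blast
qed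

context tree_diagram
begin

text \<open>Induction on the depth: the image of the edge from \<open>i\<close> to its parent cannot
  point outwards, because the image of the parent already has the image of the grandparent as its
  own parent.\<close>

lemma automorphism_fixing_ctr:
  assumes "diagram_automorphism adj \<tau>" "\<tau> ctr = ctr"
  shows "dep (\<tau> i) = dep i" and "i \<noteq> ctr \<Longrightarrow> par (\<tau> i) = \<tau> (par i)"
proof -
  have inj: "\<tau> x = \<tau> y \<longleftrightarrow> x = y" for x y
    using assms(1) by (auto simp: diagram_automorphism_def bij_def inj_eq)
  have a: "adj (\<tau> x) (\<tau> y) \<longleftrightarrow> adj x y" for x y
    using assms(1) by (auto simp: diagram_automorphism_def)
  have c: "\<tau> x = ctr \<longleftrightarrow> x = ctr" for x using inj[of x ctr] assms(2) by simp
  have main: "dep (\<tau> i) = dep i \<and> (i \<noteq> ctr \<longrightarrow> par (\<tau> i) = \<tau> (par i))" for i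
  proof (induction "dep i" arbitrary: i rule: less_induct)
    case less
    show ?case
    proof (cases "i = ctr")
      case True
      then show ?thesis using assms(2) by simp
    next
      case False
      have IH: "dep (\<tau> (par i)) = dep (par i)" "par i \<noteq> ctr \<Longrightarrow> par (\<tau> (par i)) = \<tau> (par (par i))"
        using less[of "par i"] dep_par[OF False] by auto
      have "adj (\<tau> i) (\<tau> (par i))" unfolding a using False by (simp add: adj_iff)
      moreover have "\<tau> i \<noteq> par (\<tau> (par i))" if "par i \<noteq> ctr"
      proof
        assume "\<tau> i = par (\<tau> (par i))"
        then have "\<tau> i = \<tau> (par (par i))" by (simp only: IH(2)[OF that])
        then have "dep i = dep (par (par i))" unfolding inj by (rule arg_cong)
        then show False using dep_par[OF False] dep_par[OF that] by linarith
      qed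
      moreover have "\<tau> (par i) \<noteq> ctr \<Longrightarrow> par i \<noteq> ctr" using assms(2) by auto
      ultimately have p: "par (\<tau> i) = \<tau> (par i)"
        unfolding adj_iff[of "\<tau> i" "\<tau> (par i)"] by metis
      have "\<tau> i \<noteq> ctr" using False c by simp
      from dep_par[OF this] show ?thesis using p IH(1) dep_par[OF False] by simp
    qed
  qed
  show "dep (\<tau> i) = dep i" "i \<noteq> ctr \<Longrightarrow> par (\<tau> i) = \<tau> (par i)" using main by blast+
qed

text \<open>The arms do not branch, so the images of their first vertices force all the
  others.\<close>

lemma automorphism_eqI:
  assumes "diagram_automorphism adj \<tau>" "\<tau> ctr = ctr"
    and "diagram_automorphism adj \<rho>" "\<rho> ctr = ctr"
    and B: "\<And>j. adj ctr j \<Longrightarrow> \<tau> j = \<rho> j"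
  shows "\<tau> = \<rho>"
proof
  fix i
  show "\<tau> i = \<rho> i"
  proof (induction "dep i" arbitrary: i rule: less_induct)
    case less
    consider "i = ctr" | "i \<noteq> ctr" "par i = ctr" | "i \<noteq> ctr" "par i \<noteq> ctr" by blast
    then show ?case
    proof cases
      case 1
      then show ?thesis using assms by simp
    next
      case 2
      then show ?thesis using B[of i] by (auto simp: adj_iff)
    next
      case 3
      have "\<tau> (par i) = \<rho> (par i)" using less dep_par[OF 3(1)] by simp
      then have p: "par (\<tau> i) = par (\<rho> i)"
        using automorphism_fixing_ctr(2)[OF assms(1,2) 3(1)]
          automorphism_fixing_ctr(2)[OF assms(3,4) 3(1)] by simp
      have d: "dep (\<tau> i) = dep i" "dep (\<rho> i) = dep i" "dep (\<tau> (par i)) = dep (par i)"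
        using automorphism_fixing_ctr(1) assms by metis+
      have n: "\<tau> i \<noteq> ctr" "\<rho> i \<noteq> ctr" "par (\<tau> i) \<noteq> ctr"
        using d dep_par[OF 3(1)] dep_par[OF 3(2)] dep_ctr
          automorphism_fixing_ctr(2)[OF assms(1,2) 3(1)] by auto
      show ?thesis by (rule child_unique[OF n(3,1,2) refl p[symmetric]])
    qed
  qed
qed

end

section \<open>Commutation moves\<close>

lemma comm_step_Cons: "comm_step adj xs ys \<Longrightarrow> comm_step adj (i # xs) (i # ys)"
  unfolding comm_step_def by (metis append_Cons)

lemma comm_steps_Cons: "(comm_step adj)\<^sup>*\<^sup>* xs ys \<Longrightarrow> (comm_step adj)\<^sup>*\<^sup>* (i # xs) (i # ys)"
  by (induction rule: rtranclp_induct) (auto intro: rtranclp.rtrancl_into_rtrancl comm_step_Cons)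

lemma comm_steps_move:
  "\<forall>j\<in>set us. \<not> adj j i \<Longrightarrow> (comm_step adj)\<^sup>*\<^sup>* (us @ i # vs) (i # us @ vs)"
proof (induction us)
  case (Cons j us)
  then have "(comm_step adj)\<^sup>*\<^sup>* ((j # us) @ i # vs) (j # i # us @ vs)"
    using comm_steps_Cons[of adj "us @ i # vs"] by simp
  also have "comm_step adj (j # i # us @ vs) (i # j # us @ vs)"
    using Cons.prems unfolding comm_step_def by (intro exI[of _ "[]"]) auto
  finally show ?case by simp
qed simp

context posdef_graph
begin

lemma comm_class_self: "xs \<in> comm_class adj xs"
  by (simp add: comm_class_def)

lemma refl_commute:
  assumes "\<not> adj i j" shows "refl adj i (refl adj j m) = refl adj j (refl adj i m)"
proof (cases "i = j")
  case False
  then have "simple_root adj i j = 0" "simple_root adj j i = 0"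
    using assms adj_commute by (auto simp: simple_root_def)
  then have "pr adj (refl adj j m) i = pr adj m i" "pr adj (refl adj i m) j = pr adj m j"
    unfolding refl_alt pr_diff pr_scale pr_sroot by simp_all
  then show ?thesis unfolding refl_def[of adj i "refl adj j m"] refl_def[of adj j "refl adj i m"]
    by (simp add: refl_def algebra_simps)
qed simp

lemma comm_step_act: "comm_step adj xs ys \<Longrightarrow> act adj xs = act adj ys"
proof -
  assume "comm_step adj xs ys"
  then obtain us i j vs where "xs = us @ [i, j] @ vs" "ys = us @ [j, i] @ vs" "\<not> adj i j"
    unfolding comm_step_def by blast
  then show ?thesis using refl_commute[of i j] by (simp add: act_append act_Cons comp_def)
qed

lemma comm_steps_act: "(comm_step adj)\<^sup>*\<^sup>* xs ys \<Longrightarrow> act adj xs = act adj ys"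
  by (induction rule: rtranclp_induct) (auto dest: comm_step_act)

lemma comm_steps_length: "(comm_step adj)\<^sup>*\<^sup>* xs ys \<Longrightarrow> length xs = length ys"
  by (induction rule: rtranclp_induct) (auto simp: comm_step_def)

lemma comm_steps_reduced_words:
  "(comm_step adj)\<^sup>*\<^sup>* xs ys \<Longrightarrow> xs \<in> reduced_words adj \<longleftrightarrow> ys \<in> reduced_words adj"
  by (rule reduced_words_cong) (auto dest: comm_steps_act comm_steps_length)

end

section \<open>The automorphism, its order and its orbits\<close>

locale folded_diagram = tree_diagram adj ctr par dep
  for adj :: "'v::finite \<Rightarrow> 'v \<Rightarrow> bool" and ctr par dep +
  fixes \<sigma> :: "'v \<Rightarrow> 'v"
  assumes automorphism: "diagram_automorphism adj \<sigma>"
    and no_flip: "\<not> adj i (\<sigma> i)"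
begin

abbreviation d :: "'v \<Rightarrow> int" where "d \<equiv> orb_size \<sigma>"
abbreviation r :: nat where "r \<equiv> aut_order \<sigma>"

lemma sigma_ctr [simp]: "\<sigma> ctr = ctr"
  using aut_ctr automorphism no_flip by (metis id_apply)

lemma sigma_inj [simp]: "\<sigma> x = \<sigma> y \<longleftrightarrow> x = y"
  using automorphism by (auto simp: diagram_automorphism_def bij_def inj_eq)

lemma sigma_adj [simp]: "adj (\<sigma> x) (\<sigma> y) \<longleftrightarrow> adj x y"
  using automorphism by (auto simp: diagram_automorphism_def)

lemma sigma_dep [simp]: "dep (\<sigma> i) = dep i"
  using automorphism_fixing_ctr(1)[OF automorphism] by simp

lemma sigma_par: "i \<noteq> ctr \<Longrightarrow> par (\<sigma> i) = \<sigma> (par i)"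
  using automorphism_fixing_ctr(2)[OF automorphism] by simp

lemma power_inj [simp]: "(\<sigma> ^^ l) x = (\<sigma> ^^ l) y \<longleftrightarrow> x = y"
  by (induction l) auto

lemma power_adj [simp]: "adj ((\<sigma> ^^ l) x) ((\<sigma> ^^ l) y) \<longleftrightarrow> adj x y"
  by (induction l) auto

lemma power_ctr [simp]: "(\<sigma> ^^ l) ctr = ctr"
  by (induction l) auto

lemma power_dep [simp]: "dep ((\<sigma> ^^ l) i) = dep i"
  by (induction l) auto

lemma power_automorphism: "diagram_automorphism adj (\<sigma> ^^ l)"
proof -
  have "bij (\<sigma> ^^ l)" using automorphism by (intro bij_fn) (auto simp: diagram_automorphism_def)
  then show ?thesis by (simp add: diagram_automorphism_def)
qed

text \<open>On the at most three neighbours of \<open>ctr\<close> a nontrivial \<sigma> is a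
  transposition or a 3-cycle. The last clause records that a fixed neighbour is unique and occurs
  only for a transposition; this pins down the automorphisms that commute with \<sigma>.\<close>

lemma moved_neighbour:
  assumes "\<sigma> \<noteq> id"
  obtains b where "adj ctr b" "\<sigma> b \<noteq> b"
    "\<sigma> (\<sigma> b) = b \<or> \<sigma> (\<sigma> (\<sigma> b)) = b"
    "\<forall>c. adj ctr c \<longrightarrow> \<sigma> c = c \<or> c = b \<or> c = \<sigma> b \<or> c = \<sigma> (\<sigma> b)"
    "\<forall>c c'. adj ctr c \<and> \<sigma> c = c \<and> adj ctr c' \<and> \<sigma> c' = c' \<longrightarrow> c = c' \<and> \<sigma> (\<sigma> b) = b"
proof -
  have ida: "diagram_automorphism adj id" by (simp add: diagram_automorphism_def)
  obtain b where b: "adj ctr b" "\<sigma> b \<noteq> b"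
    using automorphism_eqI[OF automorphism _ ida] assms by fastforce
  have nb: "adj ctr (\<sigma> x) \<longleftrightarrow> adj ctr x" for x
    using sigma_adj[of ctr x] by simp
  have small: "card A \<le> 3" if "\<forall>x\<in>A. adj ctr x" for A
  proof -
    have "card A \<le> card {j. adj ctr j}" by (rule card_mono) (use that in auto)
    then show ?thesis using ctr_degree by simp
  qed
  show ?thesis
  proof (cases "\<sigma> (\<sigma> b) = b")
    case True
    have eq: "c = c'" if "adj ctr c" "adj ctr c'" "c \<notin> {b, \<sigma> b}" "c' \<notin> {b, \<sigma> b}" for c c'
      using small[of "{b, \<sigma> b, c, c'}"] that b nb by (auto simp: card_insert_if split: if_splits)
    have ns: "\<sigma> c \<notin> {b, \<sigma> b}" if "c \<notin> {b, \<sigma> b}" for c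
      using that True sigma_inj[of c "\<sigma> b"] by auto
    have 1: "\<sigma> c = c \<or> c = b \<or> c = \<sigma> b \<or> c = \<sigma> (\<sigma> b)" if "adj ctr c" for c
      using eq[of "\<sigma> c" c] ns[of c] nb that by blast
    have 2: "c = c' \<and> \<sigma> (\<sigma> b) = b"
      if c: "adj ctr c" "\<sigma> c = c" "adj ctr c'" "\<sigma> c' = c'" for c c'
    proof -
      have "c \<notin> {b, \<sigma> b}" "c' \<notin> {b, \<sigma> b}" using c b True by auto
      then show ?thesis using eq c True by blast
    qed
    show ?thesis by (rule that[OF b]) (use 1 2 True in blast)+
  next
    case False
    have all: "c \<in> {b, \<sigma> b, \<sigma> (\<sigma> b)}" if "adj ctr c" for c
      using small[of "{b, \<sigma> b, \<sigma> (\<sigma> b), c}"] that b nb False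
      by (auto simp: card_insert_if split: if_splits)
    have three: "\<sigma> (\<sigma> (\<sigma> b)) = b"
      using all[of "\<sigma> (\<sigma> (\<sigma> b))"] b nb False by auto
    have 2: "c = c' \<and> \<sigma> (\<sigma> b) = b" if "adj ctr c" "\<sigma> c = c" for c c'
      using all[of c] that b by auto
    show ?thesis by (rule that[OF b]) (use all 2 three in blast)+
  qed
qed

lemma sigma_power_id: "\<sigma> = id \<or> (\<sigma> \<noteq> id \<and> \<sigma> ^^ 2 = id) \<or> (\<sigma> \<noteq> id \<and> \<sigma> ^^ 2 \<noteq> id \<and> \<sigma> ^^ 3 = id)"
proof (cases "\<sigma> = id")
  case False
  obtain b where b: "adj ctr b" "\<sigma> b \<noteq> b" "\<sigma> (\<sigma> b) = b \<or> \<sigma> (\<sigma> (\<sigma> b)) = b"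
    "\<forall>c. adj ctr c \<longrightarrow> \<sigma> c = c \<or> c = b \<or> c = \<sigma> b \<or> c = \<sigma> (\<sigma> b)"
    "\<forall>c c'. adj ctr c \<and> \<sigma> c = c \<and> adj ctr c' \<and> \<sigma> c' = c' \<longrightarrow> c = c' \<and> \<sigma> (\<sigma> b) = b"
    by (rule moved_neighbour[OF False])
  have ida: "diagram_automorphism adj id" by (simp add: diagram_automorphism_def)
  have eq: "\<sigma> ^^ l = id" if "\<And>c. adj ctr c \<Longrightarrow> (\<sigma> ^^ l) c = c" for l
    by (rule automorphism_eqI[OF power_automorphism _ ida]) (use that in auto)
  show ?thesis
  proof (cases "\<sigma> (\<sigma> b) = b")
    case True
    have "\<sigma> ^^ 2 = id"
    proof (rule eq)
      fix c assume "adj ctr c"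
      then show "(\<sigma> ^^ 2) c = c" using b(4)[rule_format, of c] True by (auto simp: numeral_2_eq_2)
    qed
    then show ?thesis using False by blast
  next
    case neq: False
    have "\<sigma> ^^ 3 = id"
    proof (rule eq)
      fix c assume "adj ctr c"
      then show "(\<sigma> ^^ 3) c = c" using b(3) b(4)[rule_format, of c] neq by (auto simp: numeral_3_eq_3)
    qed
    moreover have "(\<sigma> ^^ 2) b \<noteq> b" using neq by (simp add: numeral_2_eq_2)
    ultimately show ?thesis using False by auto
  qed
qed simp

lemma r_cases:
  "(\<sigma> = id \<and> r = 1) \<or> (\<sigma> \<noteq> id \<and> \<sigma> ^^ 2 = id \<and> r = 2) \<or>
   (\<sigma> \<noteq> id \<and> \<sigma> ^^ 2 \<noteq> id \<and> \<sigma> ^^ 3 = id \<and> r = 3)"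
proof -
  consider "\<sigma> = id" | "\<sigma> \<noteq> id" "\<sigma> ^^ 2 = id" | "\<sigma> \<noteq> id" "\<sigma> ^^ 2 \<noteq> id" "\<sigma> ^^ 3 = id"
    using sigma_power_id by blast
  then show ?thesis
  proof cases
    case 1
    have "r = 1" unfolding aut_order_def by (rule Least_equality) (use 1 in auto)
    then show ?thesis using 1 by simp
  next
    case 2
    have "r = 2" unfolding aut_order_def
    proof (rule Least_equality)
      fix y assume "0 < y \<and> \<sigma> ^^ y = id"
      then show "2 \<le> y" using 2 by (cases "y = 1") auto
    qed (use 2 in auto)
    then show ?thesis using 2 by simp
  next
    case 3
    have "r = 3" unfolding aut_order_def
    proof (rule Least_equality)
      fix y assume y: "0 < y \<and> \<sigma> ^^ y = id"
      then have "y \<noteq> 1" "y \<noteq> 2" using 3 by auto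
      then show "3 \<le> y" using y by linarith
    qed (use 3 in auto)
    then show ?thesis using 3 by simp
  qed
qed

lemma r_pos [simp]: "0 < r"
  using r_cases by auto

lemma sigma_power_r [simp]: "(\<sigma> ^^ r) x = x"
  using r_cases by auto

lemma power_r_add: "(\<sigma> ^^ (r * k + l)) x = (\<sigma> ^^ l) x"
  by (induction k) (simp_all add: funpow_add add.assoc)

lemma power_mod_r: "(\<sigma> ^^ (l mod r)) x = (\<sigma> ^^ l) x"
  using power_r_add[of "l div r" "l mod r" x] by simp

lemma orb_eq: "orb \<sigma> i = (\<lambda>l. (\<sigma> ^^ l) i) ` {..<r}"
proof -
  have "(\<sigma> ^^ l) i \<in> (\<lambda>l. (\<sigma> ^^ l) i) ` {..<r}" for l
    by (rule image_eqI[of _ _ "l mod r"]) (simp_all add: power_mod_r)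
  then show ?thesis by (auto simp: orb_def)
qed

lemma orb_self [simp]: "i \<in> orb \<sigma> i"
  unfolding orb_def by (rule CollectI) (metis funpow_0)

lemma power_cases: "l < r \<Longrightarrow> l = 0 \<or> (l = 1 \<and> 1 < r) \<or> (l = 2 \<and> r = 3)"
  using r_cases by auto

lemma power_fixed: "\<sigma> i = i \<Longrightarrow> (\<sigma> ^^ l) i = i"
  by (induction l) auto

text \<open>The order is 1, 2 or 3, so an orbit that is not a point has the full size
  \<open>r\<close>. This is why all orbit sizes are 1 or \<open>r\<close>.\<close>

lemma power_moved:
  assumes "\<sigma> i \<noteq> i" "l < r" "k < r" shows "(\<sigma> ^^ l) i = (\<sigma> ^^ k) i \<longleftrightarrow> l = k"
proof -
  have "\<sigma> (\<sigma> i) \<noteq> i" if "r = 3"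
  proof
    assume "\<sigma> (\<sigma> i) = i"
    moreover have "\<sigma> (\<sigma> (\<sigma> i)) = i" using sigma_power_r[of i] that by (simp add: numeral_3_eq_3)
    ultimately show False using assms(1) by simp
  qed
  then show ?thesis
    using power_cases[OF assms(2)] power_cases[OF assms(3)] assms(1)
    by (auto simp: numeral_2_eq_2 eq_commute[of i])
qed

lemma d_fixed: "\<sigma> i = i \<Longrightarrow> d i = 1"
proof -
  assume "\<sigma> i = i"
  then have "orb \<sigma> i = {i}" by (auto simp: orb_def power_fixed)
  then show ?thesis by (simp add: orb_size_def)
qed

lemma d_moved: assumes "\<sigma> i \<noteq> i" shows "d i = int r"
proof -
  have "inj_on (\<lambda>l. (\<sigma> ^^ l) i) {..<r}"
    using power_moved[OF assms] by (auto intro!: inj_onI)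
  then show ?thesis by (simp add: orb_size_def orb_eq card_image)
qed

lemma d_cases: "(\<sigma> i = i \<and> d i = 1) \<or> (\<sigma> i \<noteq> i \<and> d i = int r \<and> 1 < r)"
  using d_fixed[of i] d_moved[of i] r_cases by auto

lemma d_values: "d i = 1 \<or> d i = 2 \<or> d i = 3"
  using d_cases[of i] r_cases by auto

lemma d_pos [simp]: "0 < d i"
  using d_values[of i] by auto

lemma d_neq_0 [simp]: "d i \<noteq> 0"
  using d_pos[of i] by linarith

lemma d_nonneg [simp]: "0 \<le> d i"
  using d_pos[of i] by linarith

lemma d_le_r: "d i \<le> int r"
  using d_cases[of i] r_pos by linarith

lemma d_sigma [simp]: "d (\<sigma> i) = d i"
  using d_cases[of i] d_cases[of "\<sigma> i"] by auto

lemma d_power [simp]: "d ((\<sigma> ^^ l) i) = d i"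
  by (induction l) auto

lemma exists_d_eq_r: "\<exists>i. d i = int r"
  using r_cases d_fixed d_moved by (metis eq_id_iff of_nat_1)

lemma d_less: assumes "d i < d j" shows "\<sigma> i = i" "d i = 1" "\<sigma> j \<noteq> j" "d j = int r" "1 < r"
  using assms d_cases[of i] d_cases[of j] by auto

lemma adj_power: "\<sigma> i = i \<Longrightarrow> adj i j \<Longrightarrow> adj i ((\<sigma> ^^ l) j)"
  using power_adj[of l i j] by (simp add: power_fixed)

text \<open>The parent of a fixed vertex is fixed, so orbits can only grow away from the
  centre.\<close>

lemma d_par: assumes "i \<noteq> ctr" shows "d (par i) \<le> d i"
proof (cases "\<sigma> i = i")
  case True
  then have "\<sigma> (par i) = par i" using sigma_par[OF assms] by simp
  then show ?thesis using True d_fixed by simp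
next
  case False
  then show ?thesis using d_moved[OF False] d_le_r by simp
qed

lemma orb_power [simp]: "orb \<sigma> ((\<sigma> ^^ l) i) = orb \<sigma> i"
proof -
  have s: "orb \<sigma> (\<sigma> i) = orb \<sigma> i" for i
  proof
    show "orb \<sigma> (\<sigma> i) \<subseteq> orb \<sigma> i"
    proof
      fix x assume "x \<in> orb \<sigma> (\<sigma> i)"
      then obtain l where "x = (\<sigma> ^^ l) (\<sigma> i)" by (auto simp: orb_def)
      then have "x = (\<sigma> ^^ Suc l) i" by (simp add: funpow_swap1)
      then show "x \<in> orb \<sigma> i" unfolding orb_def by blast
    qed
    show "orb \<sigma> i \<subseteq> orb \<sigma> (\<sigma> i)"
    proof
      fix x assume "x \<in> orb \<sigma> i"
      then obtain l where "x = (\<sigma> ^^ l) i" by (auto simp: orb_def)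
      also have "\<dots> = (\<sigma> ^^ l) ((\<sigma> ^^ r) i)" by simp
      also obtain q where q: "r = Suc q" using r_pos gr0_implies_Suc by blast
      have "(\<sigma> ^^ l) ((\<sigma> ^^ r) i) = (\<sigma> ^^ (l + q)) (\<sigma> i)"
        unfolding q funpow_Suc_right funpow_add comp_apply ..
      finally show "x \<in> orb \<sigma> (\<sigma> i)" unfolding orb_def by blast
    qed
  qed
  show ?thesis by (induction l) (auto simp: s)
qed

lemma orb_eqD: "orb \<sigma> i = orb \<sigma> j \<Longrightarrow> \<exists>l<r. i = (\<sigma> ^^ l) j"
  using orb_self[of i] by (auto simp: orb_eq[of j])

lemma orb_memD: "i \<in> orb \<sigma> j \<Longrightarrow> \<exists>l<r. i = (\<sigma> ^^ l) j"
  by (auto simp: orb_eq[of j])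

lemma mem_orb_eq: "i \<in> orb \<sigma> j \<Longrightarrow> orb \<sigma> i = orb \<sigma> j"
  using orb_memD by fastforce

text \<open>The centralizer of a nontrivial permutation of at most three neighbours of \<open>ctr\<close> is generated by it.\<close>

lemma commuting_automorphism:
  assumes "\<sigma> \<noteq> id" "diagram_automorphism adj \<tau>" and c: "\<And>i. \<tau> (\<sigma> i) = \<sigma> (\<tau> i)"
  obtains k where "\<tau> = \<sigma> ^^ k"
proof -
  have tc: "\<tau> ctr = ctr"
    using aut_ctr assms(1,2) automorphism no_flip by blast
  have inj: "\<tau> x = \<tau> y \<longleftrightarrow> x = y" for x y
    using assms(2) by (auto simp: diagram_automorphism_def bij_def inj_eq)
  have nb: "adj ctr (\<tau> x) \<longleftrightarrow> adj ctr x" for x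
    using assms(2) tc by (metis diagram_automorphism_def)
  obtain b where b0: "adj ctr b" "\<sigma> b \<noteq> b" "\<sigma> (\<sigma> b) = b \<or> \<sigma> (\<sigma> (\<sigma> b)) = b"
    "\<forall>c. adj ctr c \<longrightarrow> \<sigma> c = c \<or> c = b \<or> c = \<sigma> b \<or> c = \<sigma> (\<sigma> b)"
    "\<forall>c c'. adj ctr c \<and> \<sigma> c = c \<and> adj ctr c' \<and> \<sigma> c' = c' \<longrightarrow> c = c' \<and> \<sigma> (\<sigma> b) = b"
    by (rule moved_neighbour[OF assms(1)])
  note b = b0(1,2,4,5)
  have "\<sigma> (\<tau> b) \<noteq> \<tau> b" using b(2) inj by (simp flip: c)
  then have "\<tau> b = b \<or> \<tau> b = \<sigma> b \<or> \<tau> b = \<sigma> (\<sigma> b)" using b(1,3) nb by blast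
  then have "\<tau> b = (\<sigma> ^^ 0) b \<or> \<tau> b = (\<sigma> ^^ 1) b \<or> \<tau> b = (\<sigma> ^^ 2) b"
    by (simp add: numeral_2_eq_2)
  then have "\<exists>k. \<tau> b = (\<sigma> ^^ k) b" by blast
  then obtain k where k: "\<tau> b = (\<sigma> ^^ k) b" by blast
  have ck: "(\<sigma> ^^ k) (\<sigma> x) = \<sigma> ((\<sigma> ^^ k) x)" for x by (simp add: funpow_swap1)
  have "\<tau> = \<sigma> ^^ k"
  proof (rule automorphism_eqI[OF assms(2) tc power_automorphism])
    fix x assume x: "adj ctr x"
    then consider "\<sigma> x = x" | "x = b" | "x = \<sigma> b" | "x = \<sigma> (\<sigma> b)" using b(3) by blast
    then show "\<tau> x = (\<sigma> ^^ k) x"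
    proof cases
      case 1
      then have "\<sigma> (\<tau> x) = \<tau> x" by (metis c)
      then have "\<tau> x = x" using b(4)[rule_format, of "\<tau> x" x] 1 x nb by blast
      then show ?thesis using 1 by (simp add: power_fixed)
    qed (simp_all add: c ck k)
  qed simp
  then show ?thesis by (rule that)
qed

lemma star_sigma: "star adj (\<sigma> i) = \<sigma> (star adj i)"
  by (rule star_automorphism[OF automorphism])

lemma d_star [simp]: "d (star adj i) = d i"
proof -
  have "\<sigma> (star adj i) = star adj i \<longleftrightarrow> \<sigma> i = i"
    unfolding star_sigma[symmetric] using bij_star by (simp add: bij_def inj_eq)
  then show ?thesis using d_cases[of i] d_cases[of "star adj i"] by argo
qed

text \<open>The involution commutes with every diagram automorphism, in particular with \<sigma>.
  The exponent is found in \<open>star_half_period\<close> by comparing levels.\<close>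

lemma star_power: assumes "\<sigma> \<noteq> id" obtains k where "star adj = \<sigma> ^^ k"
proof -
  have "diagram_automorphism adj (star adj)"
    using bij_star star_adj by (auto simp: diagram_automorphism_def)
  from commuting_automorphism[OF assms this star_sigma] that show ?thesis by blast
qed

end

section \<open>Height functions and adapted words\<close>

lemma finite_arg_max:
  fixes f :: "'a \<Rightarrow> int"
  assumes "finite A" "A \<noteq> {}"
  obtains x where "x \<in> A" "\<forall>y\<in>A. f y \<le> f x"
proof -
  have "Max (f ` A) \<in> f ` A" using assms by simp
  then obtain x where "x \<in> A" "Max (f ` A) = f x" by auto
  then show ?thesis using that assms by (metis Max_ge finite_imageI imageI)
qed

context folded_diagram
begin

definition endpoint :: "('v \<Rightarrow> int) \<Rightarrow> 'v list \<Rightarrow> 'v \<Rightarrow> int" where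
  "endpoint \<xi> is = foldl (\<lambda>\<eta> i. Q_reflect \<sigma> i \<eta>) \<xi> is"

lemma endpoint_Nil [simp]: "endpoint \<xi> [] = \<xi>"
  by (simp add: endpoint_def)

lemma endpoint_Cons: "endpoint \<xi> (i # is) = endpoint (Q_reflect \<sigma> i \<xi>) is"
  by (simp add: endpoint_def)

lemma endpoint_append: "endpoint \<xi> (is @ js) = endpoint (endpoint \<xi> is) js"
  by (simp add: endpoint_def)

lemma endpoint_count: "endpoint \<xi> is i = \<xi> i - 2 * d i * int (count_list is i)"
proof (induction "is" arbitrary: \<xi>)
  case (Cons j "is")
  show ?case unfolding endpoint_Cons Cons by (simp add: Q_reflect_def algebra_simps)
qed simp

lemma endpoint_le: "endpoint \<xi> is i \<le> \<xi> i"
  by (simp add: endpoint_count zero_le_mult_iff)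

lemma endpoint_less: "endpoint \<xi> is i < \<xi> i \<longleftrightarrow> i \<in> set is"
  by (simp add: endpoint_count zero_less_mult_iff count_list_0_iff flip: neq0_conv)

lemma endpoint_eq_iff: "endpoint \<xi> is = endpoint \<xi> js \<longleftrightarrow> (\<forall>i. count_list is i = count_list js i)"
  by (simp add: fun_eq_iff endpoint_count)

lemma adapted_append:
  "adapted adj \<sigma> \<xi> (is @ js) \<longleftrightarrow> adapted adj \<sigma> \<xi> is \<and> adapted adj \<sigma> (endpoint \<xi> is) js"
  by (induction "is" arbitrary: \<xi>) (auto simp: endpoint_Cons)

lemma sources_not_adj: "source adj \<xi> i \<Longrightarrow> source adj \<xi> j \<Longrightarrow> \<not> adj i j"
  using adj_commute unfolding source_def by (metis less_asym)

lemma source_reflect: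
  assumes "source adj \<xi> i" "j \<noteq> i" shows "source adj (Q_reflect \<sigma> j \<xi>) i"
  unfolding source_def
proof (intro allI impI)
  fix k assume "adj i k"
  then have "\<xi> k < \<xi> i" using assms(1) by (simp add: source_def)
  then show "Q_reflect \<sigma> j \<xi> k < Q_reflect \<sigma> j \<xi> i"
    unfolding Q_reflect_def fun_upd_apply using assms(2) d_pos[of j] by (smt (verit))
qed

text \<open>A source blocks its neighbours: none of them can be a source before it has been applied,
  and applying other letters only lowers values.\<close>

lemma source_adapted:
  assumes "adapted adj \<sigma> \<xi> us" "source adj \<xi> i" "i \<notin> set us"
  shows "(\<forall>j\<in>set us. \<not> adj j i) \<and> source adj (endpoint \<xi> us) i"
  using assms
proof (induction us arbitrary: \<xi>)
  case (Cons j us)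
  have "\<not> adj j i" using Cons.prems sources_not_adj[of \<xi> j i] by simp
  moreover have "source adj (Q_reflect \<sigma> j \<xi>) i" using Cons.prems by (intro source_reflect) auto
  ultimately show ?case using Cons.IH[of "Q_reflect \<sigma> j \<xi>"] Cons.prems by (simp add: endpoint_Cons)
qed simp

lemma reflect_commute: "Q_reflect \<sigma> i (Q_reflect \<sigma> j \<xi>) = Q_reflect \<sigma> j (Q_reflect \<sigma> i \<xi>)"
  by (auto simp: Q_reflect_def fun_eq_iff)

lemma adapted_swap:
  assumes "adapted adj \<sigma> \<xi> (i # j # vs)" "\<not> adj i j"
  shows "adapted adj \<sigma> \<xi> (j # i # vs)"
proof (cases "i = j")
  case False
  have "source adj \<xi> i" and j: "source adj (Q_reflect \<sigma> i \<xi>) j" using assms by auto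
  moreover have "source adj \<xi> j"
    using j assms(2) False adj_commute[of i j] unfolding source_def Q_reflect_def by (auto split: if_splits)
  moreover have "source adj (Q_reflect \<sigma> j \<xi>) i"
    using \<open>source adj \<xi> i\<close> False by (intro source_reflect) auto
  ultimately show ?thesis using assms(1) by (simp add: reflect_commute[of i j])
qed (use assms in simp)

lemma comm_step_adapted:
  assumes "comm_step adj xs ys" "adapted adj \<sigma> \<xi> xs"
  shows "adapted adj \<sigma> \<xi> ys" "endpoint \<xi> ys = endpoint \<xi> xs"
proof -
  obtain us i j vs where e: "xs = us @ [i, j] @ vs" "ys = us @ [j, i] @ vs" "\<not> adj i j"
    using assms(1) unfolding comm_step_def by blast
  show "adapted adj \<sigma> \<xi> ys"
    using assms(2) adapted_swap[of "endpoint \<xi> us" i j vs] e by (simp add: adapted_append)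
  show "endpoint \<xi> ys = endpoint \<xi> xs"
    by (simp add: e endpoint_append endpoint_Cons reflect_commute[of i j])
qed

lemma comm_steps_adapted:
  assumes "(comm_step adj)\<^sup>*\<^sup>* xs ys" "adapted adj \<sigma> \<xi> xs"
  shows "adapted adj \<sigma> \<xi> ys \<and> endpoint \<xi> ys = endpoint \<xi> xs"
  using assms
  by (induction rule: rtranclp_induct) (auto simp: comm_step_adapted)

text \<open>The first letter \<open>i\<close> of \<open>is\<close> is a source and has to occur in
  \<open>js\<close>, since the endpoints agree. No neighbour of \<open>i\<close> precedes its first
  occurrence there, so it can be moved to the front and removed from both words.\<close>

lemma adapted_same_endpoint:
  assumes "adapted adj \<sigma> \<xi> is" "adapted adj \<sigma> \<xi> js" "endpoint \<xi> is = endpoint \<xi> js"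
  shows "(comm_step adj)\<^sup>*\<^sup>* js is"
  using assms
proof (induction "is" arbitrary: \<xi> js)
  case Nil
  then have "count_list js i = 0" for i using endpoint_eq_iff[of \<xi> "[]" js] by simp
  from this[of "hd js"] have "js = []" using hd_in_set[of js] by (auto simp: count_list_0_iff)
  then show ?case by simp
next
  case (Cons i "is")
  have "endpoint \<xi> (i # is) i < \<xi> i" unfolding endpoint_less by simp
  then have "i \<in> set js" using Cons.prems(3) endpoint_less[of \<xi> js i] by simp
  then obtain us vs where js: "js = us @ i # vs" "i \<notin> set us" by (metis split_list_first)
  have "adapted adj \<sigma> \<xi> us" using Cons.prems(2) js by (simp add: adapted_append)
  then have "\<forall>j\<in>set us. \<not> adj j i"
    using source_adapted[of \<xi> us i] Cons.prems(1) js by auto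
  then have steps: "(comm_step adj)\<^sup>*\<^sup>* js (i # us @ vs)"
    unfolding js by (rule comm_steps_move)
  then have "adapted adj \<sigma> \<xi> (i # us @ vs)" "endpoint \<xi> (i # us @ vs) = endpoint \<xi> js"
    using comm_steps_adapted[OF steps Cons.prems(2)] by auto
  then have "(comm_step adj)\<^sup>*\<^sup>* (us @ vs) is"
    using Cons.prems by (intro Cons.IH[of "Q_reflect \<sigma> i \<xi>"]) (auto simp: endpoint_Cons)
  then show ?case using steps comm_steps_Cons by (metis rtranclp_trans)
qed

lemma adapted_shift: "adapted adj \<sigma> (\<lambda>i. \<xi> i + c) is \<longleftrightarrow> adapted adj \<sigma> \<xi> is"
proof (induction "is" arbitrary: \<xi>)
  case (Cons i "is")
  have "Q_reflect \<sigma> i (\<lambda>i. \<xi> i + c) = (\<lambda>j. Q_reflect \<sigma> i \<xi> j + c)"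
    by (auto simp: Q_reflect_def)
  moreover have "source adj (\<lambda>i. \<xi> i + c) i \<longleftrightarrow> source adj \<xi> i" by (simp add: source_def)
  ultimately show ?case using Cons[of "Q_reflect \<sigma> i \<xi>"] by simp
qed simp

lemma endpoint_automorphism:
  assumes "inj \<tau>" "\<And>i. d (\<tau> i) = d i"
  shows "endpoint \<eta> (map \<tau> is) \<circ> \<tau> = endpoint (\<eta> \<circ> \<tau>) is"
proof (induction "is" arbitrary: \<eta>)
  case (Cons i "is")
  have "Q_reflect \<sigma> (\<tau> i) \<eta> \<circ> \<tau> = Q_reflect \<sigma> i (\<eta> \<circ> \<tau>)"
    using assms by (auto simp: Q_reflect_def fun_eq_iff inj_eq)
  then show ?case by (simp only: endpoint_Cons list.map Cons)
qed simp

lemma adapted_automorphism: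
  assumes "diagram_automorphism adj \<tau>" "\<And>i. d (\<tau> i) = d i" "adapted adj \<sigma> (\<eta> \<circ> \<tau>) is"
  shows "adapted adj \<sigma> \<eta> (map \<tau> is)"
  using assms(3)
proof (induction "is" arbitrary: \<eta>)
  case (Cons i "is")
  have inj: "inj \<tau>" and sj: "surj \<tau>" and a: "\<And>i j. adj (\<tau> i) (\<tau> j) \<longleftrightarrow> adj i j"
    using assms(1) by (auto simp: diagram_automorphism_def bij_def)
  have "Q_reflect \<sigma> (\<tau> i) \<eta> \<circ> \<tau> = Q_reflect \<sigma> i (\<eta> \<circ> \<tau>)"
    using assms(2) inj by (auto simp: Q_reflect_def fun_eq_iff inj_eq)
  then have "adapted adj \<sigma> (Q_reflect \<sigma> (\<tau> i) \<eta> \<circ> \<tau>) is"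
    using Cons.prems by (simp only: adapted.simps)
  then have "adapted adj \<sigma> (Q_reflect \<sigma> (\<tau> i) \<eta>) (map \<tau> is)" by (rule Cons.IH)
  moreover have "source adj \<eta> (\<tau> i)"
    unfolding source_def
  proof (intro allI impI)
    fix j assume j: "adj (\<tau> i) j"
    obtain j' where j': "j = \<tau> j'" using sj by (rule surjE)
    have "source adj (\<eta> \<circ> \<tau>) i" using Cons.prems by (simp only: adapted.simps)
    then have "(\<eta> \<circ> \<tau>) j' < (\<eta> \<circ> \<tau>) i" using j a[of i j'] unfolding source_def j' by blast
    then show "\<eta> j < \<eta> (\<tau> i)" by (simp add: j')
  qed
  ultimately show ?case by simp
qed simp

lemma min_d_cases: "(d i = d j \<and> min (d i) (d j) = d i) \<or> (min (d i) (d j) = 1 \<and> (d i = 1 \<or> d j = 1))"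
  using d_cases[of i] d_cases[of j] by auto

end

section \<open>Levels of the repetition quiver and its down-sets\<close>

locale folded_parity = folded_diagram adj ctr par dep \<sigma>
  for adj :: "'v::finite \<Rightarrow> 'v \<Rightarrow> bool" and ctr par dep \<sigma> +
  fixes \<epsilon> :: "'v \<Rightarrow> int"
  assumes parity: "parity_function adj \<sigma> \<epsilon>"
begin

definition lat :: "'v \<Rightarrow> int \<Rightarrow> bool" where
  "lat i p \<longleftrightarrow> 2 * d i dvd p - \<epsilon> i"

text \<open>The vertices \<open>(i, p)\<close> with \<open>p \<le> \<xi> i\<close> form a down-set of the repetition quiver. This
  replaces both conditions on height functions, which are only used through it.\<close>

definition QD :: "('v \<Rightarrow> int) set" where
  "QD = {\<xi>. (\<forall>i. lat i (\<xi> i)) \<and> (\<forall>i j. adj i j \<longrightarrow> \<xi> i < \<xi> j + 2 * d j)}"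

lemma lat_diff: "lat i p \<Longrightarrow> lat i q \<longleftrightarrow> 2 * d i dvd p - q"
proof -
  assume p: "lat i p"
  have "p - q = (p - \<epsilon> i) - (q - \<epsilon> i)" by simp
  then show ?thesis using p dvd_diff_right_iff[of "2 * d i" "p - \<epsilon> i" "q - \<epsilon> i"]
    by (simp only: lat_def)
qed

lemma lat_add [simp]: "lat i (p + 2 * d i * k) \<longleftrightarrow> lat i p"
proof -
  have "p + 2 * d i * k - \<epsilon> i = (p - \<epsilon> i) + 2 * d i * k" by simp
  then show ?thesis unfolding lat_def by (metis dvd_add_times_triv_right_iff mult.commute)
qed

lemma lat_minus [simp]: "lat i (p - 2 * d i * k) \<longleftrightarrow> lat i p"
  using lat_add[of i p "- k"] by simp

lemma lat_minus1 [simp]: "lat i (p - 2 * d i) \<longleftrightarrow> lat i p"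
  using lat_minus[of i p 1] by simp

lemma lat_plus1 [simp]: "lat i (p + 2 * d i) \<longleftrightarrow> lat i p"
  using lat_add[of i p 1] by simp

lemma lat_gap: "lat i p \<Longrightarrow> lat i q \<Longrightarrow> p < q \<Longrightarrow> p + 2 * d i \<le> q"
  using lat_diff[of i q p] zdvd_imp_le[of "2 * d i" "q - p"] by simp

text \<open>The steps of both columns are multiples of \<open>2 * min (d i) (d j)\<close>, so the
  congruence between the two parities extends to all levels.\<close>

lemma lat_adj:
  assumes "adj i j" "lat i p" "lat j q"
  obtains k where "p - q = min (d i) (d j) + 2 * min (d i) (d j) * k"
proof -
  define m where "m = min (d i) (d j)"
  have "[\<epsilon> i = \<epsilon> j + m] (mod (2 * m))"
    using parity assms(1) unfolding parity_function_def m_def by blast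
  then have a: "2 * m dvd \<epsilon> i - (\<epsilon> j + m)" by (simp add: cong_iff_dvd_diff)
  have "m dvd d i" "m dvd d j" using min_d_cases[of i j] by (auto simp: m_def)
  then have md: "2 * m dvd 2 * d i" "2 * m dvd 2 * d j" by auto
  have pq: "2 * m dvd p - \<epsilon> i" "2 * m dvd q - \<epsilon> j"
    using dvd_trans[OF md(1)] dvd_trans[OF md(2)] assms(2,3) unfolding lat_def by blast+
  have "2 * m dvd (p - \<epsilon> i) - (q - \<epsilon> j) + (\<epsilon> i - (\<epsilon> j + m))"
    by (rule dvd_add[OF dvd_diff[OF pq] a])
  then have "2 * m dvd p - q - m" by (simp add: algebra_simps)
  then obtain k where "p - q - m = 2 * m * k" by (rule dvdE)
  then show ?thesis using that[of k] by (simp add: m_def)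
qed

text \<open>The difference is an odd multiple of the smaller orbit size. Hence adjacent values of a
  height function are strictly ordered, and a vertex with the largest value is always a
  source.\<close>

lemma lat_adj_neq: assumes "adj i j" "lat i p" "lat j q" shows "p \<noteq> q"
proof
  assume "p = q"
  moreover obtain k where "p - q = min (d i) (d j) + 2 * min (d i) (d j) * k"
    using lat_adj[OF assms] .
  ultimately have "min (d i) (d j) * (1 + 2 * k) = 0" by (simp add: algebra_simps)
  then have "1 + 2 * k = 0" by (auto simp: min_def split: if_splits)
  then show False by presburger
qed

lemma lat_power: "lat ((\<sigma> ^^ l) i) p \<longleftrightarrow> lat i (p + 2 * int l)"
proof -
  have "[\<epsilon> ((\<sigma> ^^ l) i) = \<epsilon> i - 2 * int l] (mod (2 * d i))"
    using parity unfolding parity_function_def by blast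
  then have "2 * d i dvd \<epsilon> ((\<sigma> ^^ l) i) - (\<epsilon> i - 2 * int l)" by (simp add: cong_iff_dvd_diff)
  moreover have "p + 2 * int l - \<epsilon> i = (p - \<epsilon> ((\<sigma> ^^ l) i)) + (\<epsilon> ((\<sigma> ^^ l) i) - (\<epsilon> i - 2 * int l))"
    by simp
  ultimately show ?thesis unfolding lat_def d_power by (metis dvd_add_left_iff)
qed

lemma QD_lat: "\<xi> \<in> QD \<Longrightarrow> lat i (\<xi> i)"
  by (simp add: QD_def)

lemma QD_less: "\<xi> \<in> QD \<Longrightarrow> adj i j \<Longrightarrow> \<xi> i < \<xi> j + 2 * d j"
  by (simp add: QD_def)

text \<open>Next to a short vertex \<open>s\<close> a long orbit takes the values
  \<open>\<xi> j' - 2 * k\<close> with \<open>k < r\<close>, where \<open>\<xi> j'\<close> differs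
  from \<open>\<xi> s\<close> by 1. All of them lie between \<open>\<xi> s - 2 * r + 1\<close> and
  \<open>\<xi> s + 1\<close>.\<close>

lemma Q_data_subset_QD: assumes "\<xi> \<in> Q_data adj \<sigma> \<epsilon>" shows "\<xi> \<in> QD"
proof -
  have h: "height_function adj \<sigma> \<xi>" and l: "\<And>i. lat i (\<xi> i)"
    using assms by (auto simp: Q_data_def lat_def)
  have short: "\<xi> s < \<xi> j + 2 * int r \<and> \<xi> j < \<xi> s + 2" if "adj s j" "d s < d j" for s j
  proof -
    note D = d_less[OF that(2)]
    have "orb_adj adj (orb \<sigma> s) (orb \<sigma> j)"
      unfolding orb_adj_def using that(1) orb_self by blast
    moreover have "card (orb \<sigma> s) < card (orb \<sigma> j)" using that(2) by (simp add: orb_size_def)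
    moreover have "\<forall>a\<in>orbits \<sigma>. \<forall>b\<in>orbits \<sigma>. orb_adj adj a b \<and> card a < card b \<longrightarrow>
        (\<forall>i\<in>a. \<exists>!j. j \<in> b \<and> \<bar>\<xi> i - \<xi> j\<bar> = 1 \<and>
           (\<forall>l < r. \<xi> ((\<sigma> ^^ l) j) = \<xi> j - 2 * int l))"
      using h unfolding height_function_def by (rule conjunct2)
    ultimately have "\<exists>!j'. j' \<in> orb \<sigma> j \<and> \<bar>\<xi> s - \<xi> j'\<bar> = 1 \<and>
           (\<forall>l < r. \<xi> ((\<sigma> ^^ l) j') = \<xi> j' - 2 * int l)"
      unfolding orbits_def using orb_self[of s] by blast
    from ex1_implies_ex[OF this] obtain j' where "j' \<in> orb \<sigma> j \<and> \<bar>\<xi> s - \<xi> j'\<bar> = 1 \<and>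
           (\<forall>l < r. \<xi> ((\<sigma> ^^ l) j') = \<xi> j' - 2 * int l)" by (rule exE)
    then have j': "j' \<in> orb \<sigma> j" "\<bar>\<xi> s - \<xi> j'\<bar> = 1"
        "\<And>l. l < r \<Longrightarrow> \<xi> ((\<sigma> ^^ l) j') = \<xi> j' - 2 * int l" by blast+
    have "orb \<sigma> j = orb \<sigma> j'" using mem_orb_eq[OF j'(1)] by simp
    then obtain k where "k < r" "j = (\<sigma> ^^ k) j'" using orb_eqD by blast
    then have "\<xi> j = \<xi> j' - 2 * int k" "k < r" using j'(3) by auto
    then show ?thesis using j'(2) by linarith
  qed
  have "\<xi> i < \<xi> j + 2 * d j" if a: "adj i j" for i j
  proof -
    consider "d i = d j" | "d i < d j" | "d j < d i" by linarith
    then show ?thesis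
    proof cases
      case 1
      then have "\<bar>\<xi> i - \<xi> j\<bar> = d i" using h a unfolding height_function_def by blast
      then show ?thesis using 1 d_pos[of i] by linarith
    next
      case 2
      then show ?thesis using short[OF a 2] d_less[OF 2] by simp
    next
      case 3
      then show ?thesis using short[of j i] a adj_commute d_less[OF 3] by simp
    qed
  qed
  then show ?thesis using l by (simp add: QD_def)
qed

text \<open>The strict inequalities confine each difference to a short open window, and the
  congruence of levels leaves in it only the values that a height function may take.\<close>

lemma QD_subset_Q_data: assumes x: "\<xi> \<in> QD" shows "\<xi> \<in> Q_data adj \<sigma> \<epsilon>"
proof -
  have l: "lat i (\<xi> i)" for i using x by (rule QD_lat)
  have eq: "\<bar>\<xi> i - \<xi> j\<bar> = d i" if a: "adj i j" "d i = d j" for i j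
  proof -
    obtain k where k: "\<xi> i - \<xi> j = d i + 2 * d i * k"
      using lat_adj[OF a(1) l l] a(2) by (metis min.idem)
    have "\<xi> i < \<xi> j + 2 * d j" "\<xi> j < \<xi> i + 2 * d i"
      using QD_less[OF x a(1)] QD_less[OF x adj_sym[OF a(1)]] by auto
    then have "d i * (1 + 2 * k) < d i * 2" "d i * (-2) < d i * (1 + 2 * k)"
      using k a(2) by (simp_all add: algebra_simps)
    then have "1 + 2 * k < 2" "-2 < 1 + 2 * k"
      using d_pos[of i] mult_less_cancel_left_pos by blast+
    then have "k = 0 \<or> k = -1" by presburger
    then show ?thesis using k d_pos[of i] by auto
  qed
  have ex: "\<exists>!j. j \<in> b \<and> \<bar>\<xi> i - \<xi> j\<bar> = 1 \<and> (\<forall>l < r. \<xi> ((\<sigma> ^^ l) j) = \<xi> j - 2 * int l)"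
    if A: "a \<in> orbits \<sigma>" "b \<in> orbits \<sigma>" "orb_adj adj a b" "card a < card b" "i \<in> a" for a b i
  proof -
    obtain s t where st: "s \<in> a" "t \<in> b" "adj s t" using A(3) unfolding orb_adj_def by blast
    have ab: "a = orb \<sigma> s" "b = orb \<sigma> t"
      using A(1,2) st(1,2) mem_orb_eq unfolding orbits_def by auto
    have "d s < d t" using A(4) by (simp add: ab orb_size_def)
    note D = d_less[OF this]
    have "i = s" using A(5) ab orb_memD[of i s] power_fixed[OF D(1)] by auto
    have adjb: "adj s j" if "j \<in> b" for j
      using that orb_memD[of j t] adj_power[OF D(1) st(3)] by (auto simp: ab)
    have db: "d j = int r" if "j \<in> b" for j using that orb_memD[of j t] D(4) by (auto simp: ab)
    have fin: "finite b" "b \<noteq> {}" using st by (auto simp: ab orb_eq)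
    \<comment> \<open>The vertex singled out in the definition of a height function is the highest
      one of its orbit.\<close>
    obtain j where j0: "j \<in> b" "\<forall>k\<in>b. \<xi> k \<le> \<xi> j" by (rule finite_arg_max[OF fin])
    note j = j0(1) j0(2)[rule_format]
    have bj: "b = orb \<sigma> j" using mem_orb_eq[OF j(1)[unfolded ab]] ab by simp
    have bnd: "\<xi> s < \<xi> k + 2 * int r" "\<xi> k < \<xi> s + 2" if "k \<in> b" for k
      using QD_less[OF x adjb[OF that]] QD_less[OF x adj_sym[OF adjb[OF that]]] db[OF that] D(2) by auto
    have step: "\<xi> ((\<sigma> ^^ l) j) = \<xi> j - 2 * int l" if "l < r" for l
    proof -
      have m: "(\<sigma> ^^ l) j \<in> b" unfolding bj orb_eq using that by blast
      have "lat j (\<xi> ((\<sigma> ^^ l) j) + 2 * int l)" using l[of "(\<sigma> ^^ l) j"] by (simp add: lat_power)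
      then have "2 * int r dvd \<xi> j - (\<xi> ((\<sigma> ^^ l) j) + 2 * int l)"
        using lat_diff[OF l[of j]] db[OF j(1)] by simp
      then obtain t where t: "\<xi> j - (\<xi> ((\<sigma> ^^ l) j) + 2 * int l) = 2 * int r * t" by (rule dvdE)
      have "int r * t > - int r"
        using t j(2)[OF m] that by linarith
      then have "int r * (- 1) < int r * t" by simp
      then have "t \<ge> 0" using r_pos by (simp only: mult_less_cancel_left_pos of_nat_0_less_iff)
      moreover have "int r * t < int r * 1"
      proof (cases "l = 0")
        case True
        then have "int r * t = 0" using t by simp
        then show ?thesis using r_pos by simp
      next
        case False
        then show ?thesis using t bnd(1)[OF m] bnd(2)[OF j(1)] by linarith
      qed
      then have "t < 1" using r_pos by (simp only: mult_less_cancel_left_pos of_nat_0_less_iff)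
      ultimately have "t = 0" by simp
      then show ?thesis using t by simp
    qed
    have one: "\<bar>\<xi> s - \<xi> j\<bar> = 1"
    proof -
      have m: "(\<sigma> ^^ (r - 1)) j \<in> b" unfolding bj orb_eq using r_pos by (intro imageI) simp
      have "\<xi> ((\<sigma> ^^ (r - 1)) j) = \<xi> j - 2 * (int r - 1)"
        using step[of "r - 1"] r_pos by (simp add: of_nat_diff)
      then have "\<xi> s < \<xi> j + 2" using bnd(1)[OF m] by simp
      moreover have "\<xi> j < \<xi> s + 2" using bnd(2)[OF j(1)] .
      moreover have "\<xi> s \<noteq> \<xi> j" using lat_adj_neq[OF adjb[OF j(1)] l l] .
      ultimately show ?thesis by linarith
    qed
    show ?thesis unfolding \<open>i = s\<close>
    proof (intro ex1I conjI)
      fix j' assume j': "j' \<in> b \<and> \<bar>\<xi> s - \<xi> j'\<bar> = 1 \<and> (\<forall>l < r. \<xi> ((\<sigma> ^^ l) j') = \<xi> j' - 2 * int l)"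
      then have "orb \<sigma> j = orb \<sigma> j'" using bj mem_orb_eq[of j' j] by simp
      then obtain k where k: "k < r" "j = (\<sigma> ^^ k) j'" using orb_eqD by blast
      then have "\<xi> j = \<xi> j' - 2 * int k" using j' by blast
      moreover have "\<xi> j' \<le> \<xi> j" using j(2) j' by blast
      ultimately have "k = 0" by simp
      then show "j' = j" using k by simp
    qed (use j(1) one step in auto)
  qed
  have "height_function adj \<sigma> \<xi>"
    unfolding height_function_def
  proof (intro conjI allI ballI impI)
    show "\<bar>\<xi> i - \<xi> j\<bar> = d i" if "adj i j \<and> d i = d j" for i j
      using eq that by blast
    show "\<exists>!j. j \<in> b \<and> \<bar>\<xi> i - \<xi> j\<bar> = 1 \<and> (\<forall>l < r. \<xi> ((\<sigma> ^^ l) j) = \<xi> j - 2 * int l)"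
      if "a \<in> orbits \<sigma>" "b \<in> orbits \<sigma>" "orb_adj adj a b \<and> card a < card b" "i \<in> a" for a b i
      by (rule ex[OF that(1,2) conjunct1[OF that(3)] conjunct2[OF that(3)] that(4)])
  qed
  then show ?thesis using l by (simp add: Q_data_def lat_def)
qed

lemma Q_data_eq: "Q_data adj \<sigma> \<epsilon> = QD"
  using Q_data_subset_QD QD_subset_Q_data by blast

lemma QD_max: assumes "\<xi> \<in> QD" "\<eta> \<in> QD" shows "(\<lambda>i. max (\<xi> i) (\<eta> i)) \<in> QD"
proof -
  have "max (\<xi> i) (\<eta> i) < max (\<xi> j) (\<eta> j) + 2 * d j" if "adj i j" for i j
    using QD_less[OF assms(1) that] QD_less[OF assms(2) that] by linarith
  moreover have "lat i (max (\<xi> i) (\<eta> i))" for i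
    using QD_lat[OF assms(1)] QD_lat[OF assms(2)] by (simp add: max_def)
  ultimately show ?thesis by (simp add: QD_def)
qed

lemma QD_reflect: assumes "\<xi> \<in> QD" "source adj \<xi> i" shows "Q_reflect \<sigma> i \<xi> \<in> QD"
proof -
  have "Q_reflect \<sigma> i \<xi> j < Q_reflect \<sigma> i \<xi> k + 2 * d k" if a: "adj j k" for j k
  proof -
    have "j \<noteq> k" using a adj_irrefl by auto
    moreover have "\<xi> j < \<xi> i" if "k = i" using assms(2) adj_sym[OF a] that by (simp add: source_def)
    ultimately show ?thesis
      unfolding Q_reflect_def fun_upd_apply using QD_less[OF assms(1) a] d_pos[of i] by (smt (verit))
  qed
  moreover have "lat j (Q_reflect \<sigma> i \<xi> j)" for j
    using QD_lat[OF assms(1)] by (simp add: Q_reflect_def)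
  ultimately show ?thesis by (simp add: QD_def)
qed

lemma adapted_QD: "\<xi> \<in> QD \<Longrightarrow> adapted adj \<sigma> \<xi> is \<Longrightarrow> endpoint \<xi> is \<in> QD"
  by (induction "is" arbitrary: \<xi>) (auto simp: endpoint_Cons QD_reflect)

text \<open>Among the vertices where \<xi> exceeds \<eta> choose one with the largest value of
  \<xi>. A higher neighbour would satisfy \<xi> = \<eta> and lie too high for \<eta> to be a
  down-set, so the chosen vertex is a source and can be lowered.\<close>

lemma exists_adapted:
  assumes "\<xi> \<in> QD" "\<eta> \<in> QD" "\<And>i. \<eta> i \<le> \<xi> i"
  shows "\<exists>is. adapted adj \<sigma> \<xi> is \<and> endpoint \<xi> is = \<eta>"
  using assms
proof (induction "nat (\<Sum>i\<in>UNIV. \<xi> i - \<eta> i)" arbitrary: \<xi> rule: less_induct)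
  case less
  show ?case
  proof (cases "\<xi> = \<eta>")
    case True
    then show ?thesis by (intro exI[of _ "[]"]) simp
  next
    case False
    define S where "S = {i. \<eta> i < \<xi> i}"
    have "S \<noteq> {}" using False less.prems(3) by (force simp: S_def fun_eq_iff less_le)
    then obtain i where i: "i \<in> S" "\<forall>j\<in>S. \<xi> j \<le> \<xi> i"
      using finite_arg_max[of S \<xi>] by auto
    have gap: "\<eta> i + 2 * d i \<le> \<xi> i"
      using i(1) lat_gap[OF QD_lat[OF less.prems(2)] QD_lat[OF less.prems(1)], of i] by (simp add: S_def)
    have src: "source adj \<xi> i"
      unfolding source_def
    proof (intro allI impI)
      fix j assume a: "adj i j"
      show "\<xi> j < \<xi> i"
      proof (rule ccontr)
        assume "\<not> \<xi> j < \<xi> i"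
        moreover have "\<xi> i \<noteq> \<xi> j" using lat_adj_neq[OF a QD_lat QD_lat] less.prems(1) by blast
        ultimately have gt: "\<xi> i < \<xi> j" by simp
        then have "j \<notin> S" using i(2) by auto
        then have "\<eta> j = \<xi> j" using less.prems(3)[of j] by (simp add: S_def)
        then show False using QD_less[OF less.prems(2) adj_sym[OF a]] gap gt by simp
      qed
    qed
    let ?x = "Q_reflect \<sigma> i \<xi>"
    have le: "\<eta> j \<le> ?x j" for j using gap less.prems(3)[of j] by (simp add: Q_reflect_def)
    have "(\<Sum>j\<in>UNIV. ?x j - \<eta> j) < (\<Sum>j\<in>UNIV. \<xi> j - \<eta> j)"
      by (rule sum_strict_mono_ex1) (auto simp: Q_reflect_def intro!: exI[of _ i])
    moreover have "0 \<le> (\<Sum>j\<in>UNIV. ?x j - \<eta> j)" using le by (intro sum_nonneg) simp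
    ultimately have "nat (\<Sum>j\<in>UNIV. ?x j - \<eta> j) < nat (\<Sum>j\<in>UNIV. \<xi> j - \<eta> j)" by simp
    from less.hyps[OF this QD_reflect[OF less.prems(1) src] less.prems(2) le]
    obtain "is" where "adapted adj \<sigma> ?x is" "endpoint ?x is = \<eta>" by blast
    then show ?thesis using src by (intro exI[of _ "i # is"]) (simp add: endpoint_Cons)
  qed
qed

text \<open>Both words can be routed through the maximum \<mu> of the two endpoints. At each vertex
  one endpoint equals \<mu>, so the two remaining words have no letter in common; they are reduced
  and represent the same element, hence are empty.\<close>

lemma unique_endpoint:
  assumes "\<xi> \<in> QD" "is \<in> reduced_words adj" "js \<in> reduced_words adj"
    and "adapted adj \<sigma> \<xi> is" "adapted adj \<sigma> \<xi> js"
  shows "endpoint \<xi> is = endpoint \<xi> js"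
proof -
  define \<mu> where "\<mu> = (\<lambda>i. max (endpoint \<xi> is i) (endpoint \<xi> js i))"
  have Q: "endpoint \<xi> is \<in> QD" "endpoint \<xi> js \<in> QD" using assms adapted_QD by auto
  then have mQ: "\<mu> \<in> QD" unfolding \<mu>_def by (rule QD_max)
  have le: "\<mu> i \<le> \<xi> i" for i using endpoint_le[of \<xi> "is" i] endpoint_le[of \<xi> js i] by (simp add: \<mu>_def)
  obtain ks where k: "adapted adj \<sigma> \<xi> ks" "endpoint \<xi> ks = \<mu>"
    using exists_adapted[OF assms(1) mQ le] by blast
  obtain as where a: "adapted adj \<sigma> \<mu> as" "endpoint \<mu> as = endpoint \<xi> is"
    using exists_adapted[OF mQ Q(1)] by (auto simp: \<mu>_def)
  obtain bs where b: "adapted adj \<sigma> \<mu> bs" "endpoint \<mu> bs = endpoint \<xi> js"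
    using exists_adapted[OF mQ Q(2)] by (auto simp: \<mu>_def)
  have ka: "(comm_step adj)\<^sup>*\<^sup>* is (ks @ as)"
    by (rule adapted_same_endpoint[of \<xi>])
      (use assms k a in \<open>auto simp: adapted_append endpoint_append\<close>)
  have kb: "(comm_step adj)\<^sup>*\<^sup>* js (ks @ bs)"
    by (rule adapted_same_endpoint[of \<xi>])
      (use assms k b in \<open>auto simp: adapted_append endpoint_append\<close>)
  have ra: "ks @ as \<in> reduced_words adj" using comm_steps_reduced_words[OF ka] assms(2) by simp
  have rb: "ks @ bs \<in> reduced_words adj" using comm_steps_reduced_words[OF kb] assms(3) by simp
  have "act adj (ks @ as) = act adj (ks @ bs)"
    using ra rb negating_unique by (simp add: reduced_words_iff)
  note kab = this
  have ab: "act adj as = act adj bs"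
  proof
    fix x
    have "act adj ks (act adj as x) = act adj ks (act adj bs x)"
      using fun_cong[OF kab, of x] by (simp only: act_append comp_apply)
    then show "act adj as x = act adj bs x" by (rule inj_act)
  qed
  have disj: "set as \<inter> set bs = {}"
  proof -
    have "\<not> (endpoint \<mu> as i < \<mu> i \<and> endpoint \<mu> bs i < \<mu> i)" for i
      unfolding a(2) b(2) by (simp add: \<mu>_def)
    then show ?thesis unfolding endpoint_less by blast
  qed
  have red: "reduced adj as" "reduced adj bs"
    using ra rb reduced_suffix by (auto simp: reduced_words_iff)
  have "as = []" by (rule reduced_disjoint_support[OF red(1) ab disj])
  moreover have "bs = []"
    by (rule reduced_disjoint_support[OF red(2) ab[symmetric]]) (use disj in auto)
  ultimately show ?thesis using a b by simp
qed

text \<open>The horizontal cut at level \<open>L\<close>: the highest level not above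
  \<open>L\<close> in every column. These are the height functions for which positivity of the
  linear form can be verified directly.\<close>

definition cut :: "int \<Rightarrow> 'v \<Rightarrow> int" where
  "cut L i = L - ((L - \<epsilon> i) mod (2 * d i))"

lemma cut_le: "cut L i \<le> L"
  using d_pos[of i] by (simp add: cut_def)

lemma cut_gt: "L < cut L i + 2 * d i"
  using d_pos[of i] pos_mod_bound[of "2 * d i" "L - \<epsilon> i"] by (simp add: cut_def)

lemma cut_lat: "lat i (cut L i)"
proof -
  have "cut L i - \<epsilon> i = (L - \<epsilon> i) - (L - \<epsilon> i) mod (2 * d i)" by (simp add: cut_def)
  then show ?thesis by (simp add: lat_def minus_mod_eq_mult_div)
qed

lemma cut_unique: assumes "lat i p" "p \<le> L" "L < p + 2 * d i" shows "cut L i = p"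
  using lat_gap[OF assms(1) cut_lat, of L] lat_gap[OF cut_lat assms(1), of L] assms cut_le[of L i] cut_gt[of L i]
  by linarith

lemma cut_QD: "cut L \<in> QD"
proof -
  have "cut L i < cut L j + 2 * d j" for i j
    using cut_le[of L i] cut_gt[of L j] by linarith
  then show ?thesis by (simp add: QD_def cut_lat)
qed

lemma cut_mono: "L' \<le> L \<Longrightarrow> cut L' i \<le> cut L i"
  using lat_gap[OF cut_lat cut_lat, of L i L'] cut_le[of L' i] cut_gt[of L i] by linarith

end

section \<open>The half period of the repetition quiver\<close>

lemma quadratic_nonneg_linear_zero:
  fixes b c :: real
  assumes "\<And>t. 0 \<le> 2 * t * b + t\<^sup>2 * c" "0 \<le> c"
  shows "b = 0"
proof (rule ccontr)
  assume b: "b \<noteq> 0"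
  \<comment> \<open>The minimiser \<open>- b / c\<close>, with the denominator enlarged so that
    \<open>c = 0\<close> needs no separate treatment.\<close>
  define t where "t = - b / (c + 1)"
  have "2 * t * b + t\<^sup>2 * c = - (b\<^sup>2 * (c + 2)) / (c + 1)\<^sup>2"
    using assms(2) by (simp add: t_def divide_simps power2_eq_square) algebra
  moreover have "0 < b\<^sup>2 * (c + 2) / (c + 1)\<^sup>2"
    using assms(2) b by (intro divide_pos_pos mult_pos_pos) auto
  ultimately show False using assms(1)[of t] by simp
qed

lemma sin_add_sin_diff: "sin (a + b) + sin (a - b) = 2 * sin a * cos (b::real)"
  by (simp add: sin_add sin_diff)

context folded_diagram
begin

abbreviation rd :: "'v \<Rightarrow> real" where "rd i \<equiv> real_of_int (d i)"

text \<open>The quantum integer of \<open>d i\<close> at \<open>q = exp (\<i> \<theta>)\<close>: it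
  is 1, \<open>q + 1/q\<close> or \<open>q^2 + 1 + 1/q^2\<close>.\<close>

definition kap :: "'v \<Rightarrow> real \<Rightarrow> real" where
  "kap i \<theta> = (if d i = 1 then 1 else if d i = 2 then 2 * cos \<theta> else 1 + 2 * cos (2 * \<theta>))"

definition edge_weight :: "real \<Rightarrow> 'v \<Rightarrow> 'v \<Rightarrow> real" where
  "edge_weight \<theta> i j = (if d i = d j then 1 / (rd i * kap i \<theta>) else 1 / max (rd i) (rd j))"

text \<open>Up to the factor \<open>d i * kap i \<theta>\<close>, the rows of the quantum Cartan matrix at \<open>q = exp (\<i> \<theta>)\<close>;
  with this factor the matrix becomes symmetric.\<close>

definition qrow :: "real \<Rightarrow> ('v \<Rightarrow> real) \<Rightarrow> 'v \<Rightarrow> real" where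
  "qrow \<theta> y i = 2 * cos (rd i * \<theta>) / (rd i * kap i \<theta>) * y i
     - (\<Sum>j\<in>UNIV. if adj i j then edge_weight \<theta> i j * y j else 0)"

definition qform :: "real \<Rightarrow> ('v \<Rightarrow> real) \<Rightarrow> ('v \<Rightarrow> real) \<Rightarrow> real" where
  "qform \<theta> x y = (\<Sum>i\<in>UNIV. x i * qrow \<theta> y i)"

lemma kap_pos:
  assumes "0 \<le> \<theta>" "rd i * \<theta> \<le> pi / 2" shows "0 < kap i \<theta>"
proof -
  have "0 < cos \<theta>" if "d i = 2"
  proof -
    have "2 * \<theta> \<le> pi / 2" using assms that by simp
    then show ?thesis using assms(1) pi_gt_zero by (intro cos_gt_zero_pi) linarith+
  qed
  moreover have "0 < cos (2 * \<theta>)" if "d i = 3"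
  proof -
    have "3 * \<theta> \<le> pi / 2" using assms that by simp
    then show ?thesis using assms(1) pi_gt_zero by (intro cos_gt_zero_pi) linarith+
  qed
  ultimately show ?thesis using d_values[of i] by (auto simp: kap_def)
qed

lemma kap_0: "kap i 0 = rd i"
  using d_values[of i] by (auto simp: kap_def)

lemma edge_weight_commute: "edge_weight \<theta> i j = edge_weight \<theta> j i"
  by (simp add: edge_weight_def kap_def max.commute)

lemma qrow_add: "qrow \<theta> (\<lambda>k. a * x k + b * y k) i = a * qrow \<theta> x i + b * qrow \<theta> y i"
proof -
  have "(\<Sum>j\<in>UNIV. if adj i j then edge_weight \<theta> i j * (a * x j + b * y j) else 0)
     = (\<Sum>j\<in>UNIV. a * (if adj i j then edge_weight \<theta> i j * x j else 0)
        + b * (if adj i j then edge_weight \<theta> i j * y j else 0))"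
    by (intro sum.cong) (auto simp: algebra_simps)
  then show ?thesis
    by (simp add: qrow_def sum.distrib sum_distrib_left algebra_simps add_divide_distrib del: mult_if_delta)
qed

lemma qform_right: "qform \<theta> x (\<lambda>k. a * y k + b * z k) = a * qform \<theta> x y + b * qform \<theta> x z"
  by (simp add: qform_def qrow_add sum_distrib_left sum.distrib algebra_simps)

lemma qform_commute: "qform \<theta> x y = qform \<theta> y x"
proof -
  let ?g = "\<lambda>i. 2 * cos (rd i * \<theta>) / (rd i * kap i \<theta>)"
  have e: "qform \<theta> x y = (\<Sum>i\<in>UNIV. ?g i * x i * y i)
      - (\<Sum>i\<in>UNIV. \<Sum>j\<in>UNIV. if adj i j then edge_weight \<theta> i j * x i * y j else 0)" for x y
    unfolding qform_def qrow_def sum_subtractf[symmetric] right_diff_distrib sum_distrib_left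
    by (intro sum.cong arg_cong2[of _ _ _ _ "(-)"]) (auto simp: algebra_simps)
  have "(\<Sum>i\<in>UNIV. \<Sum>j\<in>UNIV. if adj i j then edge_weight \<theta> i j * x i * y j else 0)
      = (\<Sum>j\<in>UNIV. \<Sum>i\<in>UNIV. if adj i j then edge_weight \<theta> i j * x i * y j else 0)"
    by (rule sum.swap)
  also have "\<dots> = (\<Sum>j\<in>UNIV. \<Sum>i\<in>UNIV. if adj j i then edge_weight \<theta> j i * y j * x i else 0)"
    by (intro sum.cong refl if_cong adj_commute)
      (simp_all add: edge_weight_commute[of \<theta>] mult_ac)
  finally show ?thesis unfolding e by (simp add: mult_ac)
qed

lemma qform_left: "qform \<theta> (\<lambda>k. a * y k + b * z k) x = a * qform \<theta> y x + b * qform \<theta> z x"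
  by (simp add: qform_commute[of \<theta> _ x] qform_right)

lemma qform_indicator: "qform \<theta> (\<lambda>k. of_bool (k = i)) y = qrow \<theta> y i"
  by (simp add: qform_def)

text \<open>At angle 0 the quantum integers become the orbit sizes, and dividing each coordinate by
  its orbit size recovers the positive definite form of the unfolded diagram.\<close>

lemma qform_0: assumes "x \<noteq> (\<lambda>_. 0 :: real)" shows "0 < qform 0 x x"
proof -
  define y where "y = (\<lambda>i. x i / rd i)"
  have xy: "x i = rd i * y i" for i by (simp add: y_def)
  have "y \<noteq> (\<lambda>_. 0)" using assms by (auto simp: xy fun_eq_iff)
  have w: "edge_weight 0 i j * x i * x j = y i * y j" for i j
    using min_d_cases[of i j] by (auto simp: edge_weight_def kap_0 xy max_def)
  have "qform 0 x x = (\<Sum>i\<in>UNIV. 2 * (y i)\<^sup>2 - (\<Sum>j\<in>UNIV. if adj i j then y i * y j else 0))"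
    unfolding qform_def
  proof (intro sum.cong refl)
    fix i
    have "x i * (\<Sum>j\<in>UNIV. if adj i j then edge_weight 0 i j * x j else 0)
      = (\<Sum>j\<in>UNIV. if adj i j then y i * y j else 0)"
      unfolding sum_distrib_left by (intro sum.cong) (auto simp flip: w)
    then show "x i * qrow 0 x i = 2 * (y i)\<^sup>2 - (\<Sum>j\<in>UNIV. if adj i j then y i * y j else 0)"
      unfolding qrow_def right_diff_distrib by (simp add: kap_0 xy power2_eq_square)
  qed
  then show ?thesis using posdef[OF \<open>y \<noteq> (\<lambda>_. 0)\<close>] by (simp add: sum_subtractf)
qed

lemma d_theta: assumes "0 \<le> \<theta>" "\<theta> \<le> pi / (2 * real r)" shows "rd i * \<theta> \<le> pi / 2"
proof -
  have "rd i * \<theta> \<le> real r * \<theta>"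
    using d_le_r[of i] assms(1) by (intro mult_right_mono) (metis of_int_le_iff of_int_of_nat_eq, simp)
  also have "\<dots> \<le> pi / 2" using assms(2) r_pos by (simp add: field_simps)
  finally show ?thesis .
qed

lemma continuous_qform:
  "continuous_on ({0..pi / (2 * real r)} \<times> UNIV) (\<lambda>z. qform (fst z) (\<lambda>i. snd z $ i) (\<lambda>i. (snd z :: real^'v) $ i))"
proof -
  let ?K = "{0..pi / (2 * real r)} \<times> (UNIV :: (real^'v) set)"
  have k: "continuous_on ?K (\<lambda>z. kap i (fst z))" for i
  proof -
    consider "d i = 1" | "d i = 2" | "d i = 3" using d_values[of i] by blast
    then show ?thesis by cases (simp_all add: kap_def, (intro continuous_intros)+)
  qed
  have k0: "kap i (fst z) \<noteq> 0" if "z \<in> ?K" for i z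
  proof -
    have z: "0 \<le> fst z" "fst z \<le> pi / (2 * real r)" using that by (simp_all add: mem_Times_iff)
    show ?thesis using kap_pos[OF z(1) d_theta[OF z]] by (rule less_imp_neq[symmetric])
  qed
  have w: "continuous_on ?K (\<lambda>z. edge_weight (fst z) i j)" for i j
    unfolding edge_weight_def using k0
    by (cases "d i = d j") (auto intro!: continuous_intros k)
  have "continuous_on ?K (\<lambda>z. if adj i j then edge_weight (fst z) i j * snd z $ j else 0)" for i j
    by (cases "adj i j") (auto intro!: continuous_intros w)
  then show ?thesis
    unfolding qform_def qrow_def using k0 by (intro continuous_intros k) auto
qed

text \<open>The pairs of an angle and a unit vector on which the form is not positive make up a
  compact set; the smallest angle in it is taken. There the form is positive semidefinite, so a null
  vector lies in the kernel. Absolute values give a nonnegative null vector, and connectedness makes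
  it positive.\<close>

lemma perron_frobenius:
  obtains \<theta> v where "0 < \<theta>" "\<theta> \<le> pi / (2 * real r)" "\<forall>i. 0 < v i" "\<forall>i. v (\<sigma> i) = v i"
    "\<forall>i. qrow \<theta> v i = 0"
proof -
  let ?T = "pi / (2 * real r)"
  let ?q = "\<lambda>\<theta> x. qform \<theta> (\<lambda>i. (x :: real^'v) $ i) (\<lambda>i. x $ i)"
  define S where "S = {z \<in> {0..?T} \<times> sphere (0 :: real^'v) 1. ?q (fst z) (snd z) \<le> 0}"
  have cont: "continuous_on ({0..?T} \<times> sphere (0 :: real^'v) 1) (\<lambda>z. ?q (fst z) (snd z))"
    by (rule continuous_on_subset[OF continuous_qform]) auto
  have "closed S" unfolding S_def
    by (rule continuous_on_closed_Collect_le[OF cont continuous_on_const])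
      (auto intro: closed_Times)
  moreover have "bounded S"
    by (rule bounded_subset[of "{0..?T} \<times> sphere 0 1"]) (auto simp: S_def intro: bounded_Times)
  ultimately have cS: "compact S" by (simp add: compact_eq_bounded_closed)
  obtain i0 where i0: "d i0 = int r" using exists_d_eq_r by blast
  \<comment> \<open>At the upper end of the interval the diagonal entry of a vertex with orbit size
    \<open>r\<close> is a multiple of \<open>cos (pi / 2)\<close>. This vanishing diagonal entry
    guarantees a singular angle within the bound \<open>pi / (2 * r)\<close>.\<close>
  have "(?T, axis i0 1) \<in> S"
  proof -
    have "?q ?T (axis i0 1) = qrow ?T (\<lambda>i. axis i0 (1::real) $ i) i0"
      using qform_indicator[of ?T i0 "\<lambda>i. axis i0 1 $ i"] by (simp add: axis_def of_bool_def)
    also have "\<dots> = 2 * cos (real r * ?T) / (real r * kap i0 ?T)"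
    proof -
      have "(if adj i0 j then edge_weight ?T i0 j * axis i0 1 $ j else 0) = 0" for j
        using adj_irrefl[of i0] by (auto simp: axis_def)
      then show ?thesis by (simp add: qrow_def i0)
    qed
    also have "real r * ?T = pi / 2" using r_pos by simp
    finally show ?thesis by (simp add: S_def norm_axis_1)
  qed
  then have "S \<noteq> {}" by blast
  moreover have "continuous_on S fst" by (rule continuous_on_fst[OF continuous_on_id])
  ultimately obtain z where z0: "z \<in> S" "\<forall>y\<in>S. fst z \<le> fst y"
    using continuous_attains_inf[OF cS] by blast
  note z = z0(1) z0(2)[rule_format]
  define \<theta> x where "\<theta> = fst z" and "x = (\<lambda>i. snd z $ i)"
  have T: "0 \<le> \<theta>" "\<theta> \<le> ?T" and nx: "norm (snd z) = 1" and qx: "qform \<theta> x x \<le> 0"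
    using z(1) by (auto simp: S_def \<theta>_def x_def)
  have x0: "x \<noteq> (\<lambda>_. 0)"
  proof
    assume "x = (\<lambda>_. 0)"
    then have "snd z = 0" by (simp add: x_def vec_eq_iff fun_eq_iff)
    then show False using nx by simp
  qed
  have "\<theta> \<noteq> 0" using qx qform_0[OF x0] by auto
  then have pos: "0 < \<theta>" using T by simp
  have kp: "0 < kap i \<theta>" for i using kap_pos d_theta T by blast
  have wp: "0 < edge_weight \<theta> i j" for i j
    unfolding edge_weight_def using kp[of i] d_pos[of i] d_pos[of j] by (auto simp: max_def)
  \<comment> \<open>A negative value at \<theta> would persist at a slightly smaller angle, against
    minimality.\<close>
  have nonneg: "0 \<le> qform \<theta> y y" for y
  proof (rule ccontr)
    assume "\<not> ?thesis"
    then have neg: "qform \<theta> y y < 0" by simp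
    define u where "u = (\<chi> i. y i)"
    have uy: "(\<lambda>i. u $ i) = y" by (simp add: u_def)
    have u0: "u \<noteq> 0"
    proof
      assume "u = 0"
      then have "y = (\<lambda>_. 0)" using uy by (simp add: fun_eq_iff)
      then show False using neg by (simp add: qform_def)
    qed
    define w where "w = (1 / norm u) *\<^sub>R u"
    have w: "norm w = 1" using u0 by (simp add: w_def)
    have sc: "?q t w = (1 / norm u)\<^sup>2 * qform t y y" for t
    proof -
      have "(\<lambda>i. w $ i) = (\<lambda>i. (1 / norm u) * y i + 0 * y i)"
        by (auto simp: w_def u_def)
      then show ?thesis by (simp only: qform_left qform_right) (simp add: power2_eq_square)
    qed
    have "continuous_on {0..?T} (\<lambda>t. ?q t w)"
      by (rule continuous_on_compose2[OF continuous_qform, of _ "\<lambda>t. (t, w)", simplified])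
        (auto intro!: continuous_intros)
    then obtain e where e: "e > 0" "\<And>t. t \<in> {0..?T} \<Longrightarrow> dist t \<theta> < e \<Longrightarrow>
        dist (?q t w) (?q \<theta> w) < - ?q \<theta> w"
    proof -
      assume c: "continuous_on {0..?T} (\<lambda>t. ?q t w)"
      have "0 < - ?q \<theta> w" unfolding sc using neg u0 by (simp add: mult_pos_neg)
      then show ?thesis using c that T unfolding continuous_on_iff by (metis atLeastAtMost_iff)
    qed
    define t where "t = max 0 (\<theta> - e / 2)"
    have t: "t \<in> {0..?T}" "dist t \<theta> < e" "t < \<theta>"
      using pos T e(1) by (auto simp: t_def dist_real_def max_def)
    have "?q t w < 0" using e(2)[OF t(1,2)] by (auto simp: dist_real_def)
    then have "(t, w) \<in> S" using t(1) w by (simp add: S_def)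
    then show False using z(2)[of "(t, w)"] t(3) by (simp add: \<theta>_def)
  qed
  \<comment> \<open>All edge weights are positive, so passing to absolute values cannot increase the
    form.\<close>
  define a where "a = (\<lambda>i. \<bar>x i\<bar>)"
  have "qform \<theta> a a \<le> qform \<theta> x x"
    unfolding qform_def
  proof (rule sum_mono)
    fix i
    have le: "x i * (\<Sum>j\<in>UNIV. if adj i j then edge_weight \<theta> i j * x j else 0)
      \<le> a i * (\<Sum>j\<in>UNIV. if adj i j then edge_weight \<theta> i j * a j else 0)"
      unfolding sum_distrib_left
    proof (rule sum_mono)
      fix j
      have "edge_weight \<theta> i j * (x i * x j) \<le> edge_weight \<theta> i j * (a i * a j)"
        using wp[of i j] by (intro mult_left_mono) (auto simp: a_def simp flip: abs_mult)
      then show "x i * (if adj i j then edge_weight \<theta> i j * x j else 0)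
        \<le> a i * (if adj i j then edge_weight \<theta> i j * a j else 0)"
        by (simp add: mult_ac)
    qed
    have sq: "a i * (g * a i) = x i * (g * x i)" for g
    proof -
      have "g * (a i * a i) = g * (x i * x i)" by (simp add: a_def)
      then show ?thesis by (simp only: mult.left_commute)
    qed
    show "a i * qrow \<theta> a i \<le> x i * qrow \<theta> x i"
      unfolding qrow_def right_diff_distrib by (rule diff_mono[OF eq_refl[OF sq] le])
  qed
  then have qa: "qform \<theta> a a = 0" using qx nonneg[of a] by linarith
  have row: "qrow \<theta> a i = 0" for i
  proof (rule quadratic_nonneg_linear_zero)
    let ?u = "\<lambda>k. of_bool (k = i) :: real"
    fix t
    have "0 \<le> qform \<theta> (\<lambda>k. 1 * a k + t * ?u k) (\<lambda>k. 1 * a k + t * ?u k)" by (rule nonneg)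
    also have "\<dots> = qform \<theta> a a + t * qform \<theta> a ?u + t * (qform \<theta> ?u a + t * qform \<theta> ?u ?u)"
      unfolding qform_left qform_right by simp
    also have "\<dots> = 2 * t * qrow \<theta> a i + t\<^sup>2 * qform \<theta> ?u ?u"
      unfolding qa qform_commute[of \<theta> a ?u] qform_indicator[of \<theta> i a]
      by (simp add: power2_eq_square algebra_simps)
    finally show "0 \<le> 2 * t * qrow \<theta> a i + t\<^sup>2 * qform \<theta> ?u ?u" .
  qed (rule nonneg)
  have a_nonneg: "0 \<le> a i" for i by (simp add: a_def)
  have spread: "a j = 0" if "a i = 0" "adj i j" for i j
  proof -
    have "(\<Sum>j\<in>UNIV. if adj i j then edge_weight \<theta> i j * a j else 0) = 0"
      using row[of i] that(1) by (simp add: qrow_def)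
    then have "(if adj i j then edge_weight \<theta> i j * a j else 0) = 0"
      by (subst (asm) sum_nonneg_eq_0_iff) (auto simp: a_nonneg less_imp_le[OF wp])
    then show ?thesis using that(2) wp[of i j] by simp
  qed
  have apos: "0 < a i" for i
  proof (rule ccontr)
    assume "\<not> 0 < a i"
    then have ai: "a i = 0" using a_nonneg[of i] by simp
    have "a j = 0" for j
      using connected[of i j] by (induction rule: rtranclp_induct) (auto simp: ai intro: spread)
    then show False using x0 by (auto simp: a_def fun_eq_iff)
  qed
  \<comment> \<open>Summation over the powers of \<sigma> makes the kernel vector invariant and
    keeps it positive.\<close>
  define v where "v = (\<lambda>i. \<Sum>l<r. a ((\<sigma> ^^ l) i))"
  have sg: "qrow \<theta> (\<lambda>k. y (\<sigma> k)) i = qrow \<theta> y (\<sigma> i)" for y i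
  proof -
    have b: "bij \<sigma>" using automorphism by (simp add: diagram_automorphism_def)
    have "(\<Sum>j\<in>UNIV. if adj (\<sigma> i) j then edge_weight \<theta> (\<sigma> i) j * y j else 0)
      = (\<Sum>j\<in>UNIV. if adj (\<sigma> i) (\<sigma> j) then edge_weight \<theta> (\<sigma> i) (\<sigma> j) * y (\<sigma> j) else 0)"
      by (rule sum.reindex_bij_betw[symmetric]) (use b in simp)
    moreover have "kap (\<sigma> i) \<theta> = kap i \<theta>" "edge_weight \<theta> (\<sigma> i) (\<sigma> j) = edge_weight \<theta> i j" for j
      by (simp_all add: kap_def edge_weight_def)
    ultimately show ?thesis by (simp add: qrow_def cong: if_cong)
  qed
  have rl: "qrow \<theta> (\<lambda>k. a ((\<sigma> ^^ l) k)) i = 0" for l i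
  proof (induction l arbitrary: i)
    case (Suc l)
    have "qrow \<theta> (\<lambda>k. a ((\<sigma> ^^ l) (\<sigma> k))) i = qrow \<theta> (\<lambda>k. a ((\<sigma> ^^ l) k)) (\<sigma> i)"
      by (rule sg)
    then show ?case using Suc[of "\<sigma> i"] by (simp add: funpow_swap1)
  qed (simp add: row)
  have "qrow \<theta> (\<lambda>k. \<Sum>l<n. a ((\<sigma> ^^ l) k)) i = 0" for n i
  proof (induction n)
    case (Suc n)
    have "qrow \<theta> (\<lambda>k. 1 * (\<Sum>l<n. a ((\<sigma> ^^ l) k)) + 1 * a ((\<sigma> ^^ n) k)) i = 0"
      unfolding qrow_add Suc rl by simp
    then show ?case by simp
  qed (auto simp: qrow_def intro!: sum.neutral)
  then have "qrow \<theta> v i = 0" for i by (simp add: v_def)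
  moreover have "0 < v i" for i
    unfolding v_def
    by (rule sum_pos) (use r_pos in \<open>auto simp: apos lessThan_empty_iff simp del: r_pos\<close>)
  moreover have "v (\<sigma> i) = v i" for i
  proof -
    have "v (\<sigma> i) + a i = (\<Sum>l<r. a ((\<sigma> ^^ Suc l) i)) + a ((\<sigma> ^^ 0) i)"
      by (simp add: v_def funpow_swap1)
    also have "\<dots> = (\<Sum>l<Suc r. a ((\<sigma> ^^ l) i))" by (subst sum.lessThan_Suc_shift) simp
    also have "\<dots> = v i + a i" by (simp add: v_def)
    finally show ?thesis by simp
  qed
  ultimately show ?thesis using that pos T(2) by blast
qed

end

text \<open>The coordinates of the starting vector in terms of its sine wave; \<open>k\<close> counts the levels
  between the cut and the top vertex of the column.\<close>

lemma sine_wave_coordinate_pos: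
  fixes \<theta> \<delta> v Lo Sh :: real and n k :: int
  assumes n: "n = 1 \<or> n = 2 \<or> n = 3" and th: "0 < \<theta>" "of_int n * \<theta> \<le> pi / 2"
    and v: "0 < v" and LS: "0 \<le> Lo" "0 \<le> Sh" and n1: "n = 1 \<Longrightarrow> Sh = 0"
    and eq: "2 * cos (of_int n * \<theta>) * v
      = Lo + (if n = 1 then 1 else if n = 2 then 2 * cos \<theta> else 1 + 2 * cos (2 * \<theta>)) * Sh"
    and \<delta>: "0 < \<delta>" "\<delta> < 1" and k: "0 \<le> k" "k < 2 * n"
  shows "0 < v * sin ((of_int k + \<delta>) * \<theta>)
    - (\<Sum>o'\<in>{1..k}. ((if o' = n then Lo else 0) + (if odd o' then Sh else 0))
        * sin ((of_int k + \<delta> - of_int o') * \<theta>))"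
proof -
  define s where "s = (\<lambda>a. sin (a * \<theta>))"
  have T: "s (a + b) = 2 * cos (b * \<theta>) * s a - s (a - b)" for a b
    using sin_add_sin_diff[of "a * \<theta>" "b * \<theta>"] by (simp add: s_def algebra_simps)
  have s_minus: "s (- a) = - s a" for a by (simp add: s_def)
  have s_pos: "0 < s a" if "0 < a" "a < 2 * of_int n" for a
  proof -
    have "a * \<theta> < 2 * of_int n * \<theta>" using that th by simp
    then have "a * \<theta> < pi" using th(2) by simp
    then show ?thesis unfolding s_def using that th(1) by (intro sin_gt_zero) auto
  qed
  \<comment> \<open>The factor of \<open>Sh\<close> in \<open>eq\<close> is at least
    \<open>2 * cos ((n - 1) * \<theta>)\<close>, and the cosine decreases, so \<open>Sh\<close>
    cannot exceed \<open>v\<close>.\<close>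
  have Sv: "Sh \<le> v" if "n \<noteq> 1"
  proof -
    have n23: "n = 2 \<or> n = 3" using n that by auto
    have c: "cos (of_int n * \<theta>) \<le> cos ((of_int n - 1) * \<theta>)"
    proof (rule cos_monotone_0_pi_le)
      show "of_int n * \<theta> \<le> pi" using th(2) pi_gt_zero by linarith
    qed (use n23 th in \<open>auto simp: algebra_simps\<close>)
    have K: "2 * cos ((of_int n - 1) * \<theta>) * Sh \<le> 2 * cos (of_int n * \<theta>) * v"
      using eq n23 LS by (auto simp: algebra_simps)
    also have "\<dots> \<le> 2 * cos ((of_int n - 1) * \<theta>) * v"
      using c v by simp
    finally have "cos ((of_int n - 1) * \<theta>) * Sh \<le> cos ((of_int n - 1) * \<theta>) * v" by simp
    moreover have "0 < cos ((of_int n - 1) * \<theta>)"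
    proof (rule cos_gt_zero_pi)
      show "(of_int n - 1) * \<theta> < pi / 2" using th by (simp add: algebra_simps)
      show "- (pi / 2) < (of_int n - 1) * \<theta>"
      proof -
        have "0 \<le> (of_int n - 1) * \<theta>" using th(1) n23 by auto
        then show ?thesis using pi_gt_zero by linarith
      qed
    qed
    ultimately show ?thesis by simp
  qed
  have key: "0 < v * s b - Sh * s (b - 1)" if "1 < b" "b \<le> of_int n" "n \<noteq> 1" for b
  proof -
    have "b * \<theta> \<le> of_int n * \<theta>" using that th(1) by simp
    then have "b * \<theta> \<le> pi / 2" using th(2) by simp
    moreover have "0 < (b - 1) * \<theta>" "(b - 1) * \<theta> < b * \<theta>" using that th(1) by simp_all
    ultimately have lt: "s (b - 1) < s b"
      unfolding s_def using pi_gt_zero by (intro sin_monotone_2pi) linarith+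
    have "0 < s (b - 1)" using that by (intro s_pos) auto
    then have "Sh * s (b - 1) \<le> v * s (b - 1)" using Sv[OF that(3)] by simp
    also have "\<dots> < v * s b" using lt v by simp
    finally show ?thesis by simp
  qed
  have vs: "0 < v * s a" if "0 < a" "a < 2 * of_int n" for a using s_pos[OF that] v by simp
  let ?G = "\<lambda>o'. (if o' = n then Lo else 0) + (if odd o' then Sh else 0)"
  have expand: "(\<Sum>o'\<in>{1..k}. ?G o' * sin ((of_int k + \<delta> - of_int o') * \<theta>))
     = (\<Sum>o'\<in>{1..k}. ?G o' * s (of_int k + \<delta> - of_int o'))"
    by (simp add: s_def)
  have I: "{1..0::int} = {}" "{1..1::int} = {1}" "{1..2::int} = {1,2}" "{1..3::int} = {1,2,3}"
    "{1..4::int} = {1,2,3,4}" "{1..5::int} = {1,2,3,4,5}"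
    by auto
  have "0 < v * s (of_int k + \<delta>) - (\<Sum>o'\<in>{1..k}. ?G o' * s (of_int k + \<delta> - of_int o'))"
  proof -
    \<comment> \<open>Two consecutive levels of a column are \<open>2 * n\<close> apart, which
      leaves finitely many cases. Where \<open>Lo\<close> occurs, the eigenvalue equation eliminates
      it and the sum collapses to one of the quantities known to be positive from \<open>vs\<close>
      or \<open>key\<close>.\<close>
    have "k = 0 \<or> (n = 1 \<and> k = 1) \<or> (n = 2 \<and> (k = 1 \<or> k = 2 \<or> k = 3))
      \<or> (n = 3 \<and> (k = 1 \<or> k = 2 \<or> k = 3 \<or> k = 4 \<or> k = 5))"
      using n k by presburger
    then consider "k = 0" | "n = 1" "k = 1" | "n = 2" "k = 1" | "n = 2" "k = 2" | "n = 2" "k = 3"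
      | "n = 3" "k = 1" | "n = 3" "k = 2" | "n = 3" "k = 3" | "n = 3" "k = 4" | "n = 3" "k = 5"
      by blast
    then show ?thesis
    proof cases
      case 1
      then show ?thesis using vs[of \<delta>] \<delta> n by auto
    next
      case 2
      have "Lo = 2 * cos \<theta> * v" using eq 2 n1 by simp
      then have "v * s (1 + \<delta>) - Lo * s \<delta> = v * s (1 - \<delta>)"
        using T[of \<delta> 1] s_minus[of "1 - \<delta>"] by (simp add: algebra_simps)
      then show ?thesis using vs[of "1 - \<delta>"] \<delta> n1 by (simp add: 2)
    next
      case 3
      then show ?thesis using key[of "1 + \<delta>"] \<delta> by (simp add: I)
    next
      case 4
      have Lo: "Lo = 2 * cos (2 * \<theta>) * v - 2 * cos \<theta> * Sh" using eq 4 by simp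
      have e1: "s (2 + \<delta>) = 2 * cos (2 * \<theta>) * s \<delta> + s (2 - \<delta>)"
        using T[of \<delta> 2] s_minus[of "2 - \<delta>"] by (simp add: algebra_simps)
      have e2: "s (1 + \<delta>) = 2 * cos \<theta> * s \<delta> + s (1 - \<delta>)"
        using T[of \<delta> 1] s_minus[of "1 - \<delta>"] by (simp add: algebra_simps)
      have "v * s (2 + \<delta>) - (Sh * s (1 + \<delta>) + Lo * s \<delta>) = v * s (2 - \<delta>) - Sh * s (1 - \<delta>)"
        unfolding e1 e2 Lo by (simp add: algebra_simps)
      then show ?thesis using key[of "2 - \<delta>"] \<delta> by (simp add: I 4)
    next
      case 5
      have Lo: "Lo = 2 * cos (2 * \<theta>) * v - 2 * cos \<theta> * Sh" using eq 5 by simp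
      have e1: "s (3 + \<delta>) = 2 * cos (2 * \<theta>) * s (1 + \<delta>) + s (1 - \<delta>)"
        using T[of "1 + \<delta>" 2] s_minus[of "1 - \<delta>"] by (simp add: algebra_simps)
      have e2: "s (2 + \<delta>) = 2 * cos \<theta> * s (1 + \<delta>) - s \<delta>"
        using T[of "1 + \<delta>" 1] by (simp add: algebra_simps)
      have "v * s (3 + \<delta>) - (Sh * s (2 + \<delta>) + (Lo * s (1 + \<delta>) + Sh * s \<delta>)) = v * s (1 - \<delta>)"
        unfolding e1 e2 Lo by (simp add: algebra_simps)
      then show ?thesis using vs[of "1 - \<delta>"] \<delta> by (simp add: I 5)
    next
      case 6
      then show ?thesis using key[of "1 + \<delta>"] \<delta> by (simp add: I)
    next
      case 7
      then show ?thesis using key[of "2 + \<delta>"] \<delta> by (simp add: I)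
    next
      case 8
      have Lo: "Lo = 2 * cos (3 * \<theta>) * v - (1 + 2 * cos (2 * \<theta>)) * Sh" using eq 8 by simp
      have e1: "s (3 + \<delta>) = 2 * cos (3 * \<theta>) * s \<delta> + s (3 - \<delta>)"
        using T[of \<delta> 3] s_minus[of "3 - \<delta>"] by (simp add: algebra_simps)
      have e2: "s (2 + \<delta>) = 2 * cos (2 * \<theta>) * s \<delta> + s (2 - \<delta>)"
        using T[of \<delta> 2] s_minus[of "2 - \<delta>"] by (simp add: algebra_simps)
      have "v * s (3 + \<delta>) - (Sh * s (2 + \<delta>) + (Lo + Sh) * s \<delta>) = v * s (3 - \<delta>) - Sh * s (2 - \<delta>)"
        unfolding e1 e2 Lo by (simp add: algebra_simps)
      then show ?thesis using key[of "3 - \<delta>"] \<delta> by (simp add: I 8)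
    next
      case 9
      have Lo: "Lo = 2 * cos (3 * \<theta>) * v - (1 + 2 * cos (2 * \<theta>)) * Sh" using eq 9 by simp
      have e1: "s (4 + \<delta>) = 2 * cos (3 * \<theta>) * s (1 + \<delta>) + s (2 - \<delta>)"
        using T[of "1 + \<delta>" 3] s_minus[of "2 - \<delta>"] by (simp add: algebra_simps)
      have e2: "s (3 + \<delta>) = 2 * cos (2 * \<theta>) * s (1 + \<delta>) + s (1 - \<delta>)"
        using T[of "1 + \<delta>" 2] s_minus[of "1 - \<delta>"] by (simp add: algebra_simps)
      have "v * s (4 + \<delta>) - (Sh * s (3 + \<delta>) + (Lo + Sh) * s (1 + \<delta>)) = v * s (2 - \<delta>) - Sh * s (1 - \<delta>)"
        unfolding e1 e2 Lo by (simp add: algebra_simps)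
      then show ?thesis using key[of "2 - \<delta>"] \<delta> by (simp add: I 9)
    next
      case 10
      have Lo: "Lo = 2 * cos (3 * \<theta>) * v - (1 + 2 * cos (2 * \<theta>)) * Sh" using eq 10 by simp
      have e1: "s (5 + \<delta>) = 2 * cos (3 * \<theta>) * s (2 + \<delta>) + s (1 - \<delta>)"
        using T[of "2 + \<delta>" 3] s_minus[of "1 - \<delta>"] by (simp add: algebra_simps)
      have e2: "s (4 + \<delta>) = 2 * cos (2 * \<theta>) * s (2 + \<delta>) - s \<delta>"
        using T[of "2 + \<delta>" 2] by (simp add: algebra_simps)
      have "v * s (5 + \<delta>) - (Sh * s (4 + \<delta>) + ((Lo + Sh) * s (2 + \<delta>) + Sh * s \<delta>)) = v * s (1 - \<delta>)"
        unfolding e1 e2 Lo by (simp add: algebra_simps)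
      then show ?thesis using vs[of "1 - \<delta>"] \<delta> by (simp add: I 10)
    qed
  qed
  then show ?thesis unfolding expand unfolding s_def .
qed

text \<open>The two ends of a mesh add up to \<open>2 * cos (n * \<theta>)\<close> times the wave in
  its middle. In the eigenvalue equation the quantum integer in front of \<open>Sh\<close> then
  splits the middle wave into \<open>n\<close> waves at the odd levels of the mesh.\<close>

lemma sine_wave_mesh:
  fixes \<theta> \<phi> v Lo Sh :: real and n :: int
  assumes n: "n = 1 \<or> n = 2 \<or> n = 3" and n1: "n = 1 \<Longrightarrow> Sh = 0"
    and eq: "2 * cos (of_int n * \<theta>) * v
      = Lo + (if n = 1 then 1 else if n = 2 then 2 * cos \<theta> else 1 + 2 * cos (2 * \<theta>)) * Sh"
  shows "v * sin (\<phi> * \<theta>) + v * sin ((\<phi> - 2 * of_int n) * \<theta>)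
    = (\<Sum>o'\<in>{1..2 * n - 1}. ((if o' = n then Lo else 0) + (if odd o' then Sh else 0))
        * sin ((\<phi> - of_int o') * \<theta>))"
proof -
  define s where "s = (\<lambda>a. sin (a * \<theta>))"
  have T: "s (a + b) + s (a - b) = 2 * cos (b * \<theta>) * s a" for a b
    using sin_add_sin_diff[of "a * \<theta>" "b * \<theta>"] by (simp add: s_def algebra_simps)
  have I: "{1..1::int} = {1}" "{1..3::int} = {1,2,3}" "{1..5::int} = {1,2,3,4,5}"
    by auto
  have "s \<phi> + s (\<phi> - 2 * of_int n) = 2 * cos (of_int n * \<theta>) * s (\<phi> - of_int n)"
    using T[of "\<phi> - of_int n" "of_int n"] by (simp add: algebra_simps)
  then have m: "v * s \<phi> + v * s (\<phi> - 2 * of_int n) = 2 * cos (of_int n * \<theta>) * v * s (\<phi> - of_int n)"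
    by (simp only: distrib_left[symmetric] mult_ac)
  have T2: "2 * cos \<theta> * s (\<phi> - 2) = s (\<phi> - 1) + s (\<phi> - 3)"
    and T3: "2 * cos (2 * \<theta>) * s (\<phi> - 3) = s (\<phi> - 1) + s (\<phi> - 5)"
    using T[of "\<phi> - 2" 1] T[of "\<phi> - 3" 2] by simp_all
  have "2 * cos (of_int n * \<theta>) * v * s (\<phi> - of_int n)
    = (\<Sum>o'\<in>{1..2 * n - 1}. ((if o' = n then Lo else 0) + (if odd o' then Sh else 0)) * s (\<phi> - of_int o'))"
    using n
  proof (elim disjE)
    assume n: "n = 2"
    have "2 * cos (of_int n * \<theta>) * v * s (\<phi> - 2) = Lo * s (\<phi> - 2) + Sh * (2 * cos \<theta> * s (\<phi> - 2))"
      unfolding eq by (simp add: n algebra_simps)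
    also have "\<dots> = Lo * s (\<phi> - 2) + (Sh * s (\<phi> - 1) + Sh * s (\<phi> - 3))"
      unfolding T2 by (simp only: distrib_left)
    finally show ?thesis by (simp add: n I)
  next
    assume n: "n = 3"
    have "2 * cos (of_int n * \<theta>) * v * s (\<phi> - 3)
      = (Lo + Sh) * s (\<phi> - 3) + Sh * (2 * cos (2 * \<theta>) * s (\<phi> - 3))"
      unfolding eq by (simp add: n algebra_simps)
    also have "\<dots> = (Lo + Sh) * s (\<phi> - 3) + (Sh * s (\<phi> - 1) + Sh * s (\<phi> - 5))"
      unfolding T3 by (simp only: distrib_left)
    finally show ?thesis by (simp add: n I)
  next
    assume n: "n = 1"
    show ?thesis unfolding eq using n1[OF n] by (simp add: n I)
  qed
  then show ?thesis using m by (simp add: s_def)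
qed

section \<open>The linear form of a sine wave\<close>

locale sine_wave = folded_parity adj ctr par dep \<sigma> \<epsilon>
  for adj :: "'v::finite \<Rightarrow> 'v \<Rightarrow> bool" and ctr par dep \<sigma> \<epsilon> +
  fixes \<theta> :: real and v :: "'v \<Rightarrow> real"
  assumes th_pos: "0 < \<theta>" and th_le: "\<theta> \<le> pi / (2 * real r)"
    and v_pos: "0 < v i" and v_sigma: "v (\<sigma> i) = v i" and v_row: "qrow \<theta> v i = 0"
begin

text \<open>Within a mesh of column \<open>i\<close> a shorter neighbour contributes at every odd
  level, as recorded by \<open>Sh\<close>, and all others contribute at the middle level only. The
  factor \<open>rd i / rd j\<close> is an average: of a longer orbit just one vertex has that
  level.\<close>

definition Lo :: "'v \<Rightarrow> real" where
  "Lo i = (\<Sum>j | adj i j \<and> d i \<le> d j. rd i / rd j * v j)"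

definition Sh :: "'v \<Rightarrow> real" where
  "Sh i = (\<Sum>j | adj i j \<and> d j < d i. v j)"

lemma rd_pos [simp]: "0 < rd i" "rd i \<noteq> 0"
  by (simp_all del: d_pos add: d_pos[simplified])

lemma v_power: "v ((\<sigma> ^^ l) i) = v i"
  by (induction l) (auto simp: v_sigma)

lemma Lo_Sh_nonneg: "0 \<le> Lo i" "0 \<le> Sh i"
  unfolding Lo_def Sh_def by (auto intro!: sum_nonneg mult_nonneg_nonneg simp: less_imp_le[OF v_pos] less_imp_le[OF rd_pos(1)])

lemma Sh_eq_0: "d i = 1 \<Longrightarrow> Sh i = 0"
proof -
  assume "d i = 1"
  then have "\<not> d j < d i" for j using d_pos[of j] by linarith
  then have e: "{j. adj i j \<and> d j < d i} = {}" by blast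
  show ?thesis unfolding Sh_def e by simp
qed

lemma eigen: "2 * cos (rd i * \<theta>) * v i
    = Lo i + (if d i = 1 then 1 else if d i = 2 then 2 * cos \<theta> else 1 + 2 * cos (2 * \<theta>)) * Sh i"
proof -
  have k: "0 < kap i \<theta>" by (rule kap_pos) (use th_pos th_le d_theta in auto)
  have w: "rd i * kap i \<theta> * edge_weight \<theta> i j = (if d i \<le> d j then rd i / rd j else kap i \<theta>)" for j
  proof -
    consider "d i = d j" | "d i < d j" | "d j < d i" by linarith
    then show ?thesis
    proof cases
      case 1
      then show ?thesis using k by (simp add: edge_weight_def)
    next
      case 2
      then show ?thesis using d_less[OF 2] by (simp add: edge_weight_def kap_def max_def)
    next
      case 3
      then show ?thesis using d_less[OF 3] by (simp add: edge_weight_def max_def)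
    qed
  qed
  have "2 * cos (rd i * \<theta>) / (rd i * kap i \<theta>) * v i
      = (\<Sum>j\<in>UNIV. if adj i j then edge_weight \<theta> i j * v j else 0)"
    using v_row[of i] unfolding qrow_def by simp
  then have "2 * cos (rd i * \<theta>) * v i
      = rd i * kap i \<theta> * (\<Sum>j\<in>UNIV. if adj i j then edge_weight \<theta> i j * v j else 0)"
    using k by (simp add: field_simps)
  also have "\<dots> = (\<Sum>j | adj i j. (rd i * kap i \<theta> * edge_weight \<theta> i j) * v j)"
    by (simp add: sum.If_cases sum_distrib_left mult_ac)
  also have "\<dots> = (\<Sum>j | adj i j. if d i \<le> d j then rd i / rd j * v j else kap i \<theta> * v j)"
    unfolding w by (intro sum.cong) auto
  also have "\<dots> = Lo i + kap i \<theta> * Sh i"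
  proof -
    have "{j. adj i j} \<inter> {j. d i \<le> d j} = {j. adj i j \<and> d i \<le> d j}"
      "{j. adj i j} \<inter> - {j. d i \<le> d j} = {j. adj i j \<and> d j < d i}" by auto
    then show ?thesis
      unfolding sum.If_cases[OF finite] Lo_def Sh_def sum_distrib_left by (simp only:)
  qed
  finally show ?thesis by (simp add: kap_def)
qed

lemma lat_short:
  assumes "adj i j" "d j = 1" "lat i c" shows "lat j q \<longleftrightarrow> odd (q - c)"
proof -
  have m: "min (d i) (d j) = 1" using assms(2) d_values[of i] by auto
  have o: "odd (p - c)" if p: "lat j p" for p
  proof -
    obtain k where "c - p = 1 + 2 * k" using lat_adj[OF assms(1,3) p] m by auto
    then have "p - c = 2 * (- k - 1) + 1" by simp
    then show ?thesis by (metis even_mult_iff even_numeral odd_one even_add)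
  qed
  show ?thesis
  proof
    assume "odd (q - c)"
    moreover have "odd (cut q j - c)" by (rule o[OF cut_lat])
    moreover have "cut q j \<le> q" "q < cut q j + 2" using cut_le[of q j] cut_gt[of q j] assms(2) by auto
    ultimately have "cut q j = q" by presburger
    then show "lat j q" using cut_lat[of j q] by simp
  qed (rule o)
qed

lemma lat_equal:
  assumes "adj i j" "d j = d i" "lat i c" "0 < k" "k < 2 * d i" shows "lat j (c + k) \<longleftrightarrow> k = d i"
proof -
  have r: "\<exists>t. p = c - d i * (1 + 2 * t)" if p: "lat j p" for p
  proof -
    obtain t where "c - p = d i + 2 * d i * t" using lat_adj[OF assms(1,3) p] assms(2) by auto
    then have "p = c - d i * (1 + 2 * t)" by (simp add: algebra_simps)
    then show ?thesis by blast
  qed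
  show ?thesis
  proof
    assume "lat j (c + k)"
    then obtain t where "c + k = c - d i * (1 + 2 * t)" using r[of "c + k"] by blast
    then have t: "k = d i * (- (1 + 2 * t))" by (simp only: mult_minus_right)
    have "d i * 0 < d i * (- (1 + 2 * t))" "d i * (- (1 + 2 * t)) < d i * 2"
      using assms(4,5) t by simp_all
    then have "0 < - (1 + 2 * t)" "- (1 + 2 * t) < 2"
      using d_pos[of i] mult_less_cancel_left_pos by blast+
    then have "t = - 1" by presburger
    then show "k = d i" using t by simp
  next
    assume k: "k = d i"
    obtain t where t: "cut (c + d i) j = c - d i * (1 + 2 * t)" using r[OF cut_lat] by blast
    have "d i * (- (1 + 2 * t)) \<le> d i * 1" "d i * (- 1) < d i * (- (1 + 2 * t))"
      using cut_le[of "c + d i" j] cut_gt[of "c + d i" j] assms(2) t by (simp_all add: algebra_simps)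
    then have "- (1 + 2 * t) \<le> 1" "- 1 < - (1 + 2 * t)"
      using d_pos[of i] mult_le_cancel_left_pos mult_less_cancel_left_pos by blast+
    then have "t = - 1" by presburger
    then have "cut (c + d i) j = c + k" using t k by simp
    then show "lat j (c + k)" using cut_lat[of j "c + d i"] by simp
  qed
qed

lemma lat_long:
  assumes "adj i j" "d i < d j" "lat i c" shows "\<exists>!l. l < r \<and> lat j (c + 1 + 2 * int l)"
proof -
  note D = d_less[OF assms(2)]
  let ?q = "cut (c + 2 * int r - 1) j"
  obtain k where k: "c - ?q = 1 + 2 * k" using lat_adj[OF assms(1,3) cut_lat[of j]] D(2,4) D(5) by auto
  have "?q \<le> c + 2 * int r - 1" "c + 2 * int r - 1 < ?q + 2 * int r"
    using cut_le[of "c + 2 * int r - 1" j] cut_gt[of "c + 2 * int r - 1" j] D(4) by auto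
  then have kk: "0 \<le> - k - 1" "- k - 1 < int r" using k by linarith+
  show ?thesis
  proof (rule ex1I)
    have "c + 1 + 2 * int (nat (- k - 1)) = ?q" using kk k by simp
    then show "nat (- k - 1) < r \<and> lat j (c + 1 + 2 * int (nat (- k - 1)))"
      using kk cut_lat[of j "c + 2 * int r - 1"] by (metis nat_less_iff)
  next
    fix l assume l: "l < r \<and> lat j (c + 1 + 2 * int l)"
    have q: "?q = c + 1 + 2 * (- k - 1)" using k by simp
    have lq: "lat j (c + 1 + 2 * (- k - 1))"
      using cut_lat[of j "c + 2 * int r - 1"] unfolding q .
    have "0 \<le> int l" "int l < int r" using l by simp_all
    note lr = this
    have "int l = - k - 1"
    proof (rule linorder_cases[of "int l" "- k - 1"])
      assume "int l < - k - 1"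
      then have "c + 1 + 2 * int l < c + 1 + 2 * (- k - 1)" by simp
      from lat_gap[OF conjunct2[OF l] lq this] show ?thesis using D(4) kk lr by presburger
    next
      assume "- k - 1 < int l"
      then have "c + 1 + 2 * (- k - 1) < c + 1 + 2 * int l" by simp
      from lat_gap[OF lq conjunct2[OF l] this] show ?thesis using D(4) kk lr by presburger
    qed
    then show "l = nat (- k - 1)" by simp
  qed
qed

text \<open>The set of longer neighbours is invariant under \<sigma>, which shifts levels by 2, so
  the sum is the same for all \<open>r\<close> shifts. Summed over the shifts, each neighbour is
  counted once, by \<open>lat_long\<close>.\<close>

lemma long_neighbour_sum:
  assumes "lat i c"
  shows "(\<Sum>j | adj i j \<and> d i < d j. if lat j (c + 1) then v j else 0)
    = (\<Sum>j | adj i j \<and> d i < d j. v j / rd j)"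
proof (cases "{j. adj i j \<and> d i < d j} = {}")
  case False
  define N where "N = {j. adj i j \<and> d i < d j}"
  have fixed: "\<sigma> i = i" using False d_less by blast
  have dN: "d j = int r" if "j \<in> N" for j using that d_less unfolding N_def by blast
  let ?S = "\<Sum>j\<in>N. if lat j (c + 1) then v j else 0"
  have E: "?S = (\<Sum>j\<in>N. if lat j (c + 1 + 2 * int l) then v j else 0)" for l
  proof -
    have "bij_betw (\<sigma> ^^ l) N N"
      unfolding bij_betw_def
    proof
      show "inj_on (\<sigma> ^^ l) N" by (auto intro: inj_onI)
      have "(\<sigma> ^^ l) ` N \<subseteq> N" unfolding N_def using adj_power[OF fixed] by auto
      then show "(\<sigma> ^^ l) ` N = N"
        by (intro card_subset_eq) (auto intro!: card_image inj_onI)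
    qed
    from sum.reindex_bij_betw[OF this, of "\<lambda>j. if lat j (c + 1) then v j else 0"]
    show ?thesis by (simp add: lat_power v_power cong: if_cong)
  qed
  have "(\<Sum>l<r. ?S) = (\<Sum>l<r. \<Sum>j\<in>N. if lat j (c + 1 + 2 * int l) then v j else 0)"
    by (rule sum.cong[OF refl]) (rule E)
  also have "\<dots> = (\<Sum>j\<in>N. \<Sum>l<r. if lat j (c + 1 + 2 * int l) then v j else 0)"
    by (rule sum.swap)
  also have "\<dots> = (\<Sum>j\<in>N. v j)"
  proof (rule sum.cong)
    fix j assume "j \<in> N"
    then have "\<exists>!l. l < r \<and> lat j (c + 1 + 2 * int l)" unfolding N_def using lat_long assms by blast
    then obtain l0 where l0: "l0 < r" "\<And>l. l < r \<Longrightarrow> lat j (c + 1 + 2 * int l) \<longleftrightarrow> l = l0" by blast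
    have "(\<Sum>l<r. if lat j (c + 1 + 2 * int l) then v j else 0) = (\<Sum>l<r. if l = l0 then v j else 0)"
      by (intro sum.cong) (simp_all add: l0)
    then show "(\<Sum>l<r. if lat j (c + 1 + 2 * int l) then v j else 0) = v j" using l0(1) by simp
  qed simp
  finally have "real r * ?S = (\<Sum>j\<in>N. v j)" by simp
  then have "?S = (\<Sum>j\<in>N. v j) / real r"
    by (simp add: nonzero_eq_divide_eq mult.commute r_pos[THEN less_imp_neq, symmetric])
  also have "\<dots> = (\<Sum>j\<in>N. v j / rd j)" by (simp add: sum_divide_distrib dN)
  finally show ?thesis by (simp add: N_def)
next
  case True
  show ?thesis unfolding True by simp
qed

lemma neighbour_sum:
  assumes "lat i c" "0 < k" "k < 2 * d i"
  shows "(\<Sum>j | adj i j. if lat j (c + k) then v j else 0)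
    = (if k = d i then Lo i else 0) + (if odd k then Sh i else 0)"
proof -
  let ?g = "\<lambda>j. if lat j (c + k) then v j else 0"
  have "{j. adj i j} = {j. adj i j \<and> d i = d j} \<union> ({j. adj i j \<and> d i < d j} \<union> {j. adj i j \<and> d j < d i})"
    by auto
  then have "(\<Sum>j | adj i j. ?g j) = (\<Sum>j\<in>{j. adj i j \<and> d i = d j} \<union> ({j. adj i j \<and> d i < d j} \<union> {j. adj i j \<and> d j < d i}). ?g j)"
    by (rule arg_cong)
  also have "\<dots> = (\<Sum>j | adj i j \<and> d i = d j. ?g j)
      + ((\<Sum>j | adj i j \<and> d i < d j. ?g j) + (\<Sum>j | adj i j \<and> d j < d i. ?g j))"
    by (subst sum.union_disjoint, auto)+
  also have "(\<Sum>j | adj i j \<and> d j < d i. ?g j) = (if odd k then Sh i else 0)"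
  proof -
    have "?g j = (if odd k then v j else 0)" if "adj i j" "d j < d i" for j
      using lat_short[OF that(1) d_less(2)[OF that(2)] assms(1), of "c + k"] by simp
    then show ?thesis by (auto simp: Sh_def intro!: sum.cong sum.neutral)
  qed
  also have "(\<Sum>j | adj i j \<and> d i = d j. ?g j) = (if k = d i then \<Sum>j | adj i j \<and> d i = d j. rd i / rd j * v j else 0)"
  proof -
    have "?g j = (if k = d i then v j else 0)" if "adj i j" "d i = d j" for j
      using lat_equal[OF that(1) that(2)[symmetric] assms] by simp
    then show ?thesis by (auto intro!: sum.cong sum.neutral)
  qed
  also have "(\<Sum>j | adj i j \<and> d i < d j. ?g j) = (if k = d i then \<Sum>j | adj i j \<and> d i < d j. rd i / rd j * v j else 0)"
  proof (cases "d i = 1")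
    case True
    then have "k = 1" using assms by simp
    then show ?thesis using long_neighbour_sum[OF assms(1)] True by simp
  next
    case False
    then have "{j. adj i j \<and> d i < d j} = {}" using d_less(2) by blast
    then show ?thesis by (simp only: sum.empty if_cancel)
  qed
  also have "(if k = d i then \<Sum>j | adj i j \<and> d i = d j. rd i / rd j * v j else 0)
      + ((if k = d i then \<Sum>j | adj i j \<and> d i < d j. rd i / rd j * v j else 0) + (if odd k then Sh i else 0))
    = (if k = d i then Lo i else 0) + (if odd k then Sh i else 0)"
  proof -
    have "{j. adj i j \<and> d i \<le> d j} = {j. adj i j \<and> d i = d j} \<union> {j. adj i j \<and> d i < d j}" by auto
    then have "Lo i = (\<Sum>j\<in>{j. adj i j \<and> d i = d j} \<union> {j. adj i j \<and> d i < d j}. rd i / rd j * v j)"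
      unfolding Lo_def by (rule arg_cong)
    also have "\<dots> = (\<Sum>j | adj i j \<and> d i = d j. rd i / rd j * v j) + (\<Sum>j | adj i j \<and> d i < d j. rd i / rd j * v j)"
      by (subst sum.union_disjoint) auto
    finally show ?thesis by simp
  qed
  finally show ?thesis .
qed

definition wave :: "real \<Rightarrow> 'v \<Rightarrow> int \<Rightarrow> real" where
  "wave t i p = v i * sin ((t - of_int p) * \<theta>)"

lemma wave_sum:
  assumes "lat i c" "0 \<le> k" "k < 2 * d i"
  shows "(\<Sum>j | adj i j. \<Sum>q | lat j q \<and> c < q \<and> q \<le> c + k. wave t j q)
    = (\<Sum>m\<in>{1..k}. ((if m = d i then Lo i else 0) + (if odd m then Sh i else 0))
        * sin ((t - of_int c - of_int m) * \<theta>))"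
proof -
  have "(\<Sum>q | lat j q \<and> c < q \<and> q \<le> c + k. wave t j q)
     = (\<Sum>m\<in>{1..k}. if lat j (c + m) then wave t j (c + m) else 0)" for j
  proof -
    have "(\<Sum>q | lat j q \<and> c < q \<and> q \<le> c + k. wave t j q)
      = (\<Sum>m | m \<in> {1..k} \<and> lat j (c + m). wave t j (c + m))"
      by (rule sum.reindex_bij_witness[of _ "\<lambda>m. c + m" "\<lambda>q. q - c"]) auto
    also have "\<dots> = (\<Sum>m\<in>{1..k}. if lat j (c + m) then wave t j (c + m) else 0)"
      by (rule sum.inter_filter) simp
    finally show ?thesis .
  qed
  then have "(\<Sum>j | adj i j. \<Sum>q | lat j q \<and> c < q \<and> q \<le> c + k. wave t j q)
    = (\<Sum>j | adj i j. \<Sum>m\<in>{1..k}. if lat j (c + m) then wave t j (c + m) else 0)"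
    by (simp only:)
  also have "\<dots> = (\<Sum>m\<in>{1..k}. \<Sum>j | adj i j. if lat j (c + m) then wave t j (c + m) else 0)"
    by (rule sum.swap)
  also have "\<dots> = (\<Sum>m\<in>{1..k}. (\<Sum>j | adj i j. if lat j (c + m) then v j else 0)
      * sin ((t - of_int c - of_int m) * \<theta>))"
    unfolding sum_distrib_right by (intro sum.cong) (auto simp: wave_def algebra_simps)
  also have "\<dots> = (\<Sum>m\<in>{1..k}. ((if m = d i then Lo i else 0) + (if odd m then Sh i else 0))
      * sin ((t - of_int c - of_int m) * \<theta>))"
    by (intro sum.cong refl arg_cong2[of _ _ _ _ "(*)"] neighbour_sum) (use assms in auto)
  finally show ?thesis .
qed

lemma wave_mesh:
  assumes "lat i p"
  shows "wave t i p + wave t i (p - 2 * d i)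
    = (\<Sum>j | adj i j. \<Sum>q | lat j q \<and> p - 2 * d i < q \<and> q < p. wave t j q)"
proof -
  let ?c = "p - 2 * d i"
  have "(\<Sum>j | adj i j. \<Sum>q | lat j q \<and> ?c < q \<and> q < p. wave t j q)
    = (\<Sum>j | adj i j. \<Sum>q | lat j q \<and> ?c < q \<and> q \<le> ?c + (2 * d i - 1). wave t j q)"
    by (intro sum.cong) auto
  also have "\<dots> = (\<Sum>m\<in>{1..2 * d i - 1}. ((if m = d i then Lo i else 0) + (if odd m then Sh i else 0))
        * sin ((t - of_int ?c - of_int m) * \<theta>))"
    by (rule wave_sum) (use assms d_pos[of i] in auto)
  also have "\<dots> = v i * sin ((t - of_int ?c) * \<theta>) + v i * sin ((t - of_int ?c - 2 * of_int (d i)) * \<theta>)"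
    by (rule sine_wave_mesh[symmetric]) (use d_values Sh_eq_0 eigen in auto)
  finally show ?thesis by (simp add: wave_def)
qed

text \<open>The value on \<open>w \<alpha>\<^sub>i\<close> of the linear form that takes the value \<open>wave t j q\<close> on the root
  attached to \<open>(j, q)\<close>, where \<open>w\<close> is the group element reached at the height function \<open>\<eta>\<close>.\<close>

definition coordinate :: "real \<Rightarrow> ('v \<Rightarrow> int) \<Rightarrow> 'v \<Rightarrow> real" where
  "coordinate t \<eta> i = wave t i (\<eta> i) - (\<Sum>j | adj i j. \<Sum>q | lat j q \<and> \<eta> i < q \<and> q \<le> \<eta> j. wave t j q)"

lemma finite_window [simp]: "finite {q. lat j q \<and> a < q \<and> q \<le> b}"
  by (rule finite_subset[of _ "{a<..b}"]) auto

lemma coordinate_source: "source adj \<eta> i \<Longrightarrow> coordinate t \<eta> i = wave t i (\<eta> i)"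
proof -
  assume "source adj \<eta> i"
  then have "{q. lat j q \<and> \<eta> i < q \<and> q \<le> \<eta> j} = {}" if "adj i j" for j
    using that unfolding source_def by force
  then have "(\<Sum>j | adj i j. \<Sum>q | lat j q \<and> \<eta> i < q \<and> q \<le> \<eta> j. wave t j q) = (\<Sum>j | adj i j. 0)"
    by (intro sum.cong refl) (metis (no_types, lifting) mem_Collect_eq sum.empty)
  then show ?thesis by (simp add: coordinate_def)
qed

text \<open>For \<open>j = i\<close> the mesh relation turns the coordinate into its negative. For a
  neighbour \<open>j\<close> the window of column \<open>i\<close> loses its top vertex
  \<open>(i, \<eta> i)\<close>, whose wave is the coordinate at the source.\<close>

lemma coordinate_reflect:
  assumes Q: "\<eta> \<in> QD" and s: "source adj \<eta> i"
  shows "coordinate t (Q_reflect \<sigma> i \<eta>) j = coordinate t \<eta> j - of_int (simple_root adj i j) * coordinate t \<eta> i"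
proof -
  let ?e = "Q_reflect \<sigma> i \<eta>"
  have ei: "?e i = \<eta> i - 2 * d i" and ne: "?e k = \<eta> k" if "k \<noteq> i" for k
    using that by (auto simp: Q_reflect_def)
  have ei: "?e i = \<eta> i - 2 * d i" by (simp add: Q_reflect_def)
  consider "j = i" | "j \<noteq> i" "adj i j" | "j \<noteq> i" "\<not> adj i j" by blast
  then show ?thesis
  proof cases
    case 1
    have W: "{q. lat k q \<and> ?e i < q \<and> q \<le> ?e k} = {q. lat k q \<and> \<eta> i - 2 * d i < q \<and> q < \<eta> i}"
      if a: "adj i k" for k
    proof -
      have k: "k \<noteq> i" using a adj_irrefl by auto
      have "\<eta> k < \<eta> i" using s a by (simp add: source_def)
      moreover have "q \<le> \<eta> k" if "lat k q" "q < \<eta> i" for q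
        using lat_gap[OF QD_lat[OF Q, of k] that(1)] QD_less[OF Q a] that(2) by linarith
      ultimately show ?thesis unfolding ei ne[OF k] by force
    qed
    have "(\<Sum>k | adj i k. \<Sum>q | lat k q \<and> ?e i < q \<and> q \<le> ?e k. wave t k q)
      = (\<Sum>k | adj i k. \<Sum>q | lat k q \<and> \<eta> i - 2 * d i < q \<and> q < \<eta> i. wave t k q)"
      by (intro sum.cong refl W) simp
    then have "coordinate t ?e i = wave t i (\<eta> i - 2 * d i) - (wave t i (\<eta> i) + wave t i (\<eta> i - 2 * d i))"
      unfolding coordinate_def wave_mesh[OF QD_lat[OF Q]] by (simp only: ei)
    then show ?thesis using coordinate_source[OF s, of t] by (simp add: 1 simple_root_def)
  next
    case 2
    have ji: "adj j i" using 2 adj_commute by blast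
    let ?F = "\<lambda>\<eta> k. \<Sum>q | lat k q \<and> \<eta> j < q \<and> q \<le> \<eta> k. wave t k q"
    have "{q. lat i q \<and> \<eta> j < q \<and> q \<le> \<eta> i} = insert (\<eta> i) {q. lat i q \<and> \<eta> j < q \<and> q \<le> \<eta> i - 2 * d i}"
    proof -
      have "\<eta> j < \<eta> i" using s 2 by (simp add: source_def)
      moreover have "q \<le> \<eta> i - 2 * d i" if "lat i q" "q \<le> \<eta> i" "q \<noteq> \<eta> i" for q
        using lat_gap[OF that(1) QD_lat[OF Q, of i]] that by linarith
      moreover have "q \<le> \<eta> i" if "q \<le> \<eta> i - 2 * d i" for q
        using that d_pos[of i] by linarith
      ultimately show ?thesis using QD_lat[OF Q, of i] by auto
    qed
    moreover have "\<eta> i \<notin> {q. lat i q \<and> \<eta> j < q \<and> q \<le> \<eta> i - 2 * d i}"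
      by (auto simp: not_le)
    ultimately have Fi: "?F \<eta> i = wave t i (\<eta> i) + ?F ?e i"
      unfolding ei ne[OF 2(1)] by (simp only: sum.insert[OF finite_window] not_False_eq_True)
    have "(\<Sum>k | adj j k. ?F \<eta> k) = ?F \<eta> i + (\<Sum>k \<in> {k. adj j k} - {i}. ?F \<eta> k)"
      by (rule sum.remove) (use ji in auto)
    moreover have "(\<Sum>k | adj j k. ?F ?e k) = ?F ?e i + (\<Sum>k \<in> {k. adj j k} - {i}. ?F ?e k)"
      by (rule sum.remove) (use ji in auto)
    moreover have "(\<Sum>k \<in> {k. adj j k} - {i}. ?F ?e k) = (\<Sum>k \<in> {k. adj j k} - {i}. ?F \<eta> k)"
      by (intro sum.cong refl) (simp add: ne 2)
    ultimately have "coordinate t ?e j = coordinate t \<eta> j + wave t i (\<eta> i)"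
      unfolding coordinate_def Fi ne[OF 2(1)] by simp
    then show ?thesis using coordinate_source[OF s, of t] 2 by (simp add: simple_root_def)
  next
    case 3
    have "\<not> adj j i" using 3 adj_commute by blast
    then have k: "k \<noteq> i" if "adj j k" for k using that by auto
    have "coordinate t ?e j = coordinate t \<eta> j"
      unfolding coordinate_def ne[OF 3(1)]
      by (intro arg_cong2[of _ _ _ _ "(-)"] sum.cong refl) (simp add: ne k)
    then show ?thesis using 3 by (simp add: simple_root_def)
  qed
qed

text \<open>Thus one linear form, given by its values on the simple roots at the start, produces the
  coordinates at every height function along the word; at a source it produces the wave
  itself.\<close>

lemma coordinate_act:
  assumes "\<xi> \<in> QD" "adapted adj \<sigma> \<xi> is"
  shows "(\<Sum>k\<in>UNIV. coordinate t \<xi> k * of_int (act adj is (sroot i) k)) = coordinate t (endpoint \<xi> is) i"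
  using assms(2)
proof (induction "is" arbitrary: i rule: rev_induct)
  case Nil
  have "(\<Sum>k\<in>UNIV. coordinate t \<xi> k * of_int (sroot i k)) = (\<Sum>k\<in>UNIV. if k = i then coordinate t \<xi> k else 0)"
    by (intro sum.cong) (auto simp: sroot_def)
  then show ?case by simp
next
  case (snoc j "is")
  have ad: "adapted adj \<sigma> \<xi> is" and src: "source adj (endpoint \<xi> is) j"
    using snoc.prems by (auto simp: adapted_append)
  have "refl adj j (sroot i) = sroot i - (\<lambda>k. simple_root adj j i * sroot j k)"
    unfolding refl_alt pr_sroot ..
  then have E: "act adj (is @ [j]) (sroot i) k
      = act adj is (sroot i) k - simple_root adj j i * act adj is (sroot j) k" for k
    by (simp add: act_append act_Cons act_diff act_scale)
  have "(\<Sum>k\<in>UNIV. coordinate t \<xi> k * of_int (act adj (is @ [j]) (sroot i) k))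
      = (\<Sum>k\<in>UNIV. coordinate t \<xi> k * of_int (act adj is (sroot i) k))
      - of_int (simple_root adj j i) * (\<Sum>k\<in>UNIV. coordinate t \<xi> k * of_int (act adj is (sroot j) k))"
    unfolding E of_int_diff of_int_mult right_diff_distrib sum_subtractf sum_distrib_left
    by (simp only: mult.left_commute)
  also have "\<dots> = coordinate t (endpoint \<xi> (is @ [j])) i"
    using coordinate_reflect[OF adapted_QD[OF assms(1) ad] src, of t i] snoc.IH[OF ad]
    by (simp add: endpoint_append endpoint_Cons)
  finally show ?case .
qed

text \<open>For a cut all windows end at the same level \<open>L\<close>, so they form an initial
  piece of a mesh above \<open>cut L i\<close>, and the estimate for sine waves applies.\<close>

lemma coordinate_cut_pos:
  assumes "0 < \<delta>" "\<delta> < 1" shows "0 < coordinate (of_int L + \<delta>) (cut L) i"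
proof -
  define k where "k = L - cut L i"
  have k: "0 \<le> k" "k < 2 * d i" using cut_le[of L i] cut_gt[of L i] by (auto simp: k_def)
  have L: "L = cut L i + k" by (simp add: k_def)
  have "{q. lat j q \<and> cut L i < q \<and> q \<le> cut L j} = {q. lat j q \<and> cut L i < q \<and> q \<le> cut L i + k}" for j
  proof -
    have "q \<le> cut L j \<longleftrightarrow> q \<le> L" if "lat j q" for q
      using lat_gap[OF cut_lat that, of L] cut_le[of L j] cut_gt[of L j] by linarith
    then show ?thesis using L by auto
  qed
  then have "coordinate (of_int L + \<delta>) (cut L) i = wave (of_int L + \<delta>) i (cut L i)
    - (\<Sum>j | adj i j. \<Sum>q | lat j q \<and> cut L i < q \<and> q \<le> cut L i + k. wave (of_int L + \<delta>) j q)"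
    by (simp only: coordinate_def)
  also have "\<dots> = v i * sin ((of_int k + \<delta>) * \<theta>)
    - (\<Sum>m\<in>{1..k}. ((if m = d i then Lo i else 0) + (if odd m then Sh i else 0))
        * sin ((of_int k + \<delta> - of_int m) * \<theta>))"
  proof -
    have e: "of_int L + \<delta> - of_int (cut L i) = of_int k + \<delta>" by (simp add: k_def)
    show ?thesis unfolding wave_sum[OF cut_lat k] unfolding wave_def e ..
  qed
  also have "\<dots> > 0"
    by (rule sine_wave_coordinate_pos)
      (use d_values[of i] th_pos th_le d_theta[of \<theta> i] v_pos Lo_Sh_nonneg Sh_eq_0 eigen assms k in auto)
  finally show ?thesis .
qed

lemma pairing_pos:
  fixes x :: "'v \<Rightarrow> real"
  assumes "\<And>i. 0 < x i" "m \<in> roots adj" "nonneg m"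
  shows "0 < (\<Sum>k\<in>UNIV. x k * of_int (m k))"
proof -
  obtain k where "m k \<noteq> 0" using roots_neq_0[OF assms(2)] by (auto simp: fun_eq_iff)
  then have "0 < m k" using assms(3) by (simp add: nonneg_def order_less_le)
  then have "0 < x k * of_int (m k)" using assms(1) by simp
  moreover have "0 \<le> x j * of_int (m j)" for j
    using assms(1)[of j] assms(3) by (simp add: nonneg_def)
  ultimately show ?thesis by (intro sum_pos2[of UNIV k]) auto
qed

lemma pairing_sign:
  fixes x :: "'v \<Rightarrow> real"
  assumes x: "\<And>i. 0 < x i" and m: "m \<in> roots adj"
  shows "(\<Sum>k\<in>UNIV. x k * of_int (m k)) \<noteq> 0"
    and "0 < (\<Sum>k\<in>UNIV. x k * of_int (m k)) \<longleftrightarrow> nonneg m"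
proof -
  have "(\<Sum>k\<in>UNIV. x k * of_int (m k)) < 0" if "nonneg (- m)"
    using pairing_pos[OF x _ that] m by (simp add: sum_negf)
  moreover have "0 < (\<Sum>k\<in>UNIV. x k * of_int (m k))" if "nonneg m"
    by (rule pairing_pos[OF x m that])
  ultimately show "(\<Sum>k\<in>UNIV. x k * of_int (m k)) \<noteq> 0"
    and "0 < (\<Sum>k\<in>UNIV. x k * of_int (m k)) \<longleftrightarrow> nonneg m"
    using root_sign[OF m] by force+
qed

text \<open>If the half period \<open>H\<close> were not an integer, place the wave so that it
  vanishes at the vertex \<open>(ctr, q)\<close> with \<open>t = q + H\<close> not an integer. The
  form is then positive on all simple roots at the cut below \<open>t\<close>, yet zero on a root
  met later.\<close>

lemma half_period_integer: obtains h :: int where "0 < h" "of_int h * \<theta> = pi"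
proof -
  define H where "H = pi / \<theta>"
  have H: "0 < H" "H * \<theta> = pi" using th_pos by (simp_all add: H_def)
  define q where "q = \<epsilon> ctr"
  define t where "t = of_int q + H"
  define L where "L = \<lfloor>t\<rfloor>"
  define \<delta> where "\<delta> = t - of_int L"
  have "\<delta> = 0"
  proof (rule ccontr)
    assume "\<delta> \<noteq> 0"
    then have \<delta>: "0 < \<delta>" "\<delta> < 1" unfolding \<delta>_def L_def by linarith+
    have t: "of_int L + \<delta> = t" by (simp add: \<delta>_def)
    have "q \<le> L" unfolding L_def t_def using H(1) by (simp add: le_floor_iff)
    have lq: "lat ctr q" by (simp add: lat_def q_def)
    have cq: "cut q ctr = q" by (rule cut_unique[OF lq]) simp_all
    have src: "source adj (cut q) ctr"
      unfolding source_def
    proof (intro allI impI)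
      fix j assume a: "adj ctr j"
      have "cut q ctr \<noteq> cut q j" by (rule lat_adj_neq[OF a cut_lat cut_lat])
      then show "cut q j < cut q ctr" using cut_le[of q j] cq by simp
    qed
    obtain "is" where i: "adapted adj \<sigma> (cut L) is" "endpoint (cut L) is = cut q"
      using exists_adapted[OF cut_QD cut_QD cut_mono[OF \<open>q \<le> L\<close>]] by blast
    have "coordinate t (cut q) ctr = 0"
      unfolding coordinate_source[OF src] wave_def cq t_def using H(2) by simp
    then have "(\<Sum>k\<in>UNIV. coordinate t (cut L) k * of_int (act adj is (sroot ctr) k)) = 0"
      using coordinate_act[OF cut_QD i(1), of t ctr] i(2) by simp
    moreover have "\<And>i. 0 < coordinate t (cut L) i" using coordinate_cut_pos[OF \<delta>, of L] t by simp
    ultimately show False using pairing_sign(1)[of "coordinate t (cut L)" "act adj is (sroot ctr)"] by simp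
  qed
  then have "of_int (L - q) = H" by (simp add: \<delta>_def t_def)
  then show ?thesis using that[of "L - q"] H by (metis of_int_0_less_iff)
qed

text \<open>Lowering the cut by a half period changes the sign of every coordinate, so the word
  sends all simple roots to negative roots. In between the wave is positive on every vertex removed,
  so the word is reduced.\<close>

lemma cut_longest_word:
  assumes h: "0 < h" "of_int h * \<theta> = pi"
  shows "\<exists>is. is \<in> reduced_words adj \<and> adapted adj \<sigma> (cut L) is \<and> endpoint (cut L) is = cut (L - h)"
proof -
  obtain "is" where i: "adapted adj \<sigma> (cut L) is" "endpoint (cut L) is = cut (L - h)"
    using exists_adapted[OF cut_QD cut_QD cut_mono[of "L - h" L]] h(1) by auto
  \<comment> \<open>With this value \<open>?t - p\<close> lies strictly between 0 and
    \<open>h\<close> for every level \<open>p\<close> removed, including the extreme levels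
    \<open>L\<close> and \<open>L - h + 1\<close>.\<close>
  let ?t = "of_int L + 1 / 2 :: real"
  let ?x = "coordinate ?t (cut L)"
  have x: "0 < ?x i" for i using coordinate_cut_pos[of "1/2" L i] by simp
  have shift: "wave ?t j q = - wave (of_int (L - h) + 1 / 2) j q" for j q
  proof -
    have "(?t - of_int q) * \<theta> = (of_int (L - h) + 1 / 2 - of_int q) * \<theta> + of_int h * \<theta>"
      by (simp add: algebra_simps)
    then show ?thesis unfolding wave_def h(2) by (simp only: sin_periodic_pi mult_minus_right)
  qed
  have "coordinate ?t (cut (L - h)) j = - coordinate (of_int (L - h) + 1 / 2) (cut (L - h)) j" for j
    unfolding coordinate_def shift by (simp add: sum_negf)
  then have neg: "coordinate ?t (cut (L - h)) j < 0" for j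
    using coordinate_cut_pos[of "1/2" "L - h" j] by simp
  have "nonneg (- act adj is (sroot j))" for j
  proof -
    have "(\<Sum>k\<in>UNIV. ?x k * of_int (act adj is (sroot j) k)) < 0"
      using coordinate_act[OF cut_QD i(1), of ?t j] i(2) neg[of j] by simp
    then have "\<not> nonneg (act adj is (sroot j))"
      using pairing_sign(2)[of ?x "act adj is (sroot j)", OF x] by simp
    then show ?thesis using act_neg_not_nonneg by blast
  qed
  then have n: "negating adj is" by (simp add: negating_def)
  have "reduced adj is"
    unfolding reduced_def
  proof (intro allI impI)
    fix us j vs assume e: "is = us @ j # vs"
    let ?y = "endpoint (cut L) us"
    have a: "adapted adj \<sigma> (cut L) us" "source adj ?y j" using i(1) by (auto simp: e adapted_append)
    have "endpoint (cut L) is = endpoint (Q_reflect \<sigma> j ?y) vs" by (simp add: e endpoint_append endpoint_Cons)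
    then have "cut (L - h) j \<le> Q_reflect \<sigma> j ?y j" using endpoint_le[of "Q_reflect \<sigma> j ?y" vs j] i(2) by simp
    then have "L - h < ?y j" using cut_gt[of "L - h" j] by (simp add: Q_reflect_def)
    moreover have "?y j \<le> L" using endpoint_le[of "cut L" us j] cut_le[of L j] by simp
    ultimately have b: "0 < ?t - of_int (?y j)" "?t - of_int (?y j) < of_int h" by linarith+
    have "(?t - of_int (?y j)) * \<theta> < of_int h * \<theta>" using b(2) th_pos by simp
    then have "0 < wave ?t j (?y j)"
      unfolding wave_def h(2) using b(1) th_pos v_pos[of j] by (intro mult_pos_pos sin_gt_zero) auto
    then have "0 < (\<Sum>k\<in>UNIV. ?x k * of_int (act adj us (sroot j) k))"
      using coordinate_act[OF cut_QD a(1), of ?t j] coordinate_source[OF a(2)] by simp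
    then show "nonneg (act adj us (sroot j))"
      using pairing_sign(2)[of ?x "act adj us (sroot j)", OF x] by simp
  qed
  then show ?thesis using n i reduced_words_iff by blast
qed

end

lemma (in folded_parity) exists_half_period:
  "\<exists>h>0. \<forall>L. \<exists>is. is \<in> reduced_words adj \<and> adapted adj \<sigma> (cut L) is \<and> endpoint (cut L) is = cut (L - h)"
proof -
  obtain \<theta> v where pf: "0 < \<theta>" "\<theta> \<le> pi / (2 * real r)" "\<forall>i. 0 < v i" "\<forall>i. v (\<sigma> i) = v i"
    "\<forall>i. qrow \<theta> v i = 0"
    by (rule perron_frobenius)
  interpret sine_wave adj ctr par dep \<sigma> \<epsilon> \<theta> v
    by unfold_locales (use pf in auto)
  obtain h :: int where h: "0 < h" "of_int h * \<theta> = pi" by (rule half_period_integer)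
  show ?thesis using cut_longest_word[OF h] h(1) by blast
qed

section \<open>The half period, the involution and the endpoints of longest words\<close>

context folded_parity
begin

definition hp :: int where
  "hp = (SOME h. 0 < h \<and> (\<forall>L. \<exists>is. is \<in> reduced_words adj \<and> adapted adj \<sigma> (cut L) is \<and>
    endpoint (cut L) is = cut (L - h)))"

lemma hp_pos: "0 < hp"
  and hp_word: "\<exists>is. is \<in> reduced_words adj \<and> adapted adj \<sigma> (cut L) is \<and> endpoint (cut L) is = cut (L - hp)"
  using someI_ex[OF exists_half_period[unfolded Bex_def]] unfolding hp_def by blast+

lemma cut_source: assumes "lat i L" shows "cut L i = L" "source adj (cut L) i"
proof -
  show c: "cut L i = L" by (rule cut_unique[OF assms]) simp_all
  show "source adj (cut L) i"
    unfolding source_def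
  proof (intro allI impI)
    fix j assume a: "adj i j"
    have "cut L i \<noteq> cut L j" by (rule lat_adj_neq[OF a cut_lat cut_lat])
    then show "cut L j < cut L i" using cut_le[of L j] c by simp
  qed
qed

lemma cut_pred: "lat i L \<Longrightarrow> cut (L - 1) i = L - 2 * d i"
proof (rule cut_unique)
  show "L - 2 * d i \<le> L - 1" using d_pos[of i] by linarith
qed simp_all

lemma cut_pred_notin: assumes "\<not> lat i L" shows "cut (L - 1) i = cut L i"
proof (rule cut_unique[OF cut_lat])
  have "cut L i \<noteq> L" using cut_lat[of i L] assms by metis
  then show "cut L i \<le> L - 1" using cut_le[of L i] by simp
  show "L - 1 < cut L i + 2 * d i" using cut_gt[of L i] by simp
qed

lemma same_endpoint_act:
  assumes "adapted adj \<sigma> \<xi> is" "adapted adj \<sigma> \<xi> js" "endpoint \<xi> is = endpoint \<xi> js"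
  shows "act adj is = act adj js"
  using comm_steps_act[OF adapted_same_endpoint[OF assms]] by simp

lemma same_endpoint_reduced_words:
  assumes "adapted adj \<sigma> \<xi> is" "adapted adj \<sigma> \<xi> js" "endpoint \<xi> is = endpoint \<xi> js"
    and "is \<in> reduced_words adj"
  shows "js \<in> reduced_words adj"
  using comm_steps_reduced_words[OF adapted_same_endpoint[OF assms(1-3)]] assms(4) by simp

text \<open>If the letter \<open>star i\<close> did not occur between the levels \<open>L - hp\<close> and \<open>L - hp - 1\<close>, comparing
  the longest words that start at \<open>cut L\<close> and at \<open>cut (L - 1)\<close> would give a group element without
  the letter \<open>i\<close> that changes the sign of an \<open>i\<close>-th coordinate.\<close>

lemma lat_star_imp: assumes "lat i L" shows "lat (star adj i) (L - hp)"
proof (rule ccontr)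
  let ?s = "star adj i" and ?x = "Q_reflect \<sigma> i (cut L)"
  assume neg: "\<not> lat ?s (L - hp)"
  note src = cut_source[OF assms]
  have xQ: "?x \<in> QD" by (rule QD_reflect[OF cut_QD src(2)])
  have xi: "?x i = L - 2 * d i" using src(1) by (simp add: Q_reflect_def)
  have xj: "?x j = cut L j" if "j \<noteq> i" for j using that by (simp add: Q_reflect_def)
  have le1: "cut (L - 1) j \<le> ?x j" for j
    by (cases "j = i") (simp_all add: xi xj cut_pred[OF assms] cut_mono)
  have le2: "cut (L - hp) j \<le> ?x j" for j
    using le1[of j] cut_mono[of "L - hp" "L - 1" j] hp_pos by simp
  obtain "is" where i: "is \<in> reduced_words adj" "adapted adj \<sigma> (cut L) is" "endpoint (cut L) is = cut (L - hp)"
    using hp_word[of L] by blast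
  obtain rest where rest: "adapted adj \<sigma> ?x rest" "endpoint ?x rest = cut (L - hp)"
    using exists_adapted[OF xQ cut_QD le2] by blast
  have "i # rest \<in> reduced_words adj"
    by (rule same_endpoint_reduced_words[OF i(2) _ _ i(1)])
      (use rest src i(3) in \<open>simp_all add: endpoint_Cons\<close>)
  then have rot: "rest @ [?s] \<in> reduced_words adj" by (rule reduced_words_rotate)
  obtain js where js: "js \<in> reduced_words adj" "adapted adj \<sigma> (cut (L - 1)) js"
      "endpoint (cut (L - 1)) js = cut (L - 1 - hp)"
    using hp_word[of "L - 1"] by blast
  obtain ks where ks: "adapted adj \<sigma> ?x ks" "endpoint ?x ks = cut (L - 1)"
    using exists_adapted[OF xQ cut_QD le1] by blast
  \<comment> \<open>At \<open>i\<close> the reflected height function has already reached the cut at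
    \<open>L - 1\<close>.\<close>
  have iks: "i \<notin> set ks"
    using endpoint_less[of ?x ks i] unfolding ks(2) xi cut_pred[OF assms] by simp
  obtain bs where bs: "adapted adj \<sigma> (cut (L - hp)) bs" "endpoint (cut (L - hp)) bs = cut (L - hp - 1)"
    using exists_adapted[OF cut_QD cut_QD cut_mono[of "L - hp - 1" "L - hp"]] by auto
  \<comment> \<open>Here \<open>neg\<close> enters: column \<open>star adj i\<close> has no vertex
    at level \<open>L - hp\<close>, so the next cut leaves it alone.\<close>
  have sbs: "?s \<notin> set bs"
    using endpoint_less[of "cut (L - hp)" bs ?s] unfolding bs(2) cut_pred_notin[OF neg] by simp
  have comm: "act adj (rest @ bs) = act adj (ks @ js)"
    by (rule same_endpoint_act[of ?x])
      (use rest ks bs js in \<open>auto simp: adapted_append endpoint_append algebra_simps\<close>)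
  have nj: "negating adj js" and nr: "negating adj (rest @ [?s])"
    using js(1) rot reduced_words_iff by blast+
  have W: "act adj (rest @ [?s]) = act adj js" by (rule negating_unique[OF nr nj])
  define y where "y = act adj (rev bs) (sroot ?s)"
  have "act adj (rest @ bs) y = act adj rest (sroot ?s)"
    by (simp add: act_append y_def)
  also have "\<dots> = act adj (rest @ [?s]) (refl adj ?s (sroot ?s))"
    by (simp add: act_append act_Cons del: refl_sroot)
  also have "\<dots> = - act adj js (sroot ?s)"
    unfolding W by (simp add: act_uminus)
  also have "\<dots> = sroot i" unfolding negating_star[OF nj] by simp
  finally have e: "act adj ks (act adj js y) = sroot i"
    unfolding comm by (simp add: act_append)
  have "act adj js y i = (\<Sum>m\<in>UNIV. y m * (- sroot (star adj m)) i)"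
    unfolding act_expansion[of adj js y i] negating_star[OF nj] ..
  also have "\<dots> = (\<Sum>m\<in>UNIV. if m = ?s then - y m else 0)"
  proof (rule sum.cong)
    fix m
    have "i = star adj m \<longleftrightarrow> m = ?s" by (metis star_star)
    then show "y m * (- sroot (star adj m)) i = (if m = ?s then - y m else 0)"
      by (simp add: sroot_def)
  qed simp
  also have "\<dots> = - y ?s" by simp
  also have "y ?s = 1"
    unfolding y_def using sbs by (subst act_apply_notin) (simp_all add: sroot_def)
  finally have "act adj js y i = -1" .
  moreover have "act adj js y i = 1"
    using fun_cong[OF e, of i] iks by (simp add: act_apply_notin sroot_def)
  ultimately show False by simp
qed

lemma lat_star: "lat (star adj i) (p - hp) \<longleftrightarrow> lat i p"
proof
  assume "lat (star adj i) (p - hp)"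
  moreover have "lat (star adj i) (cut p i - hp)" by (rule lat_star_imp[OF cut_lat])
  ultimately have "2 * d i dvd cut p i - hp - (p - hp)" using lat_diff by (metis d_star)
  then have "2 * d i dvd cut p i - p" by simp
  then show "lat i p" using lat_diff[OF cut_lat[of i p], of p] by simp
qed (rule lat_star_imp)

lemma cut_star: "cut (L - hp) (star adj i) = cut L i - hp"
  by (rule cut_unique) (use cut_le[of L i] cut_gt[of L i] cut_lat in \<open>simp_all add: lat_star\<close>)

text \<open>The height function obtained by moving each vertex \<open>(i, p)\<close> to
  \<open>(star adj i, p - hp)\<close>. The vertices of the twisted quiver are those between \<xi>
  and \<open>twist \<xi>\<close>.\<close>

definition twist :: "('v \<Rightarrow> int) \<Rightarrow> 'v \<Rightarrow> int" where
  "twist \<xi> = (\<lambda>i. \<xi> (star adj i) - hp)"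

lemma twist_cut: "twist (cut L) = cut (L - hp)"
proof
  fix i
  show "twist (cut L) i = cut (L - hp) i"
    using cut_star[of L "star adj i"] by (simp add: twist_def)
qed

lemma twist_QD: assumes "\<xi> \<in> QD" shows "twist \<xi> \<in> QD"
proof -
  have "lat i (\<xi> (star adj i) - hp)" for i
    using lat_star[of "star adj i" "\<xi> (star adj i)"] QD_lat[OF assms] by simp
  moreover have "\<xi> (star adj i) < \<xi> (star adj j) + 2 * d j" if "adj i j" for i j
    using QD_less[OF assms, of "star adj i" "star adj j"] that star_adj by simp
  ultimately show ?thesis by (simp add: QD_def twist_def)
qed

lemma twist_reflect: "twist (Q_reflect \<sigma> i \<xi>) = Q_reflect \<sigma> (star adj i) (twist \<xi>)"
proof
  fix j
  have "star adj j = i \<longleftrightarrow> j = star adj i" by (metis star_star)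
  then show "twist (Q_reflect \<sigma> i \<xi>) j = Q_reflect \<sigma> (star adj i) (twist \<xi>) j"
    by (auto simp: twist_def Q_reflect_def)
qed

lemma twist_source: "source adj (twist \<xi>) (star adj i) \<longleftrightarrow> source adj \<xi> i"
proof -
  have "source adj (twist \<xi>) (star adj i) \<longleftrightarrow> (\<forall>j. adj (star adj i) (star adj j) \<longrightarrow> twist \<xi> (star adj j) < twist \<xi> (star adj i))"
    unfolding source_def using bij_star by (metis bij_pointE)
  then show ?thesis by (simp add: star_adj twist_def source_def)
qed

definition reaches_twist :: "('v \<Rightarrow> int) \<Rightarrow> bool" where
  "reaches_twist \<xi> \<longleftrightarrow> (\<exists>is. is \<in> reduced_words adj \<and> adapted adj \<sigma> \<xi> is \<and> endpoint \<xi> is = twist \<xi>)"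

lemma starts_with_source:
  assumes "\<xi> \<in> QD" "source adj \<xi> i" "is \<in> reduced_words adj" "adapted adj \<sigma> \<xi> is"
  shows "\<exists>rest. i # rest \<in> reduced_words adj \<and> adapted adj \<sigma> (Q_reflect \<sigma> i \<xi>) rest \<and>
    endpoint (Q_reflect \<sigma> i \<xi>) rest = endpoint \<xi> is"
proof -
  let ?x = "Q_reflect \<sigma> i \<xi>"
  have eQ: "endpoint \<xi> is \<in> QD" by (rule adapted_QD[OF assms(1,4)])
  have "endpoint \<xi> is i < \<xi> i" unfolding endpoint_less by (rule reduced_words_letters[OF assms(3)])
  then have "endpoint \<xi> is i + 2 * d i \<le> \<xi> i" by (intro lat_gap QD_lat eQ assms(1))
  then have "endpoint \<xi> is j \<le> ?x j" for j using endpoint_le[of \<xi> "is" j] by (simp add: Q_reflect_def)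
  then obtain rest where r: "adapted adj \<sigma> ?x rest" "endpoint ?x rest = endpoint \<xi> is"
    using exists_adapted[OF QD_reflect[OF assms(1,2)] eQ] by blast
  have "i # rest \<in> reduced_words adj"
    by (rule same_endpoint_reduced_words[OF assms(4) _ _ assms(3)])
      (use r assms(2) in \<open>simp_all add: endpoint_Cons\<close>)
  then show ?thesis using r by blast
qed

text \<open>A longest word may be taken to start with the source \<open>i\<close>; moving this
  letter to the end as \<open>star adj i\<close> gives a longest word again, and the endpoint moves
  by exactly the twisted reflection.\<close>

lemma reaches_twist_reflect:
  assumes "\<xi> \<in> QD" "source adj \<xi> i" "reaches_twist \<xi>" shows "reaches_twist (Q_reflect \<sigma> i \<xi>)"
proof -
  let ?x = "Q_reflect \<sigma> i \<xi>"
  obtain "is" where i: "is \<in> reduced_words adj" "adapted adj \<sigma> \<xi> is" "endpoint \<xi> is = twist \<xi>"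
    using assms(3) unfolding reaches_twist_def by blast
  obtain rest where r: "i # rest \<in> reduced_words adj" "adapted adj \<sigma> ?x rest" "endpoint ?x rest = twist \<xi>"
    using starts_with_source[OF assms(1,2) i(1,2)] i(3) by auto
  have "adapted adj \<sigma> ?x (rest @ [star adj i])"
    using r assms(2) twist_source[of \<xi> i] by (simp add: adapted_append)
  moreover have "endpoint ?x (rest @ [star adj i]) = twist ?x"
    by (simp add: endpoint_append endpoint_Cons r(3) twist_reflect)
  ultimately show ?thesis
    unfolding reaches_twist_def using reduced_words_rotate[OF r(1)] by blast
qed

lemma reaches_twist_adapted:
  "\<xi> \<in> QD \<Longrightarrow> reaches_twist \<xi> \<Longrightarrow> adapted adj \<sigma> \<xi> us \<Longrightarrow> reaches_twist (endpoint \<xi> us)"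
  by (induction us arbitrary: \<xi>) (auto simp: endpoint_Cons QD_reflect reaches_twist_reflect)

lemma QD_le_cut: assumes "\<xi> \<in> QD" "\<And>i. \<xi> i \<le> L" shows "\<xi> i \<le> cut L i"
  using lat_gap[OF cut_lat QD_lat[OF assms(1)], of L i] cut_gt[of L i] assms(2)[of i] by linarith

text \<open>Any height function lies below a sufficiently high cut and is reached from it by source
  reflections, along which the property is inherited.\<close>

lemma reaches_twist_QD: assumes "\<xi> \<in> QD" shows "reaches_twist \<xi>"
proof -
  define L where "L = Max (range \<xi>)"
  have "\<xi> i \<le> L" for i by (simp add: L_def)
  then have "\<xi> i \<le> cut L i" for i by (rule QD_le_cut[OF assms])
  then obtain us where us: "adapted adj \<sigma> (cut L) us" "endpoint (cut L) us = \<xi>"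
    using exists_adapted[OF cut_QD assms] by blast
  have "reaches_twist (cut L)"
    unfolding reaches_twist_def twist_cut by (rule hp_word)
  from reaches_twist_adapted[OF cut_QD this us(1)] show ?thesis by (simp add: us(2))
qed

lemma adapted_words_iff:
  assumes "\<xi> \<in> QD"
  shows "is \<in> adapted_words adj \<sigma> \<xi> \<longleftrightarrow> adapted adj \<sigma> \<xi> is \<and> endpoint \<xi> is = twist \<xi>"
proof -
  obtain js where js: "js \<in> reduced_words adj" "adapted adj \<sigma> \<xi> js" "endpoint \<xi> js = twist \<xi>"
    using reaches_twist_QD[OF assms] unfolding reaches_twist_def by blast
  show ?thesis
    unfolding adapted_words_def mem_Collect_eq
    using unique_endpoint[OF assms _ js(1) _ js(2)] same_endpoint_reduced_words[OF js(2) _ _ js(1), of "is"] js(3)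
    by auto
qed

lemma adapted_words_nonempty: "\<xi> \<in> QD \<Longrightarrow> \<exists>is. is \<in> adapted_words adj \<sigma> \<xi>"
  using reaches_twist_QD unfolding reaches_twist_def adapted_words_def by blast

lemma adapted_words_class:
  assumes "\<xi> \<in> QD" "is \<in> adapted_words adj \<sigma> \<xi>"
  shows "adapted_words adj \<sigma> \<xi> = comm_class adj is"
proof -
  have i: "adapted adj \<sigma> \<xi> is" "endpoint \<xi> is = twist \<xi>" using assms adapted_words_iff by auto
  show ?thesis
  proof (intro set_eqI iffI)
    fix js assume "js \<in> adapted_words adj \<sigma> \<xi>"
    then have "adapted adj \<sigma> \<xi> js" "endpoint \<xi> js = twist \<xi>" using assms adapted_words_iff by auto
    then show "js \<in> comm_class adj is"
      unfolding comm_class_def using adapted_same_endpoint[of \<xi> js "is"] i by simp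
  next
    fix js assume "js \<in> comm_class adj is"
    then show "js \<in> adapted_words adj \<sigma> \<xi>"
      unfolding comm_class_def adapted_words_iff[OF assms(1)]
      using comm_steps_adapted[of "is" js \<xi>] i by simp
  qed
qed

lemma adapted_words_comm_classes: "\<xi> \<in> QD \<Longrightarrow> adapted_words adj \<sigma> \<xi> \<in> comm_classes adj"
  using adapted_words_nonempty adapted_words_class unfolding comm_classes_def adapted_words_def
  by (metis (no_types, lifting) imageI mem_Collect_eq)

lemma sum_inverse_d: "(\<Sum>i\<in>UNIV. 1 / rd i) = real (card (orbits \<sigma>))"
proof -
  have "(\<Sum>i\<in>UNIV. 1 / rd i) = (\<Sum>a\<in>orbits \<sigma>. \<Sum>i | orb \<sigma> i = a. 1 / rd i)"
    using sum.image_gen[of "UNIV :: 'v set" "\<lambda>i. 1 / rd i" "orb \<sigma>"] by (simp add: orbits_def)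
  also have "\<dots> = (\<Sum>a\<in>orbits \<sigma>. 1)"
  proof (rule sum.cong)
    fix a assume "a \<in> orbits \<sigma>"
    then obtain j where a: "a = orb \<sigma> j" by (auto simp: orbits_def)
    have "{i. orb \<sigma> i = a} = a" using mem_orb_eq orb_self unfolding a by blast
    moreover have "(\<Sum>i\<in>a. 1 / rd i) = (\<Sum>i\<in>a. 1 / rd j)"
      by (intro sum.cong refl) (metis a orb_memD d_power)
    moreover have "a \<noteq> {}" unfolding a using orb_self[of j] by blast
    ultimately show "(\<Sum>i | orb \<sigma> i = a. 1 / rd i) = 1" by (simp add: a orb_size_def)
  qed simp
  finally show ?thesis by simp
qed

text \<open>The letter \<open>j\<close> occurs
  \<open>(\<xi> j - \<xi> (star adj j) + hp) / (2 * d j)\<close> times. In the sum the differences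
  cancel because \<open>star\<close> permutes the vertices and preserves orbit sizes, and the
  inverse orbit sizes add up to the number of orbits.\<close>

lemma card_pos_roots_hp: "2 * int (card (pos_roots adj)) = hp * int (card (orbits \<sigma>))"
proof -
  obtain "is" where i: "is \<in> reduced_words adj" "endpoint (cut 0) is = twist (cut 0)"
    using reaches_twist_QD[OF cut_QD] unfolding reaches_twist_def by blast
  let ?x = "cut 0"
  have "2 * rd j * real (count_list is j) = real_of_int (?x j - ?x (star adj j)) + hp" for j
  proof -
    have "?x j - 2 * d j * int (count_list is j) = ?x (star adj j) - hp"
      using fun_cong[OF i(2), of j] by (simp add: endpoint_count twist_def)
    then have "2 * d j * int (count_list is j) = ?x j - ?x (star adj j) + hp" by simp
    then have "real_of_int (2 * d j * int (count_list is j)) = real_of_int (?x j - ?x (star adj j) + hp)" by (rule arg_cong)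
    then show ?thesis by simp
  qed
  then have c: "2 * real (count_list is j) = ?x j / rd j - ?x (star adj j) / rd (star adj j) + hp * (1 / rd j)" for j
    using d_neq_0[of j] by (simp add: field_simps)
  have "2 * real (length is) = (\<Sum>j\<in>UNIV. 2 * real (count_list is j))"
    using sum_count_set[of "is" UNIV] by (simp flip: of_nat_sum sum_distrib_left)
  also have "\<dots> = (\<Sum>j\<in>UNIV. ?x j / rd j) - (\<Sum>j\<in>UNIV. ?x (star adj j) / rd (star adj j)) + hp * (\<Sum>j\<in>UNIV. 1 / rd j)"
    unfolding c by (simp only: sum.distrib sum_subtractf sum_distrib_left)
  also have "(\<Sum>j\<in>UNIV. ?x (star adj j) / rd (star adj j)) = (\<Sum>j\<in>UNIV. ?x j / rd j)"
    by (rule sum.reindex_bij_betw) (use bij_star in simp)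
  finally have "2 * real (length is) = hp * real (card (orbits \<sigma>))" by (simp add: sum_inverse_d)
  then have "real_of_int (2 * int (length is)) = real_of_int (hp * int (card (orbits \<sigma>)))" by simp
  then have "2 * int (length is) = hp * int (card (orbits \<sigma>))" by (simp only: of_int_eq_iff)
  then show ?thesis using length_reduced_words[OF i(1)] by simp
qed

end

section \<open>The dual Coxeter number\<close>

context posdef_graph
begin

lemma root_pairing_le: assumes "x \<in> roots adj" "y \<in> roots adj"
  shows "ip adj x y \<le> 2" and "ip adj x y = 2 \<Longrightarrow> x = y" and "ip adj x y = 1 \<Longrightarrow> x - y \<in> roots adj"
proof -
  have n: "ip adj (x - y) (x - y) = 4 - 2 * ip adj x y"
    using assms by (simp add: ip_linear roots_def ip_commute[of y x])
  show "ip adj x y \<le> 2" using ip_nonneg[of "x - y"] n by linarith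
  show "x = y" if "ip adj x y = 2"
  proof (rule ccontr)
    assume "x \<noteq> y"
    then have "x - y \<noteq> 0" by (simp only: right_minus_eq not_False_eq_True)
    from ip_pos[OF this] show False using n that by simp
  qed
  show "x - y \<in> roots adj" if "ip adj x y = 1" using n that by (simp add: roots_def)
qed

lemma sum_roots_even:
  assumes "\<And>m. f (- m) = (f m :: 'a::comm_semiring_1)"
  shows "(\<Sum>m\<in>roots adj. f m) = 2 * (\<Sum>m\<in>pos_roots adj. f m)"
proof -
  let ?N = "uminus ` pos_roots adj"
  have "roots adj = pos_roots adj \<union> ?N"
  proof
    show "roots adj \<subseteq> pos_roots adj \<union> ?N"
    proof
      fix m assume m: "m \<in> roots adj"
      show "m \<in> pos_roots adj \<union> ?N"
      proof (cases "nonneg m")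
        case True
        then show ?thesis using m by (simp add: pos_roots_def)
      next
        case False
        then have "- m \<in> pos_roots adj" using m root_not_nonneg by (simp add: pos_roots_def)
        then have "- (- m) \<in> ?N" by (rule imageI)
        then show ?thesis by simp
      qed
    qed
  qed (auto simp: pos_roots_def)
  moreover have "pos_roots adj \<inter> ?N = {}"
    using nonneg_antisym by (auto simp: pos_roots_def)
  moreover have "(\<Sum>m\<in>?N. f m) = (\<Sum>m\<in>pos_roots adj. f m)"
    by (subst sum.reindex) (auto simp: assms inj_on_def)
  ultimately show ?thesis by (simp add: sum.union_disjoint mult_2)
qed

text \<open>The sum of the positive roots is \<open>2 * \<rho>\<close>: reflection at
  \<open>i\<close> permutes the positive roots other than \<open>sroot i\<close> and negates their
  pairings, so only \<open>sroot i\<close> contributes.\<close>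

lemma sum_pos_roots_pr: "(\<Sum>m\<in>pos_roots adj. pr adj m i) = 2"
proof -
  let ?P = "pos_roots adj - {sroot i}"
  have "(\<Sum>m\<in>?P. pr adj m i) = (\<Sum>m\<in>?P. pr adj (refl adj i m) i)"
    by (rule sum.reindex_bij_witness[of _ "refl adj i" "refl adj i"])
      (auto simp: refl_pos)
  also have "\<dots> = - (\<Sum>m\<in>?P. pr adj m i)"
    by (simp add: refl_alt pr_diff pr_scale pr_sroot simple_root_def sum_negf)
  finally have "(\<Sum>m\<in>?P. pr adj m i) = 0" by linarith
  moreover have "(\<Sum>m\<in>pos_roots adj. pr adj m i) = pr adj (sroot i) i + (\<Sum>m\<in>?P. pr adj m i)"
    by (rule sum.remove) auto
  ultimately show ?thesis by (simp add: pr_sroot simple_root_def)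
qed

end

section \<open>Orbit sums of roots as the folded root system\<close>

context folded_diagram
begin

lemma orb_not_adj: "k \<in> orb \<sigma> i \<Longrightarrow> m \<in> orb \<sigma> i \<Longrightarrow> \<not> adj k m"
proof -
  assume "k \<in> orb \<sigma> i" "m \<in> orb \<sigma> i"
  then have "dep k = dep m" using orb_memD[of k i] orb_memD[of m i] by fastforce
  then show ?thesis using dep_par[of k] dep_par[of m] by (auto simp: adj_iff)
qed

lemma mem_orb_sym: "k \<in> orb \<sigma> i \<longleftrightarrow> i \<in> orb \<sigma> k"
  using mem_orb_eq orb_self by metis

lemma sigma_mem_orb [simp]: "\<sigma> k \<in> orb \<sigma> i \<longleftrightarrow> k \<in> orb \<sigma> i"
  using mem_orb_sym[of "\<sigma> k" i] mem_orb_sym[of k i] orb_power[of 1 k] by simp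

lemma power_mem_orb [simp]: "(\<sigma> ^^ l) k \<in> orb \<sigma> i \<longleftrightarrow> k \<in> orb \<sigma> i"
  by (induction l) auto

lemma card_orb: "int (card (orb \<sigma> i)) = d i"
  by (simp add: orb_size_def)

lemma sum_shift_r: "(\<Sum>l<r. (f :: nat \<Rightarrow> 'b::ab_group_add) (Suc l)) = (\<Sum>l<r. f l)" if "f r = f 0"
proof -
  have "(\<Sum>l<r. f (Suc l)) + f 0 = (\<Sum>l<Suc r. f l)" by (subst sum.lessThan_Suc_shift) (simp add: add.commute)
  then show ?thesis using that by simp
qed

definition bar :: "('v \<Rightarrow> int) \<Rightarrow> 'v \<Rightarrow> int" where
  "bar x = (\<lambda>i. \<Sum>l<r. x ((\<sigma> ^^ l) i))"

text \<open>For a root \<open>x\<close> this is half the squared length of \<open>orbit_sum x\<close>.\<close>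

definition half_norm :: "('v \<Rightarrow> int) \<Rightarrow> int" where
  "half_norm x = (if x \<circ> \<sigma> = x then 1 else int r)"

text \<open>The sums over the \<open>\<sigma>\<close>-orbits of roots are the roots of the folded root system.\<close>

definition orbit_sum :: "('v \<Rightarrow> int) \<Rightarrow> 'v \<Rightarrow> int" where
  "orbit_sum x = (if x \<circ> \<sigma> = x then x else bar x)"

text \<open>The product of the commuting simple reflections over an orbit, which acts as a simple
  reflection of the folded system. It is written on coordinates so that no enumeration of the orbit
  is needed.\<close>

definition orb_refl :: "'v \<Rightarrow> ('v \<Rightarrow> int) \<Rightarrow> 'v \<Rightarrow> int" where
  "orb_refl i x = (\<lambda>k. if k \<in> orb \<sigma> i then x k - pr adj x k else x k)"

lemma comp_sigmaD: "x \<circ> \<sigma> = x \<Longrightarrow> x (\<sigma> i) = x i"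
  by (metis comp_apply)

lemma comp_powerD: "x \<circ> \<sigma> = x \<Longrightarrow> x ((\<sigma> ^^ l) i) = x i"
  by (induction l) (auto simp: comp_sigmaD)

lemma bar_inv: "x \<circ> \<sigma> = x \<Longrightarrow> bar x i = int r * x i"
  by (simp add: bar_def comp_powerD)

lemma bar_sigma: "bar x \<circ> \<sigma> = bar x"
proof
  fix i
  have "(\<Sum>l<r. x ((\<sigma> ^^ Suc l) i)) = (\<Sum>l<r. x ((\<sigma> ^^ l) i))"
    by (rule sum_shift_r) simp
  then show "(bar x \<circ> \<sigma>) i = bar x i" by (simp add: bar_def funpow_swap1)
qed

lemma bar_comp_power: "bar (x \<circ> (\<sigma> ^^ k)) i = bar x i"
proof -
  have "bar (x \<circ> (\<sigma> ^^ k)) i = bar x ((\<sigma> ^^ k) i)"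
    by (simp add: bar_def funpow_add[symmetric, THEN fun_cong, simplified] add.commute)
  then show ?thesis using comp_powerD[OF bar_sigma] by simp
qed

lemma bar_diff: "bar (x - y) i = bar x i - bar y i"
  by (simp add: bar_def sum_subtractf)

lemma bar_uminus: "bar (- x) i = - bar x i"
  by (simp add: bar_def sum_negf)

text \<open>For \<open>r = 1\<close> both descriptions coincide; excluding it from the second case
  keeps the half norms 1 and \<open>r\<close> distinct.\<close>

lemma half_norm_cases: obtains "half_norm x = int r" "orbit_sum x = bar x" | "half_norm x = 1" "x \<circ> \<sigma> = x" "orbit_sum x = x" "r \<noteq> 1"
proof (cases "x \<circ> \<sigma> = x")
  case True
  show ?thesis
  proof (cases "r = 1")
    case r1: True
    have "bar x = x" using bar_inv[OF True] r1 by auto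
    then show ?thesis using True r1 that(1) by (simp add: half_norm_def orbit_sum_def)
  next
    case False
    then show ?thesis using True that(2) by (simp add: half_norm_def orbit_sum_def)
  qed
next
  case False
  then show ?thesis using that(1) by (simp add: half_norm_def orbit_sum_def)
qed

lemma orbit_sum_sigma: "orbit_sum x \<circ> \<sigma> = orbit_sum x"
  by (simp add: orbit_sum_def bar_sigma)

lemma half_norm_pos: "0 < half_norm x" "half_norm x \<le> int r"
  using Suc_leI[OF r_pos] by (auto simp: half_norm_def)

lemma uminus_comp: "- x \<circ> \<sigma> = - (x \<circ> \<sigma>)" for x :: "'v \<Rightarrow> int"
  by auto

lemma half_norm_uminus: "half_norm (- x) = half_norm x"
  by (simp add: half_norm_def uminus_comp)

lemma orbit_sum_uminus: "orbit_sum (- x) = - orbit_sum x"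
proof -
  have "bar (- x) = - bar x" by (auto simp: bar_uminus)
  then show ?thesis by (simp add: orbit_sum_def uminus_comp)
qed

lemma pr_bar: "pr adj (bar x) i = (\<Sum>l<r. pr adj x ((\<sigma> ^^ l) i))"
proof -
  have "bar x = (\<Sum>l<r. x \<circ> (\<sigma> ^^ l))" by (auto simp: bar_def sum_fun_apply)
  then have "pr adj (bar x) i = ip adj (sroot i) (\<Sum>l<r. x \<circ> (\<sigma> ^^ l))"
    by (simp only: ip_sroot_left)
  also have "\<dots> = (\<Sum>l<r. pr adj x ((\<sigma> ^^ l) i))"
    unfolding ip_sum_right ip_sroot_left pr_automorphism[OF power_automorphism] ..
  finally show ?thesis .
qed

lemma pr_sigma_inv: "x \<circ> \<sigma> = x \<Longrightarrow> pr adj x (\<sigma> i) = pr adj x i"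
  using pr_automorphism[OF automorphism, of x i] by simp

lemma pr_orb: "x \<circ> \<sigma> = x \<Longrightarrow> k \<in> orb \<sigma> i \<Longrightarrow> pr adj x k = pr adj x i"
proof -
  assume x: "x \<circ> \<sigma> = x" and k: "k \<in> orb \<sigma> i"
  obtain l where "k = (\<sigma> ^^ l) i" using orb_memD[OF k] by blast
  moreover have "pr adj x ((\<sigma> ^^ l) i) = pr adj x i" for l by (induction l) (auto simp: pr_sigma_inv[OF x])
  ultimately show ?thesis by simp
qed

lemma inv_orb: "x \<circ> \<sigma> = x \<Longrightarrow> k \<in> orb \<sigma> i \<Longrightarrow> x k = (x i :: int)"
  using orb_memD[of k i] comp_powerD[of x] by auto

lemma ip_comp_inv: "y \<circ> \<sigma> = y \<Longrightarrow> ip adj (x \<circ> (\<sigma> ^^ l)) y = ip adj x y"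
proof -
  assume y: "y \<circ> \<sigma> = y"
  have "y \<circ> (\<sigma> ^^ l) = y" using comp_powerD[OF y] by auto
  then show ?thesis using ip_automorphism[OF power_automorphism, of x l y] by simp
qed

lemma ip_bar: "ip adj (bar x) y = (\<Sum>l<r. ip adj (x \<circ> (\<sigma> ^^ l)) y)"
proof -
  have "bar x = (\<Sum>l<r. x \<circ> (\<sigma> ^^ l))" by (auto simp: bar_def sum_fun_apply)
  then show ?thesis by (simp only: ip_sum_left)
qed

lemma ip_bar_inv: "y \<circ> \<sigma> = y \<Longrightarrow> ip adj (bar x) y = int r * ip adj x y"
  unfolding ip_bar by (simp add: ip_comp_inv)

lemma comp_power_roots: "x \<in> roots adj \<Longrightarrow> x \<circ> (\<sigma> ^^ l) \<in> roots adj"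
  by (simp add: roots_def ip_automorphism[OF power_automorphism])

lemma act_nonadjacent:
  assumes "distinct ms" "\<forall>k\<in>set ms. \<forall>m\<in>set ms. \<not> adj k m"
  shows "act adj ms x k = (if k \<in> set ms then x k - pr adj x k else x k)"
  using assms
proof (induction ms arbitrary: k)
  case (Cons m ms)
  let ?y = "act adj ms x"
  have IH: "?y k = (if k \<in> set ms then x k - pr adj x k else x k)" for k
    using Cons by simp
  have "?y m = x m" using Cons.prems by (simp add: IH)
  moreover have "(\<Sum>j | adj m j. ?y j) = (\<Sum>j | adj m j. x j)"
    using Cons.prems by (intro sum.cong refl) (auto simp: IH)
  ultimately have p: "pr adj ?y m = pr adj x m" by (simp add: pr_alt)
  have "act adj (m # ms) x k = refl adj m ?y k" by (simp add: act_Cons)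
  then show ?case using p IH[of k] Cons.prems by (auto simp: refl_apply IH)
qed simp

lemma orb_refl_act:
  obtains ms where "\<And>x. orb_refl i x = act adj ms x" "set ms = orb \<sigma> i" "distinct ms"
proof -
  obtain ms where ms: "set ms = orb \<sigma> i" "distinct ms"
    using finite_distinct_list[of "orb \<sigma> i"] by auto
  have "orb_refl i x = act adj ms x" for x
    using act_nonadjacent[OF ms(2)] orb_not_adj ms(1) by (auto simp: orb_refl_def)
  then show ?thesis using that ms by blast
qed

lemma ip_orb_refl: "ip adj (orb_refl i x) (orb_refl i y) = ip adj x y"
proof -
  obtain ms where "\<And>x. orb_refl i x = act adj ms x" using orb_refl_act[of i] by metis
  then show ?thesis by (simp add: ip_act)
qed

lemma orb_refl_roots [simp]: "orb_refl i x \<in> roots adj \<longleftrightarrow> x \<in> roots adj"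
  by (simp add: roots_def ip_orb_refl)

lemma pr_orb_refl_self: assumes "k \<in> orb \<sigma> i" shows "pr adj (orb_refl i x) k = - pr adj x k"
proof -
  have "(\<Sum>j | adj k j. orb_refl i x j) = (\<Sum>j | adj k j. x j)"
    using orb_not_adj[OF assms] by (intro sum.cong refl) (auto simp: orb_refl_def)
  then show ?thesis using assms by (simp add: pr_alt orb_refl_def)
qed

lemma orb_refl_orb_refl [simp]: "orb_refl i (orb_refl i x) = x"
proof
  fix k
  show "orb_refl i (orb_refl i x) k = x k"
    unfolding orb_refl_def[of i "orb_refl i x"]
    using pr_orb_refl_self[of k i x] by (simp add: orb_refl_def[of i x])
qed

lemma orb_refl_sigma: "orb_refl i x \<circ> \<sigma> = orb_refl i (x \<circ> \<sigma>)"
  by (auto simp: orb_refl_def pr_automorphism[OF automorphism])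

lemma bar_orb_refl: "bar (orb_refl i x) = orb_refl i (bar x)"
proof
  fix k
  show "bar (orb_refl i x) k = orb_refl i (bar x) k"
    by (auto simp: bar_def orb_refl_def pr_bar[unfolded bar_def] sum_subtractf)
qed

lemma orb_refl_fixed_iff: "orb_refl i x \<circ> \<sigma> = orb_refl i x \<longleftrightarrow> x \<circ> \<sigma> = x"
  unfolding orb_refl_sigma by (metis orb_refl_orb_refl)

lemma half_norm_orb_refl [simp]: "half_norm (orb_refl i x) = half_norm x"
  by (simp add: half_norm_def orb_refl_fixed_iff)

lemma orbit_sum_orb_refl: "orbit_sum (orb_refl i x) = orb_refl i (orbit_sum x)"
  by (simp add: orbit_sum_def orb_refl_fixed_iff bar_orb_refl)

lemma sum_orb_refl:
  assumes "x \<circ> \<sigma> = x" shows "(\<Sum>k\<in>UNIV. orb_refl i x k) = (\<Sum>k\<in>UNIV. x k) - d i * pr adj x i"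
proof -
  have "(\<Sum>k\<in>UNIV. orb_refl i x k) = (\<Sum>k\<in>UNIV. x k - (if k \<in> orb \<sigma> i then pr adj x k else 0))"
    by (intro sum.cong) (auto simp: orb_refl_def)
  also have "\<dots> = (\<Sum>k\<in>UNIV. x k) - (\<Sum>k\<in>orb \<sigma> i. pr adj x k)"
    by (simp add: sum_subtractf sum.If_cases)
  also have "(\<Sum>k\<in>orb \<sigma> i. pr adj x k) = (\<Sum>k\<in>orb \<sigma> i. pr adj x i)"
    by (intro sum.cong refl pr_orb[OF assms])
  finally show ?thesis by (simp add: card_orb)
qed

lemma sum_bar: "(\<Sum>k\<in>UNIV. bar x k) = int r * (\<Sum>k\<in>UNIV. x k)"
proof -
  have "(\<Sum>k\<in>UNIV. bar x k) = (\<Sum>l<r. \<Sum>k\<in>UNIV. x ((\<sigma> ^^ l) k))"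
    unfolding bar_def by (rule sum.swap)
  also have "\<dots> = (\<Sum>l<r. \<Sum>k\<in>UNIV. x k)"
  proof (rule sum.cong)
    fix l
    have "bij (\<sigma> ^^ l)" using power_automorphism by (simp add: diagram_automorphism_def)
    then show "(\<Sum>k\<in>UNIV. x ((\<sigma> ^^ l) k)) = (\<Sum>k\<in>UNIV. x k)"
      by (rule sum.reindex_bij_betw)
  qed simp
  finally show ?thesis by simp
qed

text \<open>The reflections are applied one at a time. A root would turn negative only if it became
  a simple root of the orbit on the way, but simple roots of the orbit are fixed by the other
  letters, so it would have been one from the beginning.\<close>

lemma orb_refl_pos:
  assumes "x \<in> pos_roots adj" "\<And>k. x \<noteq> sroot k" shows "orb_refl i x \<in> pos_roots adj"
proof -
  obtain ms where ms: "\<And>x. orb_refl i x = act adj ms x" "set ms = orb \<sigma> i" "distinct ms"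
    using orb_refl_act[of i] by metis
  have "act adj ns x \<in> pos_roots adj \<and> (\<forall>k\<in>orb \<sigma> i. act adj ns x \<noteq> sroot k)"
    if "set ns \<subseteq> orb \<sigma> i" for ns
    using that
  proof (induction ns)
    case (Cons m ns)
    let ?y = "act adj ns x"
    have y: "?y \<in> pos_roots adj" "\<And>k. k \<in> orb \<sigma> i \<Longrightarrow> ?y \<noteq> sroot k" and m: "m \<in> orb \<sigma> i"
      using Cons by auto
    have "refl adj m ?y \<noteq> sroot k" if k: "k \<in> orb \<sigma> i" for k
    proof
      assume e: "refl adj m ?y = sroot k"
      have km: "k \<noteq> m" using e refl_pos(2)[OF y(1) y(2)[OF m]] by auto
      have "?y = refl adj m (sroot k)" using e by (metis refl_refl)
      also have "\<dots> = sroot k"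
        using orb_not_adj[OF m k] km by (simp add: refl_def pr_sroot simple_root_def)
      finally show False using y(2)[OF k] by simp
    qed
    then show ?case using refl_pos(1)[OF y(1) y(2)[OF m]] by (simp add: act_Cons)
  qed (use assms in auto)
  from this[of ms] show ?thesis using ms by simp
qed

lemma bar_pos_root_neq_0:
  assumes "x \<in> roots adj" shows "bar x \<noteq> 0"
proof -
  have pos: "bar x \<noteq> 0" if x: "x \<in> roots adj" "nonneg x" for x
  proof
    assume z: "bar x = 0"
    have "x i = 0" for i
    proof -
      have "(\<Sum>l<r. x ((\<sigma> ^^ l) i)) = 0" using fun_cong[OF z, of i] by (simp add: bar_def)
      then have "\<forall>l\<in>{..<r}. x ((\<sigma> ^^ l) i) = 0"
        using x(2) by (subst (asm) sum_nonneg_eq_0_iff) (auto simp: nonneg_def)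
      from this[rule_format, of 0] show ?thesis by simp
    qed
    then have "x = 0" by auto
    then show False using roots_neq_0[OF x(1)] by simp
  qed
  show ?thesis
  proof (cases "nonneg x")
    case True
    then show ?thesis using pos assms by blast
  next
    case False
    then have "bar (- x) \<noteq> 0" using pos[of "- x"] root_not_nonneg[OF assms] assms by simp
    then show ?thesis by (auto simp: bar_uminus fun_eq_iff)
  qed
qed

text \<open>The vector \<open>bar x\<close> has positive norm, so it pairs positively with some
  simple root, and the reflection of that orbit lowers the height. The sum \<open>bar x\<close> is
  used because its pairings, unlike those of \<open>x\<close>, are constant on orbits.\<close>

lemma pos_root_orbit_induct [consumes 1, case_names simple refl]:
  assumes "x \<in> pos_roots adj"
    and simple: "\<And>i. P (sroot i)"
    and refl: "\<And>x i. x \<in> pos_roots adj \<Longrightarrow> P x \<Longrightarrow> P (orb_refl i x)"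
  shows "P x"
  using assms(1)
proof (induction "nat (\<Sum>k\<in>UNIV. x k)" arbitrary: x rule: less_induct)
  case less
  show ?case
  proof (cases "\<exists>k. x = sroot k")
    case False
    have rx: "x \<in> roots adj" and nx: "nonneg x" using less.prems pos_rootsD by blast+
    have "0 < ip adj (bar x) (bar x)" by (rule ip_pos[OF bar_pos_root_neq_0[OF rx]])
    then have "\<not> (\<forall>i. bar x i * pr adj (bar x) i \<le> 0)"
      unfolding ip_def using sum_nonpos[of UNIV "\<lambda>i. bar x i * pr adj (bar x) i"] by fastforce
    then obtain i where i: "0 < bar x i * pr adj (bar x) i" by (auto simp: not_le)
    moreover have "0 \<le> bar x i" using nx by (auto simp: bar_def nonneg_def intro!: sum_nonneg)
    ultimately have p: "0 < pr adj (bar x) i" by (simp add: zero_less_mult_iff)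
    have y: "orb_refl i x \<in> pos_roots adj" by (rule orb_refl_pos[OF less.prems]) (use False in blast)
    have "(\<Sum>k\<in>UNIV. bar (orb_refl i x) k) < (\<Sum>k\<in>UNIV. bar x k)"
      unfolding bar_orb_refl sum_orb_refl[OF bar_sigma] using p d_pos[of i] by (simp del: d_pos)
    then have "(\<Sum>k\<in>UNIV. orb_refl i x k) < (\<Sum>k\<in>UNIV. x k)"
      unfolding sum_bar using r_pos by (simp add: mult_less_cancel_left)
    moreover have "0 \<le> (\<Sum>k\<in>UNIV. orb_refl i x k)"
      using y by (auto simp: pos_roots_def nonneg_def intro: sum_nonneg)
    ultimately have "nat (\<Sum>k\<in>UNIV. orb_refl i x k) < nat (\<Sum>k\<in>UNIV. x k)" by simp
    from refl[OF y less.hyps[OF this y], of i] show ?thesis by simp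
  qed (use simple in auto)
qed

lemma sroot_moved: assumes "\<sigma> i \<noteq> i" shows "sroot i \<circ> \<sigma> \<noteq> sroot i"
proof
  assume "sroot i \<circ> \<sigma> = sroot i"
  then have "sroot i (\<sigma> i) = sroot i i" by (rule comp_sigmaD)
  then show False using assms by (simp add: sroot_def)
qed

lemma half_norm_sroot: "half_norm (sroot i) = d i"
proof (cases "\<sigma> i = i")
  case True
  then show ?thesis using d_fixed sroot_automorphism[OF automorphism, of i] by (simp add: half_norm_def)
next
  case False
  then show ?thesis using d_moved[OF False] sroot_moved[OF False] by (simp add: half_norm_def)
qed

lemma orbit_sum_sroot: "orbit_sum (sroot i) k = of_bool (k \<in> orb \<sigma> i)"
proof (cases "\<sigma> i = i")
  case True
  then have "orb \<sigma> i = {i}" by (auto simp: orb_def power_fixed)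
  moreover have "sroot i \<circ> \<sigma> = sroot i" using True sroot_automorphism[OF automorphism, of i] by simp
  ultimately show ?thesis by (simp add: orbit_sum_def sroot_def)
next
  case False
  have "sroot i \<circ> \<sigma> \<noteq> sroot i" by (rule sroot_moved[OF False])
  then have "orbit_sum (sroot i) k = (\<Sum>l<r. of_bool ((\<sigma> ^^ l) k = i))"
    by (simp add: orbit_sum_def bar_def sroot_def)
  also have "\<dots> = of_bool (k \<in> orb \<sigma> i)"
  proof (cases "k \<in> orb \<sigma> i")
    case k: True
    then obtain l0 where l0: "l0 < r" "i = (\<sigma> ^^ l0) k" using mem_orb_sym orb_memD by blast
    have "\<sigma> k \<noteq> k"
    proof
      assume "\<sigma> k = k"
      then have "i = k" using l0 by (simp add: power_fixed)
      then show False using False \<open>\<sigma> k = k\<close> by simp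
    qed
    then have "(\<sigma> ^^ l) k = i \<longleftrightarrow> l = l0" if "l < r" for l
      using power_moved[of k l l0] l0 that by simp
    then have "(\<Sum>l<r. of_bool ((\<sigma> ^^ l) k = i)) = (\<Sum>l<r. if l = l0 then 1 else 0 :: int)"
      by (intro sum.cong) auto
    then show ?thesis using l0 k by simp
  next
    case k: False
    have "(\<sigma> ^^ l) k \<noteq> i" for l
      using k power_mem_orb[of l k i] by (metis orb_self)
    then show ?thesis using k by simp
  qed
  finally show ?thesis .
qed

lemma orbit_sum_norm:
  assumes "x \<in> roots adj" shows "ip adj (orbit_sum x) (orbit_sum x) = 2 * half_norm x"
proof -
  have pos: "ip adj (orbit_sum x) (orbit_sum x) = 2 * half_norm x" if "x \<in> pos_roots adj" for x
    using that
  proof (induction rule: pos_root_orbit_induct)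
    case (simple i)
    let ?y = "orbit_sum (sroot i)"
    have p: "pr adj ?y k = 2" if k: "k \<in> orb \<sigma> i" for k
    proof -
      have "(\<Sum>j | adj k j. ?y j) = 0"
        using orb_not_adj[OF k] by (intro sum.neutral) (auto simp: orbit_sum_sroot)
      then show ?thesis using k by (simp add: pr_alt orbit_sum_sroot)
    qed
    have "ip adj ?y ?y = (\<Sum>k\<in>UNIV. if k \<in> orb \<sigma> i then pr adj ?y k else 0)"
      unfolding ip_def by (intro sum.cong) (auto simp: orbit_sum_sroot)
    also have "\<dots> = (\<Sum>k\<in>orb \<sigma> i. 2)" by (simp add: sum.If_cases p)
    finally have "ip adj ?y ?y = 2 * d i" by (simp add: card_orb)
    moreover have "half_norm (sroot i) = d i" by (rule half_norm_sroot)
    ultimately show ?case by simp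
  next
    case (refl x i)
    then show ?case by (simp add: orbit_sum_orb_refl ip_orb_refl)
  qed
  show ?thesis
  proof (cases "nonneg x")
    case True
    then show ?thesis using assms pos by (simp add: pos_roots_def)
  next
    case False
    then have "- x \<in> pos_roots adj" using assms root_not_nonneg by (simp add: pos_roots_def)
    from pos[OF this] show ?thesis
      by (simp add: orbit_sum_uminus half_norm_uminus ip_uminus_left ip_uminus_right)
  qed
qed

lemma bar_sign: assumes "x \<in> roots adj" shows "nonneg (bar x) \<or> nonneg (- bar x)"
proof -
  have "nonneg (bar y)" if "nonneg y" for y
    using that by (auto simp: bar_def nonneg_def intro!: sum_nonneg)
  moreover have "bar (- x) = - bar x" by (auto simp: bar_uminus)
  ultimately show ?thesis using root_sign[OF assms] by metis
qed

lemma orbit_sum_nonneg: "nonneg x \<Longrightarrow> nonneg (orbit_sum x)"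
  by (auto simp: orbit_sum_def bar_def nonneg_def intro!: sum_nonneg)

lemma sum_orbits: "(\<Sum>a\<in>orbits \<sigma>. \<Sum>k\<in>a. f k) = (\<Sum>k\<in>UNIV. f k)"
proof -
  have "(\<Sum>a\<in>orbits \<sigma>. \<Sum>k\<in>a. f k) = (\<Sum>a\<in>orbits \<sigma>. \<Sum>k | k \<in> UNIV \<and> orb \<sigma> k = a. f k)"
  proof (intro sum.cong refl)
    fix a assume "a \<in> orbits \<sigma>"
    then obtain i where "a = orb \<sigma> i" by (auto simp: orbits_def)
    then show "a = {k \<in> UNIV. orb \<sigma> k = a}" using mem_orb_eq orb_self by blast
  qed
  also have "\<dots> = (\<Sum>k\<in>UNIV. f k)" by (rule sum.group) (auto simp: orbits_def)
  finally show ?thesis .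
qed

lemma orb_fixed: "\<sigma> i = i \<Longrightarrow> orb \<sigma> i = {i}"
  by (auto simp: orb_def power_fixed)

text \<open>All candidates have the depth of \<open>i\<close>. If \<open>i\<close> is the parent of
  \<open>m\<close>, no other vertex of this depth is a neighbour of \<open>m\<close>. If it is a
  child, a power of \<sigma> that carries \<open>i\<close> to \<open>k\<close> fixes
  \<open>m\<close>, hence is trivial because \<open>m\<close> is moved by \<sigma>.\<close>

lemma neighbour_moved_unique:
  assumes "\<sigma> i \<noteq> i" "\<sigma> m \<noteq> m" "adj m i" "adj m k" "k \<in> orb \<sigma> i" shows "k = i"
proof -
  obtain l where l: "l < r" "k = (\<sigma> ^^ l) i" using orb_memD[OF assms(5)] by blast
  have dk: "dep k = dep i" using l by simp
  have nc: "i \<noteq> ctr" "m \<noteq> ctr" using assms(1,2) sigma_ctr by metis+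
  then have kc: "k \<noteq> ctr" using l power_ctr[of l] power_inj[of l i ctr] by metis
  have pk: "par k = (\<sigma> ^^ l) (par i)"
  proof -
    have "par ((\<sigma> ^^ l) i) = (\<sigma> ^^ l) (par i) \<and> (\<sigma> ^^ l) i \<noteq> ctr" for l
      using nc by (induction l) (auto simp: sigma_par, metis sigma_ctr sigma_inj)
    then show ?thesis using l by simp
  qed
  show ?thesis
  proof (cases "par m = i")
    case True
    then have "dep i < dep m" using dep_par[OF nc(2)] by simp
    then have "par k \<noteq> m" using dk dep_par[OF kc] by auto
    then show ?thesis using assms(4) True by (auto simp: adj_iff)
  next
    case False
    then have pi: "par i = m" using assms(3) by (auto simp: adj_iff)
    have "dep m < dep i" using dep_par[OF nc(1)] pi by simp
    then have "par m \<noteq> k" using dk dep_par[OF nc(2)] by auto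
    then have "par k = m" using assms(4) by (auto simp: adj_iff)
    then have "(\<sigma> ^^ l) m = (\<sigma> ^^ 0) m" using pk pi by simp
    then have "l = 0" using power_moved[OF assms(2) l(1), of 0] by simp
    then show ?thesis using l by simp
  qed
qed

text \<open>A fixed vertex sees all of an adjacent orbit, and a moved vertex sees exactly one of its
  elements; this is what the ceiling in the folded Cartan matrix expresses.\<close>

lemma sum_simple_root: "(\<Sum>k\<in>orb \<sigma> i. simple_root adj m k) = folded_cartan adj (orb \<sigma> m) (orb \<sigma> i)"
proof (cases "m \<in> orb \<sigma> i")
  case True
  have "(\<Sum>k\<in>orb \<sigma> i. simple_root adj m k) = (\<Sum>k\<in>orb \<sigma> i. if k = m then 2 else 0)"
    using orb_not_adj[OF True] by (intro sum.cong refl) (auto simp: simple_root_def)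
  then show ?thesis using True mem_orb_eq[OF True] by (simp add: folded_cartan_def)
next
  case False
  then have ne: "orb \<sigma> m \<noteq> orb \<sigma> i" using orb_self by metis
  have s: "(\<Sum>k\<in>orb \<sigma> i. simple_root adj m k) = - int (card {k \<in> orb \<sigma> i. adj m k})"
  proof -
    have "(\<Sum>k\<in>orb \<sigma> i. simple_root adj m k) = (\<Sum>k\<in>orb \<sigma> i. if adj m k then - 1 else 0)"
      using False by (intro sum.cong refl) (auto simp: simple_root_def)
    also have "\<dots> = - int (card {k \<in> orb \<sigma> i. adj m k})" by (simp add: sum.If_cases Int_def)
    finally show ?thesis .
  qed
  show ?thesis
  proof (cases "orb_adj adj (orb \<sigma> m) (orb \<sigma> i)")
    case nadj: False
    then have "{k \<in> orb \<sigma> i. adj m k} = {}" using orb_self[of m] by (auto simp: orb_adj_def)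
    then show ?thesis using s ne nadj by (simp add: folded_cartan_def)
  next
    case oadj: True
    then obtain m' k' where mk: "m' \<in> orb \<sigma> m" "k' \<in> orb \<sigma> i" "adj m' k'" by (auto simp: orb_adj_def)
    then obtain l where "m = (\<sigma> ^^ l) m'" using mem_orb_sym orb_memD by blast
    then have k: "adj m ((\<sigma> ^^ l) k')" "(\<sigma> ^^ l) k' \<in> orb \<sigma> i" using mk by auto
    define k where "k = (\<sigma> ^^ l) k'"
    have kk: "adj m k" "orb \<sigma> i = orb \<sigma> k" using k mem_orb_eq by (auto simp: k_def)
    have fc: "folded_cartan adj (orb \<sigma> m) (orb \<sigma> i) = - \<lceil>real (card (orb \<sigma> i)) / real (card (orb \<sigma> m))\<rceil>"
      using ne oadj by (simp add: folded_cartan_def)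
    have "int (card {j \<in> orb \<sigma> k. adj m j}) = \<lceil>real (card (orb \<sigma> k)) / real (card (orb \<sigma> m))\<rceil>"
    proof (cases "\<sigma> m = m")
      case True
      have "{j \<in> orb \<sigma> k. adj m j} = orb \<sigma> k"
        using adj_power[OF True kk(1)] by (auto dest: orb_memD)
      then show ?thesis by (simp add: orb_fixed[OF True])
    next
      case m: False
      have r: "1 < r" "card (orb \<sigma> m) = r" using d_cases[of m] d_moved[OF m] m by (auto simp: orb_size_def)
      show ?thesis
      proof (cases "\<sigma> k = k")
        case True
        then have "{j \<in> orb \<sigma> k. adj m j} = {k}" using kk(1) by (auto simp: orb_fixed)
        moreover have "\<lceil>1 / real r\<rceil> = 1"
          using r(1) by (intro ceiling_unique) auto
        ultimately show ?thesis using r by (simp add: orb_fixed[OF True])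
      next
        case False
        have "card (orb \<sigma> k) = r" using d_moved[OF False] by (simp add: orb_size_def)
        moreover have "{j \<in> orb \<sigma> k. adj m j} = {k}"
          using neighbour_moved_unique[OF False m kk(1)] kk(1) by auto
        ultimately show ?thesis using r by simp
      qed
    qed
    then show ?thesis using s fc kk(2) by simp
  qed
qed

text \<open>The coordinates of the folded root and coroot that a root \<open>x\<close> gives rise to.\<close>

definition folded_root :: "('v \<Rightarrow> int) \<Rightarrow> 'v set \<Rightarrow> int" where
  "folded_root x a = (if a \<in> orbits \<sigma> then orbit_sum x (inv (orb \<sigma>) a) else 0)"

definition folded_coroot :: "('v \<Rightarrow> int) \<Rightarrow> 'v set \<Rightarrow> int" where
  "folded_coroot x a = (if a \<in> orbits \<sigma> then (\<Sum>k\<in>a. x k) else 0)"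

lemma orbits_inv: "a \<in> orbits \<sigma> \<Longrightarrow> orb \<sigma> (inv (orb \<sigma>) a) = a"
  unfolding orbits_def by (rule f_inv_into_f)

lemma orb_orbits [simp]: "orb \<sigma> i \<in> orbits \<sigma>"
  by (simp add: orbits_def)

lemma folded_root_orb [simp]: "folded_root x (orb \<sigma> i) = orbit_sum x i"
proof -
  have "inv (orb \<sigma>) (orb \<sigma> i) \<in> orb \<sigma> i" using orbits_inv[OF orb_orbits, of i] orb_self by metis
  then show ?thesis using inv_orb[OF orbit_sum_sigma] by (simp add: folded_root_def)
qed

lemma orb_eq_iff: "orb \<sigma> k = orb \<sigma> i \<longleftrightarrow> k \<in> orb \<sigma> i"
  using mem_orb_eq orb_self by metis

lemma orbit_fun_eqI:
  assumes "\<And>a. a \<notin> orbits \<sigma> \<Longrightarrow> f a = g a" "\<And>i. f (orb \<sigma> i) = g (orb \<sigma> i)" shows "f = g"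
proof
  show "f a = g a" for a using assms by (cases "a \<in> orbits \<sigma>") (auto simp: orbits_def)
qed

lemma folded_root_sroot: "folded_root (sroot i) = (\<lambda>a. of_bool (a = orb \<sigma> i))"
proof (rule orbit_fun_eqI)
  show "folded_root (sroot i) (orb \<sigma> k) = of_bool (orb \<sigma> k = orb \<sigma> i)" for k
    by (simp add: orbit_sum_sroot orb_eq_iff)
qed (auto simp: folded_root_def)

lemma folded_coroot_sroot: "folded_coroot (sroot i) = (\<lambda>a. of_bool (a = orb \<sigma> i))"
proof (rule orbit_fun_eqI)
  fix j
  have "(\<Sum>k\<in>orb \<sigma> j. sroot i k) = of_bool (i \<in> orb \<sigma> j)" by (simp add: sroot_def of_bool_def)
  then show "folded_coroot (sroot i) (orb \<sigma> j) = of_bool (orb \<sigma> j = orb \<sigma> i)"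
    using orb_eq_iff[of i j] by (auto simp: folded_coroot_def)
qed (auto simp: folded_coroot_def)

lemma pr_folded: assumes "y \<circ> \<sigma> = y"
  shows "pr adj y i = (\<Sum>a\<in>orbits \<sigma>. folded_cartan adj (orb \<sigma> i) a * y (inv (orb \<sigma>) a))"
proof -
  have "pr adj y i = (\<Sum>a\<in>orbits \<sigma>. \<Sum>j\<in>a. simple_root adj i j * y j)"
    unfolding sum_orbits by (simp add: pr_def)
  also have "\<dots> = (\<Sum>a\<in>orbits \<sigma>. (\<Sum>j\<in>a. simple_root adj i j) * y (inv (orb \<sigma>) a))"
    unfolding sum_distrib_right
  proof (intro sum.cong refl)
    fix a j assume a: "a \<in> orbits \<sigma>" "j \<in> a"
    have "y j = y (inv (orb \<sigma>) a)" by (rule inv_orb[OF assms]) (simp add: a orbits_inv)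
    then show "simple_root adj i j * y j = simple_root adj i j * y (inv (orb \<sigma>) a)" by simp
  qed
  also have "\<dots> = (\<Sum>a\<in>orbits \<sigma>. folded_cartan adj (orb \<sigma> i) a * y (inv (orb \<sigma>) a))"
    by (intro sum.cong refl) (use sum_simple_root[of i] orbits_inv in metis)
  finally show ?thesis .
qed

lemma sum_pr_folded:
  "(\<Sum>k\<in>orb \<sigma> i. pr adj x k) = (\<Sum>a\<in>orbits \<sigma>. folded_coroot x a * folded_cartan adj a (orb \<sigma> i))"
proof -
  have "(\<Sum>k\<in>orb \<sigma> i. pr adj x k) = (\<Sum>j\<in>UNIV. x j * (\<Sum>k\<in>orb \<sigma> i. simple_root adj j k))"
    unfolding pr_def sum_distrib_left
    by (subst sum.swap) (intro sum.cong refl, simp add: simple_root_commute mult.commute)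
  also have "\<dots> = (\<Sum>a\<in>orbits \<sigma>. \<Sum>j\<in>a. x j * folded_cartan adj (orb \<sigma> j) (orb \<sigma> i))"
    unfolding sum_orbits sum_simple_root ..
  also have "\<dots> = (\<Sum>a\<in>orbits \<sigma>. folded_coroot x a * folded_cartan adj a (orb \<sigma> i))"
  proof (intro sum.cong refl)
    fix a assume a: "a \<in> orbits \<sigma>"
    then have "orb \<sigma> j = a" if "j \<in> a" for j using that mem_orb_eq orbits_inv by metis
    then show "(\<Sum>j\<in>a. x j * folded_cartan adj (orb \<sigma> j) (orb \<sigma> i)) = folded_coroot x a * folded_cartan adj a (orb \<sigma> i)"
      using a by (simp add: folded_coroot_def sum_distrib_right)
  qed
  finally show ?thesis .
qed

lemma folded_root_orb_refl: "folded_root (orb_refl i x) = (\<lambda>a. folded_root x a -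
    (\<Sum>j\<in>orbits \<sigma>. folded_cartan adj (orb \<sigma> i) j * folded_root x j) * of_bool (a = orb \<sigma> i))"
proof (rule orbit_fun_eqI)
  fix k
  have "(\<Sum>j\<in>orbits \<sigma>. folded_cartan adj (orb \<sigma> i) j * folded_root x j) = pr adj (orbit_sum x) i"
    unfolding pr_folded[OF orbit_sum_sigma] by (intro sum.cong) (auto simp: folded_root_def)
  then show "folded_root (orb_refl i x) (orb \<sigma> k) = folded_root x (orb \<sigma> k) -
    (\<Sum>j\<in>orbits \<sigma>. folded_cartan adj (orb \<sigma> i) j * folded_root x j) * of_bool (orb \<sigma> k = orb \<sigma> i)"
    using pr_orb[OF orbit_sum_sigma, of k i x]
    by (auto simp: orbit_sum_orb_refl orb_refl_def[of i "orbit_sum x"] orb_eq_iff)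
qed (auto simp: folded_root_def)

lemma folded_coroot_orb_refl: "folded_coroot (orb_refl i x) = (\<lambda>a. folded_coroot x a -
    (\<Sum>j\<in>orbits \<sigma>. folded_coroot x j * folded_cartan adj j (orb \<sigma> i)) * of_bool (a = orb \<sigma> i))"
proof (rule orbit_fun_eqI)
  fix k
  show "folded_coroot (orb_refl i x) (orb \<sigma> k) = folded_coroot x (orb \<sigma> k) -
    (\<Sum>j\<in>orbits \<sigma>. folded_coroot x j * folded_cartan adj j (orb \<sigma> i)) * of_bool (orb \<sigma> k = orb \<sigma> i)"
  proof (cases "orb \<sigma> k = orb \<sigma> i")
    case True
    then show ?thesis
      unfolding sum_pr_folded[symmetric] by (simp add: folded_coroot_def orb_refl_def sum_subtractf)
  next
    case False
    have "m \<notin> orb \<sigma> i" if "m \<in> orb \<sigma> k" for m using that False mem_orb_eq by metis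
    then show ?thesis using False by (simp add: folded_coroot_def orb_refl_def)
  qed
qed (auto simp: folded_coroot_def)

text \<open>A folded reflection of the pair of root and coroot is \<open>orb_refl\<close> on the
  roots above it. The converse \<open>root_corootI\<close> treats positive roots, which include the
  highest one.\<close>

lemma root_corootD:
  assumes "(b, g) \<in> root_coroot (orbits \<sigma>) (folded_cartan adj)"
  shows "\<exists>x\<in>roots adj. b = folded_root x \<and> g = folded_coroot x"
  using assms
proof (induction rule: root_coroot.induct)
  case (simple a)
  then obtain i where "a = orb \<sigma> i" by (auto simp: orbits_def)
  then show ?case using folded_root_sroot[of i] folded_coroot_sroot[of i] by (intro bexI[of _ "sroot i"]) auto
next
  case (reflect a b g)
  then obtain i where i: "a = orb \<sigma> i" by (auto simp: orbits_def)
  obtain x where x: "x \<in> roots adj" "b = folded_root x" "g = folded_coroot x" using reflect by blast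
  show ?case
    by (rule bexI[of _ "orb_refl i x"]) (simp_all only: i x folded_root_orb_refl folded_coroot_orb_refl orb_refl_roots simp_thms)
qed

lemma root_corootI:
  assumes "x \<in> pos_roots adj"
  shows "(folded_root x, folded_coroot x) \<in> root_coroot (orbits \<sigma>) (folded_cartan adj)"
  using assms
proof (induction rule: pos_root_orbit_induct)
  case (simple i)
  then show ?case unfolding folded_root_sroot folded_coroot_sroot by (rule root_coroot.simple) simp
next
  case (refl x i)
  show ?case unfolding folded_root_orb_refl folded_coroot_orb_refl by (rule root_coroot.reflect[OF orb_orbits refl(2)])
qed

section \<open>Dominant orbit sums and the highest root\<close>

lemma dominant_support:
  assumes nn: "nonneg y" and dom: "\<And>i. 0 \<le> pr adj y i" and ne: "y \<noteq> 0"
  shows "0 < y i"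
proof -
  obtain j where "y j \<noteq> 0" using ne by (auto simp: fun_eq_iff)
  then have j: "0 < y j" using nn by (simp add: nonneg_def less_le)
  from connected[of j i] show ?thesis
  proof (induction rule: rtranclp_induct)
    case base
    then show ?case by (rule j)
  next
    case (step a b)
    show ?case
    proof (rule ccontr)
      assume "\<not> 0 < y b"
      then have "y b = 0" using nn by (simp add: nonneg_def order.antisym)
      moreover have "y a \<le> (\<Sum>k | adj b k. y k)"
        by (rule member_le_sum) (use step nn in \<open>auto simp: adj_commute nonneg_def\<close>)
      ultimately show False using dom[of b] step by (simp add: pr_alt)
    qed
  qed
qed

lemma ip_dominant_nonneg: "nonneg x \<Longrightarrow> (\<And>i. 0 \<le> pr adj y i) \<Longrightarrow> 0 \<le> ip adj x y"
  unfolding ip_def by (intro sum_nonneg) (simp add: nonneg_def)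

lemma orbit_sum_neq_0: "x \<in> roots adj \<Longrightarrow> orbit_sum x \<noteq> 0"
  using orbit_sum_norm[of x] half_norm_pos[of x] by auto

lemma orbit_sum_sign: "x \<in> roots adj \<Longrightarrow> nonneg (orbit_sum x) \<or> nonneg (- orbit_sum x)"
  using root_sign[of x] orbit_sum_nonneg[of x] orbit_sum_nonneg[of "- x"] by (auto simp: orbit_sum_uminus)

lemma dominant_orbit_sum:
  assumes "x \<in> roots adj" and dom: "\<And>i. 0 \<le> pr adj (orbit_sum x) i"
  shows "0 < orbit_sum x i"
proof (rule dominant_support[OF _ dom orbit_sum_neq_0[OF assms(1)]])
  show "nonneg (orbit_sum x)"
  proof (rule ccontr)
    assume "\<not> nonneg (orbit_sum x)"
    then have "0 \<le> ip adj (- orbit_sum x) (orbit_sum x)"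
      using orbit_sum_sign[OF assms(1)] ip_dominant_nonneg[OF _ dom] by blast
    then show False using ip_pos[OF orbit_sum_neq_0[OF assms(1)]] by (simp add: ip_uminus_left)
  qed
qed

lemma ip_dominant_pos:
  assumes "\<And>i. 0 < x i" and dom: "\<And>i. 0 \<le> pr adj y i" and "y \<noteq> 0"
  shows "0 < ip adj x y"
proof -
  have "\<exists>i. pr adj y i \<noteq> 0"
  proof (rule ccontr)
    assume "\<nexists>i. pr adj y i \<noteq> 0"
    then have "ip adj y y = 0" by (simp add: ip_def)
    then show False using ip_pos[OF assms(3)] by simp
  qed
  then obtain i where "0 < pr adj y i" using dom by (metis order_less_le)
  then have "0 < x i * pr adj y i" using assms(1) by simp
  moreover have "x i * pr adj y i \<le> ip adj x y"
    unfolding ip_def by (rule member_le_sum) (use assms(1) dom in \<open>auto simp: less_imp_le\<close>)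
  ultimately show ?thesis by linarith
qed

text \<open>Among the roots of the same half norm whose orbit sums lie above that of
  \<open>x\<close>, take one with the largest coordinate sum. A negative pairing would let a
  reflection raise it further.\<close>

lemma dominant_above:
  assumes "x \<in> roots adj"
  obtains y where "y \<in> roots adj" "half_norm y = half_norm x" "\<forall>k. orbit_sum x k \<le> orbit_sum y k"
    "\<forall>i. 0 \<le> pr adj (orbit_sum y) i"
proof -
  let ?A = "{y \<in> roots adj. half_norm y = half_norm x \<and> (\<forall>k. orbit_sum x k \<le> orbit_sum y k)}"
  have "finite ?A" "?A \<noteq> {}" using assms by auto
  then obtain y where y: "y \<in> ?A" "\<forall>z\<in>?A. (\<Sum>k\<in>UNIV. orbit_sum z k) \<le> (\<Sum>k\<in>UNIV. orbit_sum y k)"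
    by (rule finite_arg_max)
  have "0 \<le> pr adj (orbit_sum y) i" for i
  proof (rule ccontr)
    assume n: "\<not> 0 \<le> pr adj (orbit_sum y) i"
    have "orbit_sum y k \<le> orbit_sum (orb_refl i y) k" for k
      using n pr_orb[OF orbit_sum_sigma, of k i y]
      by (auto simp: orbit_sum_orb_refl orb_refl_def[of i "orbit_sum y"])
    then have "orb_refl i y \<in> ?A" using y(1) by (auto intro: order_trans)
    from y(2)[rule_format, OF this] have "0 \<le> d i * pr adj (orbit_sum y) i"
      unfolding orbit_sum_orb_refl sum_orb_refl[OF orbit_sum_sigma] by linarith
    then show False using n d_pos[of i] by (simp add: zero_le_mult_iff del: d_pos)
  qed
  then show ?thesis using that y(1) by blast
qed

lemma comp_power_eq: "x \<circ> \<sigma> = x \<Longrightarrow> x \<circ> (\<sigma> ^^ l) = x"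
  using comp_powerD[of x l] by auto

lemma orbit_sum_comp_power: "orbit_sum (x \<circ> (\<sigma> ^^ l)) = orbit_sum x"
proof (cases "x \<circ> \<sigma> = x")
  case True
  then show ?thesis using comp_power_eq[OF True] by simp
next
  case False
  have "(x \<circ> (\<sigma> ^^ l)) \<circ> \<sigma> \<noteq> x \<circ> (\<sigma> ^^ l)"
  proof
    assume e: "(x \<circ> (\<sigma> ^^ l)) \<circ> \<sigma> = x \<circ> (\<sigma> ^^ l)"
    have "x (\<sigma> k) = x k" for k
    proof -
      obtain m where m: "k = (\<sigma> ^^ l) m"
        using power_automorphism[of l] by (auto simp: diagram_automorphism_def bij_def elim: surjE)
      show ?thesis using fun_cong[OF e, of m] m by (simp add: funpow_swap1)
    qed
    then show False using False by auto
  qed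
  moreover have "bar (x \<circ> (\<sigma> ^^ l)) = bar x" using bar_comp_power by blast
  ultimately show ?thesis using False by (simp add: orbit_sum_def)
qed

lemma half_norm_orbit_sum: "x \<in> roots adj \<Longrightarrow> y \<in> roots adj \<Longrightarrow> orbit_sum x = orbit_sum y \<Longrightarrow> half_norm x = half_norm y"
  using orbit_sum_norm[of x] orbit_sum_norm[of y] by simp

lemma half_norm_disj: "(half_norm x = int r \<and> orbit_sum x = bar x) \<or>
    (half_norm x = 1 \<and> x \<circ> \<sigma> = x \<and> orbit_sum x = x \<and> r \<noteq> 1)"
  by (rule half_norm_cases[of x]) auto

lemma bar_r: "half_norm x = int r \<Longrightarrow> orbit_sum x = bar x"
  using half_norm_disj[of x] by auto

lemma ip_orbit_sum_inv: "y \<circ> \<sigma> = y \<Longrightarrow> ip adj (orbit_sum x) y = half_norm x * ip adj x y"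
  using half_norm_disj[of x] ip_bar_inv[of y x] by auto

text \<open>Two dominant orbit sums pair positively. For half norm \<open>r\<close>, translates of
  the roots under \<sigma> then pair positively, so they are equal or their difference is a root,
  whose sign makes the orbit sums comparable. An invariant dominant root \<open>y\<close> of half
  norm 1 is treated through the root \<open>y - \<theta>\<close>: its orbit sum
  \<open>r * y - orbit_sum \<theta>\<close> is bounded by the first case, and
  \<open>r \<ge> 2\<close>.\<close>

lemma highest_root:
  obtains \<theta> where "\<theta> \<in> pos_roots adj" "half_norm \<theta> = int r" "\<forall>i. 0 \<le> pr adj (orbit_sum \<theta>) i"
    "\<forall>x\<in>roots adj. \<forall>k. orbit_sum x k \<le> orbit_sum \<theta> k"
proof -
  let ?A = "{y \<in> roots adj. half_norm y = int r}"
  obtain i where "d i = int r" using exists_d_eq_r by blast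
  then have "sroot i \<in> ?A" by (simp add: half_norm_sroot)
  then have "?A \<noteq> {}" by blast
  moreover have "finite ?A" by simp
  ultimately have "finite ?A" "?A \<noteq> {}" by blast+
  then obtain \<theta>0 where t0: "\<theta>0 \<in> ?A"
    "\<forall>z\<in>?A. (\<Sum>k\<in>UNIV. orbit_sum z k) \<le> (\<Sum>k\<in>UNIV. orbit_sum \<theta>0 k)"
    by (rule finite_arg_max)
  obtain \<theta> where t: "\<theta> \<in> roots adj" "half_norm \<theta> = half_norm \<theta>0" "\<forall>k. orbit_sum \<theta>0 k \<le> orbit_sum \<theta> k"
    "\<forall>i. 0 \<le> pr adj (orbit_sum \<theta>) i" using dominant_above[of \<theta>0] t0(1) by blast
  have er: "half_norm \<theta> = int r" using t(2) t0(1) by simp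
  note dom = t(4)[rule_format]
  have tpos: "0 < orbit_sum \<theta> k" for k by (rule dominant_orbit_sum[OF t(1) dom])
  have "nonneg \<theta>"
  proof (rule ccontr)
    assume "\<not> nonneg \<theta>"
    then have "nonneg (- orbit_sum \<theta>)"
      using root_not_nonneg[OF t(1)] orbit_sum_nonneg[of "- \<theta>"] by (simp add: orbit_sum_uminus)
    then show False using tpos by (simp add: nonneg_def not_le[symmetric])
  qed
  then have tp: "\<theta> \<in> pos_roots adj" using t(1) by (simp add: pos_roots_def)
  have "(\<Sum>k\<in>UNIV. orbit_sum \<theta>0 k) \<le> (\<Sum>k\<in>UNIV. orbit_sum \<theta> k)"
    by (intro sum_mono) (use t(3) in blast)
  then have mx: "(\<Sum>k\<in>UNIV. orbit_sum z k) \<le> (\<Sum>k\<in>UNIV. orbit_sum \<theta> k)" if "z \<in> ?A" for z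
    using t0(2)[rule_format, OF that] by linarith
  have long: "orbit_sum x k \<le> orbit_sum \<theta> k" if x: "x \<in> roots adj" "half_norm x = int r" for x k
  proof -
    obtain y where y: "y \<in> roots adj" "half_norm y = half_norm x" "\<forall>k. orbit_sum x k \<le> orbit_sum y k"
      "\<forall>i. 0 \<le> pr adj (orbit_sum y) i" using dominant_above[OF x(1)] by blast
    have yr: "half_norm y = int r" using y(2) x(2) by simp
    have "0 < ip adj (orbit_sum y) (orbit_sum \<theta>)"
      by (rule ip_dominant_pos[OF dominant_orbit_sum[OF y(1)] dom orbit_sum_neq_0[OF t(1)]])
        (use y(4) in blast)
    then have "0 < int r * ip adj y (orbit_sum \<theta>)"
      using ip_orbit_sum_inv[OF orbit_sum_sigma, of y \<theta>] yr by simp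
    then have "0 < ip adj (orbit_sum \<theta>) y" using r_pos by (simp add: zero_less_mult_iff ip_commute)
    then have "0 < (\<Sum>l<r. ip adj (\<theta> \<circ> (\<sigma> ^^ l)) y)" by (simp add: bar_r[OF er] ip_bar)
    then obtain l where "0 < ip adj (\<theta> \<circ> (\<sigma> ^^ l)) y"
      using sum_nonpos[of "{..<r}" "\<lambda>l. ip adj (\<theta> \<circ> (\<sigma> ^^ l)) y"] by (meson not_le)
    moreover define z where "z = \<theta> \<circ> (\<sigma> ^^ l)"
    ultimately have ipz: "0 < ip adj y z" by (simp add: ip_commute)
    have z: "z \<in> roots adj" using comp_power_roots[OF t(1)] by (simp add: z_def)
    have oz: "orbit_sum z = orbit_sum \<theta>" by (simp add: z_def orbit_sum_comp_power)
    have bz: "bar z = bar \<theta>" using bar_comp_power[of \<theta> l] by (auto simp: z_def)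
    have yx: "orbit_sum x k \<le> orbit_sum y k" using y(3) by blast
    consider "ip adj y z = 2" | "ip adj y z = 1" using ipz root_pairing_le(1)[OF y(1) z] by linarith
    then show ?thesis
    proof cases
      case 1
      then have "y = z" by (rule root_pairing_le(2)[OF y(1) z])
      then show ?thesis using yx oz by simp
    next
      case 2
      then have dr: "y - z \<in> roots adj" by (rule root_pairing_le(3)[OF y(1) z])
      have b: "bar (y - z) m = orbit_sum y m - orbit_sum \<theta> m" for m
        by (simp add: bar_diff bz bar_r[OF er] bar_r[OF yr])
      from bar_sign[OF dr] show ?thesis
      proof
        assume n: "nonneg (bar (y - z))"
        have "(\<Sum>m\<in>UNIV. bar (y - z) m) \<le> 0" using mx[of y] y(1) yr by (simp add: b sum_subtractf)
        moreover have "0 \<le> (\<Sum>m\<in>UNIV. bar (y - z) m)" using n by (auto simp: nonneg_def intro: sum_nonneg)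
        ultimately have "(\<Sum>m\<in>UNIV. bar (y - z) m) = 0" by linarith
        then have "\<forall>m\<in>UNIV. bar (y - z) m = 0"
          using n by (subst (asm) sum_nonneg_eq_0_iff) (auto simp: nonneg_def)
        then have "orbit_sum y k = orbit_sum \<theta> k" using b[of k] by simp
        then show ?thesis using yx by simp
      next
        assume "nonneg (- bar (y - z))"
        then have "bar (y - z) k \<le> 0" by (simp add: nonneg_def)
        then show ?thesis using b[of k] yx by linarith
      qed
    qed
  qed
  have "orbit_sum x k \<le> orbit_sum \<theta> k" if x: "x \<in> roots adj" for x k
  proof -
    consider "half_norm x = int r" | "half_norm x = 1" "x \<circ> \<sigma> = x" "orbit_sum x = x" "r \<noteq> 1"
      using half_norm_disj[of x] by blast
    then show ?thesis
    proof cases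
      case 1
      then show ?thesis by (rule long[OF x])
    next
      case 2
      obtain y where y: "y \<in> roots adj" "half_norm y = half_norm x" "\<forall>k. orbit_sum x k \<le> orbit_sum y k"
        "\<forall>i. 0 \<le> pr adj (orbit_sum y) i" using dominant_above[OF x(1)] by blast
      have ysz: "half_norm y = 1" "half_norm y \<noteq> int r" using 2 y(2) by auto
      then have yi: "y \<circ> \<sigma> = y" "orbit_sum y = y" using half_norm_disj[of y] by blast+
      have "0 < ip adj (orbit_sum y) (orbit_sum \<theta>)"
        by (rule ip_dominant_pos[OF dominant_orbit_sum[OF y(1)] dom orbit_sum_neq_0[OF t(1)]])
          (use y(4) in blast)
      then have "0 < int r * ip adj \<theta> y"
        using ip_orbit_sum_inv[OF yi(1), of \<theta>] er yi(2) by (simp add: ip_commute)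
      then have ip: "0 < ip adj y \<theta>" using r_pos by (simp add: zero_less_mult_iff ip_commute)
      have "ip adj y \<theta> \<noteq> 2" using root_pairing_le(2)[OF y(1) t(1)] ysz er by auto
      then have "ip adj y \<theta> = 1" using ip root_pairing_le(1)[OF y(1) t(1)] by linarith
      then have dr: "y - \<theta> \<in> roots adj" by (rule root_pairing_le(3)[OF y(1) t(1)])
      have "(y - \<theta>) \<circ> \<sigma> \<noteq> y - \<theta>"
      proof
        assume e: "(y - \<theta>) \<circ> \<sigma> = y - \<theta>"
        have "\<theta> (\<sigma> m) = \<theta> m" for m using comp_sigmaD[OF e, of m] comp_sigmaD[OF yi(1), of m] by simp
        then have "\<theta> \<circ> \<sigma> = \<theta>" by auto
        then show False using er ysz(1) 2(4) by (simp add: half_norm_def)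
      qed
      then have "half_norm (y - \<theta>) = int r" by (simp add: half_norm_def)
      from long[OF dr this, of k] bar_r[OF this] have "bar (y - \<theta>) k \<le> orbit_sum \<theta> k" by simp
      then have le: "int r * y k \<le> 2 * orbit_sum \<theta> k"
        by (simp add: bar_diff bar_inv[OF yi(1)] bar_r[OF er])
      have "2 \<le> int r" using 2(4) r_pos by linarith
      moreover have "0 \<le> y k"
        using dominant_orbit_sum[OF y(1), of k] y(4) yi(2) by fastforce
      ultimately have "2 * y k \<le> int r * y k" by (rule mult_right_mono)
      then have "y k \<le> orbit_sum \<theta> k" using le by linarith
      moreover have "orbit_sum x k \<le> y k" using y(3) yi(2) by metis
      ultimately show ?thesis by linarith
    qed
  qed
  then show ?thesis using that[OF tp er] t(4) by blast
qed

lemma sum_gb: "(\<Sum>a\<in>orbits \<sigma>. folded_coroot x a) = (\<Sum>k\<in>UNIV. x k)"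
  unfolding sum_orbits[symmetric] by (intro sum.cong) (auto simp: folded_coroot_def)

lemma folded_root_le_iff: "(\<forall>a\<in>orbits \<sigma>. folded_root x a \<le> folded_root y a) \<longleftrightarrow> (\<forall>k. orbit_sum x k \<le> orbit_sum y k)"
  by (auto simp: orbits_def simp flip: folded_root_orb)

text \<open>The coroot coordinates of \<theta> add up to the coefficient sum of \<theta>, and for
  half norm \<open>r\<close> the coordinates of the orbit sum add up to \<open>r\<close> times as
  much. Maximality fixes only the orbit sum, and that is enough to fix the number.\<close>

lemma dual_coxeter_highest:
  assumes t: "\<theta> \<in> pos_roots adj" "half_norm \<theta> = int r"
    and mx: "\<forall>x\<in>roots adj. \<forall>k. orbit_sum x k \<le> orbit_sum \<theta> k"
  shows "r_dual_coxeter adj \<sigma> = int r + (\<Sum>k\<in>UNIV. orbit_sum \<theta> k)"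
proof -
  let ?R = "root_coroot (orbits \<sigma>) (folded_cartan adj)"
  have s: "int r * (\<Sum>k\<in>UNIV. x k) = (\<Sum>k\<in>UNIV. orbit_sum x k)" if "half_norm x = int r" for x
    using sum_bar[of x] bar_r[OF that] by simp
  have "dual_coxeter (orbits \<sigma>) (folded_cartan adj) = 1 + (\<Sum>k\<in>UNIV. \<theta> k)"
    unfolding dual_coxeter_def
  proof (rule the_equality)
    have bnd: "\<forall>(b, g)\<in>?R. \<forall>i\<in>orbits \<sigma>. b i \<le> folded_root \<theta> i"
    proof safe
      fix b g i assume bg: "(b, g) \<in> ?R" and i: "i \<in> orbits \<sigma>"
      obtain x where "x \<in> roots adj" "b = folded_root x" using root_corootD[OF bg] by blast
      then show "b i \<le> folded_root \<theta> i" using mx folded_root_le_iff[of x \<theta>] i by blast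
    qed
    show "\<exists>t tv. (t, tv) \<in> ?R \<and> (\<forall>(b, g)\<in>?R. \<forall>i\<in>orbits \<sigma>. b i \<le> t i) \<and>
        1 + (\<Sum>k\<in>UNIV. \<theta> k) = 1 + (\<Sum>i\<in>orbits \<sigma>. tv i)"
      by (intro exI[of _ "folded_root \<theta>"] exI[of _ "folded_coroot \<theta>"] conjI root_corootI[OF t(1)] bnd)
        (simp add: sum_gb)
  next
    fix h assume "\<exists>t tv. (t, tv) \<in> ?R \<and> (\<forall>(b, g)\<in>?R. \<forall>i\<in>orbits \<sigma>. b i \<le> t i) \<and>
        h = 1 + (\<Sum>i\<in>orbits \<sigma>. tv i)"
    then obtain t tv where h: "(t, tv) \<in> ?R" "\<forall>(b, g)\<in>?R. \<forall>i\<in>orbits \<sigma>. b i \<le> t i"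
      "h = 1 + (\<Sum>i\<in>orbits \<sigma>. tv i)" by blast
    obtain x where x: "x \<in> roots adj" "t = folded_root x" "tv = folded_coroot x" using root_corootD[OF h(1)] by blast
    have "\<forall>i\<in>orbits \<sigma>. folded_root \<theta> i \<le> folded_root x i" using h(2) root_corootI[OF t(1)] x(2) by blast
    then have ge: "\<forall>k. orbit_sum \<theta> k \<le> orbit_sum x k" unfolding folded_root_le_iff .
    have e: "orbit_sum x = orbit_sum \<theta>"
    proof
      show "orbit_sum x k = orbit_sum \<theta> k" for k
        using mx[rule_format, OF x(1), of k] ge[rule_format, of k] by linarith
    qed
    then have "half_norm x = int r" using half_norm_orbit_sum[OF x(1) pos_rootsD(1)[OF t(1)]] t(2) by simp
    then have "int r * (\<Sum>k\<in>UNIV. x k) = int r * (\<Sum>k\<in>UNIV. \<theta> k)" using s[of x] s[OF t(2)] e by simp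
    then have "(\<Sum>k\<in>UNIV. x k) = (\<Sum>k\<in>UNIV. \<theta> k)" using r_pos by simp
    then show "h = 1 + (\<Sum>k\<in>UNIV. \<theta> k)" using h(3) x(3) sum_gb[of x] by simp
  qed
  then show ?thesis using s[OF t(2)] by (simp add: r_dual_coxeter_def distrib_left)
qed

text \<open>If \<open>x\<close> were not a translate of \<theta>, a translate pairing to 1 with
  \<open>x\<close> would give a root whose sum over \<sigma> is zero. So all pairings would be
  nonpositive, although their total is the positive pairing of \<open>x\<close> with its own orbit
  sum.\<close>

lemma orbit_sum_fibre:
  assumes t: "\<theta> \<in> roots adj" "half_norm \<theta> = int r" and x: "x \<in> roots adj" "orbit_sum x = orbit_sum \<theta>"
  shows "\<exists>l<r. x = \<theta> \<circ> (\<sigma> ^^ l)"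
proof (rule ccontr)
  assume n: "\<not> ?thesis"
  have ex: "half_norm x = int r" using half_norm_orbit_sum[OF x(1) t(1) x(2)] t(2) by simp
  have bx: "bar x = bar \<theta>" using x(2) bar_r[OF ex] bar_r[OF t(2)] by simp
  have le: "ip adj (\<theta> \<circ> (\<sigma> ^^ l)) x \<le> 0" if l: "l < r" for l
  proof (rule ccontr)
    let ?z = "\<theta> \<circ> (\<sigma> ^^ l)"
    assume "\<not> ip adj ?z x \<le> 0"
    moreover have z: "?z \<in> roots adj" by (rule comp_power_roots[OF t(1)])
    moreover have "ip adj ?z x \<noteq> 2" using root_pairing_le(2)[OF z x(1)] n l by metis
    ultimately have "ip adj ?z x = 1" using root_pairing_le(1)[OF z x(1)] by linarith
    then have "?z - x \<in> roots adj" by (rule root_pairing_le(3)[OF z x(1)])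
    moreover have "bar (?z - x) = 0"
      by (rule ext) (simp only: bar_diff bx bar_comp_power zero_fun_apply diff_self)
    ultimately show False using bar_pos_root_neq_0 by blast
  qed
  have "ip adj (bar \<theta>) x \<le> 0" unfolding ip_bar by (rule sum_nonpos) (use le in auto)
  then have "ip adj x (orbit_sum x) \<le> 0" by (simp add: bar_r[OF ex] bx ip_commute)
  then have "ip adj (orbit_sum x) (orbit_sum x) \<le> 0"
    unfolding ip_orbit_sum_inv[OF orbit_sum_sigma] using half_norm_pos(1)[of x] by (simp add: mult_le_0_iff)
  then show False using ip_pos[OF orbit_sum_neq_0[OF x(1)]] by linarith
qed

lemma card_orbit_sum_fibre:
  assumes t: "\<theta> \<in> roots adj" "half_norm \<theta> = int r"
  shows "card {x \<in> roots adj. orbit_sum x = orbit_sum \<theta>} = r"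
proof -
  have "{x \<in> roots adj. orbit_sum x = orbit_sum \<theta>} = (\<lambda>l. \<theta> \<circ> (\<sigma> ^^ l)) ` {..<r}"
    using orbit_sum_fibre[OF t] comp_power_roots[OF t(1)] orbit_sum_comp_power by auto
  moreover have "inj_on (\<lambda>l. \<theta> \<circ> (\<sigma> ^^ l)) {..<r}"
  proof (cases "r = 1")
    case False
    then have ne: "\<theta> \<circ> \<sigma> \<noteq> \<theta>" using t(2) by (auto simp: half_norm_def split: if_splits)
    have step: "k = 0" if k: "\<theta> \<circ> (\<sigma> ^^ k) = \<theta>" "k < r" for k
    proof -
      consider "k = 0" | "k = 1" | "k = 2" "r = 3" using power_cases[OF k(2)] by blast
      then show ?thesis
      proof cases
        case 2
        then show ?thesis using k ne by simp
      next
        case 3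
        have "\<theta> \<circ> \<sigma> = (\<theta> \<circ> (\<sigma> ^^ 2)) \<circ> \<sigma>" using k(1) 3(1) by simp
        also have "\<dots> = \<theta> \<circ> (\<sigma> ^^ r)" unfolding 3(2) by (auto simp: numeral_eq_Suc)
        also have "\<dots> = \<theta>" by auto
        finally show ?thesis using ne by simp
      qed simp
    qed
    have "l = m" if lm: "l \<le> m" "m < r" "\<theta> \<circ> (\<sigma> ^^ l) = \<theta> \<circ> (\<sigma> ^^ m)" for l m
    proof -
      have "\<theta> ((\<sigma> ^^ (m - l)) k) = \<theta> k" for k
      proof -
        obtain j where j: "k = (\<sigma> ^^ l) j"
          using power_automorphism[of l] by (auto simp: diagram_automorphism_def bij_def elim: surjE)
        have "(\<sigma> ^^ (m - l)) ((\<sigma> ^^ l) j) = (\<sigma> ^^ m) j"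
          using lm(1) by (metis comp_apply funpow_add le_add_diff_inverse2)
        then show ?thesis using fun_cong[OF lm(3), of j] j by simp
      qed
      then have "\<theta> \<circ> (\<sigma> ^^ (m - l)) = \<theta>" by auto
      moreover have "m - l < r" using lm(2) by linarith
      ultimately have "m - l = 0" by (rule step)
      then show ?thesis using lm(1) by simp
    qed
    then show ?thesis unfolding inj_on_def by (metis lessThan_iff nat_le_linear)
  qed (simp add: inj_on_def)
  ultimately show ?thesis by (simp add: card_image)
qed

text \<open>The matrix of \<open>y \<mapsto> \<Sum>\<^sub>x (x, y) orbit_sum x\<close> with respect to the orbit sums of the simple roots.\<close>

definition casimir :: "'v \<Rightarrow> 'v \<Rightarrow> int" where
  "casimir i k = (\<Sum>x\<in>roots adj. (\<Sum>m\<in>orb \<sigma> i. pr adj x m) * orbit_sum x k)"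

section \<open>The Casimir operator of the folded root system\<close>

lemma ip_orbit_sum_sroot: "ip adj x (orbit_sum (sroot i)) = (\<Sum>m\<in>orb \<sigma> i. pr adj x m)"
  unfolding ip_commute[of x] by (simp add: ip_def orbit_sum_sroot of_bool_def if_distrib[of "\<lambda>c. c * _"] sum.If_cases cong: if_cong)

text \<open>Substituting \<open>orb_refl i x\<close> for \<open>x\<close> negates the pairings at
  the orbit of \<open>i\<close> but leaves coordinate \<open>k\<close> alone.\<close>

lemma casimir_off: assumes "k \<notin> orb \<sigma> i" shows "casimir i k = 0"
proof -
  have "casimir i k = (\<Sum>x\<in>roots adj. (\<Sum>m\<in>orb \<sigma> i. pr adj (orb_refl i x) m) * orbit_sum (orb_refl i x) k)"
    unfolding casimir_def
    by (rule sum.reindex_bij_witness[of _ "orb_refl i" "orb_refl i"]) auto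
  also have "\<dots> = - casimir i k"
    unfolding casimir_def sum_negf[symmetric] orbit_sum_orb_refl
    using assms by (intro sum.cong refl) (simp add: pr_orb_refl_self orb_refl_def[of i "orbit_sum _"] sum_negf)
  finally show ?thesis by linarith
qed

lemma casimir_sigma: "k \<in> orb \<sigma> i \<Longrightarrow> casimir j k = casimir j i"
  unfolding casimir_def using inv_orb[OF orbit_sum_sigma, of k i] by simp

text \<open>Schur's lemma by hand: the operator is diagonal and self-adjoint, so for adjacent
  \<open>i\<close> and \<open>j\<close>, whose simple orbit sums have nonzero pairing, the diagonal
  entries agree; connectedness does the rest.\<close>

lemma casimir_constant: "casimir i i = casimir j j"
proof -
  have step: "casimir i i = casimir j j" if ij: "adj i j" for i j
  proof -
    let ?p = "\<lambda>i j. (\<Sum>x\<in>roots adj. ip adj x (orbit_sum (sroot i)) * ip adj (orbit_sum x) (orbit_sum (sroot j)))"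
    have p: "?p i j = casimir i i * ip adj (orbit_sum (sroot i)) (orbit_sum (sroot j))" for i j
    proof -
      have "?p i j = (\<Sum>k\<in>UNIV. casimir i k * pr adj (orbit_sum (sroot j)) k)"
        unfolding casimir_def ip_orbit_sum_sroot[symmetric] ip_def[of adj "orbit_sum _"]
          sum_distrib_left sum_distrib_right
        by (subst sum.swap) (simp add: mult.assoc)
      also have "\<dots> = (\<Sum>k\<in>UNIV. casimir i i * (orbit_sum (sroot i) k * pr adj (orbit_sum (sroot j)) k))"
        by (intro sum.cong refl) (auto simp: orbit_sum_sroot casimir_off intro: casimir_sigma)
      finally show ?thesis by (simp add: ip_def sum_distrib_left)
    qed
    have "?p i j = ?p j i"
      unfolding ip_orbit_sum_inv[OF orbit_sum_sigma] by (intro sum.cong refl) simp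
    then have "casimir i i * ip adj (orbit_sum (sroot i)) (orbit_sum (sroot j))
        = casimir j j * ip adj (orbit_sum (sroot i)) (orbit_sum (sroot j))"
      unfolding p by (simp add: ip_commute)
    moreover have "ip adj (orbit_sum (sroot i)) (orbit_sum (sroot j)) \<noteq> 0"
    proof -
      have "k \<notin> orb \<sigma> j" if "k \<in> orb \<sigma> i" for k
        using that orb_not_adj ij mem_orb_eq mem_orb_sym by metis
      then have neg: "pr adj (orbit_sum (sroot j)) k \<le> 0" if "k \<in> orb \<sigma> i" for k
        using that by (auto simp: pr_alt orbit_sum_sroot intro!: sum_nonneg)
      have "i \<notin> orb \<sigma> j" using \<open>\<And>k. k \<in> orb \<sigma> i \<Longrightarrow> k \<notin> orb \<sigma> j\<close> by simp
      moreover have "orbit_sum (sroot j) j \<le> (\<Sum>m | adj i m. orbit_sum (sroot j) m)"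
        by (rule member_le_sum) (use ij in \<open>auto simp: orbit_sum_sroot\<close>)
      ultimately have "pr adj (orbit_sum (sroot j)) i < 0" by (simp add: pr_alt orbit_sum_sroot)
      moreover have "(\<Sum>k\<in>orb \<sigma> i. pr adj (orbit_sum (sroot j)) k) \<le> pr adj (orbit_sum (sroot j)) i"
        using neg by (subst sum.remove[of _ i]) (auto intro!: sum_nonpos)
      ultimately show ?thesis
        using ip_orbit_sum_sroot[of "orbit_sum (sroot j)" i]
          ip_commute[of "orbit_sum (sroot i)" "orbit_sum (sroot j)"] by linarith
    qed
    ultimately show ?thesis by simp
  qed
  from connected[of i j] show ?thesis
    by (induction rule: rtranclp_induct) (use step in auto)
qed

lemma ip_orbit_sum_self: assumes "x \<in> roots adj" shows "ip adj x (orbit_sum x) = 2"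
proof -
  have "half_norm x * ip adj x (orbit_sum x) = 2 * half_norm x"
    using orbit_sum_norm[OF assms] ip_orbit_sum_inv[OF orbit_sum_sigma, of x x] by simp
  then show ?thesis using half_norm_pos(1)[of x] by simp
qed

text \<open>The trace is the sum over all roots of the pairing of a root with its orbit sum, which
  is always 2.\<close>

lemma casimir_trace: "int (card (orbits \<sigma>)) * casimir i i = 4 * int (card (pos_roots adj))"
proof -
  let ?rep = "inv (orb \<sigma>)"
  have "int (card (orbits \<sigma>)) * casimir i i = (\<Sum>a\<in>orbits \<sigma>. casimir (?rep a) (?rep a))"
    by (subst sum.cong[OF refl casimir_constant[of _ i]]) simp
  also have "\<dots> = (\<Sum>x\<in>roots adj. \<Sum>a\<in>orbits \<sigma>. (\<Sum>m\<in>orb \<sigma> (?rep a). pr adj x m) * orbit_sum x (?rep a))"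
    unfolding casimir_def by (rule sum.swap)
  also have "\<dots> = (\<Sum>x\<in>roots adj. 2)"
  proof (intro sum.cong refl)
    fix x assume x: "x \<in> roots adj"
    have "(\<Sum>a\<in>orbits \<sigma>. (\<Sum>m\<in>orb \<sigma> (?rep a). pr adj x m) * orbit_sum x (?rep a))
        = (\<Sum>a\<in>orbits \<sigma>. \<Sum>m\<in>a. orbit_sum x m * pr adj x m)"
    proof (intro sum.cong refl)
      fix a assume a: "a \<in> orbits \<sigma>"
      have "orbit_sum x m = orbit_sum x (?rep a)" if "m \<in> a" for m
        by (rule inv_orb[OF orbit_sum_sigma]) (simp add: that orbits_inv[OF a])
      then show "(\<Sum>m\<in>orb \<sigma> (?rep a). pr adj x m) * orbit_sum x (?rep a) = (\<Sum>m\<in>a. orbit_sum x m * pr adj x m)"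
        by (simp add: orbits_inv[OF a] sum_distrib_right mult.commute)
    qed
    also have "\<dots> = ip adj (orbit_sum x) x" unfolding sum_orbits by (simp add: ip_def)
    also have "\<dots> = 2" using ip_orbit_sum_self[OF x] ip_commute[of x "orbit_sum x"] by simp
    finally show "(\<Sum>a\<in>orbits \<sigma>. (\<Sum>m\<in>orb \<sigma> (?rep a). pr adj x m) * orbit_sum x (?rep a)) = 2" .
  qed
  also have "\<dots> = 2 * (\<Sum>x\<in>pos_roots adj. 2)" by (rule sum_roots_even) simp
  finally show ?thesis by simp
qed

lemma casimir_eigen:
  assumes y: "y \<circ> \<sigma> = y"
  shows "(\<Sum>x\<in>roots adj. ip adj x y * orbit_sum x k) = casimir k k * y k"
proof -
  let ?rep = "inv (orb \<sigma>)"
  have ip: "ip adj x y = (\<Sum>a\<in>orbits \<sigma>. y (?rep a) * (\<Sum>m\<in>orb \<sigma> (?rep a). pr adj x m))" for x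
  proof -
    have "ip adj x y = ip adj y x" by (rule ip_commute)
    also have "\<dots> = (\<Sum>a\<in>orbits \<sigma>. \<Sum>m\<in>a. y m * pr adj x m)"
      unfolding sum_orbits by (simp add: ip_def)
    also have "\<dots> = (\<Sum>a\<in>orbits \<sigma>. y (?rep a) * (\<Sum>m\<in>orb \<sigma> (?rep a). pr adj x m))"
    proof (intro sum.cong refl)
      fix a assume a: "a \<in> orbits \<sigma>"
      have "y m = y (?rep a)" if "m \<in> a" for m
        by (rule inv_orb[OF y]) (simp add: that orbits_inv[OF a])
      then show "(\<Sum>m\<in>a. y m * pr adj x m) = y (?rep a) * (\<Sum>m\<in>orb \<sigma> (?rep a). pr adj x m)"
        by (simp add: orbits_inv[OF a] sum_distrib_left)
    qed
    finally show ?thesis .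
  qed
  have "(\<Sum>x\<in>roots adj. ip adj x y * orbit_sum x k) = (\<Sum>a\<in>orbits \<sigma>. y (?rep a) * casimir (?rep a) k)"
    unfolding ip casimir_def ip_orbit_sum_sroot[symmetric]
    by (subst sum_distrib_right, subst sum.swap) (simp add: sum_distrib_left mult.assoc)
  also have "\<dots> = (\<Sum>a\<in>orbits \<sigma>. if a = orb \<sigma> k then y k * casimir k k else 0)"
  proof (intro sum.cong refl)
    fix a assume a: "a \<in> orbits \<sigma>"
    have k: "k \<in> orb \<sigma> (?rep a) \<longleftrightarrow> a = orb \<sigma> k"
      unfolding orbits_inv[OF a] using a mem_orb_eq orb_self by (auto simp: orbits_def)
    show "y (?rep a) * casimir (?rep a) k = (if a = orb \<sigma> k then y k * casimir k k else 0)"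
    proof (cases "a = orb \<sigma> k")
      case True
      then have kk: "k \<in> orb \<sigma> (?rep a)" using k by simp
      have "y k = y (?rep a)" by (rule inv_orb[OF y kk])
      then show ?thesis using True casimir_sigma[OF kk, of "?rep a"] casimir_constant[of k "?rep a"] by simp
    next
      case False
      then show ?thesis using k casimir_off by simp
    qed
  qed
  also have "\<dots> = casimir k k * y k" by simp
  finally show ?thesis .
qed

text \<open>For half norm \<open>r\<close> the pairing is between -2 and 2, with the extreme values
  only for the same or the opposite orbit sum. For an invariant root of half norm 1,
  \<open>r > 1\<close>, it is 0, \<open>r\<close> or \<open>- r\<close>. The square is therefore
  linear up to a correction, which allows a quadratic sum to be evaluated by
  \<open>sum_pos_roots_pr\<close>.\<close>

lemma pairing_highest_root:
  assumes t: "\<theta> \<in> roots adj" "half_norm \<theta> = int r" and x: "x \<in> roots adj"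
  shows "half_norm x * (ip adj x (orbit_sum \<theta>))\<^sup>2 = int r * \<bar>ip adj x (orbit_sum \<theta>)\<bar>
    + (if orbit_sum x = orbit_sum \<theta> \<or> orbit_sum x = - orbit_sum \<theta> then 2 * int r else 0)"
proof -
  define c where "c = ip adj x (orbit_sum \<theta>)"
  let ?T = "orbit_sum \<theta>" and ?X = "orbit_sum x"
  have TT: "ip adj ?T ?T = 2 * int r" using orbit_sum_norm[OF t(1)] t(2) by simp
  have XX: "ip adj ?X ?X = 2 * half_norm x" by (rule orbit_sum_norm[OF x])
  have XT: "ip adj ?X ?T = half_norm x * c" unfolding c_def by (rule ip_orbit_sum_inv[OF orbit_sum_sigma])
  have TX: "ip adj ?T ?X = half_norm x * c" using XT ip_commute[of ?T ?X] by simp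
  have r0: "0 < int r" using r_pos by linarith
  from half_norm_disj[of x] show ?thesis
  proof (elim disjE conjE)
    assume ex: "half_norm x = int r"
    have m: "ip adj (?X - ?T) (?X - ?T) = 2 * int r * (2 - c)"
      by (simp only: ip_diff_left ip_diff_right TT XX XT TX ex) (simp add: algebra_simps)
    have p: "ip adj (?X + ?T) (?X + ?T) = 2 * int r * (2 + c)"
      by (simp only: ip_add_left ip_add_right TT XX XT TX ex) (simp add: algebra_simps)
    have c2: "c \<le> 2" using ip_nonneg[of "?X - ?T"] m r0 by (simp add: zero_le_mult_iff)
    have c3: "- 2 \<le> c" using ip_nonneg[of "?X + ?T"] p r0 by (simp add: zero_le_mult_iff)
    have e1: "?X = ?T \<longleftrightarrow> c = 2"
    proof
      assume "?X = ?T"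
      then show "c = 2" using XT TT ex r0 by simp
    next
      assume "c = 2"
      then have "ip adj (?X - ?T) (?X - ?T) = 0" using m by simp
      then have "?X - ?T = 0" using ip_pos[of "?X - ?T"] by fastforce
      then show "?X = ?T" by simp
    qed
    have e2: "?X = - ?T \<longleftrightarrow> c = - 2"
    proof
      assume "?X = - ?T"
      then have "int r * c = int r * (- 2)" using XT TT ex by (simp add: ip_uminus_left)
      then show "c = - 2" using r0 unfolding mult_cancel_left by linarith
    next
      assume "c = - 2"
      then have "ip adj (?X + ?T) (?X + ?T) = 0" using p by simp
      then have "?X + ?T = 0" using ip_pos[of "?X + ?T"] by fastforce
      then show "?X = - ?T" by (simp add: eq_neg_iff_add_eq_0)
    qed
    have "c = - 2 \<or> c = - 1 \<or> c = 0 \<or> c = 1 \<or> c = 2" using c2 c3 by linarith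
    then show ?thesis unfolding e1 e2 c_def[symmetric] ex by (elim disjE) simp_all
  next
    assume ex: "half_norm x = 1" "x \<circ> \<sigma> = x" "?X = x" "r \<noteq> 1"
    have "c = int r * ip adj x \<theta>"
      unfolding c_def bar_r[OF t(2)] using ip_bar_inv[OF ex(2), of \<theta>] by (simp add: ip_commute)
    moreover have "x \<noteq> \<theta>" "- x \<noteq> \<theta>" using ex(1,4) t(2) half_norm_uminus[of x] by auto
    then have "ip adj x \<theta> \<noteq> 2" "ip adj (- x) \<theta> \<noteq> 2"
      using root_pairing_le(2)[OF x t(1)] root_pairing_le(2)[of "- x" \<theta>] x t(1) by auto
    then have "ip adj x \<theta> = - 1 \<or> ip adj x \<theta> = 0 \<or> ip adj x \<theta> = 1"
      using root_pairing_le(1)[OF x t(1)] root_pairing_le(1)[of "- x" \<theta>] x t(1)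
      by (simp add: ip_uminus_left) linarith
    moreover have "?X \<noteq> ?T" "?X \<noteq> - ?T"
      using XX TT ex(1,4) by (auto simp: ip_uminus_left ip_uminus_right)
    ultimately show ?thesis unfolding c_def[symmetric] ex(1)
      by (elim disjE) (simp_all add: power2_eq_square)
  qed
qed

text \<open>The Casimir operator is evaluated at the highest orbit sum. The linear part of
  \<open>pairing_highest_root\<close> gives the pairing with \<open>2 * \<rho>\<close>; the
  correction comes from the \<open>r\<close> translates of the highest root and supplies the summand
  \<open>int r\<close> of \<open>dual_coxeter_highest\<close>. So the eigenvalue is
  \<open>2 * r_dual_coxeter\<close>, and the trace turns it into a count of roots.\<close>

lemma r_dual_coxeter_eq: "r_dual_coxeter adj \<sigma> * int (card (orbits \<sigma>)) = 2 * int (card (pos_roots adj))"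
proof -
  obtain \<theta> where t: "\<theta> \<in> pos_roots adj" "half_norm \<theta> = int r" "\<forall>i. 0 \<le> pr adj (orbit_sum \<theta>) i"
    "\<forall>x\<in>roots adj. \<forall>k. orbit_sum x k \<le> orbit_sum \<theta> k" by (rule highest_root)
  let ?T = "orbit_sum \<theta>"
  note tr = pos_rootsD(1)[OF t(1)]
  define f where "f = casimir ctr ctr"
  have ipT: "ip adj x ?T = (\<Sum>k\<in>UNIV. ?T k * pr adj x k)" for x
    by (subst ip_commute) (simp add: ip_def)
  have cc: "casimir k k = f" for k unfolding f_def by (rule casimir_constant)
  have TT: "ip adj ?T ?T = 2 * int r" using orbit_sum_norm[OF tr] t(2) by simp
  have "f * (2 * int r) = (\<Sum>k\<in>UNIV. (f * ?T k) * pr adj ?T k)"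
    unfolding TT[symmetric] by (simp add: ip_def sum_distrib_left mult.assoc)
  also have "\<dots> = (\<Sum>k\<in>UNIV. (\<Sum>x\<in>roots adj. ip adj x ?T * orbit_sum x k) * pr adj ?T k)"
    unfolding casimir_eigen[OF orbit_sum_sigma] cc ..
  also have "\<dots> = (\<Sum>x\<in>roots adj. ip adj x ?T * ip adj (orbit_sum x) ?T)"
    unfolding ip_def[of adj "orbit_sum _"] sum_distrib_left sum_distrib_right
    by (subst sum.swap) (simp add: mult.assoc)
  also have "\<dots> = (\<Sum>x\<in>roots adj. half_norm x * (ip adj x ?T)\<^sup>2)"
    unfolding ip_orbit_sum_inv[OF orbit_sum_sigma] by (intro sum.cong refl) (simp add: power2_eq_square)
  also have "\<dots> = 2 * (\<Sum>x\<in>pos_roots adj. half_norm x * (ip adj x ?T)\<^sup>2)"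
    by (rule sum_roots_even) (simp add: half_norm_uminus ip_uminus_left)
  also have "(\<Sum>x\<in>pos_roots adj. half_norm x * (ip adj x ?T)\<^sup>2)
      = (\<Sum>x\<in>pos_roots adj. int r * ip adj x ?T + (if orbit_sum x = ?T then 2 * int r else 0))"
  proof (intro sum.cong refl)
    fix x assume x: "x \<in> pos_roots adj"
    have "0 \<le> ip adj x ?T" by (rule ip_dominant_nonneg) (use pos_rootsD[OF x] t(3) in auto)
    moreover have "orbit_sum x \<noteq> - ?T"
    proof
      assume e: "orbit_sum x = - ?T"
      have "?T i = 0" for i
        using orbit_sum_nonneg[OF pos_rootsD(2)[OF x]] orbit_sum_nonneg[OF pos_rootsD(2)[OF t(1)]]
        unfolding e nonneg_def by (simp add: order.antisym)
      then have "?T = 0" by auto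
      then show False using orbit_sum_neq_0[OF tr] by simp
    qed
    ultimately show "half_norm x * (ip adj x ?T)\<^sup>2 = int r * ip adj x ?T + (if orbit_sum x = ?T then 2 * int r else 0)"
      using pairing_highest_root[OF tr t(2) pos_rootsD(1)[OF x]] by simp
  qed
  also have "\<dots> = int r * (\<Sum>x\<in>pos_roots adj. ip adj x ?T)
      + 2 * int r * int (card {x \<in> pos_roots adj. orbit_sum x = ?T})"
    by (simp add: sum.distrib sum_distrib_left sum.If_cases Int_def)
  also have "{x \<in> pos_roots adj. orbit_sum x = ?T} = {x \<in> roots adj. orbit_sum x = ?T}"
  proof -
    have "nonneg x" if x: "x \<in> roots adj" "orbit_sum x = ?T" for x
    proof (rule ccontr)
      assume "\<not> nonneg x"
      then have n: "nonneg (- ?T)"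
        using root_not_nonneg[OF x(1)] orbit_sum_nonneg[of "- x"] x(2) by (simp add: orbit_sum_uminus)
      have "?T i = 0" for i
        using n orbit_sum_nonneg[OF pos_rootsD(2)[OF t(1)]]
        unfolding nonneg_def by (simp add: order.antisym)
      then have "?T = 0" by auto
      then show False using orbit_sum_neq_0[OF tr] by simp
    qed
    then show ?thesis by (auto simp: pos_roots_def)
  qed
  also have "card {x \<in> roots adj. orbit_sum x = ?T} = r" by (rule card_orbit_sum_fibre[OF tr t(2)])
  also have "(\<Sum>x\<in>pos_roots adj. ip adj x ?T) = (\<Sum>k\<in>UNIV. ?T k * (\<Sum>x\<in>pos_roots adj. pr adj x k))"
    unfolding ipT sum_distrib_left by (rule sum.swap)
  also have "\<dots> = 2 * (\<Sum>k\<in>UNIV. ?T k)" by (simp add: sum_pos_roots_pr sum_distrib_left mult.commute)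
  finally have "int r * (2 * f) = int r * (4 * (int r + (\<Sum>k\<in>UNIV. ?T k)))" by (simp add: algebra_simps)
  then have "f = 2 * r_dual_coxeter adj \<sigma>"
    using r_pos dual_coxeter_highest[OF t(1,2,4)] by simp
  then show ?thesis using casimir_trace[of ctr] by (simp add: f_def mult.commute)
qed

end

context folded_parity
begin

lemma hp_eq: "hp = r_dual_coxeter adj \<sigma>"
proof -
  have "card (orbits \<sigma>) \<noteq> 0" by (simp add: orbits_def)
  then show ?thesis using card_pos_roots_hp r_dual_coxeter_eq by (simp del: card_0_eq)
qed

section \<open>The twisted Auslander--Reiten quiver\<close>

definition column_set :: "('v \<Rightarrow> int) \<Rightarrow> ('v \<Rightarrow> int) \<Rightarrow> ('v \<times> int) set" where
  "column_set \<xi> \<eta> = {(i, p). lat i p \<and> \<eta> i < p \<and> p \<le> \<xi> i}"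

definition pos :: "('v \<Rightarrow> int) \<Rightarrow> 'v list \<Rightarrow> nat \<Rightarrow> 'v \<times> int" where
  "pos \<xi> is k = (is ! k, endpoint \<xi> (take k is) (is ! k))"

lemma verts_AR:
  assumes "\<xi> \<in> QD"
  shows "verts (twisted_AR_quiver adj \<sigma> \<epsilon> \<xi>) = column_set \<xi> (twist \<xi>)"
proof -
  have "(i, p) \<in> verts (twisted_AR_quiver adj \<sigma> \<epsilon> \<xi>) \<longleftrightarrow> (i, p) \<in> column_set \<xi> (twist \<xi>)" for i p
  proof
    assume a: "(i, p) \<in> verts (twisted_AR_quiver adj \<sigma> \<epsilon> \<xi>)"
    then show "(i, p) \<in> column_set \<xi> (twist \<xi>)"
      by (auto simp: twisted_AR_quiver_def full_subquiver_def repetition_quiver_def Let_def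
          column_set_def lat_def twist_def hp_eq)
  next
    assume a: "(i, p) \<in> column_set \<xi> (twist \<xi>)"
    then have l: "lat i p" and b: "twist \<xi> i < p" "p \<le> \<xi> i" by (auto simp: column_set_def)
    have "2 * d i dvd \<xi> i - p" using lat_diff[OF QD_lat[OF assms]] l by blast
    then obtain k where k: "\<xi> i - p = 2 * d i * k" by blast
    then have "p = \<xi> i - 2 * d i * k" by simp
    moreover have "0 \<le> 2 * d i * k" "2 * d i * k < r_dual_coxeter adj \<sigma> + \<xi> i - \<xi> (star adj i)"
      using b unfolding k[symmetric] by (simp_all add: twist_def hp_eq)
    ultimately show "(i, p) \<in> verts (twisted_AR_quiver adj \<sigma> \<epsilon> \<xi>)"
      using l by (auto simp: twisted_AR_quiver_def full_subquiver_def repetition_quiver_def Let_def lat_def)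
  qed
  then show ?thesis by auto
qed

lemma arrows_AR:
  assumes "\<xi> \<in> QD" "(i, p) \<in> column_set \<xi> (twist \<xi>)" "(j, s) \<in> column_set \<xi> (twist \<xi>)"
  shows "((i, p), (j, s)) \<in> arrows (twisted_AR_quiver adj \<sigma> \<epsilon> \<xi>) \<longleftrightarrow> adj i j \<and> s - p = min (d i) (d j)"
proof -
  have v: "(i, p) \<in> verts (twisted_AR_quiver adj \<sigma> \<epsilon> \<xi>)" "(j, s) \<in> verts (twisted_AR_quiver adj \<sigma> \<epsilon> \<xi>)"
    using assms verts_AR by auto
  have "arrows (twisted_AR_quiver adj \<sigma> \<epsilon> \<xi>) =
    {((i, p), (j, s)). adj i j \<and> s - p = min (d i) (d j) \<and>
      (i, p) \<in> verts (twisted_AR_quiver adj \<sigma> \<epsilon> \<xi>) \<and> (j, s) \<in> verts (twisted_AR_quiver adj \<sigma> \<epsilon> \<xi>)}"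
    by (auto simp: twisted_AR_quiver_def full_subquiver_def repetition_quiver_def Let_def)
  then show ?thesis using v by simp
qed

lemma endpoint_take_Suc:
  "k < length is \<Longrightarrow> endpoint \<xi> (take (Suc k) is) = Q_reflect \<sigma> (is ! k) (endpoint \<xi> (take k is))"
  by (simp add: take_Suc_conv_app_nth endpoint_append endpoint_Cons)

lemma endpoint_take_antimono: "a \<le> b \<Longrightarrow> endpoint \<xi> (take b is) i \<le> endpoint \<xi> (take a is) i"
proof -
  assume "a \<le> b"
  then have "take b is = take a is @ take (b - a) (drop a is)" by (metis le_add_diff_inverse take_add)
  then show ?thesis by (simp add: endpoint_append endpoint_le)
qed

lemma endpoint_take_less:
  assumes "a < b" "a < length is"
  shows "endpoint \<xi> (take b is) (is ! a) \<le> endpoint \<xi> (take a is) (is ! a) - 2 * d (is ! a)"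
  using endpoint_take_antimono[of "Suc a" b \<xi> "is" "is ! a"] assms
  by (simp add: endpoint_take_Suc Q_reflect_def)

lemma endpoint_take_constant:
  assumes "a \<le> b" "b \<le> length is" "\<And>c. a \<le> c \<Longrightarrow> c < b \<Longrightarrow> is ! c \<noteq> i"
  shows "endpoint \<xi> (take b is) i = endpoint \<xi> (take a is) i"
  using assms
proof (induction b)
  case (Suc b)
  show ?case
  proof (cases "a = Suc b")
    case False
    then have "is ! b \<noteq> i" "endpoint \<xi> (take b is) i = endpoint \<xi> (take a is) i"
      using Suc.IH Suc.prems by auto
    then show ?thesis using Suc.prems(2) by (auto simp: endpoint_take_Suc Q_reflect_def)
  qed simp
qed simp

lemma pos_inj: "inj_on (pos \<xi> is) {..<length is}"
proof (rule linorder_inj_onI)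
  fix a b assume ab: "a < b" "a \<in> {..<length is}" "b \<in> {..<length is}"
  show "pos \<xi> is a \<noteq> pos \<xi> is b"
  proof
    assume e: "pos \<xi> is a = pos \<xi> is b"
    then have e1: "is ! a = is ! b" and e2: "endpoint \<xi> (take a is) (is ! a) = endpoint \<xi> (take b is) (is ! b)"
      unfolding pos_def prod.inject by blast+
    have "endpoint \<xi> (take b is) (is ! a) = endpoint \<xi> (take a is) (is ! a)" using e2 by (simp only: e1)
    then show False using endpoint_take_less[of a b "is" \<xi>] ab d_pos[of "is ! a"] by (simp del: d_pos)
  qed
qed auto

lemma pos_image:
  assumes "\<And>i. lat i (\<xi> i)"
  shows "pos \<xi> is ` {..<length is} = column_set \<xi> (endpoint \<xi> is)"
proof (induction "is" rule: rev_induct)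
  case Nil
  show ?case by (auto simp: column_set_def)
next
  case (snoc x "is")
  let ?e = "endpoint \<xi> is"
  have le: "lat x (?e x)" unfolding endpoint_count using lat_minus[of x "\<xi> x"] assms by simp
  have "pos \<xi> (is @ [x]) ` {..<length (is @ [x])} = insert (x, ?e x) (pos \<xi> is ` {..<length is})"
    by (auto simp: pos_def lessThan_Suc nth_append image_def)
  also have "\<dots> = insert (x, ?e x) (column_set \<xi> ?e)" unfolding snoc ..
  also have "\<dots> = column_set \<xi> (endpoint \<xi> (is @ [x]))"
  proof -
    have "(i, p) \<in> insert (x, ?e x) (column_set \<xi> ?e) \<longleftrightarrow> (i, p) \<in> column_set \<xi> (endpoint \<xi> (is @ [x]))" for i p
    proof (cases "i = x")
      case True
      have "?e x - 2 * d x < p \<longleftrightarrow> ?e x < p \<or> p = ?e x" if l: "lat x p"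
      proof (cases "p < ?e x")
        case True
        then show ?thesis using lat_gap[OF l le True] by linarith
      next
        case False
        then show ?thesis using d_pos[of x] by (simp del: d_pos) linarith
      qed
      then show ?thesis using True le endpoint_le[of \<xi> "is" x]
        by (auto simp: column_set_def endpoint_append endpoint_Cons Q_reflect_def)
    next
      case False
      then show ?thesis by (auto simp: column_set_def endpoint_append endpoint_Cons Q_reflect_def)
    qed
    then show ?thesis by (metis subrelI subset_antisym)
  qed
  finally show ?case .
qed

text \<open>Pairs of a removed vertex and the root attached to it, taken as a set so that the order
  of removal is forgotten. The map \<open>A\<close> accumulates the letters already read, which
  makes recursion on the word possible.\<close>

definition trace :: "('v \<Rightarrow> int) \<Rightarrow> (('v \<Rightarrow> int) \<Rightarrow> 'v \<Rightarrow> int) \<Rightarrow> 'v list \<Rightarrow> (('v \<times> int) \<times> ('v \<Rightarrow> int)) set" where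
  "trace \<xi> A is = (\<lambda>k. (pos \<xi> is k, A (act adj (take k is) (sroot (is ! k))))) ` {..<length is}"

lemma trace_Cons:
  "trace \<xi> A (i # is) = insert ((i, \<xi> i), A (sroot i)) (trace (Q_reflect \<sigma> i \<xi>) (A \<circ> refl adj i) is)"
  unfolding trace_def by (simp add: lessThan_Suc_eq_insert_0 image_image pos_def endpoint_Cons act_Cons)

lemma trace_comm_step: "comm_step adj is js \<Longrightarrow> trace \<xi> A is = trace \<xi> A js"
proof -
  assume "comm_step adj is js"
  then obtain us i j vs where w: "is = us @ [i, j] @ vs" "js = us @ [j, i] @ vs" "\<not> adj i j"
    by (auto simp: comm_step_def)
  have "trace \<xi> A (us @ i # j # vs) = trace \<xi> A (us @ j # i # vs)"
  proof (induction us arbitrary: \<xi> A)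
    case Nil
    show ?case
    proof (cases "i = j")
      case False
      have "refl adj i (sroot j) = sroot j" "refl adj j (sroot i) = sroot i"
        using False w(3) adj_sym[of j i] by (auto simp: refl_def pr_sroot simple_root_def)
      moreover have "A \<circ> refl adj i \<circ> refl adj j = A \<circ> refl adj j \<circ> refl adj i"
        using refl_commute[OF w(3)] by auto
      moreover have "Q_reflect \<sigma> i \<xi> j = \<xi> j" "Q_reflect \<sigma> j \<xi> i = \<xi> i"
        using False by (auto simp: Q_reflect_def)
      ultimately show ?thesis
        using reflect_commute[of j i \<xi>] by (simp add: trace_Cons insert_commute)
    qed simp
  next
    case (Cons a us)
    show ?case unfolding append_Cons trace_Cons Cons.IH ..
  qed
  then show ?thesis using w by simp
qed

lemma trace_comm_steps: "(comm_step adj)\<^sup>*\<^sup>* is js \<Longrightarrow> trace \<xi> A is = trace \<xi> A js"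
  by (induction rule: rtranclp_induct) (auto dest: trace_comm_step)

lemma adapted_source_nth:
  assumes "adapted adj \<sigma> \<xi> is" "k < length is"
  shows "source adj (endpoint \<xi> (take k is)) (is ! k)"
proof -
  have "is = take k is @ is ! k # drop (Suc k) is" using assms(2) by (rule id_take_nth_drop)
  then have "adapted adj \<sigma> \<xi> (take k is @ is ! k # drop (Suc k) is)" using assms(1) by simp
  then show ?thesis by (simp only: adapted_append adapted.simps)
qed

lemma adapted_take: "adapted adj \<sigma> \<xi> is \<Longrightarrow> adapted adj \<sigma> \<xi> (take k is)"
  using adapted_append[of \<xi> "take k is" "drop k is"] by simp

lemma adapted_order:
  assumes ad: "adapted adj \<sigma> \<xi> is" and ij: "adj (is ! a) (is ! b)"
    and ab: "a < b" "b < length is"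
  shows "snd (pos \<xi> is b) < snd (pos \<xi> is a)"
proof -
  have "endpoint \<xi> (take a is) (is ! b) < endpoint \<xi> (take a is) (is ! a)"
    using adapted_source_nth[OF ad, of a] ab ij by (simp add: source_def)
  then show ?thesis using endpoint_take_antimono[of a b \<xi> "is" "is ! b"] ab by (simp add: pos_def)
qed

text \<open>A further removal in either column costs \<open>2 * d\<close>, more than a difference
  equal to the minimum allows. Conversely, with no such letter in between, the levels differ by less
  than twice the minimum, and the congruence of adjacent columns leaves only the minimum.\<close>

lemma adapted_consecutive:
  assumes x: "\<xi> \<in> QD" and ad: "adapted adj \<sigma> \<xi> is"
    and ij: "adj (is ! a) (is ! b)" and l: "a < length is" "b < length is"
  shows "snd (pos \<xi> is a) - snd (pos \<xi> is b) = min (d (is ! a)) (d (is ! b)) \<longleftrightarrow>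
    a < b \<and> \<not> (\<exists>c. a < c \<and> c < b \<and> is ! c \<in> {is ! a, is ! b})"
proof
  assume e: "snd (pos \<xi> is a) - snd (pos \<xi> is b) = min (d (is ! a)) (d (is ! b))"
  have dp: "0 < d (is ! a)" "0 < d (is ! b)" by simp_all
  have ab: "a < b"
  proof (rule ccontr)
    assume "\<not> a < b"
    moreover have "a \<noteq> b" using ij adj_irrefl by auto
    ultimately have "b < a" by simp
    then have "snd (pos \<xi> is a) < snd (pos \<xi> is b)"
      using adapted_order[OF ad _ _ l(1)] adj_sym[OF ij] by blast
    then show False using e dp by linarith
  qed
  moreover have "\<not> (a < c \<and> c < b \<and> is ! c \<in> {is ! a, is ! b})" for c
  proof
    assume c: "a < c \<and> c < b \<and> is ! c \<in> {is ! a, is ! b}"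
    then have cl: "c < length is" using l by simp
    from c consider "is ! c = is ! a" | "is ! c = is ! b" by blast
    then show False
    proof cases
      case 1
      have "snd (pos \<xi> is b) < snd (pos \<xi> is c)"
        using adapted_order[OF ad _ _ l(2), of c] c ij 1 by simp
      moreover have "snd (pos \<xi> is c) \<le> snd (pos \<xi> is a) - 2 * d (is ! a)"
        using endpoint_take_less[of a c "is" \<xi>] c l 1 by (simp add: pos_def)
      ultimately show False using e dp by linarith
    next
      case 2
      have "snd (pos \<xi> is c) < snd (pos \<xi> is a)"
        using adapted_order[OF ad _ _ cl, of a] c ij 2 by simp
      moreover have "snd (pos \<xi> is b) \<le> snd (pos \<xi> is c) - 2 * d (is ! b)"
        using endpoint_take_less[of c b "is" \<xi>] c cl 2 by (simp add: pos_def)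
      ultimately show False using e dp by linarith
    qed
  qed
  ultimately show "a < b \<and> \<not> (\<exists>c. a < c \<and> c < b \<and> is ! c \<in> {is ! a, is ! b})" by blast
next
  assume ab: "a < b \<and> \<not> (\<exists>c. a < c \<and> c < b \<and> is ! c \<in> {is ! a, is ! b})"
  let ?i = "is ! a" and ?j = "is ! b"
  let ?s = "endpoint \<xi> (take a is) ?i" and ?p = "endpoint \<xi> (take b is) ?j"
  have lt: "?p < ?s" using adapted_order[OF ad ij _ l(2)] ab by (simp add: pos_def)
  have nij: "?i \<noteq> ?j" using ij adj_irrefl by metis
  have "endpoint \<xi> (take b is) ?i = endpoint \<xi> (take (Suc a) is) ?i"
    by (rule endpoint_take_constant) (use ab l in \<open>auto simp: Suc_le_eq\<close>)
  also have "\<dots> = ?s - 2 * d ?i" using l by (simp add: endpoint_take_Suc Q_reflect_def)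
  finally have "endpoint \<xi> (take b is) ?i = ?s - 2 * d ?i" .
  moreover have "endpoint \<xi> (take b is) ?i < ?p"
    using adapted_source_nth[OF ad l(2)] adj_sym[OF ij] by (simp add: source_def)
  ultimately have "?s - 2 * d ?i < ?p" by linarith
  moreover have "?s < ?p + 2 * d ?j"
  proof -
    have "?p = endpoint \<xi> (take a is) ?j"
    proof (rule endpoint_take_constant)
      fix c assume "a \<le> c" "c < b"
      then show "is ! c \<noteq> ?j" using ab nij by (cases "a = c") auto
    qed (use ab l in auto)
    then show ?thesis using QD_less[OF adapted_QD[OF x adapted_take[OF ad, of a]] ij] by simp
  qed
  ultimately have b: "0 < ?s - ?p" "?s - ?p < 2 * min (d ?i) (d ?j)" using lt by auto
  have "lat ?i ?s" "lat ?j ?p" using QD_lat adapted_QD[OF x adapted_take[OF ad]] by blast+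
  then obtain k where k: "?s - ?p = min (d ?i) (d ?j) + 2 * min (d ?i) (d ?j) * k"
    using lat_adj[OF ij] by metis
  define m where "m = min (d ?i) (d ?j)"
  have m: "0 < m" by (simp add: m_def)
  have "0 < m * (1 + 2 * k)" "m * (1 + 2 * k) < m * 2" using b k unfolding m_def[symmetric]
    by (simp_all add: algebra_simps)
  then have "0 < 1 + 2 * k" "1 + 2 * k < 2" using m by (simp_all add: zero_less_mult_iff mult_less_cancel_left)
  then have "k = 0" by linarith
  then show "snd (pos \<xi> is a) - snd (pos \<xi> is b) = min (d ?i) (d ?j)" using k by (simp add: pos_def)
qed

text \<open>The map is read off from one adapted word \<open>w\<close>. Equality of traces shows
  that every other word of the class defines the same map, so an arrow of the combinatorial quiver
  can be analysed in the word from which it comes.\<close>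

lemma AR_iso_exists:
  assumes x: "\<xi> \<in> QD"
  obtains f where "f \<in> extensional (column_set \<xi> (twist \<xi>))"
    "quiver_iso (twisted_AR_quiver adj \<sigma> \<epsilon> \<xi>) (comb_AR_quiver adj (adapted_words adj \<sigma> \<xi>)) f"
    "\<forall>v\<in>column_set \<xi> (twist \<xi>). residue adj (adapted_words adj \<sigma> \<xi>) (f v) = fst v"
proof -
  obtain w where w: "w \<in> adapted_words adj \<sigma> \<xi>" using adapted_words_nonempty[OF x] by blast
  let ?V = "column_set \<xi> (twist \<xi>)"
  have wr: "w \<in> reduced_words adj" using w by (simp add: adapted_words_def)
  have ww: "adapted adj \<sigma> \<xi> js" "endpoint \<xi> js = twist \<xi>" if "js \<in> adapted_words adj \<sigma> \<xi>" for js
    using adapted_words_iff[OF x] that by blast+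
  have bij: "bij_betw (pos \<xi> js) {..<length js} ?V" if "js \<in> adapted_words adj \<sigma> \<xi>" for js
    using pos_inj pos_image[of \<xi> js] QD_lat[OF x] ww(2)[OF that] by (simp add: bij_betw_def)
  have rbij: "bij_betw (word_root adj w) {..<length w} (positive_roots adj)"
  proof -
    have "inj_on (word_root adj w) {..<length w}"
      unfolding word_root_pr using word_roots_inj[of w] wr pr_inj
      by (auto simp: inj_on_def reduced_words_iff)
    moreover have "word_root adj w ` {..<length w} = positive_roots adj"
      unfolding positive_roots_eq word_root_pr word_roots_image[OF wr, symmetric] image_image ..
    ultimately show ?thesis by (simp add: bij_betw_def)
  qed
  define f where "f = restrict (\<lambda>v. word_root adj w (inv_into {..<length w} (pos \<xi> w) v)) ?V"
  have fw: "f (pos \<xi> w k) = word_root adj w k" if "k < length w" for k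
    using that bij_betwE[OF bij[OF w]] by (simp add: f_def inv_into_f_f pos_inj)
  have fj: "f (pos \<xi> js k) = word_root adj js k" if js: "js \<in> adapted_words adj \<sigma> \<xi>" "k < length js" for js k
  proof -
    have "trace \<xi> id w = trace \<xi> id js"
      using adapted_words_class[OF x w] js(1) trace_comm_steps by (auto simp: comm_class_def)
    moreover have "(pos \<xi> js k, act adj (take k js) (sroot (js ! k))) \<in> trace \<xi> id js"
      using js(2) by (auto simp: trace_def)
    ultimately have "(pos \<xi> js k, act adj (take k js) (sroot (js ! k))) \<in> trace \<xi> id w" by simp
    then obtain k' where "k' < length w" "pos \<xi> w k' = pos \<xi> js k"
      "act adj (take k' w) (sroot (w ! k')) = act adj (take k js) (sroot (js ! k))"
      unfolding trace_def by auto
    then show ?thesis using fw[of k'] by (simp add: word_root_pr)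
  qed
  have fbij: "bij_betw f ?V (positive_roots adj)"
  proof -
    have "bij_betw (word_root adj w \<circ> inv_into {..<length w} (pos \<xi> w)) ?V (positive_roots adj)"
      using bij_betw_trans[OF bij_betw_inv_into[OF bij[OF w]] rbij] .
    then show ?thesis by (rule bij_betw_cong[THEN iffD1, rotated]) (simp add: f_def)
  qed
  have surj: "?V = pos \<xi> w ` {..<length w}" using bij_betw_imp_surj_on[OF bij[OF w]] by simp
  have finj: "inj_on f ?V" using fbij by (simp add: bij_betw_def)
  have "quiver_iso (twisted_AR_quiver adj \<sigma> \<epsilon> \<xi>) (comb_AR_quiver adj (adapted_words adj \<sigma> \<xi>)) f"
    unfolding quiver_iso_def verts_AR[OF x]
  proof (intro conjI ballI)
    show "bij_betw f ?V (verts (comb_AR_quiver adj (adapted_words adj \<sigma> \<xi>)))"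
      using fbij by (simp add: comb_AR_quiver_def)
  next
    fix u v assume uv: "u \<in> ?V" "v \<in> ?V"
    obtain i p j s where e: "u = (i, p)" "v = (j, s)" by fastforce
    have arr: "(u, v) \<in> arrows (twisted_AR_quiver adj \<sigma> \<epsilon> \<xi>) \<longleftrightarrow> adj i j \<and> s - p = min (d i) (d j)"
      using arrows_AR[OF x] uv e by simp
    show "(u, v) \<in> arrows (twisted_AR_quiver adj \<sigma> \<epsilon> \<xi>) \<longleftrightarrow>
      (f u, f v) \<in> arrows (comb_AR_quiver adj (adapted_words adj \<sigma> \<xi>))"
    proof
      assume "(u, v) \<in> arrows (twisted_AR_quiver adj \<sigma> \<epsilon> \<xi>)"
      then have a: "adj j i" "s - p = min (d j) (d i)" using arr adj_sym by (auto simp: min.commute)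
      obtain k l where kl: "k < length w" "l < length w" "pos \<xi> w k = u" "pos \<xi> w l = v"
        using surj uv by (metis imageE lessThan_iff)
      then have "w ! k = i" "w ! l = j" "snd (pos \<xi> w k) = p" "snd (pos \<xi> w l) = s"
        using e by (auto simp: pos_def)
      then have "l < k \<and> \<not> (\<exists>c. l < c \<and> c < k \<and> w ! c \<in> {w ! l, w ! k})" "adj (w ! l) (w ! k)"
        using adapted_consecutive[OF x ww(1)[OF w], of l k] a kl by auto
      then have "(word_root adj w k, word_root adj w l) \<in> arrows (comb_AR_quiver adj (adapted_words adj \<sigma> \<xi>))"
        using w kl(1) by (auto simp: comb_AR_quiver_def)
      then show "(f u, f v) \<in> arrows (comb_AR_quiver adj (adapted_words adj \<sigma> \<xi>))"
        using fw kl by metis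
    next
      assume "(f u, f v) \<in> arrows (comb_AR_quiver adj (adapted_words adj \<sigma> \<xi>))"
      then obtain js l k where a: "f u = word_root adj js k" "f v = word_root adj js l"
        "js \<in> adapted_words adj \<sigma> \<xi>" "l < k" "k < length js" "adj (js ! l) (js ! k)"
        "\<not> (\<exists>c. l < c \<and> c < k \<and> js ! c \<in> {js ! l, js ! k})"
        unfolding comb_AR_quiver_def quiver.simps by blast
      have u: "u = pos \<xi> js k"
        by (rule inj_onD[OF finj]) (use a fj bij_betwE[OF bij[OF a(3)]] uv in auto)
      have v: "v = pos \<xi> js l"
        by (rule inj_onD[OF finj]) (use a fj bij_betwE[OF bij[OF a(3)]] uv in auto)
      have "snd (pos \<xi> js l) - snd (pos \<xi> js k) = min (d (js ! l)) (d (js ! k))"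
        using adapted_consecutive[OF x ww(1)[OF a(3)] a(6)] a(4,5,7) by simp
      then have "adj i j \<and> s - p = min (d i) (d j)"
        using u v e a(6) adj_sym by (auto simp: pos_def min.commute)
      then show "(u, v) \<in> arrows (twisted_AR_quiver adj \<sigma> \<epsilon> \<xi>)" using arr by simp
    qed
  qed
  moreover have "residue adj (adapted_words adj \<sigma> \<xi>) (f v) = fst v" if v: "v \<in> ?V" for v
    unfolding residue_def
  proof (rule the_equality)
    obtain k where "k < length w" "pos \<xi> w k = v"
      using surj v by (metis imageE lessThan_iff)
    then show "\<exists>is\<in>adapted_words adj \<sigma> \<xi>. \<exists>k<length is. word_root adj is k = f v \<and> is ! k = fst v"
      using w fw by (intro bexI[of _ w] exI[of _ k]) (auto simp: pos_def)
  next
    fix i assume "\<exists>is\<in>adapted_words adj \<sigma> \<xi>. \<exists>k<length is. word_root adj is k = f v \<and> is ! k = i"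
    then obtain js k where a: "js \<in> adapted_words adj \<sigma> \<xi>" "k < length js" "word_root adj js k = f v"
      "js ! k = i" by blast
    have "v = pos \<xi> js k"
      by (rule inj_onD[OF finj]) (use a fj bij_betwE[OF bij[OF a(1)]] v in auto)
    then show "i = fst v" using a by (simp add: pos_def)
  qed
  moreover have "f \<in> extensional ?V" by (simp add: f_def)
  ultimately show ?thesis using that by blast
qed

section \<open>Uniqueness of the isomorphism\<close>

lemma column_set_neighbour:
  assumes x: "\<xi> \<in> QD" "\<eta> \<in> QD" and ij: "adj i j" and l: "lat j s"
    and q: "(i, q) \<in> column_set \<xi> \<eta>" "(i, q + 2 * d i) \<in> column_set \<xi> \<eta>" "q < s" "s < q + 2 * d i"
  shows "(j, s) \<in> column_set \<xi> \<eta>"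
proof -
  have a: "lat i q" "\<eta> i < q" "q + 2 * d i \<le> \<xi> i" using q by (auto simp: column_set_def)
  have "\<eta> i + 2 * d i \<le> q" by (rule lat_gap[OF QD_lat[OF x(2)] a(1,2)])
  then have "\<eta> j < s" using QD_less[OF x(2) adj_sym[OF ij]] q(3) by linarith
  moreover have "s \<le> \<xi> j"
  proof (rule ccontr)
    assume "\<not> s \<le> \<xi> j"
    then have "\<xi> j + 2 * d j \<le> s" using lat_gap[OF QD_lat[OF x(1)] l] by simp
    then show False using QD_less[OF x(1) ij] q(4) a(3) by linarith
  qed
  ultimately show ?thesis using l by (simp add: column_set_def)
qed

lemma column_set_interval:
  assumes "(i, p) \<in> column_set \<xi> \<eta>" "(i, q) \<in> column_set \<xi> \<eta>" "lat i s" "q \<le> s" "s \<le> p"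
  shows "(i, s) \<in> column_set \<xi> \<eta>"
  using assms by (auto simp: column_set_def)

text \<open>Consecutive vertices of a column are joined by arrows: through a neighbour at the middle
  level if that neighbour's orbit is at least as large, otherwise by entering a short column at
  \<open>q + 1\<close>, climbing it, and leaving at \<open>q + 2 * r - 1\<close>. All these vertices
  stay in the set by \<open>column_set_neighbour\<close>.\<close>

lemma constant_on_column:
  assumes x: "\<xi> \<in> QD" "\<eta> \<in> QD" and V: "V = column_set \<xi> \<eta>"
    and h: "\<And>i p j s. (i, p) \<in> V \<Longrightarrow> (j, s) \<in> V \<Longrightarrow> adj i j \<Longrightarrow> s - p = min (d i) (d j) \<Longrightarrow> h (i, p) = h (j, s)"
    and ij: "adj i j" and pq: "(i, p) \<in> V" "(i, q) \<in> V"
  shows "h (i, p) = (h (i, q) :: int)"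
proof -
  have small: "h (i, q) = h (i, q + 2 * d i)"
    if ij: "adj i j" "d i \<le> d j" and q: "(i, q) \<in> V" "(i, q + 2 * d i) \<in> V" for i j q
  proof -
    have lq: "lat i q" using q V by (simp add: column_set_def)
    obtain k where k: "q - \<epsilon> j = d i + 2 * d i * k"
      using lat_adj[OF ij(1) lq, of "\<epsilon> j"] ij(2) by (auto simp: lat_def min_def)
    have "\<exists>j'. adj i j' \<and> d i \<le> d j' \<and> lat j' (q + d i)"
    proof (cases "d i = d j")
      case True
      have "q + d i - \<epsilon> j = 2 * d j * (k + 1)" using k True by (simp add: algebra_simps)
      then have "lat j (q + d i)" unfolding lat_def by (metis dvd_triv_left)
      then show ?thesis using ij by blast
    next
      case False
      then have lt: "d i < d j" using ij(2) by simp
      note dd = d_less[OF lt]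
      \<comment> \<open>The power of \<sigma> that carries \<open>j\<close> to the vertex of its
        orbit with a level at \<open>q + d i\<close>.\<close>
      define l where "l = nat ((- (k + 1)) mod int r)"
      have l: "int l = (- (k + 1)) mod int r" using r_pos by (simp add: l_def)
      obtain D where D: "int l = - (k + 1) - int r * D"
        unfolding l using minus_mult_div_eq_mod[of "- (k + 1)" "int r"] by metis
      have "q + d i + 2 * int l - \<epsilon> j = 2 * d j * (- D)"
        using k unfolding D dd(2,4) by (simp add: algebra_simps)
      then have "lat j (q + d i + 2 * int l)" unfolding lat_def by (metis dvd_triv_left)
      then have "lat ((\<sigma> ^^ l) j) (q + d i)" by (simp add: lat_power)
      moreover have "adj i ((\<sigma> ^^ l) j)" by (rule adj_power[OF dd(1) ij(1)])
      ultimately show ?thesis using ij(2) by (intro exI[of _ "(\<sigma> ^^ l) j"]) simp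
    qed
    then obtain j' where j': "adj i j'" "d i \<le> d j'" "lat j' (q + d i)" by blast
    have m: "(j', q + d i) \<in> V"
      unfolding V by (rule column_set_neighbour[OF x j'(1,3)]) (use q V d_pos[of i] in \<open>auto simp del: d_pos\<close>)
    have "h (i, q) = h (j', q + d i)" by (rule h[OF q(1) m j'(1)]) (use j'(2) in simp)
    also have "\<dots> = h (i, q + 2 * d i)" by (rule h[OF m q(2) adj_sym[OF j'(1)]]) (use j'(2) in simp)
    finally show ?thesis .
  qed
  have walk: "h (i, q + 2 * d i * int k) = h (i, q)"
    if st: "\<And>q. (i, q) \<in> V \<Longrightarrow> (i, q + 2 * d i) \<in> V \<Longrightarrow> h (i, q) = h (i, q + 2 * d i)"
      and q: "(i, q) \<in> V" "(i, q + 2 * d i * int k) \<in> V" for i q k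
    using q(2)
  proof (induction k)
    case (Suc k)
    have lq: "lat i q" using q V by (simp add: column_set_def)
    have e: "q + 2 * d i * int (Suc k) = q + 2 * d i * int k + 2 * d i" by (simp add: algebra_simps)
    have "lat i (q + 2 * d i * int k)" using lq by (simp only: lat_add)
    moreover have "0 \<le> 2 * d i * int k" by simp
    moreover have "0 \<le> d i" by simp
    ultimately have "(i, q + 2 * d i * int k) \<in> V"
      using Suc.prems q(1) column_set_interval[of i "q + 2 * d i * int (Suc k)" \<xi> \<eta> q "q + 2 * d i * int k"]
      unfolding e V by linarith
    then show ?case using Suc.IH st[of "q + 2 * d i * int k"] Suc.prems unfolding e by metis
  qed simp
  have step: "h (i, q) = h (i, q + 2 * d i)" if q: "(i, q) \<in> V" "(i, q + 2 * d i) \<in> V" for q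
  proof (cases "d i \<le> d j")
    case True
    then show ?thesis using small[OF ij True] q by blast
  next
    case False
    then have lt: "d j < d i" by simp
    note dd = d_less[OF lt]
    have lq: "lat i q" using q V by (simp add: column_set_def)
    obtain k where k: "q - \<epsilon> j = 1 + 2 * k"
      using lat_adj[OF ij lq, of "\<epsilon> j"] dd by (auto simp: lat_def min_def)
    have "q + 1 - \<epsilon> j = 2 * d j * (k + 1)" "q + 2 * int r - 1 - \<epsilon> j = 2 * d j * (k + int r)"
      using k dd(2) by auto
    then have lj: "lat j (q + 1)" "lat j (q + 2 * int r - 1)" unfolding lat_def by (metis dvd_triv_left)+
    have r1: "1 < int r" using dd(5) by linarith
    have e: "q + 2 * int r - 1 = q + 1 + 2 * d j * int (r - 1)" using dd(2) r_pos by (simp add: of_nat_diff Suc_leI)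
    have b: "q < q + 1" "q + 1 < q + 2 * d i" "q < q + 2 * int r - 1" "q + 2 * int r - 1 < q + 2 * d i"
      using dd(4) r1 by linarith+
    have m: "(j, q + 1) \<in> V" "(j, q + 2 * int r - 1) \<in> V"
      using column_set_neighbour[OF x ij lj(1) _ _ b(1,2)] column_set_neighbour[OF x ij lj(2) _ _ b(3,4)] q
      unfolding V by blast+
    have "h (i, q) = h (j, q + 1)" by (rule h[OF q(1) m(1) ij]) (use dd in simp)
    also have "\<dots> = h (j, q + 2 * int r - 1)"
      unfolding e using walk[of j "q + 1" "r - 1"] small[OF adj_sym[OF ij]] lt m e by simp
    also have "\<dots> = h (i, q + 2 * d i)" by (rule h[OF m(2) q(2) adj_sym[OF ij]]) (use dd in simp)
    finally show ?thesis .
  qed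
  have le: "h (i, p) = h (i, q)" if "q \<le> p" "(i, p) \<in> V" "(i, q) \<in> V" for p q
  proof -
    have "2 * d i dvd p - q" using that V lat_diff[of i p q] by (simp add: column_set_def)
    then obtain k where k: "p - q = 2 * d i * k" by blast
    have "0 \<le> k"
    proof (rule ccontr)
      assume "\<not> 0 \<le> k"
      then have "2 * d i * k < 0" by (intro mult_pos_neg) auto
      then show False using k that(1) by linarith
    qed
    then have "p = q + 2 * d i * int (nat k)" using k by (simp add: algebra_simps)
    then show ?thesis using walk[of i q "nat k"] step that by metis
  qed
  show ?thesis using le[of q p] le[of p q] pq by (cases "q \<le> p") auto
qed

text \<open>The displacement is constant along arrows, hence on each column. The image of the top
  vertex shows that it is not positive, the image of the bottom vertex that it is not negative. A
  diagram without edges is a single vertex, and then the set has at most one element.\<close>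

lemma column_set_automorphism:
  assumes x: "\<xi> \<in> QD" and V: "V = column_set \<xi> (twist \<xi>)"
    and g: "bij_betw g V V" "\<And>v. v \<in> V \<Longrightarrow> fst (g v) = fst v"
    and ga: "\<And>u v. u \<in> V \<Longrightarrow> v \<in> V \<Longrightarrow> (u, v) \<in> arrows (twisted_AR_quiver adj \<sigma> \<epsilon> \<xi>) \<longleftrightarrow>
      (g u, g v) \<in> arrows (twisted_AR_quiver adj \<sigma> \<epsilon> \<xi>)"
    and v: "v \<in> V"
  shows "g v = v"
proof (cases "\<exists>j. adj (fst v) j")
  case True
  then obtain j where j: "adj (fst v) j" by blast
  obtain i p where ip: "v = (i, p)" by fastforce
  define h where "h v = snd (g v) - snd v" for v
  have gV: "g u \<in> V" if "u \<in> V" for u using g(1) that by (rule bij_betwE[THEN bspec])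
  have arr: "h (i, p) = h (j, s)" if a: "(i, p) \<in> V" "(j, s) \<in> V" "adj i j" "s - p = min (d i) (d j)" for i p j s
  proof -
    have "((i, p), (j, s)) \<in> arrows (twisted_AR_quiver adj \<sigma> \<epsilon> \<xi>)"
      using arrows_AR[OF x] a V by simp
    then have b: "(g (i, p), g (j, s)) \<in> arrows (twisted_AR_quiver adj \<sigma> \<epsilon> \<xi>)" using ga a by simp
    have e: "g (i, p) = (i, snd (g (i, p)))" "g (j, s) = (j, snd (g (j, s)))"
      using g(2)[OF a(1)] g(2)[OF a(2)] by (metis fst_conv prod.collapse)+
    have "snd (g (j, s)) - snd (g (i, p)) = min (d i) (d j)"
      using b e arrows_AR[OF x, of i "snd (g (i, p))" j "snd (g (j, s))"] gV[OF a(1)] gV[OF a(2)] V by metis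
    then show ?thesis using a(4) by (simp add: h_def)
  qed
  have const: "h (i, p) = h (i, q)" if q: "(i, q) \<in> V" for q
  proof (rule constant_on_column[OF x twist_QD[OF x] V])
    show "adj i j" "(i, p) \<in> V" "(i, q) \<in> V" using j v ip q by simp_all
  qed (rule arr)
  have vv: "lat i p" "twist \<xi> i < p" "p \<le> \<xi> i" using v ip V by (auto simp: column_set_def)
  have "(i, \<xi> i) \<in> V" using vv QD_lat[OF x] V by (simp add: column_set_def)
  then have t: "h (i, \<xi> i) = h (i, p)" "g (i, \<xi> i) \<in> V" "fst (g (i, \<xi> i)) = i"
    using const gV g(2) by force+
  then have "snd (g (i, \<xi> i)) \<le> \<xi> i" using V by (auto simp: column_set_def)
  then have up: "h (i, p) \<le> 0" using t(1) by (simp add: h_def)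
  let ?b = "twist \<xi> i + 2 * d i"
  have "?b \<le> p" using lat_gap[OF QD_lat[OF twist_QD[OF x]] vv(1,2)] .
  then have "(i, ?b) \<in> V" using vv QD_lat[OF twist_QD[OF x], of i] V by (simp add: column_set_def)
  then have b: "h (i, ?b) = h (i, p)" "g (i, ?b) \<in> V" "fst (g (i, ?b)) = i"
    using const gV g(2) by force+
  then have "lat i (snd (g (i, ?b)))" "twist \<xi> i < snd (g (i, ?b))" using V by (auto simp: column_set_def)
  then have "?b \<le> snd (g (i, ?b))" using lat_gap[OF QD_lat[OF twist_QD[OF x]]] by blast
  then have "0 \<le> h (i, p)" using b(1) by (simp add: h_def)
  then have "snd (g v) = snd v" using up ip by (simp add: h_def)
  then show ?thesis using g(2)[OF v] by (simp add: prod_eq_iff)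
next
  case False
  then have one: "k = fst v" for k using connected[of "fst v" k] by (metis converse_rtranclpE)
  obtain w where w: "w \<in> adapted_words adj \<sigma> \<xi>" using adapted_words_nonempty[OF x] by blast
  then have wr: "reduced adj w" and we: "endpoint \<xi> w = twist \<xi>"
    using reduced_words_iff adapted_words_iff[OF x] by (auto simp: adapted_words_def)
  have "length w \<le> 1"
  proof (rule ccontr)
    assume "\<not> length w \<le> 1"
    then obtain a b ws where "w = a # b # ws" by (metis One_nat_def length_0_conv length_Suc_conv list.exhaust le_refl zero_le)
    then have w2: "w = [fst v, fst v] @ ws" using one[of a] one[of b] by simp
    have "reduced adj [fst v, fst v]" by (rule reduced_prefix) (use wr w2 in simp)
    then have "nonneg (act adj [fst v] (sroot (fst v)))" using reduced_snoc[of adj "[fst v]" "fst v"] by simp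
    then show False using nonneg_antisym[OF sroot_roots nonneg_sroot] by (simp add: act_Cons)
  qed
  then have "a = b" if "a < length w" "b < length w" for a b using that by linarith
  moreover have "V = pos \<xi> w ` {..<length w}" using pos_image[of \<xi> w] QD_lat[OF x] unfolding we V by simp
  ultimately have "a = b" if "a \<in> V" "b \<in> V" for a b using that by blast
  moreover have "g v \<in> V" using v g(1) bij_betwE by blast
  ultimately show ?thesis using v by blast
qed

lemma AR_iso_unique:
  assumes x: "\<xi> \<in> QD" and V: "V = column_set \<xi> (twist \<xi>)"
    and f: "f \<in> extensional V"
      "quiver_iso (twisted_AR_quiver adj \<sigma> \<epsilon> \<xi>) H f" "\<forall>v\<in>V. res (f v) = fst v"
    and g: "g \<in> extensional V"
      "quiver_iso (twisted_AR_quiver adj \<sigma> \<epsilon> \<xi>) H g" "\<forall>v\<in>V. res (g v) = fst v"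
  shows "f = g"
proof (rule extensionalityI[OF f(1) g(1)])
  have fb: "bij_betw f V (verts H)" and folded_coroot: "bij_betw g V (verts H)"
    using f(2) g(2) V verts_AR[OF x] by (auto simp: quiver_iso_def)
  have fa: "(u, v) \<in> arrows (twisted_AR_quiver adj \<sigma> \<epsilon> \<xi>) \<longleftrightarrow> (f u, f v) \<in> arrows H"
    and gar: "(u, v) \<in> arrows (twisted_AR_quiver adj \<sigma> \<epsilon> \<xi>) \<longleftrightarrow> (g u, g v) \<in> arrows H"
    if "u \<in> V" "v \<in> V" for u v
    using f(2) g(2) that V verts_AR[OF x] by (auto simp: quiver_iso_def)
  define e where "e = inv_into V f \<circ> g"
  have folded_root: "bij_betw e V V" unfolding e_def by (rule bij_betw_trans[OF folded_coroot bij_betw_inv_into[OF fb]])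
  have eV: "e u \<in> V" if "u \<in> V" for u using folded_root that by (rule bij_betwE[THEN bspec])
  have fe: "f (e u) = g u" if "u \<in> V" for u
  proof -
    have "g u \<in> f ` V" using fb folded_coroot that by (auto simp: bij_betw_def)
    then show ?thesis by (simp add: e_def f_inv_into_f)
  qed
  fix v assume v: "v \<in> V"
  have "e v = v"
  proof (rule column_set_automorphism[OF x V folded_root _ _ v])
    fix u assume u: "u \<in> V"
    show "fst (e u) = fst u" using f(3) g(3) eV[OF u] fe[OF u] u by metis
  next
    fix u w assume u: "u \<in> V" "w \<in> V"
    show "(u, w) \<in> arrows (twisted_AR_quiver adj \<sigma> \<epsilon> \<xi>) \<longleftrightarrow> (e u, e w) \<in> arrows (twisted_AR_quiver adj \<sigma> \<epsilon> \<xi>)"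
      using fa[OF eV[OF u(1)] eV[OF u(2)]] gar[OF u] fe u by simp
  qed
  then show "f v = g v" using fe[OF v] by simp
qed

lemma AR_iso_ex1:
  assumes x: "\<xi> \<in> QD"
  shows "\<exists>!f. f \<in> extensional (verts (twisted_AR_quiver adj \<sigma> \<epsilon> \<xi>)) \<and>
    quiver_iso (twisted_AR_quiver adj \<sigma> \<epsilon> \<xi>) (comb_AR_quiver adj (adapted_words adj \<sigma> \<xi>)) f \<and>
    (\<forall>v \<in> verts (twisted_AR_quiver adj \<sigma> \<epsilon> \<xi>). residue adj (adapted_words adj \<sigma> \<xi>) (f v) = fst v)"
proof -
  obtain f where f: "f \<in> extensional (column_set \<xi> (twist \<xi>))"
    "quiver_iso (twisted_AR_quiver adj \<sigma> \<epsilon> \<xi>) (comb_AR_quiver adj (adapted_words adj \<sigma> \<xi>)) f"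
    "\<forall>v\<in>column_set \<xi> (twist \<xi>). residue adj (adapted_words adj \<sigma> \<xi>) (f v) = fst v"
    by (rule AR_iso_exists[OF x])
  show ?thesis unfolding verts_AR[OF x]
  proof (rule ex1I[of _ f])
    fix g assume g: "g \<in> extensional (column_set \<xi> (twist \<xi>)) \<and>
      quiver_iso (twisted_AR_quiver adj \<sigma> \<epsilon> \<xi>) (comb_AR_quiver adj (adapted_words adj \<sigma> \<xi>)) g \<and>
      (\<forall>v\<in>column_set \<xi> (twist \<xi>). residue adj (adapted_words adj \<sigma> \<xi>) (g v) = fst v)"
    show "g = f"
      by (rule AR_iso_unique[where res = "residue adj (adapted_words adj \<sigma> \<xi>)", OF x HOL.refl])
        (use f g in blast)+
  qed (use f in blast)
qed

end

section \<open>The adapted cluster point\<close>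

lemma bij_betw_quotient:
  assumes R: "R = {(x, y). x \<in> A \<and> y \<in> A \<and> f x = f y}"
  shows "\<exists>F. bij_betw F (A // R) (f ` A) \<and> (\<forall>x\<in>A. F (R `` {x}) = f x)"
proof -
  define F where "F C = the_elem (f ` C)" for C
  have F: "F (R `` {x}) = f x" if "x \<in> A" for x
  proof -
    have "f ` (R `` {x}) = {f x}" using that by (auto simp: R)
    then show ?thesis by (simp add: F_def)
  qed
  have "inj_on F (A // R)"
  proof (rule inj_onI)
    fix C D assume CD: "C \<in> A // R" "D \<in> A // R" "F C = F D"
    then obtain x y where xy: "x \<in> A" "C = R `` {x}" "y \<in> A" "D = R `` {y}" by (auto simp: quotient_def)
    then have "f x = f y" using CD(3) F by simp
    then show "C = D" using xy by (auto simp: R)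
  qed
  moreover have "F ` (A // R) = f ` A"
  proof -
    have "F ` (A // R) = F ` (\<lambda>x. R `` {x}) ` A" by (auto simp: quotient_def)
    then show ?thesis using F by (simp add: image_image)
  qed
  ultimately show ?thesis using F by (auto simp: bij_betw_def)
qed

context tree_diagram
begin

lemma tree_induct [case_names ctr par]:
  assumes "P ctr" "\<And>i. i \<noteq> ctr \<Longrightarrow> P (par i) \<Longrightarrow> P i" shows "P i"
proof (induction "dep i" arbitrary: i rule: less_induct)
  case less
  show ?case using assms less dep_par[of i] by (cases "i = ctr") auto
qed

lemma tree_rec: "\<exists>f. f ctr = c \<and> (\<forall>i. i \<noteq> ctr \<longrightarrow> f i = G i (f (par i)))"
proof -
  define F where "F = rec_nat (\<lambda>_. c) (\<lambda>_ h i. G i (h (par i)))"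
  have "F (dep i) i = G i (F (dep (par i)) (par i))" if "i \<noteq> ctr" for i
    unfolding dep_par[OF that] by (simp add: F_def)
  moreover have "F (dep ctr) ctr = c" by (simp add: dep_ctr F_def)
  ultimately show ?thesis by (intro exI[of _ "\<lambda>i. F (dep i) i"]) auto
qed

lemma par_adj: "i \<noteq> ctr \<Longrightarrow> adj i (par i)" "i \<noteq> ctr \<Longrightarrow> adj (par i) i"
  by (auto simp: adj_iff)

end

section \<open>Height functions are determined by their adapted words up to shift\<close>

context folded_parity
begin

lemma d_dvd: "d i \<le> d j \<Longrightarrow> d i dvd d j"
  using d_less[of i j] by (cases "d i = d j") auto

lemma QD_shift: "\<xi> \<in> QD \<Longrightarrow> (\<lambda>i. \<xi> i + 2 * int r * m) \<in> QD"
proof -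
  assume x: "\<xi> \<in> QD"
  have "lat i (\<xi> i + 2 * int r * m)" for i
  proof -
    have "d i dvd int r" using d_cases[of i] by auto
    then obtain k where "int r = d i * k" by blast
    then show ?thesis using lat_add[of i "\<xi> i" "k * m"] QD_lat[OF x, of i] by (simp add: mult.assoc)
  qed
  then show ?thesis using QD_less[OF x] by (auto simp: QD_def)
qed

lemma adapted_words_shift: "adapted_words adj \<sigma> (\<lambda>i. \<xi> i + c) = adapted_words adj \<sigma> \<xi>"
  by (simp add: adapted_words_def adapted_shift)

lemma first_occurrence_gap:
  assumes x: "\<xi> \<in> QD" and ad: "adapted adj \<sigma> \<xi> (us @ j # vs)" and j: "j \<notin> set us" and ij: "adj i j"
  shows "0 < \<xi> j - (\<xi> i - 2 * d i * int (count_list us i))"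
    and "\<xi> j - (\<xi> i - 2 * d i * int (count_list us i)) < 2 * d i"
proof -
  let ?e = "endpoint \<xi> us"
  have ad1: "adapted adj \<sigma> \<xi> us" and src: "source adj ?e j" using ad by (auto simp: adapted_append)
  have e: "?e j = \<xi> j" "?e i = \<xi> i - 2 * d i * int (count_list us i)"
    using j by (auto simp: endpoint_count count_list_0_iff)
  have "?e i < ?e j" using src adj_sym[OF ij] by (simp add: source_def)
  then show "0 < \<xi> j - (\<xi> i - 2 * d i * int (count_list us i))" unfolding e by linarith
  have "?e j < ?e i + 2 * d i" by (rule QD_less[OF adapted_QD[OF x ad1] adj_sym[OF ij]])
  then show "\<xi> j - (\<xi> i - 2 * d i * int (count_list us i)) < 2 * d i" unfolding e by linarith
qed

text \<open>For a common adapted word and an edge with \<open>d i \<le> d j\<close>, the first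
  occurrence of \<open>j\<close> confines the difference across the edge to the same open interval
  of length \<open>2 * d i\<close> for both height functions. The two differences are congruent
  modulo \<open>2 * d i\<close>, hence equal.\<close>

lemma adapted_words_determine:
  assumes x: "\<xi> \<in> QD" "\<xi>' \<in> QD" and e: "adapted_words adj \<sigma> \<xi> = adapted_words adj \<sigma> \<xi>'"
  shows "\<exists>m. \<forall>i. \<xi>' i = \<xi> i + 2 * int r * m"
proof -
  obtain w where w: "w \<in> adapted_words adj \<sigma> \<xi>" using adapted_words_nonempty[OF x(1)] by blast
  then have ww: "w \<in> reduced_words adj" "adapted adj \<sigma> \<xi> w" "adapted adj \<sigma> \<xi>' w"
    using e by (auto simp: adapted_words_def)
  have step: "\<xi>' i - \<xi> i = \<xi>' j - \<xi> j" if ij: "adj i j" "d i \<le> d j" for i j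
  proof -
    obtain us vs where w: "w = us @ j # vs" "j \<notin> set us"
      using split_list_first[OF reduced_words_letters[OF ww(1)]] by blast
    note g = first_occurrence_gap[OF x(1) ww(2)[unfolded w(1)] w(2) ij(1)]
    note g' = first_occurrence_gap[OF x(2) ww(3)[unfolded w(1)] w(2) ij(1)]
    define D where "D = (\<xi>' j - \<xi> j) - (\<xi>' i - \<xi> i)"
    have "2 * d i dvd \<xi>' i - \<xi> i" "2 * d j dvd \<xi>' j - \<xi> j"
      using lat_diff QD_lat x by blast+
    moreover have "2 * d i dvd 2 * d j" using d_dvd[OF ij(2)] by simp
    ultimately have "2 * d i dvd D" unfolding D_def by (meson dvd_diff dvd_trans)
    moreover have "\<bar>D\<bar> < 2 * d i" using g g' unfolding D_def by linarith
    ultimately have "D = 0" using dvd_imp_le_int[of D "2 * d i"] by fastforce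
    then show ?thesis by (simp add: D_def)
  qed
  have adj: "\<xi>' i - \<xi> i = \<xi>' j - \<xi> j" if "adj i j" for i j
    using step[of i j] step[of j i] that adj_sym[OF that] by linarith
  have const: "\<xi>' i - \<xi> i = \<xi>' j - \<xi> j" for i j
    using connected[of i j] by (induction rule: rtranclp_induct) (use adj in force)+
  obtain k where k: "d k = int r" using exists_d_eq_r by blast
  have "2 * int r dvd \<xi>' k - \<xi> k" using lat_diff QD_lat x unfolding k[symmetric] by blast
  then obtain m where "\<xi>' k - \<xi> k = 2 * int r * m" by blast
  then have "\<xi>' i = \<xi> i + 2 * int r * m" for i using const[of i k] by linarith
  then show ?thesis by blast
qed

lemma shift_rel_eq:
  "shift_rel adj \<sigma> \<epsilon> = {(\<xi>, \<xi>'). \<xi> \<in> QD \<and> \<xi>' \<in> QD \<and> adapted_words adj \<sigma> \<xi> = adapted_words adj \<sigma> \<xi>'}"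
proof -
  have "adapted_words adj \<sigma> \<xi> = adapted_words adj \<sigma> \<xi>'" if "\<forall>i. \<xi>' i = \<xi> i + 2 * int r * m" for \<xi> \<xi>' m
  proof -
    have "\<xi>' = (\<lambda>i. \<xi> i + 2 * int r * m)" using that by auto
    then show ?thesis by (simp add: adapted_words_shift)
  qed
  then show ?thesis unfolding shift_rel_def Q_data_eq using adapted_words_determine by blast
qed

lemma Q_data_bijection:
  "\<exists>F. bij_betw F (QD // shift_rel adj \<sigma> \<epsilon>) (adapted_words adj \<sigma> ` QD) \<and>
    (\<forall>\<xi>\<in>QD. F (shift_rel adj \<sigma> \<epsilon> `` {\<xi>}) = adapted_words adj \<sigma> \<xi>)"
  by (rule bij_betw_quotient[OF shift_rel_eq])

lemma QD_nonempty: "cut 0 \<in> QD"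
  by (rule cut_QD)

section \<open>The trivial automorphism: height functions and Dynkin quivers\<close>

definition height_quiver :: "('v \<Rightarrow> int) \<Rightarrow> 'v \<Rightarrow> 'v \<Rightarrow> bool" where
  "height_quiver \<xi> i j \<longleftrightarrow> adj i j \<and> \<xi> j < \<xi> i"

lemma QD_adj_neq: "\<xi> \<in> QD \<Longrightarrow> adj i j \<Longrightarrow> \<xi> i \<noteq> \<xi> j"
  using lat_adj_neq QD_lat by blast

lemma height_quiver_dynkin: "\<xi> \<in> QD \<Longrightarrow> dynkin_quiver adj (height_quiver \<xi>)"
  unfolding dynkin_quiver_def height_quiver_def using QD_adj_neq adj_sym by fastforce

lemma height_quiver_source: "\<xi> \<in> QD \<Longrightarrow> quiver_source (height_quiver \<xi>) i \<longleftrightarrow> source adj \<xi> i"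
  unfolding quiver_source_def source_def height_quiver_def using QD_adj_neq adj_sym by fastforce

lemma quiver_adapted_iff:
  assumes id: "\<sigma> = id" and x: "\<xi> \<in> QD"
  shows "quiver_adapted (height_quiver \<xi>) is \<longleftrightarrow> adapted adj \<sigma> \<xi> is"
  using x
proof (induction "is" arbitrary: \<xi>)
  case (Cons i "is")
  have "quiver_reflect i (height_quiver \<xi>) = height_quiver (Q_reflect \<sigma> i \<xi>)" if src: "source adj \<xi> i"
  proof (intro ext)
    fix j k
    have d1: "d m = 1" for m by (rule d_fixed) (simp add: id)
    have *: "\<xi> m < \<xi> i" "\<xi> i - 2 < \<xi> m" if "adj i m" for m
      using src that QD_less[OF Cons.prems that] by (auto simp: source_def d1)
    show "quiver_reflect i (height_quiver \<xi>) j k = height_quiver (Q_reflect \<sigma> i \<xi>) j k"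
      using *[of j] *[of k] adj_commute[of i j] adj_commute[of i k] adj_commute[of j k] adj_irrefl[of i]
      by (auto simp: quiver_reflect_def height_quiver_def Q_reflect_def d1)
  qed
  then show ?case using Cons.IH[OF QD_reflect[OF Cons.prems]] height_quiver_source[OF Cons.prems] by auto
qed simp

text \<open>The diagram is a tree, so an orientation integrates to heights by stepping up or down by
  1 along each edge away from the centre; starting at \<open>\<epsilon> ctr\<close> gives the right
  parity everywhere.\<close>

lemma exists_height_quiver:
  assumes id: "\<sigma> = id" and Q: "dynkin_quiver adj Q"
  shows "\<exists>\<xi>\<in>QD. height_quiver \<xi> = Q"
proof -
  have d1: "d m = 1" for m by (rule d_fixed) (simp add: id)
  obtain \<xi> :: "'v \<Rightarrow> int" where x: "\<xi> ctr = \<epsilon> ctr"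
    "\<forall>i. i \<noteq> ctr \<longrightarrow> \<xi> i = \<xi> (par i) + (if Q i (par i) then 1 else - 1)"
    using tree_rec[of "\<epsilon> ctr" "\<lambda>i v. v + (if Q i (par i) then 1 else - 1)"] by blast
  have q: "(Q i j \<and> \<not> Q j i) \<or> (\<not> Q i j \<and> Q j i)" if "adj i j" for i j
    using Q that unfolding dynkin_quiver_def by blast
  have step: "(Q i j \<longrightarrow> \<xi> i = \<xi> j + 1) \<and> (Q j i \<longrightarrow> \<xi> j = \<xi> i + 1)" if ij: "adj i j" for i j
  proof -
    from ij consider "i \<noteq> ctr" "j = par i" | "j \<noteq> ctr" "i = par j" unfolding adj_iff by blast
    then show ?thesis
      by cases (use x(2) q[OF ij] in auto)
  qed
  have "lat i (\<xi> i)" for i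
  proof (induction i rule: tree_induct)
    case ctr
    then show ?case by (simp add: x lat_def)
  next
    case (par i)
    obtain k where "\<xi> (par i) - \<epsilon> i = 1 + 2 * k"
      using lat_adj[OF par_adj(2)[OF par(1)] par(2), of "\<epsilon> i"] by (auto simp: d1 lat_def)
    moreover have "\<xi> i = \<xi> (par i) + 1 \<or> \<xi> i = \<xi> (par i) - 1" using x(2) par(1) by auto
    ultimately have "\<xi> i - \<epsilon> i = 2 * (k + 1) \<or> \<xi> i - \<epsilon> i = 2 * k" by auto
    then show ?case unfolding lat_def d1 by (metis dvd_triv_left mult.right_neutral)
  qed
  moreover have "\<xi> i < \<xi> j + 2 * d j" if "adj i j" for i j using step[OF that] q[OF that] by (auto simp: d1)
  ultimately have "\<xi> \<in> QD" by (simp add: QD_def)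
  moreover have "height_quiver \<xi> i j = Q i j" for i j
    using step[of i j] q[of i j] Q unfolding height_quiver_def dynkin_quiver_def by fastforce
  then have "height_quiver \<xi> = Q" by (intro ext)
  ultimately show ?thesis by blast
qed

lemma adapted_cluster_point_id:
  assumes "\<sigma> = id"
  shows "adapted_cluster_point adj \<sigma> = adapted_words adj \<sigma> ` QD"
proof -
  have "C \<in> adapted_cluster_point adj \<sigma> \<longleftrightarrow> (\<exists>\<xi>\<in>QD. C = adapted_words adj \<sigma> \<xi>)" for C
  proof
    assume "C \<in> adapted_cluster_point adj \<sigma>"
    then obtain "is" Q where a: "C = comm_class adj is" "is \<in> reduced_words adj" "dynkin_quiver adj Q"
      "quiver_adapted Q is" by (auto simp: adapted_cluster_point_def assms)
    obtain \<xi> where x: "\<xi> \<in> QD" "height_quiver \<xi> = Q" using exists_height_quiver[OF assms a(3)] by blast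
    then have "is \<in> adapted_words adj \<sigma> \<xi>"
      using a quiver_adapted_iff[OF assms x(1), of "is"] by (simp add: adapted_words_def)
    then show "\<exists>\<xi>\<in>QD. C = adapted_words adj \<sigma> \<xi>" using adapted_words_class[OF x(1)] a(1) x(1) by blast
  next
    assume "\<exists>\<xi>\<in>QD. C = adapted_words adj \<sigma> \<xi>"
    then obtain \<xi> where x: "\<xi> \<in> QD" "C = adapted_words adj \<sigma> \<xi>" by blast
    obtain w where w: "w \<in> adapted_words adj \<sigma> \<xi>" using adapted_words_nonempty[OF x(1)] by blast
    then have "w \<in> reduced_words adj" "quiver_adapted (height_quiver \<xi>) w"
      using quiver_adapted_iff[OF assms x(1), of w] by (auto simp: adapted_words_def)
    then show "C \<in> adapted_cluster_point adj \<sigma>"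
      using adapted_words_class[OF x(1) w] height_quiver_dynkin[OF x(1)] x(2)
      unfolding adapted_cluster_point_def by (auto simp: assms)
  qed
  then show ?thesis by auto
qed

section \<open>Reflection functors and source reflections\<close>

lemma twist_QD_imp: assumes "twist \<xi> \<in> QD" shows "\<xi> \<in> QD"
  unfolding QD_def mem_Collect_eq
proof (intro conjI allI impI)
  show "lat i (\<xi> i)" for i
    using QD_lat[OF assms, of "star adj i"] lat_star[of i "\<xi> i"] by (simp add: twist_def)
  show "\<xi> i < \<xi> j + 2 * d j" if "adj i j" for i j
    using QD_less[OF assms, of "star adj i" "star adj j"] that star_adj by (simp add: twist_def)
qed

lemma adapted_words_rotate:
  assumes x: "\<xi> \<in> QD" and w: "i # rest \<in> adapted_words adj \<sigma> \<xi>"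
  shows "rest @ [star adj i] \<in> adapted_words adj \<sigma> (Q_reflect \<sigma> i \<xi>)"
    and "source adj \<xi> i" and "Q_reflect \<sigma> i \<xi> \<in> QD"
proof -
  have a: "source adj \<xi> i" "adapted adj \<sigma> (Q_reflect \<sigma> i \<xi>) rest" "i # rest \<in> reduced_words adj"
    using w by (auto simp: adapted_words_def)
  have e: "endpoint (Q_reflect \<sigma> i \<xi>) rest = twist \<xi>"
    using w adapted_words_iff[OF x] by (simp add: endpoint_Cons)
  show "source adj \<xi> i" by (rule a(1))
  show "Q_reflect \<sigma> i \<xi> \<in> QD" by (rule QD_reflect[OF x a(1)])
  show "rest @ [star adj i] \<in> adapted_words adj \<sigma> (Q_reflect \<sigma> i \<xi>)"
    using reduced_words_rotate[OF a(3)] a(1,2) e twist_source[of \<xi> i]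
    by (simp add: adapted_words_def adapted_append)
qed

text \<open>Both directions are needed, since the equivalence generated by reflection functors also
  runs backwards.\<close>

lemma reflection_step_adapted:
  assumes "reflection_step adj C C'"
  shows "C \<in> adapted_words adj \<sigma> ` QD \<longleftrightarrow> C' \<in> adapted_words adj \<sigma> ` QD"
proof -
  obtain w where w: "w \<in> reduced_words adj" "C = comm_class adj w" "C' = comm_class adj (reflection_functor adj w)"
    using assms by (auto simp: reflection_step_def)
  have "w \<noteq> []" using reduced_words_letters[OF w(1)] by force
  then obtain i rest where ir: "w = i # rest" by (cases w) auto
  then have rf: "reflection_functor adj w = rest @ [star adj i]" by (simp add: reflection_functor_def)
  show ?thesis
  proof
    assume "C \<in> adapted_words adj \<sigma> ` QD"
    then obtain \<xi> where x: "\<xi> \<in> QD" "C = adapted_words adj \<sigma> \<xi>" by blast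
    then have "i # rest \<in> adapted_words adj \<sigma> \<xi>" using w(2) ir comm_class_self[of w] by simp
    note rot = adapted_words_rotate[OF x(1) this]
    have "C' = adapted_words adj \<sigma> (Q_reflect \<sigma> i \<xi>)"
      using adapted_words_class[OF rot(3,1)] w(3) rf by simp
    then show "C' \<in> adapted_words adj \<sigma> ` QD" using rot(3) by blast
  next
    assume "C' \<in> adapted_words adj \<sigma> ` QD"
    then obtain \<eta> where y: "\<eta> \<in> QD" "C' = adapted_words adj \<sigma> \<eta>" by blast
    then have r: "rest @ [star adj i] \<in> adapted_words adj \<sigma> \<eta>"
      using w(3) rf comm_class_self[of "rest @ [star adj i]"] by simp
    then have a: "adapted adj \<sigma> \<eta> rest" "source adj (endpoint \<eta> rest) (star adj i)"
      by (auto simp: adapted_words_def adapted_append)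
    have e: "Q_reflect \<sigma> (star adj i) (endpoint \<eta> rest) = twist \<eta>"
      using r adapted_words_iff[OF y(1)] by (simp add: endpoint_append endpoint_Cons)
    \<comment> \<open>The reflection is undone. That \<xi> is again a height function is seen after
      twisting, where it becomes the endpoint of \<open>rest\<close>.\<close>
    define \<xi> where "\<xi> = \<eta>(i := \<eta> i + 2 * d i)"
    have \<eta>: "Q_reflect \<sigma> i \<xi> = \<eta>" by (auto simp: \<xi>_def Q_reflect_def)
    have "Q_reflect \<sigma> (star adj i) (twist \<xi>) = twist \<eta>" using twist_reflect[of i \<xi>] \<eta> by simp
    then have t: "twist \<xi> = endpoint \<eta> rest" unfolding e[symmetric]
      by (auto simp: Q_reflect_def fun_eq_iff split: if_splits)
    have "twist \<xi> \<in> QD" unfolding t by (rule adapted_QD[OF y(1) a(1)])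
    then have x: "\<xi> \<in> QD" by (rule twist_QD_imp)
    have "source adj (twist \<xi>) (star adj i)" unfolding t by (rule a(2))
    then have "source adj \<xi> i" unfolding twist_source .
    then have "i # rest \<in> adapted_words adj \<sigma> \<xi>"
      using a(1) w(1) unfolding adapted_words_def mem_Collect_eq adapted.simps \<eta> ir by blast
    then have "C = adapted_words adj \<sigma> \<xi>" using adapted_words_class[OF x] w(2) ir by simp
    then show "C \<in> adapted_words adj \<sigma> ` QD" using x by blast
  qed
qed

lemma reflection_step_source:
  assumes x: "\<xi> \<in> QD" and src: "source adj \<xi> i"
  shows "reflection_step adj (adapted_words adj \<sigma> \<xi>) (adapted_words adj \<sigma> (Q_reflect \<sigma> i \<xi>))"
proof -
  obtain w where w: "w \<in> adapted_words adj \<sigma> \<xi>" using adapted_words_nonempty[OF x] by blast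
  obtain rest where "i # rest \<in> reduced_words adj" "adapted adj \<sigma> (Q_reflect \<sigma> i \<xi>) rest"
    using starts_with_source[OF x src, of w] w by (auto simp: adapted_words_def)
  then have ir: "i # rest \<in> adapted_words adj \<sigma> \<xi>" "i # rest \<in> reduced_words adj"
    using src by (auto simp: adapted_words_def)
  note rot = adapted_words_rotate[OF x ir(1)]
  show ?thesis unfolding reflection_step_def
    using ir(2) adapted_words_class[OF x ir(1)] adapted_words_class[OF rot(3,1)]
    by (intro bexI[of _ "i # rest"]) (simp_all add: reflection_functor_def)
qed

lemma equivclp_adapted:
  "\<xi> \<in> QD \<Longrightarrow> adapted adj \<sigma> \<xi> us \<Longrightarrow>
    equivclp (reflection_step adj) (adapted_words adj \<sigma> \<xi>) (adapted_words adj \<sigma> (endpoint \<xi> us))"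
proof (induction us arbitrary: \<xi>)
  case (Cons i us)
  then have s: "source adj \<xi> i" "adapted adj \<sigma> (Q_reflect \<sigma> i \<xi>) us" by simp_all
  have "equivclp (reflection_step adj) (adapted_words adj \<sigma> \<xi>) (adapted_words adj \<sigma> (Q_reflect \<sigma> i \<xi>))"
    by (rule r_into_equivclp) (rule reflection_step_source[OF Cons.prems(1) s(1)])
  then show ?case unfolding endpoint_Cons
    using Cons.IH[OF QD_reflect[OF Cons.prems(1) s(1)] s(2)] by (rule equivclp_trans)
qed simp

lemma equivclp_adapted_words:
  assumes x: "\<xi> \<in> QD" "\<eta> \<in> QD"
  shows "equivclp (reflection_step adj) (adapted_words adj \<sigma> \<xi>) (adapted_words adj \<sigma> \<eta>)"
proof -
  define M where "M = (\<Sum>i\<in>UNIV. \<bar>\<eta> i\<bar> + \<bar>\<xi> i\<bar>)"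
  \<comment> \<open>Lowering \<eta> by a multiple of \<open>2 * r\<close> leaves its adapted words
    unchanged and brings it below \<xi>.\<close>
  define \<eta>' where "\<eta>' = (\<lambda>i. \<eta> i + 2 * int r * (- M))"
  have "\<eta>' i \<le> \<xi> i" for i
  proof -
    have "\<bar>\<eta> i\<bar> + \<bar>\<xi> i\<bar> \<le> M" unfolding M_def by (rule member_le_sum) auto
    moreover from this have "0 \<le> M" by linarith
    then have "1 * M \<le> 2 * int r * M" using r_pos by (intro mult_right_mono) linarith+
    ultimately show ?thesis unfolding \<eta>'_def by (simp add: algebra_simps)
  qed
  moreover have "\<eta>' \<in> QD" unfolding \<eta>'_def by (rule QD_shift[OF x(2)])
  ultimately obtain us where "adapted adj \<sigma> \<xi> us" "endpoint \<xi> us = \<eta>'" using exists_adapted[OF x(1)] by blast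
  then have "equivclp (reflection_step adj) (adapted_words adj \<sigma> \<xi>) (adapted_words adj \<sigma> \<eta>')"
    using equivclp_adapted[OF x(1)] by blast
  then show ?thesis unfolding \<eta>'_def adapted_words_shift .
qed

lemma adapted_words_cluster_point:
  assumes "\<xi> \<in> QD"
  shows "{(C, C'). equivclp (reflection_step adj) C C'} `` {adapted_words adj \<sigma> \<xi>} = adapted_words adj \<sigma> ` QD"
  (is "?L = ?R")
proof
  show "?L \<subseteq> ?R"
  proof
    fix C assume "C \<in> ?L"
    then have "equivclp (reflection_step adj) (adapted_words adj \<sigma> \<xi>) C" by simp
    then show "C \<in> ?R"
      by (rule equivclp_invariant[where P = "\<lambda>C. C \<in> ?R"]) (use assms reflection_step_adapted in auto)
  qed
  show "?R \<subseteq> ?L" using equivclp_adapted_words[OF assms] by auto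
qed

lemma adapted_words_r_cluster_point: "adapted_words adj \<sigma> ` QD \<in> r_cluster_points adj"
  unfolding r_cluster_points_def adapted_words_cluster_point[OF QD_nonempty, symmetric]
  by (rule quotientI[OF adapted_words_comm_classes[OF QD_nonempty]])

lemma r_cluster_point_unique:
  assumes "X \<in> r_cluster_points adj" "C \<in> X" "C \<in> adapted_words adj \<sigma> ` QD"
  shows "X = adapted_words adj \<sigma> ` QD"
proof -
  let ?E = "equivclp (reflection_step adj)"
  obtain B where X: "X = {(C, C'). ?E C C'} `` {B}" using assms(1) by (auto simp: r_cluster_points_def quotient_def)
  then have BC: "?E B C" using assms(2) by simp
  obtain \<xi> where x: "\<xi> \<in> QD" "C = adapted_words adj \<sigma> \<xi>" using assms(3) by blast
  have "?E B D \<longleftrightarrow> ?E C D" for D using BC equivclp_trans equivclp_sym by metis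
  then have "X = {(C, C'). ?E C C'} `` {C}" unfolding X by auto
  then show ?thesis using adapted_words_cluster_point[OF x(1)] x(2) by simp
qed

end

section \<open>Coxeter words\<close>

lemma count_list_distinct: "distinct xs \<Longrightarrow> count_list xs y = (if y \<in> set xs then 1 else 0)"
  by (induction xs) auto

locale coxeter_sequence = folded_parity adj ctr par dep \<sigma> \<epsilon>
  for adj :: "'v::finite \<Rightarrow> 'v \<Rightarrow> bool" and ctr par dep \<sigma> \<epsilon> +
  fixes cs :: "'v list"
  assumes cs: "cs \<in> coxeter_sequences \<sigma>"
begin

lemma cs_image: "orb \<sigma> ` set cs = orbits \<sigma>"
  using cs by (simp add: coxeter_sequences_def)

lemma cs_distinct: "distinct cs" and cs_inj: "inj_on (orb \<sigma>) (set cs)"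
proof -
  have l: "card (orb \<sigma> ` set cs) = length cs" using cs by (simp add: coxeter_sequences_def)
  have "card (orb \<sigma> ` set cs) \<le> card (set cs)" by (rule card_image_le) simp
  then have c: "card (set cs) = length cs" using l card_length[of cs] by simp
  then show "distinct cs" by (rule card_distinct)
  show "inj_on (orb \<sigma>) (set cs)" by (rule eq_card_imp_inj_on) (simp_all add: l c)
qed

definition rep :: "'v \<Rightarrow> 'v" where
  "rep i = (SOME x. x \<in> set cs \<and> x \<in> orb \<sigma> i)"

lemma rep: "rep i \<in> set cs" "rep i \<in> orb \<sigma> i"
proof -
  have "orb \<sigma> i \<in> orb \<sigma> ` set cs" unfolding cs_image by (simp add: orbits_def)
  then obtain x where "x \<in> set cs" "orb \<sigma> i = orb \<sigma> x" by blast
  then have "x \<in> set cs \<and> x \<in> orb \<sigma> i" by simp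
  then have "rep i \<in> set cs \<and> rep i \<in> orb \<sigma> i" unfolding rep_def by (rule someI)
  then show "rep i \<in> set cs" "rep i \<in> orb \<sigma> i" by blast+
qed

lemma rep_eqI: "x \<in> set cs \<Longrightarrow> x \<in> orb \<sigma> i \<Longrightarrow> rep i = x"
  using inj_onD[OF cs_inj, of "rep i" x] rep(1)[of i] mem_orb_eq[of x i] mem_orb_eq[OF rep(2), of i] by simp

lemma rep_sigma: "rep (\<sigma> i) = rep i"
  by (rule rep_eqI[OF rep(1)]) (use rep(2)[of i] mem_orb_sym[of "rep i"] in simp)

lemma rep_power: "rep ((\<sigma> ^^ l) i) = rep i"
  by (induction l) (auto simp: rep_sigma)

text \<open>The distance from the representative along the orbit. In the height function of a
  Coxeter word the representative is the highest vertex of its orbit, and each step by \<sigma>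
  descends by 2.\<close>

definition lv :: "'v \<Rightarrow> nat" where
  "lv i = (LEAST l. i = (\<sigma> ^^ l) (rep i))"

lemma lv: "i = (\<sigma> ^^ lv i) (rep i)" "int (lv i) < d i"
proof -
  obtain l where l: "l < r" "i = (\<sigma> ^^ l) (rep i)"
    using orb_memD[of i "rep i"] rep(2)[of i] mem_orb_sym by blast
  show "i = (\<sigma> ^^ lv i) (rep i)" unfolding lv_def by (rule LeastI[of "\<lambda>l. i = (\<sigma> ^^ l) (rep i)", OF l(2)])
  show "int (lv i) < d i"
  proof (cases "\<sigma> i = i")
    case True
    then have "rep i = i" using rep(2)[of i] by (auto simp: orb_def power_fixed)
    then have "lv i \<le> 0" unfolding lv_def by (intro Least_le) simp
    then show ?thesis using d_pos[of i] by (simp del: d_pos)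
  next
    case False
    have "lv i \<le> l" unfolding lv_def by (rule Least_le[of "\<lambda>l. i = (\<sigma> ^^ l) (rep i)", OF l(2)])
    then show ?thesis using l(1) d_moved[OF False] by simp
  qed
qed

lemma sigma_fixed_power: "\<sigma> ((\<sigma> ^^ l) i) = (\<sigma> ^^ l) i \<longleftrightarrow> \<sigma> i = i"
  by (metis funpow_swap1 power_inj)

lemma lv_unique: assumes "i = (\<sigma> ^^ l) (rep i)" "int l < d i" shows "lv i = l"
proof (cases "\<sigma> i = i")
  case True
  then show ?thesis using assms(2) lv(2)[of i] d_fixed by simp
next
  case False
  have "\<sigma> (rep i) \<noteq> rep i" using False sigma_fixed_power[of "lv i" "rep i"] lv(1)[of i] by metis
  moreover have "l < r" "lv i < r" using assms(2) lv(2)[of i] d_moved[OF False] by auto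
  moreover have "(\<sigma> ^^ l) (rep i) = (\<sigma> ^^ lv i) (rep i)" using assms(1) lv(1)[of i] by simp
  ultimately show ?thesis using power_moved by metis
qed

lemma lv_0_iff: "lv i = 0 \<longleftrightarrow> i \<in> set cs"
proof
  assume "lv i = 0"
  then show "i \<in> set cs" using lv(1)[of i] rep(1)[of i] by simp
next
  assume "i \<in> set cs"
  then have "rep i = i" by (rule rep_eqI) simp
  then show "lv i = 0" by (intro lv_unique) simp_all
qed

lemma rep_self: "lv i = 0 \<Longrightarrow> rep i = i"
  using lv(1)[of i] by simp

lemma lv_fixed: "\<sigma> i = i \<Longrightarrow> lv i = 0"
  using lv(2)[of i] d_fixed[of i] by simp

lemma lv_power_moved:
  assumes "\<sigma> i \<noteq> i" shows "int (lv ((\<sigma> ^^ m) i)) = (int (lv i) + int m) mod int r"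
proof -
  let ?j = "(\<sigma> ^^ m) i"
  have "?j = (\<sigma> ^^ (lv i + m)) (rep i)" using lv(1)[of i] by (metis add.commute comp_apply funpow_add)
  then have "?j = (\<sigma> ^^ ((lv i + m) mod r)) (rep ?j)" unfolding power_mod_r rep_power .
  moreover have "int ((lv i + m) mod r) < d ?j" using d_moved[OF assms] by simp
  ultimately have "lv ?j = (lv i + m) mod r" by (rule lv_unique)
  then show ?thesis by (simp add: zmod_int)
qed

lemma lv_sigma: "int (lv (\<sigma> i)) = (if int (lv i) + 1 < d i then int (lv i) + 1 else 0)"
proof (cases "\<sigma> i = i")
  case True
  then show ?thesis using lv_fixed[OF True] d_fixed[OF True] by simp
next
  case False
  have "int (lv (\<sigma> i)) = (int (lv i) + 1) mod int r" using lv_power_moved[OF False, of 1] by simp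
  moreover have "int (lv i) + 1 \<le> int r" using lv(2)[of i] d_moved[OF False] by simp
  ultimately show ?thesis using d_moved[OF False] by (cases "int (lv i) + 1 = int r") auto
qed

definition ix :: "'v \<Rightarrow> nat" where
  "ix x = (SOME k. k < length cs \<and> cs ! k = x)"

lemma ix: "x \<in> set cs \<Longrightarrow> ix x < length cs \<and> cs ! ix x = x"
  unfolding ix_def in_set_conv_nth by (rule someI_ex)

lemma ix_nth: "k < length cs \<Longrightarrow> ix (cs ! k) = k"
  using ix[of "cs ! k"] nth_eq_iff_index_eq[OF cs_distinct, of "ix (cs ! k)" k] by simp

lemma ix_eq: "x \<in> set cs \<Longrightarrow> y \<in> set cs \<Longrightarrow> ix x = ix y \<Longrightarrow> x = y"
  using ix by metis

lemma in_take_iff: "k \<le> length cs \<Longrightarrow> y \<in> set (take k cs) \<longleftrightarrow> y \<in> set cs \<and> ix y < k"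
proof -
  assume k: "k \<le> length cs"
  have "y \<in> set (take k cs) \<longleftrightarrow> (\<exists>m<k. cs ! m = y)" using k by (auto simp: in_set_conv_nth)
  also have "\<dots> \<longleftrightarrow> y \<in> set cs \<and> ix y < k" using k ix[of y] ix_nth by (metis nth_mem order_less_le_trans)
  finally show ?thesis .
qed

text \<open>The increments are chosen so that a representative is a source when its turn comes.\<close>

definition incr :: "'v \<Rightarrow> int" where
  "incr i = (let b = rep i; p = par b in
     if lv p = 0 then (if ix p < ix b then - d p else d p) else d p - 2 * int (lv p))"

lemma incr_cong: "rep i = rep j \<Longrightarrow> incr i = incr j"
  by (simp add: incr_def)

definition height :: "('v \<Rightarrow> int) \<Rightarrow> bool" where
  "height t \<longleftrightarrow> (\<forall>i. t (\<sigma> i) = t i) \<and> (\<forall>i. i \<noteq> ctr \<longrightarrow> t i = t (par i) + incr i) \<and>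
     (\<forall>i. lat i (t i - 2 * int (lv i)))"

lemma par_power: "i \<noteq> ctr \<Longrightarrow> par ((\<sigma> ^^ l) i) = (\<sigma> ^^ l) (par i)"
proof (induction l)
  case (Suc l)
  have "(\<sigma> ^^ l) i \<noteq> ctr" using Suc.prems power_ctr[of l] power_inj[of l i ctr] by metis
  then show ?case using Suc by (simp add: sigma_par)
qed simp

lemma rep_ctr: "i \<noteq> ctr \<Longrightarrow> rep i \<noteq> ctr"
  using lv(1)[of i] power_ctr by metis

text \<open>Here \<open>D\<close> is the difference of the intended heights of \<open>b\<close> and
  its parent. The first two bounds give a down-set; the next four say that \<open>b\<close> or its
  parent is higher than the other when its turn comes, a vertex applied earlier being lowered by
  twice its orbit size. The last one serves the congruence of levels.\<close>

lemma edge: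
  assumes b: "b \<noteq> ctr"
  defines "p \<equiv> par b"
  defines "D \<equiv> incr b - 2 * int (lv b) + 2 * int (lv p)"
  shows "D < 2 * d p" "- D < 2 * d b"
    "b \<in> set cs \<Longrightarrow> p \<in> set cs \<Longrightarrow> ix p < ix b \<Longrightarrow> - 2 * d p < D"
    "b \<in> set cs \<Longrightarrow> \<not> (p \<in> set cs \<and> ix p < ix b) \<Longrightarrow> 0 < D"
    "p \<in> set cs \<Longrightarrow> b \<in> set cs \<Longrightarrow> ix b < ix p \<Longrightarrow> D < 2 * d b"
    "p \<in> set cs \<Longrightarrow> \<not> (b \<in> set cs \<and> ix b < ix p) \<Longrightarrow> D < 0"
    "d p = d b \<Longrightarrow> D = d p \<or> D = - d p"
proof -
  \<comment> \<open>The power of \<sigma> that carries \<open>rep b\<close> to \<open>b\<close> also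
    carries \<open>p'\<close> to \<open>p\<close>, so in a moved orbit the distance of
    \<open>p\<close> is the sum of the distances of \<open>p'\<close> and \<open>b\<close> modulo
    \<open>r\<close>.\<close>
  define p' where "p' = par (rep b)"
  have pp: "p = (\<sigma> ^^ lv b) p'"
    unfolding p_def p'_def using par_power[OF rep_ctr[OF b], of "lv b"] lv(1)[of b] by simp
  have dpb: "d p \<le> d b" unfolding p_def by (rule d_par[OF b])
  have bp: "b \<noteq> p" using par_adj(1)[OF b] adj_irrefl unfolding p_def by metis
  have mb: "int (lv b) < d b" by (rule lv(2))
  have inc: "incr b = (if lv p' = 0 then (if ix p' < ix (rep b) then - d p' else d p') else d p' - 2 * int (lv p'))"
    by (simp add: incr_def Let_def p'_def)
  have ixne: "ix p \<noteq> ix b" if "p \<in> set cs" "b \<in> set cs" using ix_eq that bp by blast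
  have "D < 2 * d p \<and> - D < 2 * d b \<and>
    (b \<in> set cs \<longrightarrow> p \<in> set cs \<longrightarrow> ix p < ix b \<longrightarrow> - 2 * d p < D) \<and>
    (b \<in> set cs \<longrightarrow> \<not> (p \<in> set cs \<and> ix p < ix b) \<longrightarrow> 0 < D) \<and>
    (p \<in> set cs \<longrightarrow> b \<in> set cs \<longrightarrow> ix b < ix p \<longrightarrow> D < 2 * d b) \<and>
    (p \<in> set cs \<longrightarrow> \<not> (b \<in> set cs \<and> ix b < ix p) \<longrightarrow> D < 0) \<and>
    (d p = d b \<longrightarrow> D = d p \<or> D = - d p)"
  proof (cases "\<sigma> p = p")
    case True
    then have "\<sigma> p' = p'" using pp sigma_fixed_power by simp
    then have p': "p' = p" using pp power_fixed by simp
    have z: "lv p = 0" "d p = 1" "p \<in> set cs" using lv_fixed[OF True] d_fixed[OF True] lv_0_iff by auto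
    have D: "D = (if ix p < ix (rep b) then - 1 else 1) - 2 * int (lv b)"
      unfolding D_def inc p' using z by simp
    show ?thesis
    proof (cases "lv b = 0")
      case lb: True
      then have "rep b = b" "b \<in> set cs" using rep_self lv_0_iff by auto
      then show ?thesis using D lb z ixne[OF z(3)] d_pos[of b] by (simp del: d_pos)
    next
      case False
      then have "b \<notin> set cs" using lv_0_iff by simp
      then show ?thesis using False D z mb by (simp del: d_pos)
    qed
  next
    case False
    have dr: "d p = int r" by (rule d_moved[OF False])
    then have db: "d b = int r" using dpb d_le_r[of b] by simp
    have np': "\<sigma> p' \<noteq> p'" using False pp sigma_fixed_power by simp
    have dp': "d p' = int r" by (rule d_moved[OF np'])
    have lp: "int (lv p) = (int (lv p') + int (lv b)) mod int r"
      unfolding pp by (rule lv_power_moved[OF np'])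
    have lp': "int (lv p') < int r" using lv(2)[of p'] dp' by simp
    have lb: "int (lv b) < int r" using mb db by simp
    have l2: "int (lv p) = int (lv p') + int (lv b) \<and> int (lv p') + int (lv b) < int r \<or>
        int (lv p) = int (lv p') + int (lv b) - int r \<and> int r \<le> int (lv p') + int (lv b)"
    proof (cases "int (lv p') + int (lv b) < int r")
      case True
      then show ?thesis using lp by simp
    next
      case False
      have "(int (lv p') + int (lv b)) mod int r = (int (lv p') + int (lv b) - int r) mod int r" by simp
      also have "\<dots> = int (lv p') + int (lv b) - int r" using False lp' lb by (intro mod_pos_pos_trivial) linarith+
      finally show ?thesis using lp False by simp
    qed
    have r0: "0 < int r" using r_pos by linarith
    show ?thesis
    proof (cases "lv p' = 0")
      case True
      then have e: "int (lv p) = int (lv b)" using l2 lb by linarith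
      then have D: "D = (if ix p' < ix (rep b) then - int r else int r)"
        unfolding D_def inc dp' using True by simp
      have same: "b \<in> set cs \<longleftrightarrow> p \<in> set cs" using e lv_0_iff[of b] lv_0_iff[of p] by simp
      have id: "p' = p" "rep b = b" if "b \<in> set cs"
      proof -
        have "lv b = 0" using that lv_0_iff by simp
        then show "p' = p" "rep b = b" using pp rep_self by auto
      qed
      have m: "(b \<in> set cs \<longrightarrow> p \<in> set cs \<longrightarrow> ix p < ix b \<longrightarrow> - 2 * int r < D)" "D < 2 * int r" "- D < 2 * int r"
        "D = int r \<or> D = - int r"
        using D r0 by auto
      show ?thesis
      proof (cases "b \<in> set cs")
        case bcs: True
        then have "p \<in> set cs" using same by simp
        then show ?thesis using m D id[OF bcs] ixne bcs r0 unfolding dr db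
          by (cases "ix p < ix b") auto
      next
        case False
        then show ?thesis using m same unfolding dr db by blast
      qed
    next
      case False
      have D: "D = int r - 2 * int (lv p') - 2 * int (lv b) + 2 * int (lv p)"
        unfolding D_def inc dp' using False by simp
      have DD: "(D = int r \<and> 0 < int (lv p)) \<or> (D = - int r \<and> 0 < int (lv b))"
        using l2 lp' False unfolding D by linarith
      then have "(D = int r \<and> p \<notin> set cs) \<or> (D = - int r \<and> b \<notin> set cs)"
        using lv_0_iff[of b] lv_0_iff[of p] by auto
      then show ?thesis using r0 unfolding dr db by auto
    qed
  qed
  then show "D < 2 * d p" "- D < 2 * d b"
    "b \<in> set cs \<Longrightarrow> p \<in> set cs \<Longrightarrow> ix p < ix b \<Longrightarrow> - 2 * d p < D"
    "b \<in> set cs \<Longrightarrow> \<not> (p \<in> set cs \<and> ix p < ix b) \<Longrightarrow> 0 < D"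
    "p \<in> set cs \<Longrightarrow> b \<in> set cs \<Longrightarrow> ix b < ix p \<Longrightarrow> D < 2 * d b"
    "p \<in> set cs \<Longrightarrow> \<not> (b \<in> set cs \<and> ix b < ix p) \<Longrightarrow> D < 0"
    "d p = d b \<Longrightarrow> D = d p \<or> D = - d p" by blast+
qed

lemma long_edge_ctr:
  assumes "b \<noteq> ctr" "d (par b) < d b" shows "par b = ctr"
proof (rule ccontr)
  assume n: "par b \<noteq> ctr"
  note dd = d_less[OF assms(2)]
  have "par (\<sigma> b) = par b" using sigma_par[OF assms(1)] dd(1) by simp
  moreover have "\<sigma> b \<noteq> ctr" using assms(1) sigma_ctr sigma_inj by metis
  ultimately have "\<sigma> b = b" using child_unique[OF n _ assms(1)] by simp
  then show False using dd(3) by simp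
qed

text \<open>The only freedom is the constant at the centre. Congruences propagate along edges
  between orbits of equal size; all other edges start at the centre and lead into the single moved
  orbit of its neighbours, so one choice suffices.\<close>

lemma exists_height:
  assumes nid: "\<sigma> \<noteq> id"
  obtains t where "height t"
proof -
  obtain b where b: "adj ctr b" "\<sigma> b \<noteq> b" "\<forall>c. adj ctr c \<longrightarrow> \<sigma> c = c \<or> c = b \<or> c = \<sigma> b \<or> c = \<sigma> (\<sigma> b)"
    using moved_neighbour[OF nid] by metis
  have bc: "b \<noteq> ctr" using b(2) by auto
  have parb: "par b = ctr"
  proof (rule ccontr)
    assume "par b \<noteq> ctr"
    then have "par ctr = b" "False" using b(1) bc unfolding adj_iff by auto
    then show False by simp
  qed
  have rb: "rep b \<noteq> ctr" "par (rep b) = ctr"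
  proof -
    show r: "rep b \<noteq> ctr" by (rule rep_ctr[OF bc])
    have "(\<sigma> ^^ lv b) (par (rep b)) = (\<sigma> ^^ lv b) ctr" 
      using par_power[OF r, of "lv b"] unfolding lv(1)[of b, symmetric] parb power_ctr by (rule sym)
    then show "par (rep b) = ctr" unfolding power_inj .
  qed
  have c1: "lv ctr = 0" "d ctr = 1" by (simp_all add: lv_fixed d_fixed)
  have incb: "incr b = 1 \<or> incr b = - 1" unfolding incr_def Let_def rb(2) c1 by simp
  \<comment> \<open>Chosen so that \<open>t\<close> takes at the representative of the moved
    neighbours a value that is a level of its column.\<close>
  define c where "c = cut 0 (rep b) - incr b"
  obtain t where t: "t ctr = c" "\<forall>i. i \<noteq> ctr \<longrightarrow> t i = t (par i) + incr i"
    using tree_rec[of c "\<lambda>i v. v + incr i"] by blast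
  have ts: "t (\<sigma> i) = t i" for i
  proof (induction i rule: tree_induct)
    case (par i)
    have "\<sigma> i \<noteq> ctr" using par(1) sigma_ctr sigma_inj by metis
    then show ?case using t(2) par sigma_par[OF par(1)] incr_cong[OF rep_sigma[of i]] by simp
  qed simp
  have "lat i (t i - 2 * int (lv i))" for i
  proof (induction i rule: tree_induct)
    case ctr
    have "adj ctr (rep b)" using par_adj(2)[OF rb(1)] rb(2) by simp
    then obtain k where "\<epsilon> ctr - cut 0 (rep b) = 1 + 2 * k"
      using lat_adj[of ctr "rep b" "\<epsilon> ctr" "cut 0 (rep b)"] cut_lat c1 d_pos[of "rep b"]
      by (auto simp: lat_def min_def split: if_splits simp del: d_pos)
    then have "t ctr - \<epsilon> ctr = 2 * (- k - 1) \<or> t ctr - \<epsilon> ctr = 2 * (- k)" using incb t(1) by (auto simp: c_def)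
    then have "2 dvd t ctr - \<epsilon> ctr" by (metis dvd_triv_left)
    then show ?case using c1 by (simp add: lat_def)
  next
    case (par i)
    show ?case
    proof (cases "d (par i) = d i")
      case True
      let ?D = "incr i - 2 * int (lv i) + 2 * int (lv (par i))"
      have D: "?D = d (par i) \<or> ?D = - d (par i)" by (rule edge(7)[OF par(1) True])
      obtain k where k: "t (par i) - 2 * int (lv (par i)) - \<epsilon> i = d i + 2 * d i * k"
        using lat_adj[OF par_adj(2)[OF par(1)] par(2), of "\<epsilon> i"] True by (auto simp: lat_def)
      have "t i - 2 * int (lv i) - \<epsilon> i = d i + 2 * d i * k + ?D" using k t(2) par(1) by simp
      then have "t i - 2 * int (lv i) - \<epsilon> i = 2 * d i * (k + 1) \<or> t i - 2 * int (lv i) - \<epsilon> i = 2 * d i * k"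
        using D True by (auto simp: algebra_simps)
      then show ?thesis unfolding lat_def by (metis dvd_triv_left)
    next
      case False
      then have lt: "d (par i) < d i" using d_par[OF par(1)] by simp
      have pc: "par i = ctr" by (rule long_edge_ctr[OF par(1) lt])
      have "adj ctr i" using par_adj(2)[OF par(1)] pc by simp
      then have "i = b \<or> i = \<sigma> b \<or> i = \<sigma> (\<sigma> b)" using b(3) d_less(3)[OF lt] by blast
      then have ri: "rep i = rep b" using rep_sigma by metis
      then have "t i = c + incr b" using t par(1) pc incr_cong[OF ri] by simp
      then have "t i = cut 0 (rep b)" by (simp add: c_def)
      then have "lat (rep i) (t i - 2 * int (lv i) + 2 * int (lv i))" using cut_lat ri by simp
      then have "lat ((\<sigma> ^^ lv i) (rep i)) (t i - 2 * int (lv i))" unfolding lat_power .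
      then show ?thesis using lv(1)[of i] by simp
    qed
  qed
  then have "height t" using ts t(2) unfolding height_def by blast
  then show ?thesis by (rule that)
qed

text \<open>Each representative drops from the top of its orbit to the bottom, which rotates the
  values on the orbit: the result is the old height function transported by \<sigma> and lowered by
  2.\<close>

lemma coxeter_round:
  assumes t: "height t"
  defines "\<xi> \<equiv> \<lambda>i. t i - 2 * int (lv i)"
  shows "\<xi> \<in> QD" and "adapted adj \<sigma> \<xi> cs" and "endpoint \<xi> cs (\<sigma> i) = \<xi> i - 2"
proof -
  have diff: "\<xi> b = \<xi> (par b) + (incr b - 2 * int (lv b) + 2 * int (lv (par b)))" if "b \<noteq> ctr" for b
    using t that by (simp add: height_def \<xi>_def)
  have "\<xi> i < \<xi> j + 2 * d j" if ij: "adj i j" for i j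
  proof -
    from ij consider "i \<noteq> ctr" "j = par i" | "j \<noteq> ctr" "i = par j" unfolding adj_iff by blast
    then show ?thesis
    proof cases
      case 1
      show ?thesis using diff[OF 1(1)] edge(1)[OF 1(1)] unfolding 1(2) by linarith
    next
      case 2
      show ?thesis using diff[OF 2(1)] edge(2)[OF 2(1)] unfolding 2(2) by linarith
    qed
  qed
  then show x: "\<xi> \<in> QD" using t by (simp add: QD_def height_def \<xi>_def)
  have src: "\<xi> y - (if y \<in> set cs \<and> ix y < ix x then 2 * d y else 0) < \<xi> x" if xy: "x \<in> set cs" "adj x y" for x y
  proof -
    from xy(2) consider "x \<noteq> ctr" "y = par x" | "y \<noteq> ctr" "x = par y" unfolding adj_iff by blast
    then show ?thesis
    proof cases
      case 1
      show ?thesis using diff[OF 1(1)] edge(3,4)[OF 1(1) xy(1)] 1(2) by auto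
    next
      case 2
      show ?thesis using diff[OF 2(1)] edge(5,6)[OF 2(1)] xy(1) 2(2) by auto
    qed
  qed
  have "adapted adj \<sigma> \<xi> (take k cs)" if "k \<le> length cs" for k
    using that
  proof (induction k)
    case (Suc k)
    then have k: "k < length cs" by simp
    have "source adj (endpoint \<xi> (take k cs)) (cs ! k)"
      unfolding source_def
    proof (intro allI impI)
      fix y assume y: "adj (cs ! k) y"
      have c: "count_list (take k cs) z = (if z \<in> set cs \<and> ix z < k then 1 else 0)" for z
        using in_take_iff[of k z] k cs_distinct
        by (simp add: count_list_distinct)
      have "\<xi> y - (if y \<in> set cs \<and> ix y < ix (cs ! k) then 2 * d y else 0) < \<xi> (cs ! k)"
        by (rule src) (use k y in auto)
      then show "endpoint \<xi> (take k cs) y < endpoint \<xi> (take k cs) (cs ! k)"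
        using ix_nth[OF k] by (auto simp: endpoint_count c)
    qed
    then show ?case using Suc by (simp add: take_Suc_conv_app_nth adapted_append)
  qed simp
  from this[of "length cs"] show "adapted adj \<sigma> \<xi> cs" by simp
  have "count_list cs (\<sigma> i) = (if lv (\<sigma> i) = 0 then 1 else 0)"
    using cs_distinct lv_0_iff[of "\<sigma> i"] by (simp add: count_list_distinct)
  moreover have "t (\<sigma> i) = t i" using t by (simp add: height_def)
  ultimately show "endpoint \<xi> cs (\<sigma> i) = \<xi> i - 2"
    using lv_sigma[of i] lv(2)[of i] by (auto simp: endpoint_count \<xi>_def split: if_splits)
qed

lemma coxeter_rounds:
  assumes x: "adapted adj \<sigma> \<xi> cs" and e: "\<And>i. endpoint \<xi> cs (\<sigma> i) = \<xi> i - 2"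
  shows "adapted adj \<sigma> \<xi> (concat (map (\<lambda>l. map (\<sigma> ^^ l) cs) [0..<k])) \<and>
    (\<forall>i. endpoint \<xi> (concat (map (\<lambda>l. map (\<sigma> ^^ l) cs) [0..<k])) ((\<sigma> ^^ k) i) = \<xi> i - 2 * int k)"
proof (induction k)
  case (Suc k)
  let ?W = "concat (map (\<lambda>l. map (\<sigma> ^^ l) cs) [0..<k])"
  let ?e = "endpoint \<xi> ?W"
  have W: "concat (map (\<lambda>l. map (\<sigma> ^^ l) cs) [0..<Suc k]) = ?W @ map (\<sigma> ^^ k) cs" by simp
  have ek: "?e \<circ> (\<sigma> ^^ k) = (\<lambda>i. \<xi> i + (- 2 * int k))" using Suc by auto
  have "adapted adj \<sigma> (?e \<circ> (\<sigma> ^^ k)) cs" unfolding ek adapted_shift by (rule x)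
  then have "adapted adj \<sigma> ?e (map (\<sigma> ^^ k) cs)"
    using adapted_automorphism[OF power_automorphism d_power] by blast
  moreover have "endpoint ?e (map (\<sigma> ^^ k) cs) ((\<sigma> ^^ Suc k) i) = \<xi> i - 2 * int (Suc k)" for i
  proof -
    have "inj (\<sigma> ^^ k)" by (simp add: inj_def)
    then have "endpoint ?e (map (\<sigma> ^^ k) cs) \<circ> (\<sigma> ^^ k) = endpoint (?e \<circ> (\<sigma> ^^ k)) cs"
      by (rule endpoint_automorphism) simp
    from fun_cong[OF this, of "\<sigma> i"]
    have "endpoint ?e (map (\<sigma> ^^ k) cs) ((\<sigma> ^^ k) (\<sigma> i)) = endpoint \<xi> cs (\<sigma> i) - 2 * int k"
      unfolding ek by (simp add: endpoint_count)
    then show ?thesis using e[of i] by (simp add: funpow_swap1)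
  qed
  ultimately show ?case unfolding W adapted_append endpoint_append using Suc by blast
qed simp

text \<open>Write \<open>star\<close> as a power of \<sigma> with exponent \<open>k\<close>. The
  centre is fixed, so \<open>lat_star\<close> there makes \<open>hp\<close> even; at a vertex of
  orbit size \<open>r\<close> it makes \<open>k\<close> congruent to \<open>hp div 2\<close> modulo
  \<open>r\<close>. Thus the rotation over all rounds of a Coxeter word is the one that
  \<open>twist\<close> requires.\<close>

lemma star_half_period:
  assumes "\<sigma> \<noteq> id"
  shows "2 dvd hp" and "star adj ((\<sigma> ^^ nat (hp div 2)) i) = i"
proof -
  obtain k where k: "star adj = \<sigma> ^^ k" using star_power[OF assms] by blast
  have "lat ctr (\<epsilon> ctr - hp)" using lat_star[of ctr "\<epsilon> ctr"] k by (simp add: lat_def)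
  then show hp2: "2 dvd hp" by (simp add: lat_def d_fixed)
  define H where "H = nat (hp div 2)"
  have H: "hp = 2 * int H" using hp2 hp_pos by (auto simp: H_def)
  obtain j where j: "d j = int r" using exists_d_eq_r by blast
  have "lat j (\<epsilon> j - hp + 2 * int k)"
    using lat_star[of j "\<epsilon> j"] unfolding k lat_power by (simp add: lat_def)
  then have "2 * int r dvd 2 * (int k - int H)" using j H by (simp add: lat_def algebra_simps)
  then have "int r dvd int k - int H" by (subst (asm) dvd_times_left_cancel_iff) simp_all
  then have "int k mod int r = int H mod int r" by (simp add: mod_eq_dvd_iff)
  then have kH: "k mod r = H mod r" by (metis of_nat_eq_iff zmod_int)
  have "(\<sigma> ^^ H) i = star adj i" for i
    using power_mod_r[of k i] power_mod_r[of H i] kH k by simp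
  then show "star adj ((\<sigma> ^^ nat (hp div 2)) i) = i" unfolding H_def[symmetric] by simp
qed

lemma coxeter_word_adapted:
  assumes nid: "\<sigma> \<noteq> id"
  shows "\<exists>\<xi>\<in>QD. coxeter_word adj \<sigma> cs \<in> adapted_words adj \<sigma> \<xi>"
proof -
  obtain t where t: "height t" by (rule exists_height[OF nid])
  define \<xi> where "\<xi> = (\<lambda>i. t i - 2 * int (lv i))"
  have c: "\<xi> \<in> QD" "adapted adj \<sigma> \<xi> cs" "\<And>i. endpoint \<xi> cs (\<sigma> i) = \<xi> i - 2"
    unfolding \<xi>_def by (rule coxeter_round[OF t])+
  define H where "H = nat (hp div 2)"
  have H: "hp = 2 * int H" using star_half_period(1)[OF nid] hp_pos by (auto simp: H_def)
  have W: "coxeter_word adj \<sigma> cs = concat (map (\<lambda>l. map (\<sigma> ^^ l) cs) [0..<H])"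
    by (simp add: coxeter_word_def hp_eq[symmetric] H_def)
  note rounds = coxeter_rounds[OF c(2,3), of H, folded W]
  have "endpoint \<xi> (coxeter_word adj \<sigma> cs) j = twist \<xi> j" for j
  proof -
    obtain i where i: "j = (\<sigma> ^^ H) i"
      using power_automorphism[of H] by (auto simp: diagram_automorphism_def bij_def elim: surjE)
    show ?thesis using rounds star_half_period(2)[OF nid, of i] unfolding i twist_def H_def[symmetric] H by simp
  qed
  then have "coxeter_word adj \<sigma> cs \<in> adapted_words adj \<sigma> \<xi>"
    using adapted_words_iff[OF c(1)] rounds by auto
  then show ?thesis using c(1) by blast
qed

end

section \<open>Identification of the adapted cluster point\<close>

context folded_parity
begin

lemma coxeter_sequences_nonempty: "\<exists>cs. cs \<in> coxeter_sequences \<sigma>"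
proof -
  obtain as where as: "set as = orbits \<sigma>" "distinct as"
    using finite_distinct_list[of "orbits \<sigma>"] by (auto simp: orbits_def)
  have "orb \<sigma> ` inv (orb \<sigma>) ` orbits \<sigma> = orbits \<sigma>"
    using orbits_inv by (force simp: image_image)
  then have "map (inv (orb \<sigma>)) as \<in> coxeter_sequences \<sigma>"
    using as distinct_card[of as] by (simp add: coxeter_sequences_def)
  then show ?thesis by blast
qed

lemma coxeter_class:
  assumes "\<sigma> \<noteq> id" "cs \<in> coxeter_sequences \<sigma>"
  shows "comm_class adj (coxeter_word adj \<sigma> cs) \<in> adapted_words adj \<sigma> ` QD"
proof -
  interpret coxeter_sequence adj ctr par dep \<sigma> \<epsilon> cs by unfold_locales (rule assms(2))
  obtain \<xi> where x: "\<xi> \<in> QD" "coxeter_word adj \<sigma> cs \<in> adapted_words adj \<sigma> \<xi>"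
    using coxeter_word_adapted[OF assms(1)] by blast
  then show ?thesis using adapted_words_class[OF x] by (metis imageI)
qed

lemma adapted_cluster_point_eq: "adapted_cluster_point adj \<sigma> = adapted_words adj \<sigma> ` QD"
proof (cases "\<sigma> = id")
  case True
  then show ?thesis by (rule adapted_cluster_point_id)
next
  case False
  have "(THE X. X \<in> r_cluster_points adj \<and>
    (\<forall>is\<in>coxeter_sequences \<sigma>. comm_class adj (coxeter_word adj \<sigma> is) \<in> X)) = adapted_words adj \<sigma> ` QD"
  proof (rule the_equality)
    show "adapted_words adj \<sigma> ` QD \<in> r_cluster_points adj \<and>
      (\<forall>is\<in>coxeter_sequences \<sigma>. comm_class adj (coxeter_word adj \<sigma> is) \<in> adapted_words adj \<sigma> ` QD)"
      using adapted_words_r_cluster_point coxeter_class[OF False] by blast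
  next
    fix X assume X: "X \<in> r_cluster_points adj \<and>
      (\<forall>is\<in>coxeter_sequences \<sigma>. comm_class adj (coxeter_word adj \<sigma> is) \<in> X)"
    obtain cs where cs: "cs \<in> coxeter_sequences \<sigma>" using coxeter_sequences_nonempty by blast
    then have "comm_class adj (coxeter_word adj \<sigma> cs) \<in> X" using X by blast
    then show "X = adapted_words adj \<sigma> ` QD"
      by (rule r_cluster_point_unique[OF conjunct1[OF X] _ coxeter_class[OF False cs]])
  qed
  then show ?thesis using False by (simp add: adapted_cluster_point_def)
qed

end

theorem theorem2p24:
  fixes adj :: "'v::finite \<Rightarrow> 'v \<Rightarrow> bool"
    and \<sigma> :: "'v \<Rightarrow> 'v"
    and \<epsilon> :: "'v \<Rightarrow> int"
  assumes "ADE_diagram adj"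
    and "diagram_automorphism adj \<sigma>"
    and "\<nexists>i. adj i (\<sigma> i)"
    and "parity_function adj \<sigma> \<epsilon>"
  shows "(\<forall>\<xi> \<in> Q_data adj \<sigma> \<epsilon>.
            adapted_words adj \<sigma> \<xi> \<in> comm_classes adj \<and>
            (\<exists>!f. f \<in> extensional (verts (twisted_AR_quiver adj \<sigma> \<epsilon> \<xi>)) \<and>
                  quiver_iso (twisted_AR_quiver adj \<sigma> \<epsilon> \<xi>)
                    (comb_AR_quiver adj (adapted_words adj \<sigma> \<xi>)) f \<and>
                  (\<forall>x \<in> verts (twisted_AR_quiver adj \<sigma> \<epsilon> \<xi>).
                     residue adj (adapted_words adj \<sigma> \<xi>) (f x) = fst x))) \<and>
         (\<exists>F. bij_betw F (Q_data adj \<sigma> \<epsilon> // shift_rel adj \<sigma> \<epsilon>) (adapted_cluster_point adj \<sigma>) \<and>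
              (\<forall>\<xi> \<in> Q_data adj \<sigma> \<epsilon>.
                 F (shift_rel adj \<sigma> \<epsilon> `` {\<xi>}) = adapted_words adj \<sigma> \<xi>))"
proof -
  obtain ctr par dep where tree: "tree_diagram adj ctr par dep" using ADE_tree_diagram[OF assms(1)] by blast
  interpret tree_diagram adj ctr par dep by (rule tree)
  interpret folded_parity adj ctr par dep \<sigma> \<epsilon>
    by unfold_locales (use assms in blast)+
  show ?thesis
    unfolding Q_data_eq adapted_cluster_point_eq
    using adapted_words_comm_classes AR_iso_ex1 Q_data_bijection by blast
qed

end
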